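(* Let $d\ge 2$, let $G=(V,E)$ be a connected infinite $d$-regular graph, and let $\mathsf v\in(0,\infty)$. For each $\alpha\in[0,1]$, the voter model with stirring $(\xi_t)$ on $G$ with parameter $\mathsf v$ started from $\pi^{\mathrm{site}}_\alpha$ has a law at time $t$ which converges weakly as $t\to\infty$ to a probability measure $\mu^{\mathrm{stir}}_\alpha$; the measures $\mu^{\mathrm{stir}}_\alpha$, $\alpha\in[0,1]$, are pairwise distinct and stationary for $(\xi_t)$. Moreover: 1. if $G$ has the continuous infinite collision property, then the only extremal stationary measures of $(\xi_t)$ are $\mu^{\mathrm{stir}}_0=\delta_{\bar 0}$ and $\mu^{\mathrm{stir}}_1=\delta_{\bar 1}$; 2. if $G$ has the continuous finite collision property and the tail $\sigma$-algebra of a continuous-time simple random walk on $G$ is trivial, then the set of extremal stationary measures of $(\xi_t)$ is $\{\mu^{\mathrm{stir}}_\alpha:\alpha\in[0,1]\}$.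
   Context: The voter model with stirring on a $d$-regular graph $G=(V,E)$ with parameter $\mathsf v$ is the Feller process $(\xi_t)$ on $\{0,1\}^V$ with the following independent transitions: for each ordered pair of neighbours $(x,y)$, at rate $1/d$, site $x$ adopts the value of $y$; for each edge $\{x,y\}\in E$, at rate $\mathsf v/d$, the values at $x$ and $y$ are interchanged. $\bar0,\bar1$ are the constant configurations and $\pi^{\mathrm{site}}_\alpha$ is the Bernoulli($\alpha$) product measure on $\{0,1\}^V$. A continuous-time simple random walk on $G$ jumps at rate 1 to a uniformly chosen neighbour. $G$ has the continuous infinite collision property if for any starting points two independent continuous-time simple random walks $X^1,X^2$ satisfy $P(\forall s>0\ \exists t\ge s: X^1_t=X^2_t)=1$; it has the continuous finite collision property if for any starting points $P(\exists s>0: X^1_t\neq X^2_t\ \forall t\ge s)=1$. The tail $\sigma$-algebra $\bigcap_{t\ge0}\sigma(W_s:s\ge t)$ of a continuous-time Markov chain $W$ is trivial if each of its events has probability 0 or 1 under every starting state. A stationary measure is extremal if it is not a nontrivial convex combination of two other stationary measures. *)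

theory Defs
  imports "HOL-Probability.Probability"
begin

definition regular_graph :: "('v \<Rightarrow> 'v \<Rightarrow> bool) \<Rightarrow> nat \<Rightarrow> bool" where
  "regular_graph E d \<longleftrightarrow> (\<forall>x y. E x y \<longrightarrow> E y x) \<and> (\<forall>x. \<not> E x x) \<and>
     (\<forall>x. finite {y. E x y} \<and> card {y. E x y} = d)"

definition connected_graph :: "('v \<Rightarrow> 'v \<Rightarrow> bool) \<Rightarrow> bool" where
  "connected_graph E \<longleftrightarrow> (\<forall>x y. E\<^sup>*\<^sup>* x y)"

definition cfg_space :: "('v \<Rightarrow> bool) measure" where
  "cfg_space = PiM UNIV (\<lambda>_. count_space UNIV)"

definition cfg_top :: "('v \<Rightarrow> bool) topology" where
  "cfg_top = product_topology (\<lambda>_. discrete_topology UNIV) UNIV"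

definition cfg_cont :: "(('v \<Rightarrow> bool) \<Rightarrow> real) set" where
  "cfg_cont = {f. continuous_map cfg_top euclideanreal f}"

definition cfg_probs :: "('v \<Rightarrow> bool) measure set" where
  "cfg_probs = {M. prob_space M \<and> sets M = sets cfg_space}"

definition bernoulli_product :: "real \<Rightarrow> ('v \<Rightarrow> bool) measure" where
  "bernoulli_product \<alpha> = PiM UNIV (\<lambda>_. measure_pmf (bernoulli_pmf \<alpha>))"

definition cylinder_fun :: "(('v \<Rightarrow> bool) \<Rightarrow> real) \<Rightarrow> bool" where
  "cylinder_fun f \<longleftrightarrow> (\<exists>A. finite A \<and> (\<forall>\<eta> \<zeta>. (\<forall>x\<in>A. \<eta> x = \<zeta> x) \<longrightarrow> f \<eta> = f \<zeta>))"

text \<open>Generator on cylinder functions. The sum runs over ordered pairs of neighbours: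
  voter move x adopts y at rate 1/d; each unordered edge is swapped at rate v/d, i.e.
  v/(2d) per ordered pair.\<close>

definition voter_stir_gen ::
  "('v \<Rightarrow> 'v \<Rightarrow> bool) \<Rightarrow> nat \<Rightarrow> real \<Rightarrow> (('v \<Rightarrow> bool) \<Rightarrow> real) \<Rightarrow> ('v \<Rightarrow> bool) \<Rightarrow> real" where
  "voter_stir_gen E d v f \<eta> =
     (\<Sum>\<^sub>\<infinity>(x, y)\<in>{(x, y). E x y}.
        (1 / real d) * (f (\<eta>(x := \<eta> y)) - f \<eta>)
      + (v / (2 * real d)) * (f (\<eta>(x := \<eta> y, y := \<eta> x)) - f \<eta>))"

definition feller_semigroup ::
  "(real \<Rightarrow> (('v \<Rightarrow> bool) \<Rightarrow> real) \<Rightarrow> (('v \<Rightarrow> bool) \<Rightarrow> real)) \<Rightarrow> bool" where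
  "feller_semigroup T \<longleftrightarrow>
     (\<forall>t\<ge>0. \<forall>f\<in>cfg_cont. T t f \<in> cfg_cont) \<and>
     (\<forall>t\<ge>0. \<forall>f\<in>cfg_cont. \<forall>g\<in>cfg_cont. \<forall>a b.
         T t (\<lambda>\<eta>. a * f \<eta> + b * g \<eta>) = (\<lambda>\<eta>. a * T t f \<eta> + b * T t g \<eta>)) \<and>
     (\<forall>f\<in>cfg_cont. T 0 f = f) \<and>
     (\<forall>s\<ge>0. \<forall>t\<ge>0. \<forall>f\<in>cfg_cont. T (s + t) f = T s (T t f)) \<and>
     (\<forall>t\<ge>0. \<forall>f\<in>cfg_cont. (\<forall>\<eta>. f \<eta> \<ge> 0) \<longrightarrow> (\<forall>\<eta>. T t f \<eta> \<ge> 0)) \<and>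
     (\<forall>t\<ge>0. T t (\<lambda>_. 1) = (\<lambda>_. 1)) \<and>
     (\<forall>f\<in>cfg_cont. uniform_limit UNIV (\<lambda>t. T t f) f (at_right 0))"

text \<open>The semigroup of the voter model with stirring: the (unique) Feller semigroup whose
  generator acts on cylinder functions as voter_stir_gen.\<close>

definition voter_stir_semigroup ::
  "('v \<Rightarrow> 'v \<Rightarrow> bool) \<Rightarrow> nat \<Rightarrow> real \<Rightarrow>
   (real \<Rightarrow> (('v \<Rightarrow> bool) \<Rightarrow> real) \<Rightarrow> (('v \<Rightarrow> bool) \<Rightarrow> real)) \<Rightarrow> bool" where
  "voter_stir_semigroup E d v T \<longleftrightarrow> feller_semigroup T \<and>
     (\<forall>f. cylinder_fun f \<longrightarrow>
        uniform_limit UNIV (\<lambda>t \<eta>. (T t f \<eta> - f \<eta>) / t) (voter_stir_gen E d v f) (at_right 0))"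

text \<open>The law at time t of the process started from \<mu>0 is the measure
  f \<mapsto> \<integral> T t f d\<mu>0; weak convergence of these laws to \<nu>:\<close>

definition law_weak_conv ::
  "(real \<Rightarrow> (('v \<Rightarrow> bool) \<Rightarrow> real) \<Rightarrow> (('v \<Rightarrow> bool) \<Rightarrow> real)) \<Rightarrow>
   ('v \<Rightarrow> bool) measure \<Rightarrow> ('v \<Rightarrow> bool) measure \<Rightarrow> bool" where
  "law_weak_conv T \<mu>0 \<nu> \<longleftrightarrow>
     (\<forall>f\<in>cfg_cont. ((\<lambda>t. \<integral>\<eta>. T t f \<eta> \<partial>\<mu>0) \<longlongrightarrow> (\<integral>\<eta>. f \<eta> \<partial>\<nu>)) at_top)"

definition stationary ::
  "(real \<Rightarrow> (('v \<Rightarrow> bool) \<Rightarrow> real) \<Rightarrow> (('v \<Rightarrow> bool) \<Rightarrow> real)) \<Rightarrow> ('v \<Rightarrow> bool) measure \<Rightarrow> bool" where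
  "stationary T \<mu> \<longleftrightarrow> \<mu> \<in> cfg_probs \<and>
     (\<forall>t\<ge>0. \<forall>f\<in>cfg_cont. (\<integral>\<eta>. T t f \<eta> \<partial>\<mu>) = (\<integral>\<eta>. f \<eta> \<partial>\<mu>))"

definition extremal_stationary ::
  "(real \<Rightarrow> (('v \<Rightarrow> bool) \<Rightarrow> real) \<Rightarrow> (('v \<Rightarrow> bool) \<Rightarrow> real)) \<Rightarrow> ('v \<Rightarrow> bool) measure \<Rightarrow> bool" where
  "extremal_stationary T \<mu> \<longleftrightarrow> stationary T \<mu> \<and>
     \<not> (\<exists>\<mu>1 \<mu>2 c. stationary T \<mu>1 \<and> stationary T \<mu>2 \<and> \<mu>1 \<noteq> \<mu>2 \<and> 0 < c \<and> c < 1 \<and>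
          (\<forall>A\<in>sets cfg_space. measure \<mu> A = c * measure \<mu>1 A + (1 - c) * measure \<mu>2 A))"

text \<open>Enumeration of the d neighbours of x (the law of the walk does not depend on the choice).\<close>

definition nbr :: "('v \<Rightarrow> 'v \<Rightarrow> bool) \<Rightarrow> nat \<Rightarrow> 'v \<Rightarrow> nat \<Rightarrow> 'v" where
  "nbr E d x = (SOME g. bij_betw g {..<d} {y. E x y})"

text \<open>One step: a uniform neighbour index and an Exp(1) holding time.\<close>

definition step_space :: "nat \<Rightarrow> (nat \<times> real) measure" where
  "step_space d = measure_pmf (pmf_of_set {..<d}) \<Otimes>\<^sub>M
                  density lborel (\<lambda>x. ennreal (exponential_density 1 x))"

definition rw_space :: "nat \<Rightarrow> (nat \<Rightarrow> nat \<times> real) measure" where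
  "rw_space d = PiM UNIV (\<lambda>_. step_space d)"

fun jump_chain :: "('v \<Rightarrow> 'v \<Rightarrow> bool) \<Rightarrow> nat \<Rightarrow> 'v \<Rightarrow> (nat \<Rightarrow> nat \<times> real) \<Rightarrow> nat \<Rightarrow> 'v" where
  "jump_chain E d x \<omega> 0 = x"
| "jump_chain E d x \<omega> (Suc n) = nbr E d (jump_chain E d x \<omega> n) (fst (\<omega> n))"

definition jump_count :: "(nat \<Rightarrow> nat \<times> real) \<Rightarrow> real \<Rightarrow> nat" where
  "jump_count \<omega> t = card {n. 1 \<le> n \<and> (\<Sum>k<n. snd (\<omega> k)) \<le> t}"

definition ctsrw :: "('v \<Rightarrow> 'v \<Rightarrow> bool) \<Rightarrow> nat \<Rightarrow> 'v \<Rightarrow> (nat \<Rightarrow> nat \<times> real) \<Rightarrow> real \<Rightarrow> 'v" where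
  "ctsrw E d x \<omega> t = jump_chain E d x \<omega> (jump_count \<omega> t)"

definition inf_collision :: "('v \<Rightarrow> 'v \<Rightarrow> bool) \<Rightarrow> nat \<Rightarrow> bool" where
  "inf_collision E d \<longleftrightarrow> (\<forall>x1 x2. AE \<omega> in rw_space d \<Otimes>\<^sub>M rw_space d.
      \<forall>s>0. \<exists>t\<ge>s. ctsrw E d x1 (fst \<omega>) t = ctsrw E d x2 (snd \<omega>) t)"

definition finite_collision :: "('v \<Rightarrow> 'v \<Rightarrow> bool) \<Rightarrow> nat \<Rightarrow> bool" where
  "finite_collision E d \<longleftrightarrow> (\<forall>x1 x2. AE \<omega> in rw_space d \<Otimes>\<^sub>M rw_space d.
      \<exists>s>0. \<forall>t\<ge>s. ctsrw E d x1 (fst \<omega>) t \<noteq> ctsrw E d x2 (snd \<omega>) t)"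

definition srw_tail_sets :: "('v \<Rightarrow> 'v \<Rightarrow> bool) \<Rightarrow> nat \<Rightarrow> 'v \<Rightarrow> (nat \<Rightarrow> nat \<times> real) set set" where
  "srw_tail_sets E d x = (\<Inter>t\<in>{0::real..}. sigma_sets (space (rw_space d))
      {{\<omega> \<in> space (rw_space d). ctsrw E d x \<omega> s = y} | s y. s \<ge> t})"

definition srw_tail_trivial :: "('v \<Rightarrow> 'v \<Rightarrow> bool) \<Rightarrow> nat \<Rightarrow> bool" where
  "srw_tail_trivial E d \<longleftrightarrow> (\<forall>x. \<forall>A\<in>srw_tail_sets E d x.
      measure (rw_space d) A = 0 \<or> measure (rw_space d) A = 1)"

end

theory Submission
  imports Defs "HOL-Probability.Probability"
begin

text \<open>
  The dual of the process follows at most n particles that perform random walks and, on jumping to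
  an occupied site, coalesce with probability 1/(1+v) and otherwise swap. By duality the moments
  f(A) = nu(eta = 1 on A) of a stationary measure nu are bounded harmonic functions of the finite set
  A for the dual. Let h(x,y) be the probability that two dual particles ever coalesce and HH the sum
  of h over all pairs of particles. Up to a constant, HH bounds the expected total interaction of the
  dual particles, so f differs from its average along independent walks by O(HH).

  If walks collide infinitely often, then h = 1, and under a stationary measure any two sites agree
  almost surely. If walks collide finitely often, then HH tends to 0 along independent walks, whence
  the averages of f converge; the limits are harmonic for independent walks, hence constants c(|A|) by
  tail triviality. The sequence c is completely monotone, and f is recovered from c(|A|) by running
  the dual for a long time: nu is the limit law started from the exchangeable measure with moments c.
  Thus stationary measures correspond affinely to completely monotone sequences, whose extreme points
  are the powers of numbers in [0,1].
\<close>

section \<open>Semigroups of bounded jump generators\<close>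

text \<open>No dual process is ever built. Every semigroup is the exponential series of a generator
  with uniformly bounded rates, and comparisons of expectations are maximum principles for such
  generators; this is why the dual is cut off at n particles. Sample paths enter only because the
  collision properties and tail triviality speak of them, and the Markov property links them to the
  series.

  The comparison with independent walks rests on an exact identity: as h is harmonic for two dual
  particles, the moves to vacant sites change HH at a rate carried entirely by the pairs about to
  interact. So HH pays for every interaction in advance, for any number of particles, without
  estimates on collision times or on the geometry of the graph. The identity needs the reversal
  symmetry of edges: a third particle sees an exchange of two others as two free moves, and these
  cancel.

  Moment sequences are treated through their iterated differences, not through mixing measures on
  [0,1]; a variance computed on exchangeable sites replaces de Finetti's theorem.\<close>

definition bnd :: "real \<Rightarrow> ('a \<Rightarrow> real) \<Rightarrow> bool" where
  "bnd B f \<longleftrightarrow> (\<forall>a. \<bar>f a\<bar> \<le> B)"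

text \<open>At each state only finitely many targets carry a rate, so \<open>L\<close> makes sense
  on arbitrary functions without measurability. The exit rate is bounded by \<open>\<Lambda>\<close>
  uniformly in the state, which makes the exponential series converge on bounded functions.\<close>

definition jump_op :: "real \<Rightarrow> (('a \<Rightarrow> real) \<Rightarrow> 'a \<Rightarrow> real) \<Rightarrow> bool" where
  "jump_op \<Lambda> L \<longleftrightarrow> (\<forall>a. \<exists>S w. finite S \<and> (\<forall>b\<in>S. 0 \<le> w b) \<and> sum w S \<le> \<Lambda> \<and>
     (\<forall>f. L f a = (\<Sum>b\<in>S. w b * (f b - f a))))"

text \<open>The series of exp(tL). It stands for the expectation of \<open>f\<close> at time
  \<open>t\<close> under the chain with generator \<open>L\<close> started from
  \<open>a\<close>.\<close>

definition sgrp :: "(('a \<Rightarrow> real) \<Rightarrow> 'a \<Rightarrow> real) \<Rightarrow> real \<Rightarrow> ('a \<Rightarrow> real) \<Rightarrow> 'a \<Rightarrow> real" where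
  "sgrp L t f a = (\<Sum>n. (L ^^ n) f a / fact n * t ^ n)"

lemma bndD: "bnd B f \<Longrightarrow> \<bar>f a\<bar> \<le> B" by (auto simp: bnd_def)

lemma bnd_nonneg: "bnd B f \<Longrightarrow> 0 \<le> B"
  using bndD[of B f undefined] by linarith

lemma jump_opE:
  assumes "jump_op \<Lambda> L"
  obtains S w where "finite S" "\<forall>b\<in>S. 0 \<le> w b" "sum w S \<le> \<Lambda>"
     "\<forall>f. L f a = (\<Sum>b\<in>S. w b * (f b - f a))"
  using assms[unfolded jump_op_def, THEN spec, of a] by (elim exE conjE) (rule that)

lemma jump_op_nonneg: assumes "jump_op \<Lambda> L" shows "0 \<le> \<Lambda>"
proof -
  fix a
  obtain S w where S: "finite S" "\<forall>b\<in>S. 0 \<le> w b" "sum w S \<le> \<Lambda>"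
     "\<forall>f. L f a = (\<Sum>b\<in>S. w b * (f b - f a))" by (rule jump_opE[OF assms(1)])
  have "0 \<le> sum w S" using S(2) by (intro sum_nonneg) auto
  then show ?thesis using S(3) by linarith
qed

text \<open>Generators arise as sums over moves. Different moves may have the same target, so the
  rates of all moves into one state are added up.\<close>

lemma jump_opI:
  assumes "\<And>a. finite (N a)" "\<And>a m. m \<in> N a \<Longrightarrow> 0 \<le> r a m" "\<And>a. sum (r a) (N a) \<le> \<Lambda>"
    "\<And>f a. L f a = (\<Sum>m\<in>N a. r a m * (f (mv a m) - f a))"
  shows "jump_op \<Lambda> L"
  unfolding jump_op_def
proof (rule allI)
  fix a
  let ?w = "\<lambda>b. \<Sum>m\<in>{m\<in>N a. mv a m = b}. r a m"
  show "\<exists>S w. finite S \<and> (\<forall>b\<in>S. 0 \<le> w b) \<and> sum w S \<le> \<Lambda> \<and> (\<forall>f. L f a = (\<Sum>b\<in>S. w b * (f b - f a)))"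
  proof (intro exI[of _ "mv a ` N a"] exI[of _ ?w] conjI ballI allI)
    show "finite (mv a ` N a)" using assms by auto
    show "0 \<le> ?w b" for b using assms by (auto intro!: sum_nonneg)
    show "sum ?w (mv a ` N a) \<le> \<Lambda>"
      using sum.image_gen[OF assms(1), of "r a" a "mv a"] assms(3)[of a] by simp
    fix f
    have "L f a = (\<Sum>b\<in>mv a ` N a. \<Sum>m\<in>{m\<in>N a. mv a m = b}. r a m * (f (mv a m) - f a))"
      unfolding assms(4) by (rule sum.image_gen[OF assms(1)])
    also have "\<dots> = (\<Sum>b\<in>mv a ` N a. ?w b * (f b - f a))"
      by (intro sum.cong refl) (simp add: sum_distrib_right)
    finally show "L f a = (\<Sum>b\<in>mv a ` N a. ?w b * (f b - f a))" .
  qed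
qed

text \<open>On an infinite state space a minimum need not be attained, so a lower bound is improved
  iteratively: if \<open>w\<close> is at least \<open>- m\<close>, then exp(\<Lambda>t) w decreases
  at most at rate \<Lambda> exp(\<Lambda>t) m, and integration yields bounds with (\<Lambda>t)^n /
  n!, which vanish in the limit. The differential inequality is required only on \<open>S\<close>;
  elsewhere the sign is given, which later takes care of configurations with coinciding
  particles.\<close>

theorem max_principle:
  fixes w w' :: "real \<Rightarrow> 'a \<Rightarrow> real"
  assumes \<Lambda>: "0 \<le> \<Lambda>"
    and bound: "\<And>t a. 0 \<le> t \<Longrightarrow> t \<le> T \<Longrightarrow> - M \<le> w t a"
    and init: "\<And>a. 0 \<le> w 0 a"
    and out: "\<And>t a. a \<notin> S \<Longrightarrow> 0 \<le> t \<Longrightarrow> t \<le> T \<Longrightarrow> 0 \<le> w t a"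
    and der: "\<And>t a. a \<in> S \<Longrightarrow> 0 \<le> t \<Longrightarrow> t \<le> T \<Longrightarrow>
       ((\<lambda>s. w s a) has_real_derivative w' t a) (at t within {0..})"
    and ineq: "\<And>t a m. a \<in> S \<Longrightarrow> 0 \<le> t \<Longrightarrow> t \<le> T \<Longrightarrow> 0 \<le> m \<Longrightarrow> (\<And>b. - m \<le> w t b) \<Longrightarrow>
       - \<Lambda> * w t a - \<Lambda> * m \<le> w' t a"
    and t: "0 \<le> t" "t \<le> T"
  shows "0 \<le> w t a"
proof -
  \<comment> \<open>The factor exp(\<Lambda>T) lets the crude bound by \<open>M\<close> survive
    multiplication with exp(\<Lambda>t) and serve as the case n = 0.\<close>
  define M' where "M' = \<bar>M\<bar> * exp (\<Lambda> * T)"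
  have M': "0 \<le> M'" by (simp add: M'_def)
  let ?\<beta> = "\<lambda>n t. M' * (\<Lambda> * t) ^ n / fact n"
  have key: "- ?\<beta> n t \<le> exp (\<Lambda> * t) * w t a" if "0 \<le> t" "t \<le> T" for n t a
    using that
  proof (induction n arbitrary: t a)
    case 0
    have "exp (\<Lambda> * t) * (- w t a) \<le> exp (\<Lambda> * t) * \<bar>M\<bar>"
      using bound[OF 0, of a] by (intro mult_left_mono) auto
    also have "\<dots> \<le> M'" unfolding M'_def
      using 0 \<Lambda> by (subst mult.commute, intro mult_left_mono) (auto intro: mult_left_mono)
    finally show ?case by simp
  next
    case (Suc n)
    show ?case
    proof (cases "a \<in> S")
      case False
      have "0 \<le> exp (\<Lambda> * t) * w t a" using out[OF False Suc.prems] by simp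
      moreover have "0 \<le> ?\<beta> (Suc n) t" using M' \<Lambda> Suc.prems by (intro divide_nonneg_nonneg mult_nonneg_nonneg zero_le_power) auto
      ultimately show ?thesis by linarith
    next
      case True
      define y where "y s = exp (\<Lambda> * s) * w s a + ?\<beta> (Suc n) s" for s
      have dy: "(y has_real_derivative (exp (\<Lambda> * s) * (w' s a + \<Lambda> * w s a) + \<Lambda> * ?\<beta> n s)) (at s within {0..})"
        if "0 \<le> s" "s \<le> T" for s
      proof -
        have "((\<lambda>s. ?\<beta> (Suc n) s) has_real_derivative
            M' * (real (Suc n) * (\<Lambda> * s) ^ n * \<Lambda>) / fact (Suc n)) (at s within {0..})"
          by (rule derivative_eq_intros | simp del: fact_Suc of_nat_Suc power_Suc)+
        moreover have "M' * (real (Suc n) * (\<Lambda> * s) ^ n * \<Lambda>) / fact (Suc n) = \<Lambda> * ?\<beta> n s"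
          by (simp add: field_simps del: of_nat_Suc)
        ultimately have d\<beta>: "((\<lambda>s. ?\<beta> (Suc n) s) has_real_derivative \<Lambda> * ?\<beta> n s) (at s within {0..})"
          by metis
        have "((\<lambda>s. exp (\<Lambda> * s) * w s a) has_real_derivative exp (\<Lambda> * s) * (w' s a + \<Lambda> * w s a)) (at s within {0..})"
          by (auto intro!: derivative_eq_intros der[OF True that] simp: algebra_simps)
        from DERIV_add[OF this d\<beta>] show ?thesis unfolding y_def .
      qed
      have "y 0 \<le> y t"
      proof (rule DERIV_nonneg_imp_increasing_open[OF \<open>0 \<le> t\<close>])
        fix s assume s: "0 < s" "s < t"
        then have sT: "0 \<le> s" "s \<le> T" using Suc.prems by auto
        have "at s within {0..} = at s" using s by (intro at_within_interior) auto
        then have "(y has_real_derivative (exp (\<Lambda> * s) * (w' s a + \<Lambda> * w s a) + \<Lambda> * ?\<beta> n s)) (at s)"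
          using dy[OF sT] by simp
        moreover have "0 \<le> exp (\<Lambda> * s) * (w' s a + \<Lambda> * w s a) + \<Lambda> * ?\<beta> n s"
        proof -
          \<comment> \<open>The bound of stage n at time \<open>s\<close> with the exponential
            factor removed, so that in the worst case the two terms of the derivative of
            \<open>y\<close> cancel.\<close>
          define m where "m = ?\<beta> n s / exp (\<Lambda> * s)"
          have m0: "0 \<le> m" unfolding m_def using M' \<Lambda> sT by simp
          have "- m \<le> w s b" for b
            using Suc.IH[OF sT, of b] unfolding m_def by (simp add: field_simps)
          from ineq[OF True sT m0 this] have "- \<Lambda> * m \<le> w' s a + \<Lambda> * w s a" by simp
          then have "exp (\<Lambda> * s) * (- \<Lambda> * m) \<le> exp (\<Lambda> * s) * (w' s a + \<Lambda> * w s a)"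
            by (intro mult_left_mono) auto
          moreover have "exp (\<Lambda> * s) * (- \<Lambda> * m) = - \<Lambda> * ?\<beta> n s" unfolding m_def by simp
          ultimately show ?thesis by simp
        qed
        ultimately show "\<exists>z. DERIV y s :> z \<and> 0 \<le> z" by blast
      next
        show "continuous_on {0..t} y"
        proof (rule DERIV_continuous_on)
          fix s assume "s \<in> {0..t}"
          then show "(y has_real_derivative (exp (\<Lambda> * s) * (w' s a + \<Lambda> * w s a) + \<Lambda> * ?\<beta> n s)) (at s within {0..t})"
            using dy[of s] Suc.prems by (auto intro: DERIV_subset)
        qed
      qed
      moreover have "y 0 = w 0 a" unfolding y_def by simp
      ultimately show ?thesis using init[of a] unfolding y_def by linarith
    qed
  qed
  have "(\<lambda>n. (\<Lambda> * t) ^ n / fact n) \<longlonglongrightarrow> 0"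
    using summable_LIMSEQ_zero[OF summable_exp[of "\<Lambda> * t"]] by (simp add: field_simps)
  then have "(\<lambda>n. - (M' * ((\<Lambda> * t) ^ n / fact n))) \<longlonglongrightarrow> - (M' * 0)" by (intro tendsto_intros)
  then have "- (M' * 0) \<le> exp (\<Lambda> * t) * w t a"
    by (rule LIMSEQ_le_const2) (use key[OF t] in auto)
  then show ?thesis by (simp add: zero_le_mult_iff)
qed

text \<open>Inflow comes from values at least \<open>- m\<close> and outflow has rate at most
  \<open>\<Lambda>\<close>; as \<open>f a + m\<close> is nonnegative, the actual exit rate may be
  replaced by \<open>\<Lambda>\<close>. This is the inequality that \<open>max_principle\<close>
  asks for.\<close>

lemma jump_op_le:
  assumes "jump_op \<Lambda> L" "0 \<le> m" "\<And>b. - m \<le> f b"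
  shows "- \<Lambda> * f a - \<Lambda> * m \<le> L f a"
proof -
  obtain S w where S': "finite S" "\<forall>b\<in>S. 0 \<le> w b" "sum w S \<le> \<Lambda>"
     "\<forall>f. L f a = (\<Sum>b\<in>S. w b * (f b - f a))" by (rule jump_opE[OF assms(1)])
  note S = S'(1) S'(2)[rule_format] S'(3) S'(4)[rule_format]
  have "(\<Sum>b\<in>S. w b * (- m - f a)) \<le> L f a"
    unfolding S(4) using S assms by (intro sum_mono mult_left_mono) auto
  moreover have "(\<Sum>b\<in>S. w b * (- m - f a)) = - (sum w S * (m + f a))"
    by (simp add: sum_distrib_right flip: sum_negf) (simp add: algebra_simps)
  moreover have "sum w S * (m + f a) \<le> \<Lambda> * (m + f a)"
    using S assms(3)[of a] by (intro mult_right_mono) auto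
  ultimately show ?thesis by (simp add: algebra_simps)
qed

lemma jump_op_linear:
  assumes "jump_op \<Lambda> L"
  shows "L (\<lambda>a. c * f a + e * g a) a = c * L f a + e * L g a"
proof -
  obtain S w where S': "finite S" "\<forall>b\<in>S. 0 \<le> w b" "sum w S \<le> \<Lambda>"
     "\<forall>f. L f a = (\<Sum>b\<in>S. w b * (f b - f a))" by (rule jump_opE[OF assms(1)])
  note S = S'(1) S'(4)[rule_format]
  have "L (\<lambda>a. c * f a + e * g a) a = (\<Sum>b\<in>S. c * (w b * (f b - f a)) + e * (w b * (g b - g a)))"
    unfolding S(2) by (intro sum.cong refl) (simp add: algebra_simps)
  then show ?thesis unfolding S(2)[of f] S(2)[of g] sum_distrib_left sum.distrib .
qed

lemma jump_op_const: assumes "jump_op \<Lambda> L" shows "L (\<lambda>_. c) a = 0"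
proof -
  obtain S w where S': "finite S" "\<forall>b\<in>S. 0 \<le> w b" "sum w S \<le> \<Lambda>"
     "\<forall>f. L f a = (\<Sum>b\<in>S. w b * (f b - f a))" by (rule jump_opE[OF assms(1)])
  note S = S'(1) S'(4)[rule_format]
  show ?thesis unfolding S(2) by simp
qed

lemma jump_op_diff:
  assumes "jump_op \<Lambda> L" shows "L (\<lambda>a. f a - g a) a = L f a - L g a"
  using jump_op_linear[OF assms, of 1 f "-1" g a] by simp

lemma jump_op_add:
  assumes "jump_op \<Lambda> L" shows "L (\<lambda>a. f a + g a) a = L f a + L g a"
  using jump_op_linear[OF assms, of 1 f 1 g a] by simp

lemma jump_op_cmult:
  assumes "jump_op \<Lambda> L" shows "L (\<lambda>a. c * f a) a = c * L f a"
  using jump_op_linear[OF assms, of c f 0 f a] by simp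

lemma jump_op_bnd:
  assumes "jump_op \<Lambda> L" "bnd B f" shows "bnd (2 * \<Lambda> * B) (L f)"
  unfolding bnd_def
proof
  fix a
  obtain S w where S': "finite S" "\<forall>b\<in>S. 0 \<le> w b" "sum w S \<le> \<Lambda>"
     "\<forall>f. L f a = (\<Sum>b\<in>S. w b * (f b - f a))" by (rule jump_opE[OF assms(1)])
  note S = S'(1) S'(2)[rule_format] S'(3) S'(4)[rule_format]
  have "\<bar>L f a\<bar> \<le> (\<Sum>b\<in>S. \<bar>w b * (f b - f a)\<bar>)" unfolding S(4) by (rule sum_abs)
  also have "\<dots> \<le> (\<Sum>b\<in>S. w b * (2 * B))"
  proof (intro sum_mono)
    fix b assume "b \<in> S"
    then show "\<bar>w b * (f b - f a)\<bar> \<le> w b * (2 * B)"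
      using S(2)[of b] bndD[OF assms(2), of a] bndD[OF assms(2), of b]
      by (auto simp: abs_mult intro!: mult_left_mono)
  qed
  also have "\<dots> = sum w S * (2 * B)" by (simp add: sum_distrib_right)
  also have "\<dots> \<le> \<Lambda> * (2 * B)" using S(3) bnd_nonneg[OF assms(2)] by (intro mult_right_mono) auto
  finally show "\<bar>L f a\<bar> \<le> 2 * \<Lambda> * B" by simp
qed

lemma jump_op_bnd_pow:
  assumes "jump_op \<Lambda> L" "bnd B f" shows "bnd ((2 * \<Lambda>) ^ n * B) ((L ^^ n) f)"
proof (induction n)
  case (Suc n)
  from jump_op_bnd[OF assms(1) Suc] show ?case by (simp add: mult_ac)
qed (use assms in simp)

section \<open>The exponential series as a Markov semigroup\<close>

lemma summable_exp_bound:
  fixes C r :: real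
  shows "summable (\<lambda>n. C * (r ^ n / fact n))"
  using summable_mult[OF summable_exp[of r], of C] by (simp add: field_simps)

lemma sgrp_term_le:
  assumes "jump_op \<Lambda> L" "bnd B f"
  shows "norm ((L ^^ n) f a / fact n * t ^ n) \<le> B * ((2 * \<Lambda> * \<bar>t\<bar>) ^ n / fact n)"
proof -
  have "\<bar>(L ^^ n) f a\<bar> * (\<bar>t\<bar> ^ n / fact n) \<le> ((2 * \<Lambda>) ^ n * B) * (\<bar>t\<bar> ^ n / fact n)"
    using bndD[OF jump_op_bnd_pow[OF assms, of n], of a] by (intro mult_right_mono) auto
  then show ?thesis by (simp add: abs_mult power_abs power_mult_distrib mult_ac)
qed

lemma sgrp_summable:
  assumes "jump_op \<Lambda> L" "bnd B f"
  shows "summable (\<lambda>n. (L ^^ n) f a / fact n * t ^ n)"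
  by (rule summable_comparison_test'[OF summable_exp_bound sgrp_term_le[OF assms]])

lemma sgrp_0[simp]: "sgrp L 0 f a = f a"
  unfolding sgrp_def powser_zero by simp

lemma sgrp_bound_exp:
  assumes "jump_op \<Lambda> L" "bnd B f"
  shows "\<bar>sgrp L t f a\<bar> \<le> B * exp (2 * \<Lambda> * \<bar>t\<bar>)"
proof -
  have "norm (sgrp L t f a) \<le> (\<Sum>n. B * ((2 * \<Lambda> * \<bar>t\<bar>) ^ n / fact n))"
    unfolding sgrp_def by (rule norm_suminf_le[OF sgrp_term_le[OF assms] summable_exp_bound])
  moreover have "(\<lambda>n. B * ((2 * \<Lambda> * \<bar>t\<bar>) ^ n / fact n)) sums (B * exp (2 * \<Lambda> * \<bar>t\<bar>))"
    using sums_mult[OF exp_converges[of "2 * \<Lambda> * \<bar>t\<bar>"], of B]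
    unfolding real_scaleR_def divide_inverse by (subst (2) mult.commute)
  from sums_unique[OF this, symmetric]
  have "(\<Sum>n. B * ((2 * \<Lambda> * \<bar>t\<bar>) ^ n / fact n)) = B * exp (2 * \<Lambda> * \<bar>t\<bar>)" .
  ultimately show ?thesis by simp
qed

lemma sgrp_deriv:
  assumes "jump_op \<Lambda> L" "bnd B f"
  shows "((\<lambda>t. sgrp L t f a) has_real_derivative sgrp L t (L f) a) (at t within S)"
proof -
  have "((\<lambda>t. sgrp L t f a) has_real_derivative (\<Sum>n. diffs (\<lambda>n. (L ^^ n) f a / fact n) n * t ^ n)) (at t)"
    unfolding sgrp_def[abs_def]
    by (rule termdiffs_strong_converges_everywhere) (rule sgrp_summable[OF assms])
  moreover have "diffs (\<lambda>n. (L ^^ n) f a / fact n) = (\<lambda>n. (L ^^ n) (L f) a / fact n)"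
  proof
    fix n
    have "(L ^^ Suc n) f a = (L ^^ n) (L f) a" by (simp only: funpow_Suc_right o_apply)
    then show "diffs (\<lambda>n. (L ^^ n) f a / fact n) n = (L ^^ n) (L f) a / fact n"
      unfolding diffs_def fact_Suc by (simp del: of_nat_Suc funpow.simps)
  qed
  ultimately have "((\<lambda>t. sgrp L t f a) has_real_derivative sgrp L t (L f) a) (at t)"
    unfolding sgrp_def[of L t "L f"] by simp
  then show ?thesis by (rule DERIV_subset) simp
qed

lemma jump_op_suminf:
  assumes "jump_op \<Lambda> L" "\<And>a. summable (\<lambda>n. F n a)"
  shows "L (\<lambda>a. \<Sum>n. F n a) a = (\<Sum>n. L (F n) a)"
proof -
  obtain S w where S': "finite S" "\<forall>b\<in>S. 0 \<le> w b" "sum w S \<le> \<Lambda>"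
     "\<forall>f. L f a = (\<Sum>b\<in>S. w b * (f b - f a))" by (rule jump_opE[OF assms(1)])
  note S = S'(1) S'(4)[rule_format]
  have "(\<Sum>n. L (F n) a) = (\<Sum>b\<in>S. \<Sum>n. w b * (F n b - F n a))"
    unfolding S(2) by (intro suminf_sum summable_mult summable_diff assms)
  also have "\<dots> = (\<Sum>b\<in>S. w b * ((\<Sum>n. F n b) - (\<Sum>n. F n a)))"
  proof (intro sum.cong refl)
    fix b
    have "(\<Sum>n. w b * (F n b - F n a)) = w b * (\<Sum>n. F n b - F n a)"
      by (intro suminf_mult summable_diff assms(2))
    then show "(\<Sum>n. w b * (F n b - F n a)) = w b * ((\<Sum>n. F n b) - (\<Sum>n. F n a))"
      using suminf_diff[OF assms(2)[of b] assms(2)[of a]] by simp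
  qed
  finally show ?thesis unfolding S(2) by simp
qed

lemma jump_op_sgrp:
  assumes "jump_op \<Lambda> L" "bnd B f"
  shows "L (sgrp L t f) a = sgrp L t (L f) a"
proof -
  have "L (sgrp L t f) a = L (\<lambda>a. \<Sum>n. (L ^^ n) f a / fact n * t ^ n) a"
    unfolding sgrp_def ..
  also have "\<dots> = (\<Sum>n. L (\<lambda>a. (L ^^ n) f a / fact n * t ^ n) a)"
    by (rule jump_op_suminf[OF assms(1) sgrp_summable[OF assms]])
  also have "\<dots> = (\<Sum>n. (L ^^ n) (L f) a / fact n * t ^ n)"
  proof (intro suminf_cong)
    show "L (\<lambda>a. (L ^^ n) f a / fact n * t ^ n) a = (L ^^ n) (L f) a / fact n * t ^ n" for n
      using jump_op_cmult[OF assms(1), of "t ^ n / fact n" "(L ^^ n) f" a]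
      by (simp add: mult_ac funpow_swap1)
  qed
  finally show ?thesis unfolding sgrp_def .
qed

lemma sgrp_deriv':
  assumes "jump_op \<Lambda> L" "bnd B f"
  shows "((\<lambda>t. sgrp L t f a) has_real_derivative L (sgrp L t f) a) (at t within S)"
  using sgrp_deriv[OF assms] jump_op_sgrp[OF assms] by metis

lemma jump_supersolution_nonneg:
  assumes L: "jump_op \<Lambda> L"
    and "\<And>t a. 0 \<le> t \<Longrightarrow> t \<le> T \<Longrightarrow> - M \<le> w t a"
    and "\<And>a. 0 \<le> w 0 a"
    and "\<And>t a. a \<notin> S \<Longrightarrow> 0 \<le> t \<Longrightarrow> t \<le> T \<Longrightarrow> 0 \<le> w t a"
    and "\<And>t a. a \<in> S \<Longrightarrow> 0 \<le> t \<Longrightarrow> t \<le> T \<Longrightarrow>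
       ((\<lambda>s. w s a) has_real_derivative w' t a) (at t within {0..})"
    and "\<And>t a. a \<in> S \<Longrightarrow> 0 \<le> t \<Longrightarrow> t \<le> T \<Longrightarrow> L (w t) a \<le> w' t a"
    and "0 \<le> t" "t \<le> T"
  shows "0 \<le> w t a"
proof (rule max_principle[of \<Lambda> T M w S w' t a, OF jump_op_nonneg[OF L] assms(2,3,4,5)])
  fix t a m assume "a \<in> S" "0 \<le> t" "t \<le> T" "0 \<le> m" "\<And>b. - m \<le> w t b"
  then show "- \<Lambda> * w t a - \<Lambda> * m \<le> w' t a"
    using jump_op_le[OF L, of m "w t" a] assms(6)[of a t] by force
qed (use assms in auto)

lemma sgrp_nonneg:
  assumes L: "jump_op \<Lambda> L" and f: "bnd B f" "\<And>a. 0 \<le> f a" and t: "0 \<le> t"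
  shows "0 \<le> sgrp L t f a"
proof (rule jump_supersolution_nonneg[OF L, of t "B * exp (2 * \<Lambda> * t)" "\<lambda>t. sgrp L t f" UNIV "\<lambda>t. L (sgrp L t f)"])
  fix s a assume s: "0 \<le> s" "s \<le> t"
  have "B * exp (2 * \<Lambda> * \<bar>s\<bar>) \<le> B * exp (2 * \<Lambda> * t)"
    using s jump_op_nonneg[OF L] bnd_nonneg[OF f(1)] by (intro mult_left_mono) (auto intro: mult_left_mono)
  with sgrp_bound_exp[OF L f(1), of s a]
  show "- (B * exp (2 * \<Lambda> * t)) \<le> sgrp L s f a" by linarith
qed (use f t sgrp_deriv'[OF L f(1)] in auto)

lemma sgrp_linear:
  assumes L: "jump_op \<Lambda> L" and f: "bnd B f" and g: "bnd C g"
  shows "sgrp L t (\<lambda>a. c * f a + e * g a) a = c * sgrp L t f a + e * sgrp L t g a"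
proof -
  have p: "(L ^^ n) (\<lambda>a. c * f a + e * g a) = (\<lambda>a. c * (L ^^ n) f a + e * (L ^^ n) g a)" for n
    by (induction n) (auto simp: jump_op_linear[OF L])
  have "sgrp L t (\<lambda>a. c * f a + e * g a) a
     = (\<Sum>n. c * ((L ^^ n) f a / fact n * t ^ n) + e * ((L ^^ n) g a / fact n * t ^ n))"
    unfolding sgrp_def p by (intro suminf_cong) (simp add: add_divide_distrib algebra_simps)
  also have "\<dots> = c * sgrp L t f a + e * sgrp L t g a"
    unfolding sgrp_def suminf_mult[OF sgrp_summable[OF L f], symmetric] suminf_mult[OF sgrp_summable[OF L g], symmetric]
    by (intro suminf_add[symmetric] summable_mult sgrp_summable[OF L f] sgrp_summable[OF L g])
  finally show ?thesis .
qed

lemma sgrp_diff: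
  assumes "jump_op \<Lambda> L" and "bnd B f" and "bnd C g"
  shows "sgrp L t (\<lambda>a. f a - g a) a = sgrp L t f a - sgrp L t g a"
  using sgrp_linear[OF assms, of t 1 "-1" a] by simp

lemma sgrp_add:
  assumes "jump_op \<Lambda> L" and "bnd B f" and "bnd C g"
  shows "sgrp L t (\<lambda>a. f a + g a) a = sgrp L t f a + sgrp L t g a"
  using sgrp_linear[OF assms, of t 1 1 a] by simp

lemma sgrp_cmult:
  assumes "jump_op \<Lambda> L" and "bnd B f"
  shows "sgrp L t (\<lambda>a. c * f a) a = c * sgrp L t f a"
  using sgrp_linear[OF assms assms(2), of t c 0 a] by simp

lemma sgrp_harmonic:
  assumes L: "jump_op \<Lambda> L" and f: "\<And>a. L f a = 0"
  shows "sgrp L t f a = f a"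
proof -
  have "(L ^^ n) f b = (if n = 0 then f b else 0)" for n b
  proof (induction n arbitrary: b)
    case (Suc n)
    have "(L ^^ Suc n) f b = L ((L ^^ n) f) b" by simp
    also have "(L ^^ n) f = (if n = 0 then f else (\<lambda>_. 0))" using Suc by auto
    also have "L \<dots> b = 0" using f jump_op_const[OF L] by simp
    finally show ?case by simp
  qed simp
  then have "(\<lambda>n. (L ^^ n) f a / fact n * t ^ n) = (\<lambda>n. if n = 0 then f a else 0)" by auto
  then show ?thesis unfolding sgrp_def using suminf_finite[of "{0}" "\<lambda>n. if n = (0::nat) then f a else 0"] by auto
qed

lemma sgrp_const: "jump_op \<Lambda> L \<Longrightarrow> sgrp L t (\<lambda>_. c) a = c"
  by (rule sgrp_harmonic) (auto intro: jump_op_const)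

lemma bndI_const: "bnd \<bar>c\<bar> (\<lambda>_. c)" by (simp add: bnd_def)

lemma sgrp_mono:
  assumes L: "jump_op \<Lambda> L" and f: "bnd B f" and g: "bnd C g" and le: "\<And>a. f a \<le> g a" and t: "0 \<le> t"
  shows "sgrp L t f a \<le> sgrp L t g a"
proof -
  have "bnd (B + C) (\<lambda>a. g a - f a)" unfolding bnd_def
  proof
    show "\<bar>g a - f a\<bar> \<le> B + C" for a using bndD[OF f, of a] bndD[OF g, of a] by linarith
  qed
  from sgrp_nonneg[OF L this _ t, of a] le sgrp_diff[OF L g f, of t a] show ?thesis by simp
qed

lemma sgrp_bnd:
  assumes L: "jump_op \<Lambda> L" and f: "bnd B f" and t: "0 \<le> t"
  shows "bnd B (sgrp L t f)"
  unfolding bnd_def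
proof
  fix a
  have "sgrp L t f a \<le> sgrp L t (\<lambda>_. B) a"
    using bndD[OF f] by (intro sgrp_mono[OF L f bndI_const _ t]) (auto simp: abs_le_iff)
  moreover have "sgrp L t (\<lambda>_. - B) a \<le> sgrp L t f a"
    using bndD[OF f] by (intro sgrp_mono[OF L bndI_const f _ t]) (auto simp: abs_le_iff minus_le_iff)
  ultimately show "\<bar>sgrp L t f a\<bar> \<le> B" by (simp add: sgrp_const[OF L])
qed

text \<open>The two differences of \<open>u\<close> and the series are both supersolutions with zero
  initial value. Later identities such as the semigroup law and duality are obtained by checking the
  backward equation and invoking this.\<close>

lemma sgrp_unique:
  assumes L: "jump_op \<Lambda> L"
    and u: "\<And>t a. 0 \<le> t \<Longrightarrow> \<bar>u t a\<bar> \<le> B"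
    and der: "\<And>t a. 0 \<le> t \<Longrightarrow> ((\<lambda>s. u s a) has_real_derivative L (u t) a) (at t within {0..})"
    and t: "0 \<le> t"
  shows "u t a = sgrp L t (u 0) a"
proof -
  have b0: "bnd B (u 0)" using u[of 0] by (auto simp: bnd_def)
  have bs: "\<bar>sgrp L t (u 0) a\<bar> \<le> B" if "0 \<le> t" for t a using sgrp_bnd[OF L b0 that] by (rule bndD)
  have "0 \<le> u t a - sgrp L t (u 0) a"
  proof (rule jump_supersolution_nonneg[OF L, of t "2 * B" "\<lambda>t a. u t a - sgrp L t (u 0) a" UNIV "\<lambda>t a. L (u t) a - L (sgrp L t (u 0)) a"])
    show "- (2 * B) \<le> u t a - sgrp L t (u 0) a" if "0 \<le> t" for t a using u[OF that, of a] bs[OF that, of a] by linarith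
  qed (use t in \<open>auto intro!: DERIV_diff der sgrp_deriv'[OF L b0] simp: jump_op_diff[OF L]\<close>)
  moreover have "0 \<le> sgrp L t (u 0) a - u t a"
  proof (rule jump_supersolution_nonneg[OF L, of t "2 * B" "\<lambda>t a. sgrp L t (u 0) a - u t a" UNIV "\<lambda>t a. L (sgrp L t (u 0)) a - L (u t) a"])
    show "- (2 * B) \<le> sgrp L t (u 0) a - u t a" if "0 \<le> t" for t a using u[OF that, of a] bs[OF that, of a] by linarith
  qed (use t in \<open>auto intro!: DERIV_diff der sgrp_deriv'[OF L b0] simp: jump_op_diff[OF L]\<close>)
  ultimately show ?thesis by simp
qed

lemma sgrp_semigroup:
  assumes L: "jump_op \<Lambda> L" and f: "bnd B f" and s: "0 \<le> s" and t: "0 \<le> t"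
  shows "sgrp L (t + s) f a = sgrp L t (sgrp L s f) a"
proof -
  have "sgrp L (t + s) f a = sgrp L t (\<lambda>a. sgrp L (0 + s) f a) a"
  proof (rule sgrp_unique[OF L _ _ t, of "\<lambda>t a. sgrp L (t + s) f a"])
    show "\<bar>sgrp L (t + s) f a\<bar> \<le> B" if "0 \<le> t" for t a
      using bndD[OF sgrp_bnd[OF L f]] that s by simp
    show "((\<lambda>r. sgrp L (r + s) f a) has_real_derivative L (\<lambda>a. sgrp L (t + s) f a) a) (at t within {0..})" for t a
      using DERIV_shift[of "\<lambda>t. sgrp L t f a" "L (sgrp L (t + s) f) a" t s] sgrp_deriv'[OF L f, of a "t + s" UNIV]
      by (auto intro: DERIV_subset)
  qed
  then show ?thesis by simp
qed

text \<open>Each power of \<open>L\<close> looks at finitely many states, so pointwise convergence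
  passes to every term; the common bound \<open>B\<close> dominates the series.\<close>

lemma sgrp_tendsto:
  assumes L: "jump_op \<Lambda> L" and f: "\<And>n. bnd B (f n)" and lim: "\<And>a. (\<lambda>n. f n a) \<longlonglongrightarrow> g a"
  shows "(\<lambda>n. sgrp L t (f n) a) \<longlonglongrightarrow> sgrp L t g a"
proof -
  have *: "(\<lambda>n. (L ^^ k) (f n) a) \<longlonglongrightarrow> (L ^^ k) g a" for k a
  proof (induction k arbitrary: a)
    case (Suc k)
    obtain S w where S': "finite S" "\<forall>b\<in>S. 0 \<le> w b" "sum w S \<le> \<Lambda>"
      "\<forall>f. L f a = (\<Sum>b\<in>S. w b * (f b - f a))" by (rule jump_opE[OF L])
    note S = S'(1) S'(4)[rule_format]
    show ?case using Suc.IH unfolding funpow.simps comp_def S(2) by (intro tendsto_intros)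
  qed (use lim in simp)
  have "((\<lambda>n. suminf (\<lambda>k. (L ^^ k) (f n) a / fact k * t ^ k)) \<longlongrightarrow> (\<Sum>k. (L ^^ k) g a / fact k * t ^ k)) sequentially"
  proof (rule tannerys_theorem[THEN conjunct2, THEN conjunct2])
    show "eventually (\<lambda>(k,n). norm ((L ^^ k) (f n) a / fact k * t ^ k) \<le> B * ((2 * \<Lambda> * \<bar>t\<bar>) ^ k / fact k)) (at_top \<times>\<^sub>F sequentially)"
      using sgrp_term_le[OF L f] by (intro always_eventually) auto
  qed (intro tendsto_intros * summable_exp_bound | simp)+
  then show ?thesis unfolding sgrp_def .
qed

text \<open>A map that carries one generator to the other carries all their powers. This serves to
  freeze coordinates, to project to pairs and to relabel particles.\<close>

lemma sgrp_intertwine: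
  assumes "\<And>F a. L1 (\<lambda>a. F (\<Phi> a)) a = L2 F (\<Phi> a)"
  shows "sgrp L1 t (\<lambda>a. F (\<Phi> a)) a = sgrp L2 t F (\<Phi> a)"
proof -
  have "(L1 ^^ n) (\<lambda>a. F (\<Phi> a)) = (\<lambda>a. (L2 ^^ n) F (\<Phi> a))" for n
    by (induction n) (auto simp: assms)
  then show ?thesis unfolding sgrp_def by simp
qed

text \<open>The factor exp(-\<Lambda>t) bounds from below the probability of not having jumped by
  time t.\<close>

lemma sgrp_ge_exp:
  assumes L: "jump_op \<Lambda> L" and f: "bnd B f" "\<And>a. 0 \<le> f a" and t: "0 \<le> t"
  shows "exp (- \<Lambda> * t) * f a \<le> sgrp L t f a"
proof -
  have "exp (\<Lambda> * 0) * sgrp L 0 f a \<le> exp (\<Lambda> * t) * sgrp L t f a"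
  proof (rule DERIV_nonneg_imp_nondecreasing[OF t])
    fix s assume s: "0 \<le> s" "s \<le> t"
    have "((\<lambda>s. exp (\<Lambda> * s) * sgrp L s f a) has_real_derivative exp (\<Lambda> * s) * (\<Lambda> * sgrp L s f a + L (sgrp L s f) a)) (at s)"
      by (auto intro!: derivative_eq_intros sgrp_deriv'[OF L f(1)] simp: algebra_simps)
    moreover have "0 \<le> \<Lambda> * sgrp L s f a + L (sgrp L s f) a"
      using jump_op_le[OF L, of 0 "sgrp L s f" a] sgrp_nonneg[OF L f s(1)] by simp
    ultimately show "\<exists>y. ((\<lambda>s. exp (\<Lambda> * s) * sgrp L s f a) has_real_derivative y) (at s) \<and> 0 \<le> y"
      by (meson exp_ge_zero mult_nonneg_nonneg)
  qed
  then show ?thesis by (simp add: exp_minus field_simps)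
qed

lemma sgrp_lipschitz:
  assumes L: "jump_op \<Lambda> L" and f: "bnd B f" and "0 \<le> s" "0 \<le> t"
  shows "\<bar>sgrp L s f a - sgrp L t f a\<bar> \<le> 2 * \<Lambda> * B * \<bar>s - t\<bar>"
proof -
  have "norm (sgrp L s f a - sgrp L t f a) \<le> 2 * \<Lambda> * B * norm (s - t)"
  proof (rule field_differentiable_bound[of "{0..}"])
    show "((\<lambda>t. sgrp L t f a) has_field_derivative sgrp L x (L f) a) (at x within {0..})" if "x \<in> {0..}" for x
      by (rule sgrp_deriv[OF L f])
    show "norm (sgrp L x (L f) a) \<le> 2 * \<Lambda> * B" if "x \<in> {0..}" for x
      using bndD[OF sgrp_bnd[OF L jump_op_bnd[OF L f]]] that by simp
  qed (use assms in auto)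
  then show ?thesis by simp
qed

text \<open>The error is uniform in the state, which the product rule in
  \<open>sgrp_commuting_sum\<close> needs: there the difference quotient of one semigroup is fed
  into the other.\<close>

lemma sgrp_taylor:
  assumes L: "jump_op \<Lambda> L" and f: "bnd B f" and s: "0 \<le> s" and t: "0 \<le> t" and st: "s \<noteq> t"
  shows "\<bar>(sgrp L s f a - sgrp L t f a) / (s - t) - sgrp L t (L f) a\<bar> \<le> 2 * \<Lambda> * (2 * \<Lambda> * B) * \<bar>s - t\<bar>"
proof -
  let ?g = "\<lambda>r. sgrp L r f a"
  have "\<exists>\<xi>. min s t < \<xi> \<and> \<xi> < max s t \<and> ?g (max s t) - ?g (min s t) = (max s t - min s t) * sgrp L \<xi> (L f) a"
    by (rule MVT2) (use st sgrp_deriv[OF L f, of a _ UNIV] in \<open>auto simp: min_def max_def\<close>)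
  then obtain \<xi> where \<xi>: "min s t < \<xi>" "\<xi> < max s t" "?g (max s t) - ?g (min s t) = (max s t - min s t) * sgrp L \<xi> (L f) a"
    by blast
  then have "(sgrp L s f a - sgrp L t f a) / (s - t) = sgrp L \<xi> (L f) a"
    using st by (auto simp: min_def max_def field_simps split: if_splits)
  moreover have "\<bar>sgrp L \<xi> (L f) a - sgrp L t (L f) a\<bar> \<le> 2 * \<Lambda> * (2 * \<Lambda> * B) * \<bar>\<xi> - t\<bar>"
    by (rule sgrp_lipschitz[OF L jump_op_bnd[OF L f]]) (use \<xi> s t in auto)
  moreover have "2 * \<Lambda> * (2 * \<Lambda> * B) * \<bar>\<xi> - t\<bar> \<le> 2 * \<Lambda> * (2 * \<Lambda> * B) * \<bar>s - t\<bar>"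
    using jump_op_nonneg[OF L] bnd_nonneg[OF f] \<xi> by (intro mult_left_mono) (auto simp: min_def max_def split: if_splits)
  ultimately show ?thesis by linarith
qed

lemma sgrp_pow_commute:
  assumes L1: "jump_op \<Lambda> L1" and L2: "jump_op \<Gamma> L2" and f: "bnd B f"
    and comm: "\<And>g a. L1 (L2 g) a = L2 (L1 g) a"
  shows "L1 (sgrp L2 t f) a = sgrp L2 t (L1 f) a"
proof -
  have p: "L1 ((L2 ^^ n) f) = (L2 ^^ n) (L1 f)" for n
    by (induction n) (use comm in auto)
  have "L1 (sgrp L2 t f) a = L1 (\<lambda>a. \<Sum>n. (L2 ^^ n) f a / fact n * t ^ n) a"
    unfolding sgrp_def ..
  also have "\<dots> = (\<Sum>n. L1 (\<lambda>a. (L2 ^^ n) f a / fact n * t ^ n) a)"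
    by (rule jump_op_suminf[OF L1 sgrp_summable[OF L2 f]])
  also have "\<dots> = (\<Sum>n. (L2 ^^ n) (L1 f) a / fact n * t ^ n)"
  proof (intro suminf_cong)
    show "L1 (\<lambda>a. (L2 ^^ n) f a / fact n * t ^ n) a = (L2 ^^ n) (L1 f) a / fact n * t ^ n" for n
      using jump_op_cmult[OF L1, of "t ^ n / fact n" "(L2 ^^ n) f" a] p[of n]
      by (simp add: mult_ac)
  qed
  finally show ?thesis unfolding sgrp_def .
qed

text \<open>The right-hand side depends on time twice. A product rule gives its derivative,
  commutation turns that derivative into \<open>L\<close> applied to it, and uniqueness of the
  backward equation concludes.\<close>

theorem sgrp_commuting_sum:
  assumes L1: "jump_op \<Lambda> L1" and L2: "jump_op \<Gamma> L2" and L: "jump_op \<Delta> L" and f: "bnd B f"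
    and sum: "\<And>g a. L g a = L1 g a + L2 g a"
    and comm: "\<And>g a. L1 (L2 g) a = L2 (L1 g) a"
    and t: "0 \<le> t"
  shows "sgrp L t f a = sgrp L1 t (sgrp L2 t f) a"
proof -
  define g where "g t = sgrp L2 t f" for t
  have gb: "bnd B (g t)" if "0 \<le> t" for t unfolding g_def by (rule sgrp_bnd[OF L2 f that])
  have "sgrp L1 t (g t) a = sgrp L t (\<lambda>a. sgrp L1 0 (g 0) a) a"
  proof (rule sgrp_unique[OF L, of "\<lambda>t a. sgrp L1 t (g t) a" B])
    show "\<bar>sgrp L1 t (g t) a\<bar> \<le> B" if "0 \<le> t" for t a using bndD[OF sgrp_bnd[OF L1 gb[OF that] that]] .
    fix t :: real and a assume t: "0 \<le> t"
    have Lg: "bnd (2 * \<Gamma> * B) (L2 (g t))" by (rule jump_op_bnd[OF L2 gb[OF t]])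
    have Lgt: "L2 (g t) b = sgrp L2 t (L2 f) b" for b unfolding g_def by (rule jump_op_sgrp[OF L2 f])
    \<comment> \<open>Difference quotient of the inner semigroup. It converges to
      \<open>L2 (g t)\<close> uniformly in the state, so the outer semigroup, a contraction, keeps
      the error small.\<close>
    define q where "q s b = (g s b - g t b) / (s - t)" for s b
    have q: "\<bar>q s b - L2 (g t) b\<bar> \<le> 2 * \<Gamma> * (2 * \<Gamma> * B) * \<bar>s - t\<bar>" if "0 \<le> s" "s \<noteq> t" for s b
      unfolding q_def Lgt unfolding g_def by (rule sgrp_taylor[OF L2 f that(1) t that(2)])
    have "((\<lambda>s. (sgrp L1 s (g s) a - sgrp L1 t (g t) a) / (s - t)) \<longlongrightarrow>
         L1 (sgrp L1 t (g t)) a + sgrp L1 t (L2 (g t)) a) (at t within {0..})"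
    proof (rule Lim_transform_eventually)
      have "((\<lambda>s. (sgrp L1 s (g t) a - sgrp L1 t (g t) a) / (s - t)) \<longlongrightarrow> L1 (sgrp L1 t (g t)) a) (at t within {0..})"
        using sgrp_deriv'[OF L1 gb[OF t], of a t "{0..}"] unfolding has_field_derivative_iff .
      moreover have "((\<lambda>s. sgrp L1 s (\<lambda>b. q s b - L2 (g t) b) a) \<longlongrightarrow> 0) (at t within {0..})"
      proof (rule Lim_null_comparison)
        show "\<forall>\<^sub>F s in at t within {0..}. norm (sgrp L1 s (\<lambda>b. q s b - L2 (g t) b) a) \<le> 2 * \<Gamma> * (2 * \<Gamma> * B) * \<bar>s - t\<bar>"
          unfolding eventually_at_filter
        proof (intro always_eventually allI impI)
          fix s assume s: "s \<noteq> t" "s \<in> {0..}"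
          have "bnd (2 * \<Gamma> * (2 * \<Gamma> * B) * \<bar>s - t\<bar>) (\<lambda>b. q s b - L2 (g t) b)"
            using q s by (auto simp: bnd_def)
          from bndD[OF sgrp_bnd[OF L1 this]] s
          show "norm (sgrp L1 s (\<lambda>b. q s b - L2 (g t) b) a) \<le> 2 * \<Gamma> * (2 * \<Gamma> * B) * \<bar>s - t\<bar>" by auto
        qed
        show "((\<lambda>s. 2 * \<Gamma> * (2 * \<Gamma> * B) * \<bar>s - t\<bar>) \<longlongrightarrow> 0) (at t within {0..})"
          by (auto intro!: tendsto_eq_intros)
      qed
      moreover have "((\<lambda>s. sgrp L1 s (L2 (g t)) a) \<longlongrightarrow> sgrp L1 t (L2 (g t)) a) (at t within {0..})"
        using DERIV_continuous[OF sgrp_deriv[OF L1 Lg]] unfolding continuous_within .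
      ultimately have "((\<lambda>s. (sgrp L1 s (g t) a - sgrp L1 t (g t) a) / (s - t) + (sgrp L1 s (\<lambda>b. q s b - L2 (g t) b) a
           + sgrp L1 s (L2 (g t)) a)) \<longlongrightarrow> L1 (sgrp L1 t (g t)) a + (0 + sgrp L1 t (L2 (g t)) a)) (at t within {0..})"
        by (intro tendsto_add)
      then show "((\<lambda>s. (sgrp L1 s (g t) a - sgrp L1 t (g t) a) / (s - t) + (sgrp L1 s (\<lambda>b. q s b - L2 (g t) b) a
           + sgrp L1 s (L2 (g t)) a)) \<longlongrightarrow> L1 (sgrp L1 t (g t)) a + sgrp L1 t (L2 (g t)) a) (at t within {0..})"
        by simp
      show "\<forall>\<^sub>F s in at t within {0..}. (sgrp L1 s (g t) a - sgrp L1 t (g t) a) / (s - t) + (sgrp L1 s (\<lambda>b. q s b - L2 (g t) b) a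
           + sgrp L1 s (L2 (g t)) a) = (sgrp L1 s (g s) a - sgrp L1 t (g t) a) / (s - t)"
        unfolding eventually_at_filter
      proof (intro always_eventually allI impI)
        fix s assume s: "s \<noteq> t" "s \<in> {0..}"
        have bq: "bnd (2 * \<Gamma> * (2 * \<Gamma> * B) * \<bar>s - t\<bar>) (\<lambda>b. q s b - L2 (g t) b)"
          using q s by (auto simp: bnd_def)
        have bgs: "bnd B (g s)" using gb s by simp
        have "sgrp L1 s (\<lambda>b. q s b - L2 (g t) b) a + sgrp L1 s (L2 (g t)) a
          = sgrp L1 s (\<lambda>b. (q s b - L2 (g t) b) + L2 (g t) b) a"
          by (rule sgrp_add[OF L1 bq Lg, symmetric])
        also have "(\<lambda>b. (q s b - L2 (g t) b) + L2 (g t) b) = (\<lambda>b. (1 / (s - t)) * (g s b - g t b))"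
          by (auto simp: q_def)
        also have "sgrp L1 s \<dots> a = (1 / (s - t)) * (sgrp L1 s (g s) a - sgrp L1 s (g t) a)"
        proof -
          have "bnd (B + B) (\<lambda>b. g s b - g t b)" unfolding bnd_def
          proof
            show "\<bar>g s b - g t b\<bar> \<le> B + B" for b using bndD[OF bgs, of b] bndD[OF gb[OF t], of b] by linarith
          qed
          from sgrp_cmult[OF L1 this, of s "1 / (s - t)" a] sgrp_diff[OF L1 bgs gb[OF t], of s a] show ?thesis by simp
        qed
        finally show "(sgrp L1 s (g t) a - sgrp L1 t (g t) a) / (s - t) + (sgrp L1 s (\<lambda>b. q s b - L2 (g t) b) a
           + sgrp L1 s (L2 (g t)) a) = (sgrp L1 s (g s) a - sgrp L1 t (g t) a) / (s - t)"
          using s by (simp add: field_simps)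
      qed
    qed
    moreover have "sgrp L1 t (L2 (g t)) a = L2 (sgrp L1 t (g t)) a"
      by (rule sgrp_pow_commute[OF L2 L1 gb[OF t], symmetric]) (use comm in simp)
    ultimately show "((\<lambda>s. sgrp L1 s (g s) a) has_real_derivative L (\<lambda>a. sgrp L1 t (g t) a) a) (at t within {0..})"
      unfolding has_field_derivative_iff sum by simp
  qed (use t in auto)
  then show ?thesis by (simp add: g_def)
qed

section \<open>Correlation functions of configurations\<close>

definition ind :: "bool \<Rightarrow> 'v set \<Rightarrow> ('v \<Rightarrow> bool) \<Rightarrow> real" where
  "ind b A \<eta> = (if \<forall>x\<in>A. \<eta> x = b then 1 else 0)"

lemma ind_empty[simp]: "ind b {} \<eta> = 1" by (simp add: ind_def)
lemma ind_nonneg: "0 \<le> ind b A \<eta>" and ind_le_1: "ind b A \<eta> \<le> 1" by (auto simp: ind_def)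

lemma cylinder_ind: "finite A \<Longrightarrow> cylinder_fun (ind b A)"
  unfolding cylinder_fun_def ind_def by (intro exI[of _ A]) auto

lemma cylinder_const: "cylinder_fun (\<lambda>_. c)"
  unfolding cylinder_fun_def by blast

lemma cylinder_fun_comb:
  assumes "cylinder_fun f" "cylinder_fun g"
  shows "cylinder_fun (\<lambda>\<eta>. h (f \<eta>) (g \<eta>))"
proof -
  obtain A where A: "finite A" "\<forall>\<eta> \<zeta>. (\<forall>x\<in>A. \<eta> x = \<zeta> x) \<longrightarrow> f \<eta> = f \<zeta>" using assms(1) unfolding cylinder_fun_def by auto
  obtain B where B: "finite B" "\<forall>\<eta> \<zeta>. (\<forall>x\<in>B. \<eta> x = \<zeta> x) \<longrightarrow> g \<eta> = g \<zeta>" using assms(2) unfolding cylinder_fun_def by auto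
  show ?thesis unfolding cylinder_fun_def
  proof (intro exI[of _ "A \<union> B"] conjI allI impI)
    fix \<eta> \<zeta> :: "'a \<Rightarrow> bool" assume "\<forall>x\<in>A \<union> B. \<eta> x = \<zeta> x"
    then have "f \<eta> = f \<zeta>" "g \<eta> = g \<zeta>" using A(2) B(2) by blast+
    then show "h (f \<eta>) (g \<eta>) = h (f \<zeta>) (g \<zeta>)" by simp
  qed (use A B in auto)
qed

lemma cylinder_sum:
  assumes "finite S" "\<And>s. s \<in> S \<Longrightarrow> cylinder_fun (f s)"
  shows "cylinder_fun (\<lambda>\<eta>. \<Sum>s\<in>S. c s * f s \<eta>)"
  using assms
proof (induction S)
  case (insert s S)
  have "cylinder_fun (f s)" "cylinder_fun (\<lambda>\<eta>. \<Sum>s\<in>S. c s * f s \<eta>)" using insert by simp_all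
  from cylinder_fun_comb[OF this, of "\<lambda>a b. c s * a + b"] show ?case using insert(1,2) by simp
qed (simp add: cylinder_const)

section \<open>Cylinder functions among the continuous functions\<close>

lemma openin_agree:
  assumes "finite A"
  shows "openin cfg_top {\<zeta>. \<forall>x\<in>A. \<zeta> x = \<eta> x}"
  unfolding cfg_top_def openin_product_topology_alt
proof (intro ballI)
  fix \<zeta> assume "\<zeta> \<in> {\<zeta>. \<forall>x\<in>A. \<zeta> x = \<eta> x}"
  then show "\<exists>U. finite {i \<in> UNIV. U i \<noteq> topspace (discrete_topology UNIV)} \<and>
      (\<forall>i\<in>UNIV. openin (discrete_topology UNIV) (U i)) \<and> \<zeta> \<in> Pi\<^sub>E UNIV U \<and> Pi\<^sub>E UNIV U \<subseteq> {\<zeta>. \<forall>x\<in>A. \<zeta> x = \<eta> x}"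
  proof (intro exI[of _ "\<lambda>x. if x \<in> A then {\<eta> x} else UNIV"] conjI)
    show "finite {i \<in> UNIV. (if i \<in> A then {\<eta> i} else UNIV) \<noteq> topspace (discrete_topology UNIV)}"
      by (rule finite_subset[OF _ assms]) (simp add: subset_iff)
  qed (auto simp: PiE_iff, (metis (mono_tags, lifting) singletonD)+)
qed

lemma topspace_cfg_top[simp]: "topspace cfg_top = UNIV"
  by (simp add: cfg_top_def)

lemma cylinder_cont: assumes "cylinder_fun f" shows "f \<in> cfg_cont"
proof -
  obtain A where A: "finite A" "\<forall>\<eta> \<zeta>. (\<forall>x\<in>A. \<eta> x = \<zeta> x) \<longrightarrow> f \<eta> = f \<zeta>" using assms unfolding cylinder_fun_def by auto
  have "openin cfg_top {\<zeta>. f \<zeta> \<in> U}" for U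
  proof (subst openin_subopen, intro ballI)
    fix \<eta> assume \<eta>: "\<eta> \<in> {\<zeta>. f \<zeta> \<in> U}"
    have "{\<zeta>. \<forall>x\<in>A. \<zeta> x = \<eta> x} \<subseteq> {\<zeta>. f \<zeta> \<in> U}"
    proof
      fix \<zeta> assume "\<zeta> \<in> {\<zeta>. \<forall>x\<in>A. \<zeta> x = \<eta> x}"
      then have "f \<zeta> = f \<eta>" by (intro A(2)[rule_format]) simp
      with \<eta> show "\<zeta> \<in> {\<zeta>. f \<zeta> \<in> U}" by simp
    qed
    then show "\<exists>W. openin cfg_top W \<and> \<eta> \<in> W \<and> W \<subseteq> {\<zeta>. f \<zeta> \<in> U}"
      using openin_agree[OF A(1), of \<eta>] by blast
  qed
  then have "\<forall>U. openin euclideanreal U \<longrightarrow> openin cfg_top {x \<in> topspace cfg_top. f x \<in> U}" by simp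
  then show ?thesis unfolding cfg_cont_def continuous_map_def by simp
qed

lemma compact_cfg_top: "compact_space (cfg_top :: ('v \<Rightarrow> bool) topology)"
  unfolding cfg_top_def compact_space_product_topology by (auto simp: compact_space_discrete_topology)

lemma cfg_cont_local:
  fixes f :: "('v \<Rightarrow> bool) \<Rightarrow> real"
  assumes "f \<in> cfg_cont" "0 < e"
  shows "\<exists>A. finite A \<and> (\<forall>\<zeta>. (\<forall>x\<in>A. \<zeta> x = \<eta> x) \<longrightarrow> \<bar>f \<zeta> - f \<eta>\<bar> < e)"
proof -
  have "openin cfg_top {\<zeta> \<in> topspace cfg_top. f \<zeta> \<in> ball (f \<eta>) e}"
    using assms(1) unfolding cfg_cont_def by (intro openin_continuous_map_preimage) auto
  then obtain U where U: "finite {i \<in> UNIV. U i \<noteq> topspace (discrete_topology UNIV)}"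
      "\<eta> \<in> Pi\<^sub>E UNIV U" "Pi\<^sub>E UNIV U \<subseteq> {\<zeta>. f \<zeta> \<in> ball (f \<eta>) e}"
  proof -
    have "\<eta> \<in> {\<zeta> \<in> topspace cfg_top. f \<zeta> \<in> ball (f \<eta>) e}" using assms(2) by simp
    from bspec[OF \<open>openin cfg_top _\<close>[unfolded cfg_top_def openin_product_topology_alt] this[unfolded cfg_top_def]] that
    show thesis by auto
  qed
  show ?thesis
  proof (intro exI[of _ "{i \<in> UNIV. U i \<noteq> topspace (discrete_topology UNIV)}"] conjI allI impI U(1))
    fix \<zeta> assume "\<forall>x\<in>{i \<in> UNIV. U i \<noteq> topspace (discrete_topology UNIV)}. \<zeta> x = \<eta> x"
    then have "\<zeta> x \<in> U x" for x using U(2) by (cases "U x = UNIV") (auto simp: PiE_iff)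
    then have "\<zeta> \<in> Pi\<^sub>E UNIV U" by (simp add: PiE_iff)
    then show "\<bar>f \<zeta> - f \<eta>\<bar> < e" using U(3) by (auto simp: dist_real_def)
  qed
qed

text \<open>By compactness, finitely many cylinder neighbourhoods cover the space such that on each
  of them \<open>f\<close> stays within e/2 of its value at the centre; only the sites defining
  these neighbourhoods matter.\<close>

theorem cfg_cont_approx:
  fixes f :: "('v \<Rightarrow> bool) \<Rightarrow> real"
  assumes f: "f \<in> cfg_cont" and e: "0 < e"
  shows "\<exists>g. cylinder_fun g \<and> (\<forall>\<eta>. \<bar>f \<eta> - g \<eta>\<bar> \<le> e)"
proof -
  have "\<forall>\<eta>. \<exists>A. finite A \<and> (\<forall>\<zeta>. (\<forall>x\<in>A. \<zeta> x = \<eta> x) \<longrightarrow> \<bar>f \<zeta> - f \<eta>\<bar> < e / 2)"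
    using cfg_cont_local[OF f, of "e / 2"] e by auto
  then obtain A where A: "\<And>\<eta>. finite (A \<eta>)" "\<And>\<eta> \<zeta>. (\<forall>x\<in>A \<eta>. \<zeta> x = \<eta> x) \<Longrightarrow> \<bar>f \<zeta> - f \<eta>\<bar> < e / 2"
    by metis
  let ?N = "\<lambda>\<eta>. {\<zeta>. \<forall>x\<in>A \<eta>. \<zeta> x = \<eta> x}"
  have "\<forall>U\<in>range ?N. openin cfg_top U"
  proof
    fix U assume "U \<in> range ?N"
    then obtain \<eta> where "U = ?N \<eta>" by (rule rangeE)
    then show "openin cfg_top U" using openin_agree[OF A(1), of \<eta>] by simp
  qed
  moreover have "topspace cfg_top \<subseteq> \<Union>(range ?N)"
  proof
    fix \<eta> :: "'v \<Rightarrow> bool"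
    have "\<exists>\<eta>'. \<forall>x\<in>A \<eta>'. \<eta> x = \<eta>' x" by (rule exI[of _ \<eta>]) simp
    then show "\<eta> \<in> \<Union>(range ?N)" by simp
  qed
  ultimately obtain \<F> where \<F>: "finite \<F>" "\<F> \<subseteq> range ?N" "topspace cfg_top \<subseteq> \<Union>\<F>"
    using compact_cfg_top[unfolded compact_space_def compactin_def, THEN conjunct2, rule_format, of "range ?N"] by blast
  obtain F where F0: "finite F" "\<F> = ?N ` F"
    using finite_subset_image[OF \<F>(1,2)] by (elim exE conjE) (rule that)
  have F: "finite F" "UNIV \<subseteq> (\<Union>\<eta>\<in>F. ?N \<eta>)" using F0 \<F>(3) by simp_all
  let ?B = "\<Union>\<eta>\<in>F. A \<eta>"
  \<comment> \<open>\<open>r\<close> switches off all sites outside the finite set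
    \<open>?B\<close>. The configurations \<open>\<zeta>\<close> and \<open>r \<zeta>\<close> lie in
    the same neighbourhood, whose centre links the two values.\<close>
  define r :: "('v \<Rightarrow> bool) \<Rightarrow> ('v \<Rightarrow> bool)" where "r \<zeta> = (\<lambda>x. x \<in> ?B \<and> \<zeta> x)" for \<zeta>
  have "cylinder_fun (\<lambda>\<eta>. f (r \<eta>))"
    unfolding cylinder_fun_def using F(1) A(1)
    by (intro exI[of _ ?B]) (force intro!: arg_cong[of _ _ f] simp: r_def fun_eq_iff)
  moreover have "\<bar>f \<zeta> - f (r \<zeta>)\<bar> \<le> e" for \<zeta>
  proof -
    have "\<zeta> \<in> (\<Union>\<eta>\<in>F. ?N \<eta>)" using F(2) by (rule subsetD) simp
    then obtain \<eta> where \<eta>: "\<eta> \<in> F" "\<forall>x\<in>A \<eta>. \<zeta> x = \<eta> x" by (elim UN_E CollectE) (rule that)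
    then have "\<forall>x\<in>A \<eta>. r \<zeta> x = \<eta> x" by (simp add: r_def) blast
    from A(2)[OF this] A(2)[OF \<eta>(2)] have "\<bar>f \<zeta> - f \<eta>\<bar> < e / 2" "\<bar>f (r \<zeta>) - f \<eta>\<bar> < e / 2" by simp_all
    then show ?thesis by linarith
  qed
  ultimately show ?thesis by blast
qed

text \<open>Induction over the sites: \<open>f\<close> is affine in the value at \<open>x\<close>,
  so it is its value with a zero at \<open>x\<close> plus the indicator of a one at \<open>x\<close>
  times the increment.\<close>

lemma cylinder_span:
  assumes "finite A" "\<And>\<eta> \<zeta>. (\<forall>x\<in>A. \<eta> x = \<zeta> x) \<Longrightarrow> f \<eta> = (f \<zeta> :: real)"
  shows "\<exists>c. \<forall>\<eta>. f \<eta> = (\<Sum>B\<in>Pow A. c B * ind True B \<eta>)"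
  using assms
proof (induction A arbitrary: f)
  case empty
  then show ?case by (intro exI[of _ "\<lambda>_. f (\<lambda>_. False)"]) auto
next
  case (insert x A)
  have "\<exists>c. \<forall>\<eta>. f (\<eta>(x := b)) = (\<Sum>B\<in>Pow A. c B * ind True B \<eta>)" for b
    by (rule insert.IH) (auto intro!: insert.prems)
  then obtain c where c: "\<And>b \<eta>. f (\<eta>(x := b)) = (\<Sum>B\<in>Pow A. c b B * ind True B \<eta>)" by metis
  let ?c = "\<lambda>B. if x \<in> B then c True (B - {x}) - c False (B - {x}) else c False B"
  have "f \<eta> = (\<Sum>B\<in>Pow (insert x A). ?c B * ind True B \<eta>)" for \<eta>
  proof -
    have "(\<Sum>B\<in>Pow (insert x A). ?c B * ind True B \<eta>)
        = (\<Sum>B\<in>Pow A. ?c B * ind True B \<eta>) + (\<Sum>B\<in>insert x ` Pow A. ?c B * ind True B \<eta>)"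
      unfolding Pow_insert using insert.hyps by (intro sum.union_disjoint) auto
    also have "(\<Sum>B\<in>insert x ` Pow A. ?c B * ind True B \<eta>) = (\<Sum>B\<in>Pow A. ?c (insert x B) * ind True (insert x B) \<eta>)"
      using insert.hyps by (subst sum.reindex) (auto simp: inj_on_def insert_ident subset_iff)
    also have "\<dots> = (\<Sum>B\<in>Pow A. (c True B - c False B) * (of_bool (\<eta> x) * ind True B \<eta>))"
    proof (intro sum.cong refl)
      fix B assume "B \<in> Pow A"
      then have "insert x B - {x} = B" using insert.hyps by auto
      then show "?c (insert x B) * ind True (insert x B) \<eta> = (c True B - c False B) * (of_bool (\<eta> x) * ind True B \<eta>)"
        by (auto simp: ind_def)
    qed
    also have "(\<Sum>B\<in>Pow A. ?c B * ind True B \<eta>) = (\<Sum>B\<in>Pow A. c False B * ind True B \<eta>)"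
      using insert.hyps by (intro sum.cong refl) auto
    also have "(\<Sum>B\<in>Pow A. c False B * ind True B \<eta>) + (\<Sum>B\<in>Pow A. (c True B - c False B) * (of_bool (\<eta> x) * ind True B \<eta>))
       = (\<Sum>B\<in>Pow A. c (\<eta> x) B * ind True B \<eta>)"
      by (cases "\<eta> x") (simp_all add: sum.distrib[symmetric] algebra_simps)
    also have "\<dots> = f \<eta>" using c[of \<eta> "\<eta> x"] by simp
    finally show ?thesis by simp
  qed
  then show ?case by (intro exI[of _ ?c] allI)
qed

lemma cylinder_spanE:
  fixes f :: "('v \<Rightarrow> bool) \<Rightarrow> real"
  assumes "cylinder_fun f"
  obtains \<A> :: "'v set set" and c :: "'v set \<Rightarrow> real" where "finite \<A>" "\<forall>A\<in>\<A>. finite A"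
    "f = (\<lambda>\<eta>. \<Sum>A\<in>\<A>. c A * ind True A \<eta>)"
proof -
  obtain A where A: "finite A" "\<forall>\<eta> \<zeta>. (\<forall>x\<in>A. \<eta> x = \<zeta> x) \<longrightarrow> f \<eta> = f \<zeta>"
    using assms unfolding cylinder_fun_def by auto
  have "\<exists>c. \<forall>\<eta>. f \<eta> = (\<Sum>B\<in>Pow A. c B * ind True B \<eta>)"
    by (rule cylinder_span[OF A(1)]) (use A(2) in blast)
  then obtain c where "f = (\<lambda>\<eta>. \<Sum>B\<in>Pow A. c B * ind True B \<eta>)" by blast
  then show thesis using that[of "Pow A" c] A(1) by (auto intro: finite_subset)
qed

section \<open>Measures on configurations\<close>

lemma space_cfg_space[simp]: "space cfg_space = UNIV"
  by (simp add: cfg_space_def space_PiM)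

lemma cfg_coord_sets: "{\<eta>. \<eta> x = b} \<in> sets (cfg_space :: ('v \<Rightarrow> bool) measure)"
proof -
  have "(\<lambda>\<eta> :: 'v \<Rightarrow> bool. \<eta> x) \<in> measurable cfg_space (count_space UNIV)"
    unfolding cfg_space_def by (rule measurable_component_singleton) simp
  then have "(\<lambda>\<eta> :: 'v \<Rightarrow> bool. \<eta> x) -` {b} \<inter> space cfg_space \<in> sets cfg_space"
    by (rule measurable_sets) simp
  then show ?thesis by (simp add: vimage_def)
qed

lemma cfg_ind_sets:
  assumes "finite A" shows "{\<eta>. \<forall>x\<in>A. \<eta> x = b} \<in> sets (cfg_space :: ('v \<Rightarrow> bool) measure)"
proof -
  have "{\<eta> \<in> space (cfg_space :: ('v \<Rightarrow> bool) measure). \<forall>x\<in>A. \<eta> x = b} \<in> sets cfg_space"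
    using assms cfg_coord_sets by (intro sets.sets_Collect_finite_All) simp_all
  then show ?thesis by simp
qed

lemma ind_eq_indicator: "ind b A = indicator {\<eta>. \<forall>x\<in>A. \<eta> x = b}"
  by (auto simp: ind_def fun_eq_iff)

lemma cfg_probsD: assumes "\<mu> \<in> cfg_probs" shows "prob_space \<mu>" "sets \<mu> = sets cfg_space" "space \<mu> = UNIV"
  using assms sets_eq_imp_space_eq[of \<mu> cfg_space] by (auto simp: cfg_probs_def)

lemma integral_ind:
  assumes "\<mu> \<in> cfg_probs" "finite A"
  shows "(\<integral>\<eta>. ind b A \<eta> \<partial>\<mu>) = measure \<mu> {\<eta>. \<forall>x\<in>A. \<eta> x = b}"
  using cfg_probsD[OF assms(1)] cfg_ind_sets[OF assms(2), of b] unfolding ind_eq_indicator by simp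

lemma ind_measurable: "finite A \<Longrightarrow> ind b A \<in> borel_measurable cfg_space"
  unfolding ind_eq_indicator using cfg_ind_sets by (intro borel_measurable_indicator) auto

lemma cylinder_measurable: assumes "cylinder_fun f" shows "f \<in> borel_measurable cfg_space"
proof -
  obtain \<A> c where A': "finite \<A>" "\<forall>A\<in>\<A>. finite A" "f = (\<lambda>\<eta>. \<Sum>A\<in>\<A>. c A * ind True A \<eta>)"
    by (rule cylinder_spanE[OF assms])
  note A = A'(1) A'(2)[rule_format] A'(3)
  show ?thesis unfolding A(3) using A(2) ind_measurable
    by (intro borel_measurable_sum borel_measurable_times) auto
qed

lemma cfg_cont_bounded: assumes "f \<in> cfg_cont" shows "\<exists>B. bnd B f"
proof -
  have "compactin euclideanreal (f ` topspace cfg_top)"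
    using assms compact_cfg_top unfolding cfg_cont_def compact_space_def by (blast intro: image_compactin)
  then have "bounded (range f)" by (simp add: compact_imp_bounded)
  then show ?thesis unfolding bnd_def bounded_iff by auto
qed

lemma cfg_cont_measurable: assumes "f \<in> cfg_cont" shows "f \<in> borel_measurable cfg_space"
proof -
  have "\<forall>n. \<exists>g. cylinder_fun g \<and> (\<forall>\<eta>. \<bar>f \<eta> - g \<eta>\<bar> \<le> 1 / Suc n)"
    using cfg_cont_approx[OF assms] by simp
  then obtain g where g: "\<And>n. cylinder_fun (g n)" "\<And>n \<eta>. \<bar>f \<eta> - g n \<eta>\<bar> \<le> 1 / Suc n" by metis
  show ?thesis
  proof (rule borel_measurable_LIMSEQ_real)
    show "g n \<in> borel_measurable cfg_space" for n using cylinder_measurable[OF g(1)] .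
    show "(\<lambda>n. g n \<eta>) \<longlonglongrightarrow> f \<eta>" for \<eta>
    proof -
      have "(\<lambda>n. g n \<eta> - f \<eta>) \<longlonglongrightarrow> 0"
      proof (rule Lim_null_comparison[OF _ LIMSEQ_inverse_real_of_nat])
        show "\<forall>\<^sub>F n in sequentially. norm (g n \<eta> - f \<eta>) \<le> inverse (real (Suc n))"
          using g(2)[of \<eta>] by (simp add: inverse_eq_divide abs_minus_commute)
      qed
      then show ?thesis by (simp add: LIM_zero_iff)
    qed
  qed
qed

lemma cfg_cont_integrable:
  assumes "f \<in> cfg_cont" "\<mu> \<in> cfg_probs" shows "integrable \<mu> f"
proof -
  obtain B where B: "bnd B f" using cfg_cont_bounded[OF assms(1)] by auto
  interpret prob_space \<mu> using cfg_probsD[OF assms(2)] by simp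
  show ?thesis
    by (rule integrable_const_bound[where B = B])
      (use bndD[OF B] cfg_cont_measurable[OF assms(1)] cfg_probsD[OF assms(2)] measurable_cong_sets in auto)
qed

lemma cfg_cont_diff: "f \<in> cfg_cont \<Longrightarrow> g \<in> cfg_cont \<Longrightarrow> (\<lambda>\<eta>. f \<eta> - g \<eta>) \<in> cfg_cont"
  unfolding cfg_cont_def by (auto intro: continuous_intros)

text \<open>The events of having ones on a finite set are closed under intersection, because the
  finite sets unite, and they generate the sigma-algebra.\<close>

theorem cfg_probs_eqI:
  fixes \<mu> \<nu> :: "('v \<Rightarrow> bool) measure"
  assumes \<mu>: "\<mu> \<in> cfg_probs" and \<nu>: "\<nu> \<in> cfg_probs"
    and eq: "\<And>A. finite A \<Longrightarrow> (\<integral>\<eta>. ind True A \<eta> \<partial>\<mu>) = (\<integral>\<eta>. ind True A \<eta> \<partial>\<nu>)"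
  shows "\<mu> = \<nu>"
proof -
  interpret M: prob_space \<mu> using cfg_probsD[OF \<mu>] by simp
  interpret N: prob_space \<nu> using cfg_probsD[OF \<nu>] by simp
  let ?U = "\<lambda>A. {\<eta> :: 'v \<Rightarrow> bool. \<forall>x\<in>A. \<eta> x = True}"
  let ?E = "?U ` {A. finite A}"
  have gen: "sets (cfg_space :: ('v \<Rightarrow> bool) measure) = sigma_sets UNIV ?E"
  proof (rule antisym)
    have "sets (cfg_space :: ('v \<Rightarrow> bool) measure) = sigma_sets UNIV {{f. f i \<in> A} |i A. True}"
      unfolding cfg_space_def sets_PiM_single by simp
    also have "\<dots> \<subseteq> sigma_sets UNIV ?E"
    proof (rule sigma_sets_mono, safe)
      fix i :: 'v and B :: "bool set"
      interpret sigma_algebra UNIV "sigma_sets UNIV ?E" by (rule sigma_algebra_sigma_sets) simp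
      have t: "?U {i} \<in> sigma_sets UNIV ?E"
        by (rule sigma_sets.Basic) (rule imageI, simp)
      have f: "UNIV - ?U {i} \<in> sigma_sets UNIV ?E"
        using compl_sets[OF t] by simp
      have "{f. f i \<in> B} = (if True \<in> B then ?U {i} else {}) \<union> (if False \<in> B then UNIV - ?U {i} else {})"
      proof (rule set_eqI)
        fix f :: "'v \<Rightarrow> bool"
        show "f \<in> {f. f i \<in> B} \<longleftrightarrow> f \<in> (if True \<in> B then ?U {i} else {}) \<union> (if False \<in> B then UNIV - ?U {i} else {})"
          by (cases "f i") auto
      qed
      also have "\<dots> \<in> sigma_sets UNIV ?E" using t f sigma_sets.Empty[of UNIV ?E] by (intro Un) (simp_all only: split: if_split, simp_all)
      finally show "{f. f i \<in> B} \<in> sigma_sets UNIV ?E" .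
    qed
    finally show "sets (cfg_space :: ('v \<Rightarrow> bool) measure) \<subseteq> sigma_sets UNIV ?E" .
    show "sigma_sets UNIV ?E \<subseteq> sets (cfg_space :: ('v \<Rightarrow> bool) measure)"
      using cfg_ind_sets[of _ True] sets.sigma_sets_subset[of ?E "cfg_space :: ('v \<Rightarrow> bool) measure"] by auto
  qed
  show ?thesis
  proof (rule measure_eqI_generator_eq[of ?E UNIV _ _ "\<lambda>_. UNIV"])
    show "Int_stable ?E"
    proof (rule Int_stableI)
      fix a b assume "a \<in> ?E" "b \<in> ?E"
      then obtain A B where "finite A" "finite B" "a = ?U A" "b = ?U B" by auto
      then show "a \<inter> b \<in> ?E" by (intro image_eqI[of _ _ "A \<union> B"]) auto
    qed
    show "sets \<mu> = sigma_sets UNIV ?E" "sets \<nu> = sigma_sets UNIV ?E"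
      using gen cfg_probsD[OF \<mu>] cfg_probsD[OF \<nu>] by simp_all
    show "emeasure \<mu> X = emeasure \<nu> X" if X: "X \<in> ?E" for X
    proof -
      obtain A where "finite A" "X = ?U A" using X by auto
      then show ?thesis using eq[of A] integral_ind[OF \<mu>, of A True] integral_ind[OF \<nu>, of A True]
        by (simp add: M.emeasure_eq_measure N.emeasure_eq_measure)
    qed
    show "range (\<lambda>_. UNIV) \<subseteq> ?E" by (auto intro!: image_eqI[of _ _ "{}"])
  qed auto
qed


section \<open>Inclusion-exclusion and Kolmogorov extension\<close>

definition incl :: "('v set \<Rightarrow> real) \<Rightarrow> 'v set \<Rightarrow> 'v set \<Rightarrow> real" where
  "incl \<phi> A C = (\<Sum>B\<in>Pow C. (-1) ^ card B * \<phi> (A \<union> B))"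

lemma incl_empty[simp]: "incl \<phi> A {} = \<phi> A" by (simp add: incl_def)

text \<open>The subsets of \<open>insert x C\<close> split into those without and those with
  \<open>x\<close>. In terms of events: from ones on \<open>A\<close> and zeros on \<open>C\<close>,
  the part with a one at \<open>x\<close> is removed.\<close>

lemma incl_insert:
  assumes "finite C" "x \<notin> C"
  shows "incl \<phi> A (insert x C) = incl \<phi> A C - incl \<phi> (insert x A) C"
proof -
  have "incl \<phi> A (insert x C) = incl \<phi> A C + (\<Sum>B\<in>insert x ` Pow C. (-1) ^ card B * \<phi> (A \<union> B))"
    unfolding incl_def Pow_insert using assms by (intro sum.union_disjoint) auto
  also have "(\<Sum>B\<in>insert x ` Pow C. (-1) ^ card B * \<phi> (A \<union> B)) = (\<Sum>B\<in>Pow C. (-1) ^ card (insert x B) * \<phi> (A \<union> insert x B))"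
    using assms by (subst sum.reindex) (auto simp: inj_on_def insert_ident subset_iff)
  also have "\<dots> = (\<Sum>B\<in>Pow C. - ((-1) ^ card B * \<phi> (insert x A \<union> B)))"
  proof (intro sum.cong refl)
    fix B assume "B \<in> Pow C"
    then have "finite B" "x \<notin> B" using assms by (auto intro: finite_subset)
    then show "(-1) ^ card (insert x B) * \<phi> (A \<union> insert x B) = - ((-1) ^ card B * \<phi> (insert x A \<union> B))" by simp
  qed
  finally show ?thesis by (simp add: incl_def sum_negf)
qed

text \<open>The patterns on \<open>J\<close> exhaust all possibilities; this gives the
  finite-dimensional laws mass one.\<close>

lemma incl_total:
  assumes "finite J"
  shows "(\<Sum>A\<in>Pow J. incl \<phi> (A \<union> A0) (J - A)) = \<phi> A0"
  using assms
proof (induction J arbitrary: A0)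
  case (insert x J)
  have "(\<Sum>A\<in>Pow (insert x J). incl \<phi> (A \<union> A0) (insert x J - A)) = (\<Sum>A\<in>Pow J. incl \<phi> (A \<union> A0) (insert x J - A))
      + (\<Sum>A\<in>insert x ` Pow J. incl \<phi> (A \<union> A0) (insert x J - A))"
    unfolding Pow_insert using insert.hyps by (intro sum.union_disjoint) auto
  also have "(\<Sum>A\<in>insert x ` Pow J. incl \<phi> (A \<union> A0) (insert x J - A)) = (\<Sum>A\<in>Pow J. incl \<phi> (insert x A \<union> A0) (insert x J - insert x A))"
    using insert.hyps by (subst sum.reindex) (auto simp: inj_on_def insert_ident subset_iff)
  also have "(\<Sum>A\<in>Pow J. incl \<phi> (A \<union> A0) (insert x J - A)) + \<dots> = (\<Sum>A\<in>Pow J. incl \<phi> (A \<union> A0) (J - A))"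
    unfolding sum.distrib[symmetric]
  proof (intro sum.cong refl)
    fix A assume "A \<in> Pow J"
    then have "insert x J - A = insert x (J - A)" "insert x J - insert x A = J - A" "x \<notin> J - A"
      using insert.hyps by auto
    then show "incl \<phi> (A \<union> A0) (insert x J - A) + incl \<phi> (insert x A \<union> A0) (insert x J - insert x A) = incl \<phi> (A \<union> A0) (J - A)"
      using incl_insert[of "J - A" x \<phi> "A \<union> A0"] insert.hyps by simp
  qed
  finally show ?case using insert.IH by simp
qed simp

text \<open>Kolmogorov extension in terms of the correlation function \<^term>\<open>\<phi>\<close>: the number
  \<^term>\<open>incl \<phi> A C\<close> is the probability of all ones on \<^term>\<open>A\<close> and all zeros on \<^term>\<open>C\<close>.\<close>

theorem cfg_probs_exists:
  fixes \<phi> :: "'v set \<Rightarrow> real"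
  assumes one: "\<phi> {} = 1"
    and pos: "\<And>A C. finite A \<Longrightarrow> finite C \<Longrightarrow> A \<inter> C = {} \<Longrightarrow> 0 \<le> incl \<phi> A C"
  shows "\<exists>\<mu>\<in>cfg_probs. \<forall>A. finite A \<longrightarrow> (\<integral>\<eta>. ind True A \<eta> \<partial>\<mu>) = \<phi> A"
proof -
  \<comment> \<open>Candidate law of the random set of ones inside \<open>J\<close>.\<close>
  define q where "q J A = (if A \<subseteq> J then incl \<phi> A (J - A) else 0)" for J A
  define Q where "Q J = embed_pmf (q J)" for J
  have q0: "0 \<le> q J A" if "finite J" for J A
    using that pos[of A "J - A"] by (auto simp: q_def intro: finite_subset)
  have pQ: "pmf (Q J) A = q J A" if J: "finite J" for J A
    unfolding Q_def
  proof (rule pmf_embed_pmf)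
    show "0 \<le> q J A" for A using q0[OF J] .
    have "(\<integral>\<^sup>+ A. ennreal (q J A) \<partial>count_space UNIV) = (\<Sum>A\<in>Pow J. ennreal (q J A))"
      using J by (intro nn_integral_count_space') (auto simp: q_def)
    also have "\<dots> = ennreal (\<Sum>A\<in>Pow J. q J A)" using q0[OF J] by (intro sum_ennreal) auto
    also have "(\<Sum>A\<in>Pow J. q J A) = (\<Sum>A\<in>Pow J. incl \<phi> (A \<union> {}) (J - A))"
      by (intro sum.cong refl) (auto simp: q_def)
    also have "\<dots> = 1" using incl_total[OF J, of \<phi> "{}"] one by simp
    finally show "(\<integral>\<^sup>+ A. ennreal (q J A) \<partial>count_space UNIV) = 1" by simp
  qed
  have setQ: "set_pmf (Q J) \<subseteq> Pow J" if "finite J" for J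
    using pQ[OF that] by (auto simp: set_pmf_eq q_def split: if_splits)
  \<comment> \<open>Consistency is shown for one additional site, where it is
    \<open>incl_insert\<close>; \<open>cons\<close> iterates it.\<close>
  have step: "map_pmf (\<lambda>A. A \<inter> H) (Q (insert x H)) = Q H" if H: "finite H" "x \<notin> H" for H x
  proof (rule pmf_eqI)
    fix A0
    have fin: "finite (insert x H)" using H by simp
    show "pmf (map_pmf (\<lambda>A. A \<inter> H) (Q (insert x H))) A0 = pmf (Q H) A0"
    proof (cases "A0 \<subseteq> H")
      case True
      have "(\<lambda>A. A \<inter> H) -` {A0} \<inter> set_pmf (Q (insert x H)) = {A0, insert x A0} \<inter> set_pmf (Q (insert x H))"
        using True H setQ[OF fin] by auto
      then have "pmf (map_pmf (\<lambda>A. A \<inter> H) (Q (insert x H))) A0 = measure (Q (insert x H)) {A0, insert x A0}"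
        unfolding pmf_map by (metis measure_Int_set_pmf)
      also have "\<dots> = q (insert x H) A0 + q (insert x H) (insert x A0)"
      proof -
        have "A0 \<noteq> insert x A0" using True H by auto
        then show ?thesis by (subst measure_measure_pmf_finite) (simp_all add: pQ[OF fin])
      qed
      also have "\<dots> = q H A0"
      proof -
        have "insert x H - A0 = insert x (H - A0)" "insert x H - insert x A0 = H - A0" "x \<notin> H - A0"
          using True H by auto
        then show ?thesis using True incl_insert[of "H - A0" x \<phi> A0] H by (simp add: q_def subset_insertI2 insert_mono)
      qed
      finally show ?thesis using pQ H by simp
    next
      case False
      then have "(\<lambda>A. A \<inter> H) -` {A0} = {}" by auto
      then show ?thesis using False pQ[OF H(1)] by (simp add: pmf_map q_def)
    qed
  qed
  have cons: "map_pmf (\<lambda>A. A \<inter> J) (Q (J \<union> K)) = Q J" if "finite J" "finite K" for J K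
    using that(2,1)
  proof (induction K)
    case empty
    have "map_pmf (\<lambda>A. A \<inter> J) (Q J) = map_pmf (\<lambda>A. A) (Q J)"
      using setQ[OF empty] by (intro map_pmf_cong) auto
    then show ?case by (simp add: map_pmf_ident)
  next
    case (insert x K)
    show ?case
    proof (cases "x \<in> J")
      case True then show ?thesis using insert by (simp add: insert_absorb)
    next
      case False
      have "map_pmf (\<lambda>A. A \<inter> J) (Q (J \<union> insert x K)) = map_pmf (\<lambda>A. A \<inter> J) (map_pmf (\<lambda>A. A \<inter> (J \<union> K)) (Q (insert x (J \<union> K))))"
        unfolding map_pmf_comp by (simp add: Int_assoc Int_absorb1 Int_absorb2)
      also have "\<dots> = Q J" using step[of "J \<union> K" x] insert False by simp
      finally show ?thesis .
    qed
  qed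
  \<comment> \<open>Zeros and ones are coded as real numbers so that the extension theorem for
    Polish spaces applies; testing positivity decodes them in \<open>\<mu>\<close>.\<close>
  define e where "e J A = restrict (\<lambda>x. if x \<in> A then 1 else 0 :: real) J" for J A :: "'v set"
  define P where "P J = distr (measure_pmf (Q J)) (PiM J (\<lambda>_. borel :: real measure)) (e J)" for J
  have em: "e J \<in> measurable (measure_pmf p) (PiM J (\<lambda>_. borel :: real measure))" for J p
    unfolding e_def by (auto simp: space_PiM)
  interpret PP: polish_projective UNIV P
  proof (unfold polish_projective_def projective_family_def, intro conjI allI impI)
    fix J :: "'v set" assume J: "finite J"
    show "prob_space (P J)" unfolding P_def by (intro measure_pmf.prob_space_distr em)
  next
    fix J H :: "'v set" assume JH: "J \<subseteq> H" "finite H"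
    have m: "(\<lambda>f. restrict f J) \<in> measurable (PiM H (\<lambda>_. borel :: real measure)) (PiM J (\<lambda>_. borel))"
      by (rule measurable_restrict_subset[OF JH(1)])
    have "distr (P H) (PiM J (\<lambda>_. borel)) (\<lambda>f. restrict f J) = distr (measure_pmf (Q H)) (PiM J (\<lambda>_. borel)) ((\<lambda>f. restrict f J) \<circ> e H)"
      unfolding P_def by (rule distr_distr[OF m em])
    also have "(\<lambda>f. restrict f J) \<circ> e H = e J \<circ> (\<lambda>A. A \<inter> J)"
      using JH(1) by (auto simp: e_def restrict_def fun_eq_iff)
    also have "distr (measure_pmf (Q H)) (PiM J (\<lambda>_. borel)) \<dots> = distr (measure_pmf (map_pmf (\<lambda>A. A \<inter> J) (Q H))) (PiM J (\<lambda>_. borel)) (e J)"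
      unfolding map_pmf_rep_eq by (rule distr_distr[symmetric]) (auto simp: e_def space_PiM)
    also have "map_pmf (\<lambda>A. A \<inter> J) (Q H) = Q J"
      using cons[of J H] JH by (simp add: Un_absorb1 finite_subset[OF JH])
    finally have "distr (P H) (PiM J (\<lambda>_. borel)) (\<lambda>f. restrict f J) = P J" unfolding P_def .
    then show "P J = distr (P H) (PiM J (\<lambda>_. borel)) (\<lambda>f. restrict f J)" by (rule sym)
  qed
  define \<mu> where "\<mu> = distr PP.lim cfg_space (\<lambda>\<omega> x. 0 < \<omega> x)"
  have mm: "(\<lambda>\<omega> x. 0 < \<omega> x) \<in> measurable PP.lim (cfg_space :: ('v \<Rightarrow> bool) measure)"
    unfolding cfg_space_def
  proof (rule measurable_PiM_single')
    fix x :: 'v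
    have "(\<lambda>\<omega>. \<omega> x) \<in> borel_measurable PP.lim"
      unfolding measurable_cong_sets[OF PP.sets_lim refl] by (rule measurable_component_singleton) simp
    then show "(\<lambda>\<omega>. 0 < \<omega> x) \<in> measurable PP.lim (count_space UNIV)" by measurable
  qed (auto simp: space_PiM)
  have \<mu>: "\<mu> \<in> cfg_probs" unfolding cfg_probs_def \<mu>_def using PP.P.prob_space_distr[OF mm] by simp
  moreover have "(\<integral>\<eta>. ind True A \<eta> \<partial>\<mu>) = \<phi> A" if A: "finite A" for A
  proof -
    have "(\<integral>\<eta>. ind True A \<eta> \<partial>\<mu>) = measure \<mu> {\<eta>. \<forall>x\<in>A. \<eta> x = True}" by (rule integral_ind[OF \<mu> A])
    also have "\<dots> = measure PP.lim ((\<lambda>\<omega> x. 0 < \<omega> x) -` {\<eta>. \<forall>x\<in>A. \<eta> x = True} \<inter> space PP.lim)"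
      unfolding \<mu>_def by (rule measure_distr[OF mm cfg_ind_sets[OF A]])
    also have "(\<lambda>\<omega> x. 0 < \<omega> x) -` {\<eta>. \<forall>x\<in>A. \<eta> x = True} \<inter> space PP.lim = PP.emb UNIV A (PiE A (\<lambda>_. {0<..}))"
      by (auto simp: prod_emb_def space_PiM)
    also have "measure PP.lim \<dots> = measure (P A) (PiE A (\<lambda>_. {0<..}))"
      using A by (intro PP.measure_lim_emb sets_PiM_I_finite) auto
    also have "\<dots> = measure (Q A) (e A -` (PiE A (\<lambda>_. {0<..})) \<inter> space (measure_pmf (Q A)))"
      unfolding P_def using A by (intro measure_distr em sets_PiM_I_finite) auto
    also have "e A -` (PiE A (\<lambda>_. {0<..})) \<inter> space (measure_pmf (Q A)) = {B. A \<subseteq> B}"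
      by (auto simp: e_def PiE_iff split: if_splits)
    also have "measure (Q A) {B. A \<subseteq> B} = measure (Q A) {A}"
    proof -
      have "{B. A \<subseteq> B} \<inter> set_pmf (Q A) = {A} \<inter> set_pmf (Q A)" using setQ[OF A] by auto
      then show ?thesis by (metis measure_Int_set_pmf)
    qed
    also have "\<dots> = \<phi> A" using pQ[OF A, of A] by (simp add: measure_pmf_single q_def)
    finally show ?thesis .
  qed
  ultimately show ?thesis by (intro bexI[of _ \<mu>] allI impI)
qed

section \<open>The dual particle system\<close>

lemma sgrp_mono_time:
  assumes L: "jump_op \<Lambda> L" and f: "bnd B f" and sub: "\<And>a. 0 \<le> L f a" and st: "0 \<le> s" "s \<le> t"
  shows "sgrp L s f a \<le> sgrp L t f a"
proof (rule DERIV_nonneg_imp_nondecreasing[OF st(2)])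
  fix r assume "s \<le> r" "r \<le> t"
  then have "0 \<le> sgrp L r (L f) a" using st by (intro sgrp_nonneg[OF L jump_op_bnd[OF L f] sub]) simp
  then show "\<exists>y. ((\<lambda>t. sgrp L t f a) has_real_derivative y) (at r) \<and> 0 \<le> y"
    using sgrp_deriv[OF L f, of a r UNIV] by (intro exI conjI)
qed

text \<open>\<open>P\<close> is a class of states that the chain does not leave, so values elsewhere
  are never consulted.\<close>

lemma sgrp_local:
  assumes agree: "\<And>a. P a \<Longrightarrow> f a = g a"
    and loc: "\<And>f g a. (\<And>b. P b \<Longrightarrow> f b = g b) \<Longrightarrow> P a \<Longrightarrow> L f a = L g a"
    and a: "P a"
  shows "sgrp L t f a = sgrp L t g a"
proof -
  have "(L ^^ n) f b = (L ^^ n) g b" if "P b" for n b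
    using that
  proof (induction n arbitrary: b)
    case (Suc n)
    show ?case unfolding funpow.simps o_apply by (rule loc[OF Suc.IH Suc.prems])
  qed (use agree in simp)
  from this[OF a] show ?thesis unfolding sgrp_def by simp
qed

text \<open>The evolution is constant in time, so its derivative vanishes; it is taken at time 1, an
  interior point of the times where invariance is known.\<close>

lemma sgrp_invariant_harmonic:
  assumes L: "jump_op \<Lambda> L" and f: "bnd B f" and inv: "\<And>t. 0 \<le> t \<Longrightarrow> sgrp L t f = f"
  shows "L f a = 0"
proof -
  have "((\<lambda>t. sgrp L t f a) has_real_derivative L (sgrp L 1 f) a) (at 1)"
    by (rule sgrp_deriv'[OF L f])
  moreover have "((\<lambda>t. sgrp L t f a) has_real_derivative 0) (at 1)"
  proof (rule DERIV_cong_ev[OF refl _ refl, THEN iffD1, OF _ DERIV_const[of "f a"]])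
    have "\<forall>\<^sub>F t in nhds 1. t > (0::real)" using eventually_nhds_in_open[of "{0<..}" "1::real"] by simp
    then show "\<forall>\<^sub>F t in nhds 1. f a = sgrp L t f a" by eventually_elim (simp add: inv)
  qed
  ultimately show ?thesis using inv[of 1] DERIV_unique by auto
qed

locale stirring_graph =
  fixes E :: "'v \<Rightarrow> 'v \<Rightarrow> bool" and d :: nat and \<theta> :: real
  assumes d2: "2 \<le> d" and reg: "regular_graph E d" and conn: "connected_graph E"
    and \<theta>: "0 < \<theta>" "\<theta> < 1"
begin

definition nb :: "'v \<Rightarrow> 'v set" where "nb x = {y. E x y}"

lemma d0: "0 < real d" using d2 by simp

lemma nb_fin[simp]: "finite (nb x)" and nb_card[simp]: "card (nb x) = d"
  using reg by (auto simp: nb_def regular_graph_def)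

lemma nb_sym: "y \<in> nb x \<Longrightarrow> x \<in> nb y" using reg by (auto simp: nb_def regular_graph_def)
lemma nb_irr[simp]: "x \<notin> nb x" using reg by (auto simp: nb_def regular_graph_def)

definition rwop :: "('v \<Rightarrow> real) \<Rightarrow> 'v \<Rightarrow> real" where
  "rwop \<phi> x = (\<Sum>y\<in>nb x. 1 / d * (\<phi> y - \<phi> x))"

definition moves :: "nat set \<Rightarrow> (nat \<Rightarrow> 'v) \<Rightarrow> (nat \<times> 'v) set" where
  "moves J x = Sigma J (\<lambda>j. nb (x j))"

text \<open>Labelled particles, with labels outside \<open>J\<close> frozen. Unlike in the dual,
  moves onto occupied sites keep the full rate and labels may coincide.\<close>

definition walkop :: "nat set \<Rightarrow> ((nat \<Rightarrow> 'v) \<Rightarrow> real) \<Rightarrow> (nat \<Rightarrow> 'v) \<Rightarrow> real" where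
  "walkop J F x = (\<Sum>m\<in>moves J x. 1 / d * (F (x(fst m := snd m)) - F x))"

text \<open>Time is scaled so that a lone particle jumps at rate 1. A swap of two occupied sites
  does not change the set of particles, so at an occupied target only the coalescing fraction
  \<open>\<theta>\<close> of the rate is visible; in the end \<open>\<theta>\<close> is
  1/(1+v).\<close>

definition \<rho> :: "'v set \<Rightarrow> 'v \<Rightarrow> real" where
  "\<rho> A y = (if y \<in> A then \<theta> / d else 1 / d)"

definition smoves :: "'v set \<Rightarrow> ('v \<times> 'v) set" where "smoves A = Sigma A nb"

text \<open>The cutoff keeps the total rate below \<open>n\<close>. Moves never increase the number
  of particles, so the cutoff is invisible from sets of at most \<open>n\<close> sites; all other
  states are absorbing.\<close>

definition dualop :: "nat \<Rightarrow> ('v set \<Rightarrow> real) \<Rightarrow> 'v set \<Rightarrow> real" where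
  "dualop n f A = (if finite A \<and> card A \<le> n then
     (\<Sum>m\<in>smoves A. \<rho> A (snd m) * (f (insert (snd m) (A - {fst m})) - f A)) else 0)"

lemma \<rho>_nonneg: "0 \<le> \<rho> A y" and \<rho>_le: "\<rho> A y \<le> 1 / d"
  using \<theta> d0 by (auto simp: \<rho>_def divide_right_mono)

lemma moves_fin[simp]: "finite J \<Longrightarrow> finite (moves J x)" by (simp add: moves_def)
lemma smoves_fin[simp]: "finite A \<Longrightarrow> finite (smoves A)" by (simp add: smoves_def)
lemma moves_card: "finite J \<Longrightarrow> card (moves J x) = card J * d" by (simp add: moves_def)
lemma smoves_card: "finite A \<Longrightarrow> card (smoves A) = card A * d" by (simp add: smoves_def)

lemma jump_rwop: "jump_op 1 rwop"
  by (rule jump_opI[of nb "\<lambda>_ _. 1 / d" 1 rwop "\<lambda>_ y. y"]) (use d0 in \<open>simp_all add: rwop_def\<close>)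

lemma jump_walkop: assumes "finite J" shows "jump_op (card J) (walkop J)"
  by (rule jump_opI[of "moves J" "\<lambda>_ _. 1 / d" _ "walkop J" "\<lambda>x m. x(fst m := snd m)"])
     (use d0 assms in \<open>simp_all add: walkop_def moves_card\<close>)

lemma jump_dualop: "jump_op n (dualop n)"
proof (rule jump_opI[of "\<lambda>A. if finite A \<and> card A \<le> n then smoves A else {}" "\<lambda>A m. \<rho> A (snd m)" n "dualop n"
    "\<lambda>A m. insert (snd m) (A - {fst m})"])
  fix A :: "'v set"
  show "sum (\<lambda>m. \<rho> A (snd m)) (if finite A \<and> card A \<le> n then smoves A else {}) \<le> real n"
  proof (cases "finite A \<and> card A \<le> n")
    case True
    have "sum (\<lambda>m. \<rho> A (snd m)) (smoves A) \<le> (\<Sum>m\<in>smoves A. 1 / d)" by (intro sum_mono \<rho>_le)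
    also have "\<dots> = card A" using True d0 by (simp add: smoves_card)
    finally show ?thesis using True by simp
  next
    case False
    then show ?thesis by (simp only: if_False sum.empty of_nat_0_le_iff)
  qed
qed (auto simp: dualop_def \<rho>_nonneg)

section \<open>Sums over ordered pairs of particles\<close>

definition pairsum :: "('v set \<Rightarrow> real) \<Rightarrow> 'v set \<Rightarrow> real" where
  "pairsum b A = (\<Sum>x\<in>A. \<Sum>z\<in>A - {x}. b {x, z})"

definition S1 :: "'v set \<Rightarrow> ('v \<times> 'v) set" where "S1 A = {m \<in> smoves A. snd m \<notin> A}"
definition S2 :: "'v set \<Rightarrow> ('v \<times> 'v) set" where "S2 A = {m \<in> smoves A. snd m \<in> A}"

lemma smoves_split: "finite A \<Longrightarrow> sum f (smoves A) = sum f (S1 A) + sum f (S2 A)"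
proof -
  assume A: "finite A"
  have "smoves A = S1 A \<union> S2 A" "S1 A \<inter> S2 A = {}" by (auto simp: S1_def S2_def)
  then show ?thesis using A by (metis finite_Un smoves_fin sum.union_disjoint)
qed

lemma dualop_pair:
  assumes "x \<noteq> z"
  shows "dualop 2 b {x, z} = (\<Sum>y\<in>nb x. \<rho> {x, z} y * (b {y, z} - b {x, z})) + (\<Sum>y\<in>nb z. \<rho> {x, z} y * (b {y, x} - b {x, z}))"
proof -
  have "smoves {x, z} = Pair x ` nb x \<union> Pair z ` nb z" by (auto simp: smoves_def)
  moreover have "Pair x ` nb x \<inter> Pair z ` nb z = {}" using assms by auto
  moreover have "{x, z} - {x} = {z}" "{x, z} - {z} = {x}" using assms by auto
  ultimately show ?thesis using assms
    by (simp add: dualop_def sum.union_disjoint sum.reindex inj_on_def)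
qed

lemma pairsum_dualop_1:
  assumes A: "finite A"
  shows "(\<Sum>x\<in>A. \<Sum>z\<in>A - {x}. dualop 2 b {x, z}) =
    2 * (\<Sum>m\<in>smoves A. \<Sum>z\<in>A - {fst m}. \<rho> {fst m, z} (snd m) * (b {snd m, z} - b {fst m, z}))"
proof -
  let ?q = "\<lambda>x z. \<Sum>y\<in>nb x. \<rho> {x, z} y * (b {y, z} - b {x, z})"
  have sw: "(\<Sum>x\<in>A. \<Sum>z\<in>A - {x}. ?q z x) = (\<Sum>x\<in>A. \<Sum>z\<in>A - {x}. ?q x z)"
  proof -
    have D: "A - {x} = {z \<in> A. z \<noteq> x}" for x by auto
    have "(\<Sum>x\<in>A. \<Sum>z\<in>A - {x}. ?q z x) = (\<Sum>x\<in>A. \<Sum>z\<in>A. if z \<noteq> x then ?q z x else 0)"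
      using A unfolding D by (intro sum.cong refl sum.inter_filter)
    also have "\<dots> = (\<Sum>z\<in>A. \<Sum>x\<in>A. if z \<noteq> x then ?q z x else 0)" by (rule sum.swap)
    also have "\<dots> = (\<Sum>x\<in>A. \<Sum>z\<in>A - {x}. ?q x z)"
      using A unfolding D by (subst sum.inter_filter) (auto intro!: sum.cong)
    finally show ?thesis .
  qed
  have "(\<Sum>x\<in>A. \<Sum>z\<in>A - {x}. dualop 2 b {x, z}) = (\<Sum>x\<in>A. \<Sum>z\<in>A - {x}. ?q x z + ?q z x)"
  proof (intro sum.cong refl)
    fix x z assume "z \<in> A - {x}"
    then show "dualop 2 b {x, z} = ?q x z + ?q z x" by (subst dualop_pair) (auto simp: insert_commute)
  qed
  also have "\<dots> = 2 * (\<Sum>x\<in>A. \<Sum>z\<in>A - {x}. ?q x z)" using sw by (simp add: sum.distrib)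
  also have "(\<Sum>x\<in>A. \<Sum>z\<in>A - {x}. ?q x z) = (\<Sum>x\<in>A. \<Sum>y\<in>nb x. \<Sum>z\<in>A - {x}. \<rho> {x, z} y * (b {y, z} - b {x, z}))"
    by (intro sum.cong refl sum.swap)
  also have "\<dots> = (\<Sum>m\<in>smoves A. \<Sum>z\<in>A - {fst m}. \<rho> {fst m, z} (snd m) * (b {snd m, z} - b {fst m, z}))"
    unfolding smoves_def using A by (subst sum.Sigma) (auto simp: case_prod_beta)
  finally show ?thesis .
qed

lemma pairsum_remove:
  assumes A: "finite A" "x \<in> A"
  shows "pairsum b A = pairsum b (A - {x}) + 2 * (\<Sum>z\<in>A - {x}. b {x, z})"
proof -
  have "pairsum b A = (\<Sum>z\<in>A - {x}. b {x, z}) + (\<Sum>w\<in>A - {x}. \<Sum>z\<in>A - {w}. b {w, z})"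
    unfolding pairsum_def by (rule sum.remove[OF A])
  also have "(\<Sum>w\<in>A - {x}. \<Sum>z\<in>A - {w}. b {w, z}) = (\<Sum>w\<in>A - {x}. b {x, w} + (\<Sum>z\<in>A - {x} - {w}. b {w, z}))"
  proof (intro sum.cong refl)
    fix w assume w: "w \<in> A - {x}"
    then have "(\<Sum>z\<in>A - {w}. b {w, z}) = b {w, x} + (\<Sum>z\<in>A - {w} - {x}. b {w, z})"
      using A by (intro sum.remove) auto
    moreover have "A - {w} - {x} = A - {x} - {w}" by auto
    ultimately show "(\<Sum>z\<in>A - {w}. b {w, z}) = b {x, w} + (\<Sum>z\<in>A - {x} - {w}. b {w, z})"
      by (simp add: insert_commute)
  qed
  finally show ?thesis by (simp add: sum.distrib pairsum_def)
qed

lemma pairsum_move: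
  assumes A: "finite A" "x \<in> A" "y \<notin> A"
  shows "pairsum b (insert y (A - {x})) - pairsum b A = 2 * (\<Sum>z\<in>A - {x}. b {y, z} - b {x, z})"
proof -
  have "insert y (A - {x}) - {y} = A - {x}" using A by auto
  then show ?thesis
    using pairsum_remove[of "insert y (A - {x})" y b] pairsum_remove[OF A(1,2), of b] A(1)
    by (simp add: sum_subtractf algebra_simps)
qed

text \<open>A move of one particle affects only the pairs that contain it. To a vacant site each
  such pair moves as freely as the whole set. Onto an occupied site y the pair (x, y) itself
  coalesces at rate \<theta>/d, while every pair (x, z) with another z treats the move as free;
  these contributions cancel against those of the reverse move from y to x. The factor 2 comes from
  counting ordered pairs.\<close>

theorem pairsum_dualop:
  assumes A: "finite A"
  shows "(\<Sum>x\<in>A. \<Sum>z\<in>A - {x}. dualop 2 b {x, z}) =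
    (\<Sum>m\<in>S1 A. 1 / d * (pairsum b (insert (snd m) (A - {fst m})) - pairsum b A))
    + 2 * (\<Sum>m\<in>S2 A. \<theta> / d * (b {snd m} - b {fst m, snd m}))"
proof -
  let ?t = "\<lambda>m. \<Sum>z\<in>A - {fst m}. \<rho> {fst m, z} (snd m) * (b {snd m, z} - b {fst m, z})"
  have 1: "2 * sum ?t (S1 A) = (\<Sum>m\<in>S1 A. 1 / d * (pairsum b (insert (snd m) (A - {fst m})) - pairsum b A))"
  proof (subst sum_distrib_left, intro sum.cong refl)
    fix m assume m: "m \<in> S1 A"
    then have "fst m \<in> A" "snd m \<notin> A" by (auto simp: S1_def smoves_def)
    have "?t m = (\<Sum>z\<in>A - {fst m}. 1 / d * (b {snd m, z} - b {fst m, z}))"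
      using \<open>fst m \<in> A\<close> \<open>snd m \<notin> A\<close> by (intro sum.cong refl) (auto simp: \<rho>_def)
    also have "\<dots> = 1 / d * (\<Sum>z\<in>A - {fst m}. b {snd m, z} - b {fst m, z})" by (rule sum_distrib_left[symmetric])
    finally show "2 * ?t m = 1 / d * (pairsum b (insert (snd m) (A - {fst m})) - pairsum b A)"
      using pairsum_move[OF A \<open>fst m \<in> A\<close> \<open>snd m \<notin> A\<close>, of b] by simp
  qed
  let ?k = "\<lambda>m. \<Sum>z\<in>A - {fst m, snd m}. b {fst m, z}"
  have 2: "?t m = \<theta> / d * (b {snd m} - b {fst m, snd m}) + 1 / d * (?k (prod.swap m) - ?k m)" if m: "m \<in> S2 A" for m
  proof -
    have *: "snd m \<in> A - {fst m}" "snd m \<noteq> fst m" using m by (auto simp: S2_def smoves_def)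
    have "?t m = \<rho> {fst m, snd m} (snd m) * (b {snd m, snd m} - b {fst m, snd m})
        + (\<Sum>z\<in>A - {fst m} - {snd m}. \<rho> {fst m, z} (snd m) * (b {snd m, z} - b {fst m, z}))"
      using A * by (intro sum.remove) auto
    also have "(\<Sum>z\<in>A - {fst m} - {snd m}. \<rho> {fst m, z} (snd m) * (b {snd m, z} - b {fst m, z}))
       = (\<Sum>z\<in>A - {fst m} - {snd m}. 1 / d * (b {snd m, z} - b {fst m, z}))"
      using * by (intro sum.cong refl) (auto simp: \<rho>_def)
    also have "\<dots> = 1 / d * ((\<Sum>z\<in>A - {fst m} - {snd m}. b {snd m, z}) - (\<Sum>z\<in>A - {fst m} - {snd m}. b {fst m, z}))"
      by (simp add: sum_distrib_left[symmetric] sum_subtractf diff_divide_distrib sum_divide_distrib)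
    also have "A - {fst m} - {snd m} = A - {fst m, snd m}" by auto
    also have "\<rho> {fst m, snd m} (snd m) = \<theta> / d" by (simp add: \<rho>_def)
    finally show ?thesis by (simp add: insert_commute)
  qed
  \<comment> \<open>Reversing the edge is an involution of the moves between occupied sites, so the
    terms of third particles cancel in the sum.\<close>
  have 3: "sum (\<lambda>m. ?k (prod.swap m)) (S2 A) = sum ?k (S2 A)"
  proof (rule sum.reindex_bij_witness[of _ prod.swap prod.swap])
    show "prod.swap m \<in> S2 A" if "m \<in> S2 A" for m using that nb_sym by (auto simp: S2_def smoves_def)
    show "prod.swap m \<in> S2 A" if "m \<in> S2 A" for m using that nb_sym by (auto simp: S2_def smoves_def)
  qed auto
  have "sum ?t (S2 A) = (\<Sum>m\<in>S2 A. \<theta> / d * (b {snd m} - b {fst m, snd m})) + 1 / d * (sum (\<lambda>m. ?k (prod.swap m)) (S2 A) - sum ?k (S2 A))"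
    using 2 by (simp add: sum.distrib sum_distrib_left[symmetric] sum_subtractf sum_divide_distrib[symmetric] cong: sum.cong)
  then have "sum ?t (S2 A) = (\<Sum>m\<in>S2 A. \<theta> / d * (b {snd m} - b {fst m, snd m}))" using 3 by simp
  then show ?thesis unfolding pairsum_dualop_1[OF A] smoves_split[OF A] using 1 by (simp add: algebra_simps)
qed

section \<open>Probability that two dual particles coalesce, by a given time and ever\<close>

definition cp :: "real \<Rightarrow> 'v set \<Rightarrow> real" where
  "cp t = sgrp (dualop 2) t (\<lambda>B. of_bool (card B \<le> 1))"

lemma bnd_of_bool: "bnd 1 (\<lambda>a. of_bool (P a))" by (simp add: bnd_def)

lemma card_move_le: "finite A \<Longrightarrow> x \<in> A \<Longrightarrow> card (insert y (A - {x})) \<le> card A"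
  by (metis card.insert_remove card_Diff_singleton card_insert_le_m1 card_gt_0_iff empty_iff finite_Diff le_refl)

lemma cp_0: "cp 0 B = of_bool (card B \<le> 1)" by (simp add: cp_def)

text \<open>Having at most one particle persists once reached, so its indicator is
  subharmonic.\<close>

lemma cp_mono: assumes "0 \<le> s" "s \<le> t" shows "cp s B \<le> cp t B"
  unfolding cp_def
proof (rule sgrp_mono_time[OF jump_dualop bnd_of_bool _ assms])
  fix A :: "'v set"
  show "0 \<le> dualop 2 (\<lambda>B. of_bool (card B \<le> 1)) A"
  proof -
    have "0 \<le> \<rho> A (snd m) * (of_bool (card (insert (snd m) (A - {fst m})) \<le> 1) - of_bool (card A \<le> 1))"
      if "finite A" "m \<in> smoves A" for m
      using card_move_le[OF that(1), of "fst m" "snd m"] that(2) by (intro mult_nonneg_nonneg \<rho>_nonneg) (auto simp: smoves_def)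
    note * = this
    show ?thesis
    proof (cases "finite A \<and> card A \<le> 2")
      case True
      show ?thesis unfolding dualop_def if_P[OF True] using True by (intro sum_nonneg *) simp_all
    next
      case False
      show ?thesis unfolding dualop_def if_not_P[OF False] by simp
    qed
  qed
qed

lemma cp_nonneg: "0 \<le> t \<Longrightarrow> 0 \<le> cp t B"
  unfolding cp_def by (rule sgrp_nonneg[OF jump_dualop bnd_of_bool]) simp_all

lemma cp_le_1: "0 \<le> t \<Longrightarrow> cp t B \<le> 1"
  unfolding cp_def by (rule abs_le_D1[OF bndD[OF sgrp_bnd[OF jump_dualop bnd_of_bool]]])

lemma cp_1: "0 \<le> t \<Longrightarrow> card B \<le> 1 \<Longrightarrow> cp t B = 1"
  using cp_mono[of 0 t B] cp_le_1[of t B] by (simp add: cp_0)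

definition h :: "'v set \<Rightarrow> real" where "h B = lim (\<lambda>n. cp (real n) B)"

lemma cp_LIMSEQ: "(\<lambda>n. cp (real n) B) \<longlonglongrightarrow> h B"
proof -
  have "incseq (\<lambda>n. cp (real n) B)" by (auto simp: incseq_def intro: cp_mono)
  moreover have "bdd_above (range (\<lambda>n. cp (real n) B))" by (auto intro!: bdd_aboveI[of _ 1] cp_le_1)
  ultimately have "convergent (\<lambda>n. cp (real n) B)" using LIMSEQ_incseq_SUP unfolding convergent_def by blast
  then show ?thesis unfolding h_def by (simp add: convergent_LIMSEQ_iff)
qed

lemma cp_le_h: assumes "0 \<le> t" shows "cp t B \<le> h B"
proof (rule LIMSEQ_le_const[OF cp_LIMSEQ])
  show "\<exists>N. \<forall>n\<ge>N. cp t B \<le> cp (real n) B"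
    using assms by (intro exI[of _ "nat \<lceil>t\<rceil>"] allI impI cp_mono) linarith+
qed

lemma h_le_1: "h B \<le> 1"
  by (rule LIMSEQ_le_const2[OF cp_LIMSEQ]) (intro exI[of _ 0] allI impI cp_le_1 of_nat_0_le_iff)

lemma h_nonneg: "0 \<le> h B"
  using cp_le_h[of 0 B] cp_nonneg[of 0 B] by simp

lemma h_1: "card B \<le> 1 \<Longrightarrow> h B = 1"
  using cp_le_h[of 0 B] h_le_1[of B] by (simp add: cp_0)

lemma bnd_h: "bnd 1 h"
  using h_nonneg h_le_1 by (simp add: bnd_def)

lemma cp_tendsto: "((\<lambda>t. cp t B) \<longlongrightarrow> h B) at_top"
proof (rule tendstoI)
  fix e :: real assume "0 < e"
  from tendstoD[OF cp_LIMSEQ this, of B] obtain N where N: "dist (cp (real N) B) (h B) < e"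
    unfolding eventually_sequentially by blast
  have "dist (cp t B) (h B) < e" if "real N \<le> t" for t
    using N cp_mono[of "real N" t B] cp_le_h[of t B] cp_le_h[of "real N" B] that by (auto simp: dist_real_def)
  then show "\<forall>\<^sub>F t in at_top. dist (cp t B) (h B) < e" unfolding eventually_at_top_linorder by blast
qed

text \<open>Applying the semigroup to \<open>cp\<close> only shifts time, and the shift disappears
  in the limit.\<close>

lemma h_harmonic: "dualop 2 h B = 0"
proof (rule sgrp_invariant_harmonic[OF jump_dualop bnd_h])
  fix t :: real assume t: "0 \<le> t"
  show "sgrp (dualop 2) t h = h"
  proof
    fix B
    have "(\<lambda>n. sgrp (dualop 2) t (cp (real n)) B) \<longlonglongrightarrow> sgrp (dualop 2) t h B"
    proof (rule sgrp_tendsto[OF jump_dualop _ cp_LIMSEQ])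
      show "bnd 1 (cp (real n))" for n using cp_nonneg[of "real n"] cp_le_1[of "real n"] by (auto simp: bnd_def)
    qed
    moreover have "sgrp (dualop 2) t (cp (real n)) B = cp (t + real n) B" for n
      unfolding cp_def by (rule sgrp_semigroup[OF jump_dualop bnd_of_bool _ t, symmetric]) simp
    moreover have "(\<lambda>n. cp (t + real n) B) \<longlonglongrightarrow> h B"
      by (rule filterlim_compose[OF cp_tendsto])
        (rule filterlim_tendsto_add_at_top[OF tendsto_const filterlim_real_sequentially])
    ultimately have "(\<lambda>n. cp (t + real n) B) \<longlonglongrightarrow> sgrp (dualop 2) t h B" by simp
    from LIMSEQ_unique[OF this \<open>(\<lambda>n. cp (t + real n) B) \<longlonglongrightarrow> h B\<close>] show "sgrp (dualop 2) t h B = h B" .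
  qed
qed

section \<open>Comparison with independent walks and duality\<close>

text \<open>Ordered pairs of labels are counted. Labels at the same site contribute \<open>h\<close>
  of a singleton, which is 1; this keeps \<open>HH\<close> at least 2 wherever labels
  coincide.\<close>

definition HH :: "nat set \<Rightarrow> (nat \<Rightarrow> 'v) \<Rightarrow> real" where
  "HH J x = (\<Sum>i\<in>J. \<Sum>j\<in>J - {i}. h {x i, x j})"

definition good :: "nat set \<Rightarrow> (nat \<Rightarrow> 'v) \<Rightarrow> (nat \<times> 'v) set" where
  "good J x = {m \<in> moves J x. snd m \<notin> x ` J}"
definition bad :: "nat set \<Rightarrow> (nat \<Rightarrow> 'v) \<Rightarrow> (nat \<times> 'v) set" where
  "bad J x = {m \<in> moves J x. snd m \<in> x ` J}"

lemma moves_split: assumes "finite J" shows "sum f (moves J x) = sum f (good J x) + sum f (bad J x)"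
proof -
  have "moves J x = good J x \<union> bad J x" "good J x \<inter> bad J x = {}" by (auto simp: good_def bad_def)
  then show ?thesis using assms by (metis finite_Un moves_fin sum.union_disjoint)
qed

lemma HH_nonneg: "0 \<le> HH J x" unfolding HH_def by (intro sum_nonneg h_nonneg)

lemma HH_le: "finite J \<Longrightarrow> HH J x \<le> real (card J) * real (card J)"
proof -
  assume J: "finite J"
  have "HH J x \<le> (\<Sum>i\<in>J. \<Sum>j\<in>J. 1)"
    unfolding HH_def using J
    by (intro sum_mono order_trans[OF sum_mono[OF h_le_1]] sum_mono2) auto
  then show ?thesis by simp
qed

lemma HH_noninj:
  assumes J: "finite J" and "\<not> inj_on x J" shows "2 \<le> HH J x"
proof -
  obtain i j where ij: "i \<in> J" "j \<in> J" "i \<noteq> j" "x i = x j" using assms(2) by (auto simp: inj_on_def)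
  let ?f = "\<lambda>i. \<Sum>j\<in>J - {i}. h {x i, x j}"
  have 1: "1 \<le> ?f i" if "i \<in> J" "j \<in> J" "i \<noteq> j" "x i = x j" for i j
  proof -
    have "h {x i, x j} \<le> ?f i" using that J by (intro member_le_sum) (auto intro: h_nonneg)
    moreover have "h {x i, x j} = 1" using that by (intro h_1) simp
    ultimately show ?thesis by simp
  qed
  have "sum ?f {i, j} \<le> sum ?f J" using ij J by (intro sum_mono2) (auto intro!: sum_nonneg h_nonneg)
  then show ?thesis using 1[OF ij] 1[of j i] ij unfolding HH_def by simp
qed

lemma image_move:
  assumes "inj_on x J" "j \<in> J" shows "(x(j := y)) ` J = insert y (x ` J - {x j})"
proof -
  have "(x(j := y)) ` J = insert y (x ` (J - {j}))" using assms by auto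
  also have "x ` (J - {j}) = x ` J - {x j}" using assms by (subst inj_on_image_set_diff[of x J]) auto
  finally show ?thesis .
qed

lemma inj_move: assumes "inj_on x J" "y \<notin> x ` J" shows "inj_on (x(j := y)) J"
  using assms by (auto simp: inj_on_def)

lemma pairsum_image:
  assumes x: "inj_on x J" shows "pairsum b (x ` J) = (\<Sum>i\<in>J. \<Sum>j\<in>J - {i}. b {x i, x j})"
proof -
  have "pairsum b (x ` J) = (\<Sum>i\<in>J. \<Sum>z\<in>x ` J - {x i}. b {x i, z})"
    unfolding pairsum_def by (rule sum.reindex[OF x, unfolded o_def])
  also have "\<dots> = (\<Sum>i\<in>J. \<Sum>j\<in>J - {i}. b {x i, x j})"
  proof (intro sum.cong refl)
    fix i assume i: "i \<in> J"
    have "x ` J - {x i} = x ` (J - {i})" using x i by (subst inj_on_image_set_diff[of x J]) auto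
    then show "(\<Sum>z\<in>x ` J - {x i}. b {x i, z}) = (\<Sum>j\<in>J - {i}. b {x i, x j})"
      using inj_on_subset[OF x, of "J - {i}"] by (simp add: sum.reindex)
  qed
  finally show ?thesis .
qed

lemma HH_pairsum: "inj_on x J \<Longrightarrow> HH J x = pairsum h (x ` J)"
  unfolding HH_def by (rule pairsum_image[symmetric])

lemma smoves_image:
  assumes x: "inj_on x J" shows "bij_betw (\<lambda>m. (x (fst m), snd m)) (moves J x) (smoves (x ` J))"
  unfolding bij_betw_def
proof
  show "inj_on (\<lambda>m. (x (fst m), snd m)) (moves J x)"
    using x by (auto simp: inj_on_def moves_def)
  show "(\<lambda>m. (x (fst m), snd m)) ` moves J x = smoves (x ` J)"
    by (force simp: moves_def smoves_def)
qed

lemma good_image: assumes x: "inj_on x J" shows "bij_betw (\<lambda>m. (x (fst m), snd m)) (good J x) (S1 (x ` J))"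
  unfolding bij_betw_def
proof
  show "inj_on (\<lambda>m. (x (fst m), snd m)) (good J x)"
    using x by (auto simp: inj_on_def moves_def good_def)
  show "(\<lambda>m. (x (fst m), snd m)) ` good J x = S1 (x ` J)"
    by (force simp: moves_def smoves_def good_def S1_def)
qed

lemma bad_image: assumes x: "inj_on x J" shows "bij_betw (\<lambda>m. (x (fst m), snd m)) (bad J x) (S2 (x ` J))"
  unfolding bij_betw_def
proof
  show "inj_on (\<lambda>m. (x (fst m), snd m)) (bad J x)"
    using x by (auto simp: inj_on_def moves_def bad_def)
  show "(\<lambda>m. (x (fst m), snd m)) ` bad J x = S2 (x ` J)"
    by (force simp: moves_def smoves_def bad_def S2_def)
qed

lemma dualop_image:
  assumes J: "finite J" "card J \<le> n" and x: "inj_on x J"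
  shows "dualop n f (x ` J) = (\<Sum>m\<in>good J x. 1 / d * (f ((x(fst m := snd m)) ` J) - f (x ` J)))
     + (\<Sum>m\<in>bad J x. \<theta> / d * (f ((x(fst m := snd m)) ` J) - f (x ` J)))"
proof -
  have "dualop n f (x ` J) = (\<Sum>m\<in>smoves (x ` J). \<rho> (x ` J) (snd m) * (f (insert (snd m) (x ` J - {fst m})) - f (x ` J)))"
    using J x by (simp add: dualop_def card_image)
  also have "\<dots> = (\<Sum>m\<in>moves J x. \<rho> (x ` J) (snd m) * (f (insert (snd m) (x ` J - {x (fst m)})) - f (x ` J)))"
    by (subst sum.reindex_bij_betw[OF smoves_image[OF x], symmetric]) simp
  also have "\<dots> = (\<Sum>m\<in>moves J x. \<rho> (x ` J) (snd m) * (f ((x(fst m := snd m)) ` J) - f (x ` J)))"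
  proof (intro sum.cong refl)
    fix m assume "m \<in> moves J x"
    then have "fst m \<in> J" by (auto simp: moves_def)
    then show "\<rho> (x ` J) (snd m) * (f (insert (snd m) (x ` J - {x (fst m)})) - f (x ` J)) = \<rho> (x ` J) (snd m) * (f ((x(fst m := snd m)) ` J) - f (x ` J))"
      by (simp only: image_move[OF x])
  qed
  also have "\<dots> = (\<Sum>m\<in>good J x. \<rho> (x ` J) (snd m) * (f ((x(fst m := snd m)) ` J) - f (x ` J))) + (\<Sum>m\<in>bad J x. \<rho> (x ` J) (snd m) * (f ((x(fst m := snd m)) ` J) - f (x ` J)))"
    by (rule moves_split[OF J(1)])
  also have "(\<Sum>m\<in>good J x. \<rho> (x ` J) (snd m) * (f ((x(fst m := snd m)) ` J) - f (x ` J))) = (\<Sum>m\<in>good J x. 1 / d * (f ((x(fst m := snd m)) ` J) - f (x ` J)))"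
    by (intro sum.cong refl) (simp add: good_def \<rho>_def)
  also have "(\<Sum>m\<in>bad J x. \<rho> (x ` J) (snd m) * (f ((x(fst m := snd m)) ` J) - f (x ` J))) = (\<Sum>m\<in>bad J x. \<theta> / d * (f ((x(fst m := snd m)) ` J) - f (x ` J)))"
    by (intro sum.cong refl) (simp add: bad_def \<rho>_def)
  finally show ?thesis .
qed

text \<open>The expected interaction time of the coalescing system is bounded by the coalescence
  probability: \<^term>\<open>HH\<close> is a strict supersolution for the walk killed at the interaction rate.\<close>

lemma HH_super:
  assumes J: "finite J" and x: "inj_on x J"
  shows "(\<Sum>m\<in>good J x. 1 / d * (HH J (x(fst m := snd m)) - HH J x)) - card (bad J x) / d * HH J x
     \<le> - (2 * \<theta> / d * card (bad J x))"
proof -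
  let ?A = "x ` J"
  have A: "finite ?A" using J by simp
  have "(\<Sum>m\<in>good J x. 1 / d * (HH J (x(fst m := snd m)) - HH J x))
     = (\<Sum>m\<in>good J x. 1 / d * (pairsum h (insert (snd m) (?A - {x (fst m)})) - pairsum h ?A))"
  proof (intro sum.cong refl)
    fix m assume m: "m \<in> good J x"
    then have "fst m \<in> J" "snd m \<notin> ?A" by (auto simp: good_def moves_def)
    then show "1 / d * (HH J (x(fst m := snd m)) - HH J x) = 1 / d * (pairsum h (insert (snd m) (?A - {x (fst m)})) - pairsum h ?A)"
      by (simp only: HH_pairsum[OF x] HH_pairsum[OF inj_move[OF x]] image_move[OF x] not_False_eq_True)
  qed
  also have "\<dots> = (\<Sum>m\<in>S1 ?A. 1 / d * (pairsum h (insert (snd m) (?A - {fst m})) - pairsum h ?A))"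
    by (subst sum.reindex_bij_betw[OF good_image[OF x], symmetric]) simp
  \<comment> \<open>Harmonicity of \<open>h\<close> annihilates the left-hand side of
    \<open>pairsum_dualop\<close>; what the moves to vacant sites contribute is therefore carried by
    the pairs about to interact.\<close>
  also have "\<dots> = - 2 * (\<Sum>m\<in>S2 ?A. \<theta> / d * (h {snd m} - h {fst m, snd m}))"
  proof -
    have "(\<Sum>x\<in>?A. \<Sum>z\<in>?A - {x}. dualop 2 h {x, z}) = 0" by (simp add: h_harmonic)
    then show ?thesis using pairsum_dualop[OF A, of h] by simp
  qed
  also have "\<dots> = (\<Sum>m\<in>bad J x. - (2 * \<theta> / d) + 2 * \<theta> / d * h {x (fst m), snd m})"
    by (subst sum.reindex_bij_betw[OF bad_image[OF x], symmetric])
       (simp add: h_1 sum_distrib_left right_diff_distrib sum_negf[symmetric] algebra_simps)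
  \<comment> \<open>The interacting pair occurs in \<open>HH\<close> in both orders, so 2h is at
    most \<open>HH\<close>. With \<open>\<theta>\<close> below 1, the part of the drift lost through
    \<open>h\<close> is paid for by killing at rate 1/d.\<close>
  also have "\<dots> \<le> (\<Sum>m\<in>bad J x. - (2 * \<theta> / d) + 1 / d * HH J x)"
  proof (intro sum_mono add_left_mono)
    fix m assume m: "m \<in> bad J x"
    then obtain i j where ij: "fst m = i" "i \<in> J" "j \<in> J" "snd m = x j" "x j \<in> nb (x i)" by (auto simp: bad_def moves_def)
    then have "i \<noteq> j" by auto
    let ?f = "\<lambda>i. \<Sum>j\<in>J - {i}. h {x i, x j}"
    have 1: "h {x i, x j} \<le> ?f i" "h {x j, x i} \<le> ?f j"
      using ij J \<open>i \<noteq> j\<close> by (auto intro!: member_le_sum[of _ _ "\<lambda>l. h {x _, x l}"] intro: h_nonneg)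
    have "sum ?f {i, j} \<le> sum ?f J" using ij J by (intro sum_mono2) (auto intro!: sum_nonneg h_nonneg)
    then have "2 * h {x i, x j} \<le> HH J x" using 1 \<open>i \<noteq> j\<close> by (simp add: HH_def insert_commute)
    then have "\<theta> * (2 * h {x i, x j}) \<le> 1 * HH J x"
      using \<theta> h_nonneg[of "{x i, x j}"] by (intro mult_mono) auto
    then have "\<theta> * (2 * h {x i, x j}) / d \<le> HH J x / d" using d0 by (intro divide_right_mono) auto
    then show "2 * \<theta> / d * h {x (fst m), snd m} \<le> 1 / d * HH J x" using ij by (simp add: algebra_simps)
  qed
  finally show ?thesis by (simp add: algebra_simps sum.distrib)
qed

text \<open>The moves to vacant sites, together with killing at rate 1/d per move onto an occupied
  site, form a generator of total rate card J for which \<open>HH\<close> is a strict supersolution.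
  If \<open>D\<close> follows these moves up to an error proportional to the number of interacting
  moves, a multiple of \<open>HH\<close> dominates it. Configurations with coinciding labels are
  settled by size alone.\<close>

theorem interaction_comparison:
  fixes D D' :: "real \<Rightarrow> (nat \<Rightarrow> 'v) \<Rightarrow> real"
  assumes J: "finite J"
    and bound: "\<And>t x. 0 \<le> t \<Longrightarrow> \<bar>D t x\<bar> \<le> 1"
    and init: "\<And>x. D 0 x = 0"
    and der: "\<And>t x. inj_on x J \<Longrightarrow> 0 \<le> t \<Longrightarrow> ((\<lambda>s. D s x) has_real_derivative D' t x) (at t within {0..})"
    and ineq: "\<And>t x. inj_on x J \<Longrightarrow> 0 \<le> t \<Longrightarrow>
       \<bar>D' t x - (\<Sum>m\<in>good J x. 1 / d * (D t (x(fst m := snd m)) - D t x))\<bar> \<le> 3 * real (card (bad J x)) / d"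
    and t: "0 \<le> t"
  shows "\<bar>D t x\<bar> \<le> 2 / \<theta> * HH J x"
proof -
  \<comment> \<open>With this factor the drift of \<open>HH\<close> yields 4/d per interacting move:
    3/d cover the assumed error and 1/d the killing term, as \<open>D\<close> is bounded by
    1.\<close>
  let ?C = "2 / \<theta>"
  have C: "2 \<le> ?C" using \<theta> by (simp add: field_simps)
  have main: "0 \<le> ?C * HH J x + \<sigma> * D t x" if \<sigma>: "\<sigma> = 1 \<or> \<sigma> = -1" for \<sigma> :: real
  proof (rule max_principle[of "card J" t 1 "\<lambda>t x. ?C * HH J x + \<sigma> * D t x" "{x. inj_on x J}" "\<lambda>t x. \<sigma> * D' t x"])
    have lb: "- 1 \<le> \<sigma> * D s x" if "0 \<le> s" for s x using bound[OF that, of x] \<sigma> by auto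
    have CH: "0 \<le> ?C * HH J x" for x using \<theta> HH_nonneg by simp
    show "- 1 \<le> ?C * HH J x + \<sigma> * D s x" if "0 \<le> s" for s x using lb[OF that, of x] CH[of x] by linarith
    show "0 \<le> ?C * HH J x + \<sigma> * D 0 x" for x using CH init by simp
    show "0 \<le> ?C * HH J x + \<sigma> * D s x" if "x \<notin> {x. inj_on x J}" "0 \<le> s" for s x
    proof -
      have "2 * 2 \<le> ?C * HH J x" using C HH_noninj[OF J, of x] that \<theta> by (intro mult_mono) auto
      then show ?thesis using lb[OF that(2), of x] by linarith
    qed
    show "((\<lambda>s. ?C * HH J x + \<sigma> * D s x) has_real_derivative \<sigma> * D' s x) (at s within {0..})"
      if "x \<in> {x. inj_on x J}" "0 \<le> s" for s x
      using der[of x s] that by (auto intro!: derivative_eq_intros)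
    fix s m :: real and x :: "nat \<Rightarrow> 'v"
    assume x: "x \<in> {x. inj_on x J}" and s: "0 \<le> s" and m: "0 \<le> m" and lo: "\<And>x. - m \<le> ?C * HH J x + \<sigma> * D s x"
    define W where "W x = ?C * HH J x + \<sigma> * D s x" for x
    let ?g = "real (card (good J x))" and ?b = "real (card (bad J x))"
    have cnt: "(?g + ?b) / d = card J"
      using moves_split[OF J, of "\<lambda>_. 1::real" x] moves_card[OF J, of x] d0 by (simp add: field_simps flip: of_nat_mult)
    have x': "inj_on x J" using x by simp
    let ?S = "\<lambda>f. \<Sum>m\<in>good J x. 1 / d * (f (x(fst m := snd m)) - f x)"
    have "?S W = ?C * ?S (HH J) + \<sigma> * ?S (D s)"
      unfolding W_def sum_distrib_left sum.distrib[symmetric] by (intro sum.cong refl) (simp add: algebra_simps)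
    have "- (?g / d * m) - ?g / d * W x \<le> ?S W"
    proof -
      have "(\<Sum>m'\<in>good J x. 1 / d * (- m - W x)) \<le> ?S W"
        using lo d0 unfolding W_def by (intro sum_mono mult_left_mono) auto
      then show ?thesis by (simp add: algebra_simps)
    qed
    moreover have "?S W - ?b / d * W x \<le> \<sigma> * D' s x"
    proof -
      have "?C * (?S (HH J) - ?b / d * HH J x) \<le> ?C * (- (2 * \<theta> / d * ?b))"
        using HH_super[OF J x'] \<theta> by (intro mult_left_mono) auto
      also have "\<dots> = - (4 * ?b / d)" using \<theta> by (simp add: field_simps)
      finally have 1: "?C * ?S (HH J) - ?C * (?b / d * HH J x) \<le> - (4 * ?b / d)" by (simp add: right_diff_distrib)
      have 2: "\<sigma> * ?S (D s) - 3 * ?b / d \<le> \<sigma> * D' s x"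
        using ineq[OF x' s] \<sigma> by (auto simp: abs_le_iff)
      have 3: "- (?b / d) \<le> ?b / d * (\<sigma> * D s x)"
      proof -
        have "?b / d * (- 1) \<le> ?b / d * (\<sigma> * D s x)" using lb[OF s, of x] d0 by (intro mult_left_mono) auto
        then show ?thesis by simp
      qed
      have "?b / d * W x = ?C * (?b / d * HH J x) + ?b / d * (\<sigma> * D s x)" unfolding W_def by (simp add: algebra_simps)
      with 1 2 3 \<open>?S W = _\<close> show ?thesis by (simp add: algebra_simps)
    qed
    ultimately have "- (?g / d * m) - ?g / d * W x - ?b / d * W x \<le> \<sigma> * D' s x" by linarith
    moreover have "?g / d * W x + ?b / d * W x = card J * W x" unfolding cnt[symmetric] by (simp add: algebra_simps add_divide_distrib)
    moreover have "?g / d * m \<le> card J * m" unfolding cnt[symmetric] using m d0 by (intro mult_right_mono divide_right_mono) auto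
    ultimately show "- real (card J) * (?C * HH J x + \<sigma> * D s x) - real (card J) * m \<le> \<sigma> * D' s x"
      unfolding W_def[symmetric] by simp
  qed (use t in auto)
  from main[of 1] main[of "-1"] show ?thesis by (simp add: abs_le_iff)
qed

lemma sum_bad_le:
  fixes f :: "nat \<times> 'v \<Rightarrow> real" and c :: real
  assumes J: "finite J" and "\<And>m. m \<in> bad J x \<Longrightarrow> \<bar>f m\<bar> \<le> c"
  shows "\<bar>\<Sum>m\<in>bad J x. 1 / d * f m\<bar> \<le> c * card (bad J x) / d"
proof -
  have "\<bar>\<Sum>m\<in>bad J x. 1 / d * f m\<bar> \<le> (\<Sum>m\<in>bad J x. \<bar>1 / d * f m\<bar>)" by (rule sum_abs)
  also have "\<dots> \<le> (\<Sum>m\<in>bad J x. 1 / d * c)"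
    using assms d0 by (intro sum_mono) (simp add: abs_mult divide_right_mono)
  finally show ?thesis by (simp add: mult_ac)
qed

text \<open>\<open>f\<close> is invariant for the dual, its evolution obeys independent walks, and
  the two generators agree on moves to vacant sites. An interacting move costs at most 2 for the
  jump of the difference itself and 1 for the missing rate 1-\<theta>; this is the 3 in
  \<open>interaction_comparison\<close>.\<close>

theorem harmonic_vs_walk:
  assumes J: "finite J" "card J \<le> n" and f: "\<And>A. 0 \<le> f A" "\<And>A. f A \<le> 1"
    and harm: "\<And>A. dualop n f A = 0" and t: "0 \<le> t"
  shows "\<bar>f (x ` J) - sgrp (walkop J) t (\<lambda>x. f (x ` J)) x\<bar> \<le> 2 / \<theta> * HH J x"
proof -
  let ?F = "\<lambda>x. f (x ` J)" and ?U = "\<lambda>t. sgrp (walkop J) t (\<lambda>x. f (x ` J))"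
  have b: "bnd 1 ?F" using f by (simp add: bnd_def)
  have L: "jump_op (card J) (walkop J)" by (rule jump_walkop[OF J(1)])
  have U0: "0 \<le> ?U t x" if "0 \<le> t" for t x by (rule sgrp_nonneg[OF L b f(1) that])
  have U1: "?U t x \<le> 1" if "0 \<le> t" for t x using bndD[OF sgrp_bnd[OF L b that], of x] by simp
  show ?thesis
  proof (rule interaction_comparison[OF J(1), of "\<lambda>t x. ?F x - ?U t x" "\<lambda>t x. - walkop J (?U t) x" t x, OF _ _ _ _ t])
    show "\<bar>?F x - ?U t x\<bar> \<le> 1" if "0 \<le> t" for t x
      using U0[OF that, of x] U1[OF that, of x] f(1)[of "x ` J"] f(2)[of "x ` J"] by (simp add: abs_le_iff)
    show "?F x - ?U 0 x = 0" for x by simp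
    show "((\<lambda>s. ?F x - ?U s x) has_real_derivative - walkop J (?U t) x) (at t within {0..})" for t x
      using DERIV_diff[OF DERIV_const[of "?F x"] sgrp_deriv'[OF L b, of x t "{0..}"]] by simp
    fix t :: real and x :: "nat \<Rightarrow> 'v" assume x: "inj_on x J" and t: "0 \<le> t"
    let ?D = "\<lambda>x. ?F x - ?U t x"
    let ?b = "real (card (bad J x))"
    have "walkop J ?D x = walkop J ?F x - walkop J (?U t) x" by (rule jump_op_diff[OF L])
    then have 1: "- walkop J (?U t) x - (\<Sum>m\<in>good J x. 1 / d * (?D (x(fst m := snd m)) - ?D x))
       = (\<Sum>m\<in>bad J x. 1 / d * (?D (x(fst m := snd m)) - ?D x)) - walkop J ?F x"
      unfolding walkop_def[of J ?D] moves_split[OF J(1)] by linarith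
    have 2: "\<bar>\<Sum>m\<in>bad J x. 1 / d * (?D (x(fst m := snd m)) - ?D x)\<bar> \<le> 2 * ?b / d"
    proof (rule sum_bad_le[OF J(1)])
      fix m
      show "\<bar>?D (x(fst m := snd m)) - ?D x\<bar> \<le> 2"
        using U0[OF t, of x] U1[OF t, of x] f(1)[of "x ` J"] f(2)[of "x ` J"] U0[OF t, of "x(fst m := snd m)"] U1[OF t, of "x(fst m := snd m)"]
          f(1)[of "(x(fst m := snd m)) ` J"] f(2)[of "(x(fst m := snd m)) ` J"] by (simp only: abs_le_iff) linarith
    qed
    have "walkop J ?F x = (\<Sum>m\<in>bad J x. 1 / d * ((1 - \<theta>) * (?F (x(fst m := snd m)) - ?F x)))"
    proof -
      have "walkop J ?F x = walkop J ?F x - dualop n f (x ` J)" using harm by simp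
      also have "\<dots> = (\<Sum>m\<in>bad J x. 1 / d * (?F (x(fst m := snd m)) - ?F x)) - (\<Sum>m\<in>bad J x. \<theta> / d * (?F (x(fst m := snd m)) - ?F x))"
        unfolding walkop_def dualop_image[OF J x] moves_split[OF J(1)] by simp
      also have "\<dots> = (\<Sum>m\<in>bad J x. 1 / d * ((1 - \<theta>) * (?F (x(fst m := snd m)) - ?F x)))"
        unfolding sum_subtractf[symmetric]
        by (intro sum.cong refl) (simp add: algebra_simps diff_divide_distrib add_divide_distrib del: fun_upd_image)
      finally show ?thesis .
    qed
    moreover have "\<bar>\<Sum>m\<in>bad J x. 1 / d * ((1 - \<theta>) * (?F (x(fst m := snd m)) - ?F x))\<bar> \<le> 1 * ?b / d"
    proof (rule sum_bad_le[OF J(1)])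
      fix m
      have "\<bar>?F (x(fst m := snd m)) - ?F x\<bar> \<le> 1"
        using f(1)[of "x ` J"] f(2)[of "x ` J"] f(1)[of "(x(fst m := snd m)) ` J"] f(2)[of "(x(fst m := snd m)) ` J"] by (simp only: abs_le_iff) linarith
      then have "(1 - \<theta>) * \<bar>?F (x(fst m := snd m)) - ?F x\<bar> \<le> 1 * 1" using \<theta> by (intro mult_mono) auto
      then show "\<bar>(1 - \<theta>) * (?F (x(fst m := snd m)) - ?F x)\<bar> \<le> 1" using \<theta> by (simp add: abs_mult)
    qed
    ultimately have 3: "\<bar>walkop J ?F x\<bar> \<le> 1 * ?b / d" by simp
    have "\<bar>(\<Sum>m\<in>bad J x. 1 / d * (?D (x(fst m := snd m)) - ?D x)) - walkop J ?F x\<bar> \<le> 2 * ?b / d + 1 * ?b / d"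
      using 2 3 by linarith
    also have "\<dots> = 3 * ?b / d" by (simp add: field_simps)
    finally show "\<bar>- walkop J (?U t) x - (\<Sum>m\<in>good J x. 1 / d * (?D (x(fst m := snd m)) - ?D x))\<bar> \<le> 3 * ?b / d"
      unfolding 1 .
  qed
qed

text \<open>Moves to vacant sites preserve the number of particles, so a function of the cardinality
  has no drift until an interaction occurs.\<close>

theorem card_fun_vs_dual:
  assumes J: "finite J" "card J \<le> n" and c: "\<And>k. 0 \<le> c k" "\<And>k. c k \<le> 1" and t: "0 \<le> t"
  shows "\<bar>sgrp (dualop n) t (\<lambda>B. c (card B)) (x ` J) - c (card (x ` J))\<bar> \<le> 2 / \<theta> * HH J x"
proof -
  let ?V = "\<lambda>t. sgrp (dualop n) t (\<lambda>B. c (card B))"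
  have b: "bnd 1 (\<lambda>B::'v set. c (card B))" using c by (simp add: bnd_def)
  note L = jump_dualop[of n]
  have V0: "0 \<le> ?V t B" if "0 \<le> t" for t B by (rule sgrp_nonneg[OF L b c(1) that])
  have V1: "?V t B \<le> 1" if "0 \<le> t" for t B using bndD[OF sgrp_bnd[OF L b that], of B] by simp
  show ?thesis
  proof (rule interaction_comparison[OF J(1), of "\<lambda>t x. ?V t (x ` J) - c (card (x ` J))" "\<lambda>t x. dualop n (?V t) (x ` J)" t x, OF _ _ _ _ t])
    show "\<bar>?V t (x ` J) - c (card (x ` J))\<bar> \<le> 1" if "0 \<le> t" for t x
      using V0[OF that, of "x ` J"] V1[OF that, of "x ` J"] c(1)[of "card (x ` J)"] c(2)[of "card (x ` J)"] by (simp add: abs_le_iff)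
    show "?V 0 (x ` J) - c (card (x ` J)) = 0" for x by simp
    show "((\<lambda>s. ?V s (x ` J) - c (card (x ` J))) has_real_derivative dualop n (?V t) (x ` J)) (at t within {0..})" for t x
      using DERIV_diff[OF sgrp_deriv'[OF L b, of "x ` J" t "{0..}"] DERIV_const[of "c (card (x ` J))"]] by simp
    fix t :: real and x :: "nat \<Rightarrow> 'v" assume x: "inj_on x J" and t: "0 \<le> t"
    let ?D = "\<lambda>x. ?V t (x ` J) - c (card (x ` J))"
    let ?b = "real (card (bad J x))"
    have "(\<Sum>m\<in>good J x. 1 / d * (?D (x(fst m := snd m)) - ?D x)) = (\<Sum>m\<in>good J x. 1 / d * (?V t ((x(fst m := snd m)) ` J) - ?V t (x ` J)))"
    proof (intro sum.cong refl)
      fix m assume "m \<in> good J x"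
      then have "inj_on (x(fst m := snd m)) J" using inj_move[OF x] by (simp add: good_def)
      then have "card ((x(fst m := snd m)) ` J) = card (x ` J)" using x by (simp only: card_image)
      then show "1 / d * (?D (x(fst m := snd m)) - ?D x) = 1 / d * (?V t ((x(fst m := snd m)) ` J) - ?V t (x ` J))" by simp
    qed
    then have "dualop n (?V t) (x ` J) - (\<Sum>m\<in>good J x. 1 / d * (?D (x(fst m := snd m)) - ?D x))
       = (\<Sum>m\<in>bad J x. \<theta> / d * (?V t ((x(fst m := snd m)) ` J) - ?V t (x ` J)))"
      unfolding dualop_image[OF J x] by simp
    also have "\<dots> = (\<Sum>m\<in>bad J x. 1 / d * (\<theta> * (?V t ((x(fst m := snd m)) ` J) - ?V t (x ` J))))" by simp
    finally have eq: "dualop n (?V t) (x ` J) - (\<Sum>m\<in>good J x. 1 / d * (?D (x(fst m := snd m)) - ?D x)) = \<dots>" .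
    show "\<bar>dualop n (?V t) (x ` J) - (\<Sum>m\<in>good J x. 1 / d * (?D (x(fst m := snd m)) - ?D x))\<bar> \<le> 3 * ?b / d"
      unfolding eq
    proof (rule sum_bad_le[OF J(1)])
      fix m
      have "\<bar>?V t ((x(fst m := snd m)) ` J) - ?V t (x ` J)\<bar> \<le> 1"
        using V0[OF t, of "x ` J"] V1[OF t, of "x ` J"] V0[OF t, of "(x(fst m := snd m)) ` J"] V1[OF t, of "(x(fst m := snd m)) ` J"]
        by (simp only: abs_le_iff) linarith
      then have "\<theta> * \<bar>?V t ((x(fst m := snd m)) ` J) - ?V t (x ` J)\<bar> \<le> 1 * 1" using \<theta> by (intro mult_mono) auto
      then show "\<bar>\<theta> * (?V t ((x(fst m := snd m)) ` J) - ?V t (x ` J))\<bar> \<le> 3" using \<theta> by (simp add: abs_mult)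
    qed
  qed
qed


section \<open>Decay of the remaining interaction along the dual\<close>

lemma dual_local:
  assumes "\<And>B. finite B \<and> card B \<le> n \<Longrightarrow> f B = g B" and A: "finite A" "card A \<le> n"
  shows "sgrp (dualop n) t f A = sgrp (dualop n) t g A"
proof (rule sgrp_local[of "\<lambda>B. finite B \<and> card B \<le> n"])
  fix f g :: "'v set \<Rightarrow> real" and A :: "'v set"
  assume eq: "\<And>B. finite B \<and> card B \<le> n \<Longrightarrow> f B = g B" and A: "finite A \<and> card A \<le> n"
  show "dualop n f A = dualop n g A"
    unfolding dualop_def if_P[OF A]
  proof (intro sum.cong refl)
    fix m assume "m \<in> smoves A"
    then have "card (insert (snd m) (A - {fst m})) \<le> n"
      using card_move_le[of A "fst m" "snd m"] A by (auto simp: smoves_def)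
    then have "f (insert (snd m) (A - {fst m})) = g (insert (snd m) (A - {fst m}))" using A by (intro eq) simp
    then show "\<rho> A (snd m) * (f (insert (snd m) (A - {fst m})) - f A) = \<rho> A (snd m) * (g (insert (snd m) (A - {fst m})) - g A)"
      using eq[OF A] by simp
  qed
qed (use assms in auto)

text \<open>At a coalescence all pairs with the lost particle leave the sum, whereas the
  two-particle generators account for the coalescing pair alone; the other terms are nonnegative and
  are dropped. Vanishing on singletons makes a coalesced pair count as zero.\<close>

lemma pairsum_dual_super:
  assumes A: "finite A" "card A \<le> n" and b: "\<And>z. b {z} = 0" "\<And>B. 0 \<le> b B"
  shows "dualop n (pairsum b) A \<le> (\<Sum>x\<in>A. \<Sum>z\<in>A - {x}. dualop 2 b {x, z})"
proof -
  have "dualop n (pairsum b) A = (\<Sum>m\<in>S1 A. \<rho> A (snd m) * (pairsum b (insert (snd m) (A - {fst m})) - pairsum b A))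
     + (\<Sum>m\<in>S2 A. \<rho> A (snd m) * (pairsum b (insert (snd m) (A - {fst m})) - pairsum b A))"
    using A smoves_split[OF A(1)] by (simp add: dualop_def)
  also have "(\<Sum>m\<in>S1 A. \<rho> A (snd m) * (pairsum b (insert (snd m) (A - {fst m})) - pairsum b A))
     = (\<Sum>m\<in>S1 A. 1 / d * (pairsum b (insert (snd m) (A - {fst m})) - pairsum b A))"
    by (intro sum.cong refl) (simp add: S1_def \<rho>_def)
  also have "(\<Sum>m\<in>S2 A. \<rho> A (snd m) * (pairsum b (insert (snd m) (A - {fst m})) - pairsum b A))
     \<le> (\<Sum>m\<in>S2 A. \<theta> / d * (- 2 * b {fst m, snd m}))"
  proof (intro sum_mono)
    fix m assume m: "m \<in> S2 A"
    then have *: "fst m \<in> A" "snd m \<in> A" "fst m \<noteq> snd m" by (auto simp: S2_def smoves_def)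
    then have "insert (snd m) (A - {fst m}) = A - {fst m}" by auto
    moreover have "b {fst m, snd m} \<le> (\<Sum>z\<in>A - {fst m}. b {fst m, z})"
      using * A by (intro member_le_sum b(2)) auto
    ultimately have "pairsum b (insert (snd m) (A - {fst m})) - pairsum b A \<le> - 2 * b {fst m, snd m}"
      using pairsum_remove[OF A(1) *(1), of b] by simp
    moreover have "\<rho> A (snd m) = \<theta> / d" using * by (simp add: \<rho>_def)
    ultimately show "\<rho> A (snd m) * (pairsum b (insert (snd m) (A - {fst m})) - pairsum b A) \<le> \<theta> / d * (- 2 * b {fst m, snd m})"
      using \<theta> d0 by (simp only:) (intro mult_left_mono, auto)
  qed
  also have "(\<Sum>m\<in>S2 A. \<theta> / d * (- 2 * b {fst m, snd m})) = 2 * (\<Sum>m\<in>S2 A. \<theta> / d * (b {snd m} - b {fst m, snd m}))"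
    unfolding sum_distrib_left b(1) by (intro sum.cong refl) simp
  finally show ?thesis unfolding pairsum_dualop[OF A(1)] by simp
qed

definition Ghat :: "nat \<Rightarrow> 'v set \<Rightarrow> real" where
  "Ghat n A = (if finite A \<and> card A \<le> n then pairsum h A else 0)"

lemma bnd_Ghat: "bnd (real n * real n) (Ghat n)"
  unfolding bnd_def
proof
  fix A :: "'v set"
  have "0 \<le> pairsum h A" unfolding pairsum_def by (intro sum_nonneg h_nonneg)
  moreover have "pairsum h A \<le> real n * real n" if A: "finite A" "card A \<le> n"
  proof -
    have "pairsum h A \<le> (\<Sum>x\<in>A. \<Sum>z\<in>A. 1)"
      unfolding pairsum_def using A
      by (intro sum_mono order_trans[OF sum_mono[OF h_le_1]] sum_mono2) auto
    also have "\<dots> = real (card A) * real (card A)" by simp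
    also have "\<dots> \<le> real n * real n" using A by (intro mult_mono) auto
    finally show ?thesis .
  qed
  ultimately show "\<bar>Ghat n A\<bar> \<le> real n * real n" by (simp add: Ghat_def)
qed

lemma Ghat_nonneg: "0 \<le> Ghat n A"
  unfolding Ghat_def pairsum_def by (simp add: sum_nonneg h_nonneg)

text \<open>In the two-particle dual, \<open>h - cp t\<close> solves the backward equation and
  starts from \<open>h\<close> on pairs. By \<open>pairsum_dual_super\<close> its pair sum is a
  supersolution for n particles, so it dominates the expected pair sum of \<open>h\<close> at time
  t.\<close>

lemma Ghat_dual_le:
  assumes A: "finite A" "card A \<le> n" and t: "0 \<le> t"
  shows "sgrp (dualop n) t (Ghat n) A \<le> pairsum (\<lambda>B. h B - cp t B) A"
proof -
  define ok where "ok B \<longleftrightarrow> finite B \<and> card B \<le> n" for B :: "'v set"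
  \<comment> \<open>Probability that a pair coalesces later than \<open>t\<close>. Unlike
    \<open>h\<close> it vanishes on singletons, and at time 0 it agrees with \<open>h\<close> on
    sets of two sites.\<close>
  define b where "b t B = h B - cp t B" for t B
  have b0: "0 \<le> b t B" if "0 \<le> t" for t B using cp_le_h[OF that] by (simp add: b_def)
  have b1: "b t {z} = 0" if "0 \<le> t" for t z using cp_1[OF that, of "{z}"] h_1[of "{z}"] by (simp add: b_def)
  have db: "((\<lambda>s. b s B) has_real_derivative dualop 2 (b t) B) (at t within {0..})" for t B
  proof -
    have "dualop 2 (b t) B = 0 - dualop 2 (cp t) B"
      unfolding b_def[abs_def] using jump_op_diff[OF jump_dualop, of 2 h "cp t" B] h_harmonic by simp
    then show ?thesis unfolding b_def[of _ B]
      using DERIV_diff[OF DERIV_const[of "h B"] sgrp_deriv'[OF jump_dualop bnd_of_bool, of 2 "\<lambda>B. card B \<le> 1" B t "{0..}"]]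
      by (simp add: cp_def)
  qed
  let ?V = "\<lambda>t. sgrp (dualop n) t (Ghat n)"
  define w where "w t B = (if ok B then pairsum (b t) B else 0) - ?V t B" for t B
  define w' where "w' t B = (if ok B then (\<Sum>x\<in>B. \<Sum>z\<in>B - {x}. dualop 2 (b t) {x, z}) else 0) - dualop n (?V t) B" for t B
  have ps0: "0 \<le> pairsum (b t) B" if "0 \<le> t" for t B unfolding pairsum_def by (intro sum_nonneg b0 that)
  have "0 \<le> w t A"
  proof (rule jump_supersolution_nonneg[OF jump_dualop[of n], of t "real n * real n" w UNIV w' t A])
    show "- (real n * real n) \<le> w s B" if "0 \<le> s" for s B
      using ps0[OF that, of B] bndD[OF sgrp_bnd[OF jump_dualop[of n] bnd_Ghat[of n] that], of B] unfolding w_def by (auto simp: abs_le_iff)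
    have "pairsum (b 0) B = pairsum h B" for B
      unfolding pairsum_def by (intro sum.cong refl) (auto simp: b_def cp_0)
    then show "0 \<le> w 0 B" for B unfolding w_def by (simp add: Ghat_def ok_def)
    show "((\<lambda>s. w s B) has_real_derivative w' s B) (at s within {0..})" for s B
    proof -
      have "((\<lambda>s. if ok B then pairsum (b s) B else 0) has_real_derivative
        (if ok B then (\<Sum>x\<in>B. \<Sum>z\<in>B - {x}. dualop 2 (b s) {x, z}) else 0)) (at s within {0..})"
        by (cases "ok B") (auto simp: pairsum_def intro!: DERIV_sum db)
      from DERIV_diff[OF this sgrp_deriv'[OF jump_dualop bnd_Ghat]]
      show ?thesis unfolding w_def w'_def .
    qed
    show "dualop n (w s) B \<le> w' s B" if s: "0 \<le> s" for s B
    proof -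
      have "dualop n (w s) B = dualop n (\<lambda>B. if ok B then pairsum (b s) B else 0) B - dualop n (?V s) B"
        unfolding w_def[abs_def] by (rule jump_op_diff[OF jump_dualop])
      moreover have "dualop n (\<lambda>B. if ok B then pairsum (b s) B else 0) B \<le> (if ok B then (\<Sum>x\<in>B. \<Sum>z\<in>B - {x}. dualop 2 (b s) {x, z}) else 0)"
      proof (cases "ok B")
        case True
        have "dualop n (\<lambda>B. if ok B then pairsum (b s) B else 0) B = dualop n (pairsum (b s)) B"
          unfolding dualop_def using True card_move_le[of B]
          by (auto simp: ok_def smoves_def intro!: sum.cong) (metis card_move_le le_trans)+
        then show ?thesis using True pairsum_dual_super[of B n "b s", OF _ _ b1[OF s] b0[OF s]] by (simp add: ok_def)
      next
        case False
        then have "\<not> (finite B \<and> card B \<le> n)" by (simp add: ok_def)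
        then show ?thesis using False unfolding dualop_def by (simp only: if_False order_refl)
      qed
      ultimately show ?thesis unfolding w'_def by simp
    qed
  qed (use t in auto)
  then show ?thesis using A unfolding w_def ok_def b_def[abs_def] by simp
qed

theorem Ghat_vanishes:
  assumes A: "finite A" "card A \<le> n"
  shows "((\<lambda>t. sgrp (dualop n) t (Ghat n) A) \<longlongrightarrow> 0) at_top"
proof (rule tendsto_sandwich[OF _ _ tendsto_const])
  show "\<forall>\<^sub>F t in at_top. 0 \<le> sgrp (dualop n) t (Ghat n) A"
    using eventually_ge_at_top[of 0] by eventually_elim (rule sgrp_nonneg[OF jump_dualop bnd_Ghat Ghat_nonneg])
  show "\<forall>\<^sub>F t in at_top. sgrp (dualop n) t (Ghat n) A \<le> pairsum (\<lambda>B. h B - cp t B) A"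
    using eventually_ge_at_top[of 0] by eventually_elim (rule Ghat_dual_le[OF A])
  have "((\<lambda>t. pairsum (\<lambda>B. h B - cp t B) A) \<longlongrightarrow> (\<Sum>x\<in>A. \<Sum>z\<in>A - {x}. h {x, z} - h {x, z})) at_top"
    unfolding pairsum_def by (intro tendsto_sum tendsto_diff tendsto_const cp_tendsto)
  then show "((\<lambda>t. pairsum (\<lambda>B. h B - cp t B) A) \<longlongrightarrow> 0) at_top" by simp
qed

text \<open>Being harmonic, \<open>f\<close> equals its own evolution. The evolved distance between
  \<open>f\<close> and \<open>c\<close> of the cardinality is at most \<open>K\<close> times the
  evolved \<open>Ghat\<close>, which vanishes.\<close>

theorem harmonic_representation:
  assumes A: "finite A" "card A \<le> n" and f: "bnd 1 f" and harm: "\<And>B. dualop n f B = 0"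
    and c: "bnd 1 c" and K: "0 \<le> K"
    and close: "\<And>B. finite B \<Longrightarrow> card B \<le> n \<Longrightarrow> \<bar>f B - c (card B)\<bar> \<le> K * pairsum h B"
  shows "((\<lambda>t. sgrp (dualop n) t (\<lambda>B. c (card B)) A) \<longlongrightarrow> f A) at_top"
proof -
  let ?V = "sgrp (dualop n)"
  have bc: "bnd 1 (\<lambda>B::'v set. c (card B))" using c by (simp add: bnd_def)
  have bK: "bnd (\<bar>e\<bar> * (real n * real n)) (\<lambda>B. e * Ghat n B)" for e
    using bndD[OF bnd_Ghat[of n]] by (simp add: bnd_def abs_mult mult_left_mono)
  define g where "g B = (if finite B \<and> card B \<le> n then c (card B) - f B else 0)" for B
  have bg: "bnd 2 g" unfolding bnd_def
  proof
    fix B show "\<bar>g B\<bar> \<le> 2" using bndD[OF f, of B] bndD[OF c, of "card B"] unfolding g_def by auto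
  qed
  have gle: "g B \<le> K * Ghat n B" "(- K) * Ghat n B \<le> g B" for B
    using close[of B] by (auto simp: g_def Ghat_def abs_le_iff)
  have eq: "?V t (\<lambda>B. c (card B)) A - f A = ?V t g A" for t
  proof -
    have "?V t g A = ?V t (\<lambda>B. c (card B) - f B) A" by (rule dual_local[OF _ A]) (simp add: g_def)
    also have "\<dots> = ?V t (\<lambda>B. c (card B)) A - ?V t f A" by (rule sgrp_diff[OF jump_dualop bc f])
    also have "?V t f A = f A" by (rule sgrp_harmonic[OF jump_dualop harm])
    finally show ?thesis by simp
  qed
  have lim: "((\<lambda>t. e * ?V t (Ghat n) A) \<longlongrightarrow> 0) at_top" for e
    using tendsto_mult[OF tendsto_const[of e] Ghat_vanishes[OF A]] by simp
  have "((\<lambda>t. ?V t g A) \<longlongrightarrow> 0) at_top"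
  proof (rule tendsto_sandwich[OF _ _ lim[of "- K"] lim[of K]])
    show "\<forall>\<^sub>F t in at_top. - K * ?V t (Ghat n) A \<le> ?V t g A"
      using eventually_ge_at_top[of 0]
    proof eventually_elim
      case (elim t)
      show ?case using sgrp_mono[OF jump_dualop[of n] bK[of "- K"] bg gle(2) elim, of A] sgrp_cmult[OF jump_dualop[of n] bnd_Ghat[of n], of t "- K" A] by simp
    qed
    show "\<forall>\<^sub>F t in at_top. ?V t g A \<le> K * ?V t (Ghat n) A"
      using eventually_ge_at_top[of 0]
    proof eventually_elim
      case (elim t)
      show ?case using sgrp_mono[OF jump_dualop[of n] bg bK[of K] gle(1) elim, of A] sgrp_cmult[OF jump_dualop[of n] bnd_Ghat[of n], of t "K" A] by simp
    qed
  qed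
  then show ?thesis unfolding eq[symmetric] by (simp add: LIM_zero_iff)
qed

end

section \<open>Feller semigroups\<close>

lemma feller_cont: "feller_semigroup T \<Longrightarrow> 0 \<le> t \<Longrightarrow> f \<in> cfg_cont \<Longrightarrow> T t f \<in> cfg_cont"
  by (erule feller_semigroup_def[THEN iffD1, THEN conjunct1, rule_format])

lemma feller_lin: "feller_semigroup T \<Longrightarrow> 0 \<le> t \<Longrightarrow> f \<in> cfg_cont \<Longrightarrow> g \<in> cfg_cont \<Longrightarrow>
    T t (\<lambda>\<eta>. a * f \<eta> + b * g \<eta>) = (\<lambda>\<eta>. a * T t f \<eta> + b * T t g \<eta>)"
  by (erule feller_semigroup_def[THEN iffD1, THEN conjunct2, THEN conjunct1, rule_format])

lemma feller_0: "feller_semigroup T \<Longrightarrow> f \<in> cfg_cont \<Longrightarrow> T 0 f = f"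
  by (erule feller_semigroup_def[THEN iffD1, THEN conjunct2, THEN conjunct2, THEN conjunct1, rule_format])

lemma feller_add: "feller_semigroup T \<Longrightarrow> 0 \<le> s \<Longrightarrow> 0 \<le> t \<Longrightarrow> f \<in> cfg_cont \<Longrightarrow> T (s + t) f = T s (T t f)"
  by (erule feller_semigroup_def[THEN iffD1, THEN conjunct2, THEN conjunct2, THEN conjunct2, THEN conjunct1, rule_format])

lemma feller_pos:
  assumes "feller_semigroup T" "0 \<le> t" "f \<in> cfg_cont" "\<And>\<eta>. 0 \<le> f \<eta>" shows "0 \<le> T t f \<eta>"
  using assms(1)[unfolded feller_semigroup_def, THEN conjunct2, THEN conjunct2, THEN conjunct2, THEN conjunct2,
      THEN conjunct1, THEN spec, THEN mp, OF assms(2), THEN bspec, OF assms(3)] assms(4) by simp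

lemma feller_1: "feller_semigroup T \<Longrightarrow> 0 \<le> t \<Longrightarrow> T t (\<lambda>_. 1) = (\<lambda>_. 1)"
  by (erule feller_semigroup_def[THEN iffD1, THEN conjunct2, THEN conjunct2, THEN conjunct2, THEN conjunct2, THEN conjunct2, THEN conjunct1, rule_format])

lemma feller_strong: "feller_semigroup T \<Longrightarrow> f \<in> cfg_cont \<Longrightarrow> uniform_limit UNIV (\<lambda>t. T t f) f (at_right 0)"
  by (erule feller_semigroup_def[THEN iffD1, THEN conjunct2, THEN conjunct2, THEN conjunct2, THEN conjunct2, THEN conjunct2, THEN conjunct2, rule_format])

lemma feller_contraction:
  assumes T: "feller_semigroup T" and t: "0 \<le> t" and f: "f \<in> cfg_cont" and g: "g \<in> cfg_cont"
    and le: "\<And>\<eta>. \<bar>f \<eta> - g \<eta>\<bar> \<le> e"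
  shows "\<bar>T t f \<eta> - T t g \<eta>\<bar> \<le> e"
proof -
  note lin = feller_lin[OF T t] and pos = feller_pos[OF T t] and one = feller_1[OF T t]
  have one': "(\<lambda>_. 1) \<in> cfg_cont" by (rule cylinder_cont[OF cylinder_const])
  have "0 \<le> \<sigma> * (T t f \<eta> - T t g \<eta>) + e" if \<sigma>: "\<sigma> = 1 \<or> \<sigma> = -1" for \<sigma> :: real
  proof -
    let ?k = "\<lambda>\<eta>. 1 * f \<eta> + (-1) * g \<eta>"
    have k: "?k \<in> cfg_cont" using cfg_cont_diff[OF f g] by simp
    have "(\<lambda>\<eta>. \<sigma> * ?k \<eta> + e * 1) \<in> cfg_cont"
      using k unfolding cfg_cont_def by (auto intro!: continuous_intros)
    then have "0 \<le> T t (\<lambda>\<eta>. \<sigma> * ?k \<eta> + e * 1) \<eta>"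
    proof (rule pos)
      show "0 \<le> \<sigma> * ?k \<eta> + e * 1" for \<eta> using le[of \<eta>] \<sigma> by (auto simp: abs_le_iff)
    qed
    then show ?thesis unfolding lin[OF k one'] lin[OF f g] one by (simp add: algebra_simps)
  qed
  from this[of 1] this[of "-1"] show ?thesis by (simp add: abs_le_iff)
qed

lemma feller_sum:
  assumes T: "feller_semigroup T" and t: "0 \<le> t" and S: "finite S" and f: "\<And>m. m \<in> S \<Longrightarrow> cylinder_fun (f m)"
  shows "T t (\<lambda>\<eta>. \<Sum>m\<in>S. c m * f m \<eta>) \<eta> = (\<Sum>m\<in>S. c m * T t (f m) \<eta>)"
  using S f
proof (induction S)
  case empty
  have "T t (\<lambda>\<eta>. 0 * (1::real) + 0 * 1) = (\<lambda>\<eta>. 0 * T t (\<lambda>_. 1) \<eta> + 0 * T t (\<lambda>_. 1) \<eta>)"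
    by (rule feller_lin[OF T t cylinder_cont[OF cylinder_const] cylinder_cont[OF cylinder_const]])
  from fun_cong[OF this, of \<eta>] show ?case by simp
next
  case (insert m S)
  have 1: "f m \<in> cfg_cont" using insert by (intro cylinder_cont) simp
  have 2: "(\<lambda>\<eta>. \<Sum>m\<in>S. c m * f m \<eta>) \<in> cfg_cont" using insert by (intro cylinder_cont cylinder_sum) simp_all
  have "T t (\<lambda>\<eta>. c m * f m \<eta> + 1 * (\<Sum>m\<in>S. c m * f m \<eta>)) = (\<lambda>\<eta>. c m * T t (f m) \<eta> + 1 * T t (\<lambda>\<eta>. \<Sum>m\<in>S. c m * f m \<eta>) \<eta>)"
    by (rule feller_lin[OF T t 1 2])
  from fun_cong[OF this, of \<eta>] show ?case using insert by simp
qed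

text \<open>The generator limit is given only at time 0 from the right. The semigroup law and
  contraction carry it to right derivatives at every time; for left derivatives the quotient is
  based at the earlier time, and strong continuity compares \<open>T y g\<close> with
  \<open>T t g\<close>.\<close>

lemma feller_deriv:
  assumes T: "feller_semigroup T" and f: "f \<in> cfg_cont" and g: "g \<in> cfg_cont"
    and gen: "uniform_limit UNIV (\<lambda>t \<eta>. (T t f \<eta> - f \<eta>) / t) g (at_right 0)" and t: "0 \<le> t"
  shows "((\<lambda>t. T t f \<eta>) has_real_derivative T t g \<eta>) (at t within {0..})"
  unfolding has_field_derivative_iff
proof (rule tendstoI)
  fix e :: real assume e: "0 < e"
  note cc = feller_cont[OF T] and sg = feller_add[OF T] and lin = feller_lin[OF T] and str = feller_strong[OF T g]
  have "\<forall>\<^sub>F s in at_right 0. (\<forall>\<eta>\<in>UNIV. dist ((T s f \<eta> - f \<eta>) / s) (g \<eta>) < e / 3) \<and> (\<forall>\<eta>\<in>UNIV. dist (T s g \<eta>) (g \<eta>) < e / 3)"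
    using e by (intro eventually_conj uniform_limitD[OF gen] uniform_limitD[OF str]) simp_all
  then obtain \<delta> where \<delta>: "0 < \<delta>" "\<And>s. 0 < s \<Longrightarrow> s < \<delta> \<Longrightarrow>
      (\<forall>\<eta>\<in>UNIV. dist ((T s f \<eta> - f \<eta>) / s) (g \<eta>) < e / 3) \<and> (\<forall>\<eta>\<in>UNIV. dist (T s g \<eta>) (g \<eta>) < e / 3)"
    unfolding eventually_at_right_field by blast
  have q: "(T (r + s) f \<eta> - T r f \<eta>) / s = T r (\<lambda>\<eta>. (T s f \<eta> - f \<eta>) / s) \<eta>" if "0 \<le> r" "0 < s" for r s
  proof -
    have "(\<lambda>\<eta>. (T s f \<eta> - f \<eta>) / s) = (\<lambda>\<eta>. (1 / s) * T s f \<eta> + (- 1 / s) * f \<eta>)" by (auto simp: diff_divide_distrib)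
    then show ?thesis using lin[OF that(1) cc[OF _ f] f, of s "1 / s" "- 1 / s"] sg[OF that(1) _ f, of s] that
      by (simp add: diff_divide_distrib)
  qed
  have qc: "(\<lambda>\<eta>. (T s f \<eta> - f \<eta>) / s) \<in> cfg_cont" if "0 < s" for s
  proof -
    have "(\<lambda>\<eta>. (T s f \<eta> - f \<eta>) / s) = (\<lambda>\<eta>. (1 / s) * (T s f \<eta> - f \<eta>))" by auto
    moreover have "\<dots> \<in> cfg_cont" using cfg_cont_diff[OF cc[OF _ f, of s] f] that unfolding cfg_cont_def
      by (auto intro!: continuous_intros)
    ultimately show ?thesis by simp
  qed
  have main: "\<bar>(T (r + s) f \<eta> - T r f \<eta>) / s - T r g \<eta>\<bar> \<le> e / 3" if "0 \<le> r" "0 < s" "s < \<delta>" for r s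
    unfolding q[OF that(1,2)]
  proof (rule feller_contraction[OF T that(1) qc[OF that(2)] g])
    show "\<bar>(T s f \<eta> - f \<eta>) / s - g \<eta>\<bar> \<le> e / 3" for \<eta>
      using \<delta>(2)[OF that(2,3), THEN conjunct1, rule_format, of \<eta>] by (simp add: dist_real_def)
  qed
  have shift: "\<bar>T (r + s) g \<eta> - T r g \<eta>\<bar> \<le> e / 3" if "0 \<le> r" "0 < s" "s < \<delta>" for r s
    unfolding sg[OF that(1) less_imp_le[OF that(2)] g]
  proof (rule feller_contraction[OF T that(1) cc[OF less_imp_le[OF that(2)] g] g])
    show "\<bar>T s g \<eta> - g \<eta>\<bar> \<le> e / 3" for \<eta>
      using \<delta>(2)[OF that(2,3), THEN conjunct2, rule_format, of \<eta>] by (simp add: dist_real_def)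
  qed
  have "dist ((T y f \<eta> - T t f \<eta>) / (y - t)) (T t g \<eta>) < e" if y: "y \<in> {0..}" "y \<noteq> t" "dist y t < \<delta>" for y
  proof (cases "t < y")
    case True
    then show ?thesis using main[OF t, of "y - t"] y e by (simp add: dist_real_def)
  next
    case False
    then have *: "0 \<le> y" "0 < t - y" "t - y < \<delta>" using y by (auto simp: dist_real_def)
    have "(T y f \<eta> - T t f \<eta>) / (y - t) = (T t f \<eta> - T y f \<eta>) / (t - y)"
      using minus_divide_divide[of "T t f \<eta> - T y f \<eta>" "t - y"] by simp
    moreover have "\<bar>(T t f \<eta> - T y f \<eta>) / (t - y) - T t g \<eta>\<bar> \<le> e / 3 + e / 3"
      using main[OF *] shift[OF *] by (simp only: add.commute[of y] diff_add_cancel)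
    ultimately show ?thesis using e by (simp add: dist_real_def)
  qed
  then show "\<forall>\<^sub>F y in at t within {0..}. dist ((T y f \<eta> - T t f \<eta>) / (y - t)) (T t g \<eta>) < e"
    unfolding eventually_at using \<delta>(1) by blast
qed

context stirring_graph
begin

section \<open>Duality\<close>

lemma ind_cong: "(\<forall>x\<in>A. \<eta> x = b) \<longleftrightarrow> (\<forall>x\<in>B. \<zeta> x = b) \<Longrightarrow> ind b A \<eta> = ind b B \<zeta>"
  by (simp add: ind_def)

lemma ind_adopt: assumes "x \<in> A" shows "ind b A (\<eta>(x := \<eta> y)) = ind b (insert y (A - {x})) \<eta>"
proof (rule ind_cong)
  have "(\<forall>z\<in>A. (\<eta>(x := \<eta> y)) z = b) \<longleftrightarrow> (\<eta>(x := \<eta> y)) x = b \<and> (\<forall>z\<in>A - {x}. (\<eta>(x := \<eta> y)) z = b)"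
    using assms by blast
  then show "(\<forall>z\<in>A. (\<eta>(x := \<eta> y)) z = b) \<longleftrightarrow> (\<forall>z\<in>insert y (A - {x}). \<eta> z = b)" by simp
qed

text \<open>With both sites in \<open>A\<close> a swap does not affect the event; otherwise it acts
  on it like an adoption.\<close>

lemma ind_swap:
  fixes A :: "'v set"
  assumes "x \<in> A" "x \<noteq> y"
  shows "ind b A (\<eta>(x := \<eta> y, y := \<eta> x)) = ind b (if y \<in> A then A else insert y (A - {x})) \<eta>"
proof (rule ind_cong)
  let ?\<zeta> = "\<eta>(x := \<eta> y, y := \<eta> x)"
  have 1: "(\<forall>z\<in>A. \<zeta> z = b) \<longleftrightarrow> \<zeta> x = b \<and> (y \<in> A \<longrightarrow> \<zeta> y = b) \<and> (\<forall>z\<in>A - {x} - {y}. \<zeta> z = b)" for \<zeta> :: "'v \<Rightarrow> bool"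
    using assms(1) by blast
  have 2: "(\<forall>z\<in>insert y (A - {x}). \<zeta> z = b) \<longleftrightarrow> \<zeta> y = b \<and> (\<forall>z\<in>A - {x} - {y}. \<zeta> z = b)" for \<zeta> :: "'v \<Rightarrow> bool"
    by blast
  show "(\<forall>z\<in>A. ?\<zeta> z = b) \<longleftrightarrow> (\<forall>z\<in>if y \<in> A then A else insert y (A - {x}). \<eta> z = b)"
  proof (cases "y \<in> A")
    case True
    show ?thesis unfolding if_P[OF True] 1[of ?\<zeta>] 1[of \<eta>] using True assms(2) by (simp add: conj_left_commute)
  next
    case False
    show ?thesis unfolding if_not_P[OF False] 1[of ?\<zeta>] 2[of \<eta>] using False assms(2)
      by auto
  qed
qed

text \<open>For an edge leaving \<open>A\<close>, adoption and swap have the same effect on the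
  event, at total rate 1/d + v/d; for an edge inside \<open>A\<close> only adoption matters, at rate
  1/d. Dividing by 1+v gives \<open>\<rho>\<close> and the time change of the duality.\<close>

lemma gen_ind:
  assumes A: "finite A" and v: "0 < v" and \<theta>v: "\<theta> = 1 / (1 + v)"
  shows "voter_stir_gen E d v (ind b A) \<eta> =
    (\<Sum>m\<in>smoves A. (1 + v) * \<rho> A (snd m) * (ind b (insert (snd m) (A - {fst m})) \<eta> - ind b A \<eta>))"
proof -
  let ?f = "ind b A"
  define g where "g m = 1 / d * (?f (\<eta>(fst m := \<eta> (snd m))) - ?f \<eta>)" for m
  define s where "s m = v / (2 * d) * (?f (\<eta>(fst m := \<eta> (snd m), snd m := \<eta> (fst m))) - ?f \<eta>)" for m
  let ?\<Delta> = "\<lambda>m. ind b (insert (snd m) (A - {fst m})) \<eta> - ind b A \<eta>"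
  \<comment> \<open>The ordered pairs that start outside \<open>A\<close> and end in it. There
    adoption is invisible, and the swap supplies the second half of the rate v/d.\<close>
  let ?R = "prod.swap ` S1 A"
  have fin: "finite (S1 A)" "finite (S2 A)" using A by (auto simp: S1_def S2_def)
  have dis: "smoves A \<inter> ?R = {}" by (auto simp: smoves_def S1_def)
  have E1: "m \<in> {(x, y). E x y}" if "m \<in> smoves A \<union> ?R" for m
    using that nb_sym by (auto simp: smoves_def S1_def nb_def)
  have zero: "g m + s m = 0" if "m \<in> {(x, y). E x y}" "m \<notin> smoves A \<union> ?R" for m
  proof -
    obtain x y where m: "m = (x, y)" by (cases m)
    have "x \<notin> A" using that m by (auto simp: smoves_def nb_def)
    moreover have "y \<notin> A" using that m \<open>x \<notin> A\<close> reg
      by (auto simp: smoves_def S1_def nb_def regular_graph_def image_iff)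
    ultimately show ?thesis unfolding g_def s_def m by (auto simp: ind_def)
  qed
  have "voter_stir_gen E d v ?f \<eta> = (\<Sum>\<^sub>\<infinity>m\<in>{(x, y). E x y}. g m + s m)"
    unfolding voter_stir_gen_def g_def s_def by (intro infsum_cong) (simp add: case_prod_beta)
  also have "\<dots> = (\<Sum>\<^sub>\<infinity>m\<in>smoves A \<union> ?R. g m + s m)"
    by (rule infsum_cong_neutral) (use E1 zero in auto)
  also have "\<dots> = (\<Sum>m\<in>smoves A \<union> ?R. g m + s m)" using A fin by (intro infsum_finite) auto
  also have "\<dots> = (\<Sum>m\<in>smoves A. g m + s m) + (\<Sum>m\<in>?R. g m + s m)"
    using A fin dis by (intro sum.union_disjoint) auto
  also have "(\<Sum>m\<in>?R. g m + s m) = (\<Sum>m\<in>S1 A. s m)"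
  proof -
    have "(\<Sum>m\<in>?R. g m + s m) = (\<Sum>m\<in>S1 A. g (prod.swap m) + s (prod.swap m))"
      by (subst sum.reindex) (auto simp: o_def)
    also have "\<dots> = (\<Sum>m\<in>S1 A. s m)"
    proof (intro sum.cong refl)
      fix m assume "m \<in> S1 A"
      then have *: "snd m \<notin> A" "fst m \<noteq> snd m" by (auto simp: S1_def smoves_def)
      then have "g (prod.swap m) = 0" unfolding g_def by (auto simp: ind_def)
      moreover have "s (prod.swap m) = s m" using * unfolding s_def by (simp add: fun_upd_twist)
      ultimately show "g (prod.swap m) + s (prod.swap m) = s m" by simp
    qed
    finally show ?thesis .
  qed
  also have "(\<Sum>m\<in>smoves A. g m + s m) = (\<Sum>m\<in>S1 A. g m + s m) + (\<Sum>m\<in>S2 A. g m + s m)"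
    by (rule smoves_split[OF A])
  also have "(\<Sum>m\<in>S2 A. g m + s m) = (\<Sum>m\<in>S2 A. (1 + v) * \<rho> A (snd m) * ?\<Delta> m)"
  proof (intro sum.cong refl)
    fix m assume m: "m \<in> S2 A"
    then have *: "fst m \<in> A" "snd m \<in> A" "fst m \<noteq> snd m" by (auto simp: S2_def smoves_def)
    have "s m = 0" unfolding s_def ind_swap[OF *(1,3)] using * by simp
    moreover have "g m = 1 / d * ?\<Delta> m" unfolding g_def ind_adopt[OF *(1)] ..
    moreover have "(1 + v) * \<rho> A (snd m) = 1 / d"
    proof -
      have "(1 + v) * \<theta> = 1" unfolding \<theta>v using v by simp
      moreover have "(1 + v) * \<rho> A (snd m) = (1 + v) * \<theta> / d" using * by (simp add: \<rho>_def)
      ultimately show ?thesis by simp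
    qed
    ultimately show "g m + s m = (1 + v) * \<rho> A (snd m) * ?\<Delta> m" by simp
  qed
  finally have eq: "voter_stir_gen E d v ?f \<eta> = (\<Sum>m\<in>S1 A. g m + s m) + (\<Sum>m\<in>S2 A. (1 + v) * \<rho> A (snd m) * ?\<Delta> m) + (\<Sum>m\<in>S1 A. s m)" .
  have "(\<Sum>m\<in>S1 A. g m + s m) + (\<Sum>m\<in>S1 A. s m) = (\<Sum>m\<in>S1 A. (1 + v) * \<rho> A (snd m) * ?\<Delta> m)"
    unfolding sum.distrib[symmetric]
  proof (intro sum.cong refl)
    fix m assume m: "m \<in> S1 A"
    then have *: "fst m \<in> A" "snd m \<notin> A" "fst m \<noteq> snd m" by (auto simp: S1_def smoves_def)
    have "s m = v / (2 * d) * ?\<Delta> m" unfolding s_def ind_swap[OF *(1,3)] using * by simp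
    moreover have "g m = 1 / d * ?\<Delta> m" unfolding g_def ind_adopt[OF *(1)] ..
    moreover have "(1 + v) * \<rho> A (snd m) = 1 / d + v / (2 * d) + v / (2 * d)" using * d0 by (simp add: \<rho>_def field_simps)
    ultimately show "g m + s m + s m = (1 + v) * \<rho> A (snd m) * ?\<Delta> m" by (simp only: distrib_right)
  qed
  then show ?thesis unfolding eq smoves_split[OF A] by linarith
qed

text \<open>For fixed \<open>\<eta>\<close>, the left-hand side as a function of \<open>A\<close>
  is, after the time change, a bounded solution of the backward equation of the dual by
  \<open>gen_ind\<close>; uniqueness identifies it.\<close>

theorem duality:
  assumes T: "voter_stir_semigroup E d v T" and v: "0 < v" and \<theta>v: "\<theta> = 1 / (1 + v)"
    and A: "finite A" "card A \<le> n" and t: "0 \<le> t"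
  shows "T t (ind b A) \<eta> = sgrp (dualop n) ((1 + v) * t) (\<lambda>B. ind b B \<eta>) A"
proof -
  have F: "feller_semigroup T" and G: "\<And>f. cylinder_fun f \<Longrightarrow>
      uniform_limit UNIV (\<lambda>t \<eta>. (T t f \<eta> - f \<eta>) / t) (voter_stir_gen E d v f) (at_right 0)"
    using T[unfolded voter_stir_semigroup_def, THEN conjunct1] T[unfolded voter_stir_semigroup_def, THEN conjunct2, rule_format] .
  define ok where "ok B \<longleftrightarrow> finite B \<and> card B \<le> n" for B :: "'v set"
  \<comment> \<open>Beyond the cutoff \<open>u\<close> is frozen, to match \<open>dualop n\<close>,
    which is zero there.\<close>
  define u where "u \<tau> B = (if ok B then T (\<tau> / (1 + v)) (ind b B) \<eta> else ind b B \<eta>)" for \<tau> B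
  note T0 = feller_0[OF F]
  have ic: "ind b B \<in> cfg_cont" if "finite B" for B by (rule cylinder_cont[OF cylinder_ind[OF that]])
  have zero: "T t (\<lambda>_. 0) \<eta> = 0" if "0 \<le> t" for t
    using feller_sum[OF F that, of "{} :: nat set" "\<lambda>_ _. 0" "\<lambda>_. 0" \<eta>] by simp
  have zc: "(\<lambda>_. 0) \<in> cfg_cont" by (rule cylinder_cont[OF cylinder_const])
  have ub: "\<bar>u \<tau> B\<bar> \<le> 1" if "0 \<le> \<tau>" for \<tau> B
  proof (cases "ok B")
    case True
    have "\<bar>T (\<tau> / (1 + v)) (ind b B) \<eta> - T (\<tau> / (1 + v)) (\<lambda>_. 0) \<eta>\<bar> \<le> 1"
      using that v True ind_nonneg[of b B] ind_le_1[of b B] by (intro feller_contraction[OF F _ ic zc]) (auto simp: ok_def)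
    then show ?thesis using zero[of "\<tau> / (1 + v)"] that v True by (simp add: u_def)
  qed (simp add: u_def ind_nonneg ind_le_1)
  have "u \<tau> A = sgrp (dualop n) \<tau> (u 0) A" if "0 \<le> \<tau>" for \<tau>
  proof (rule sgrp_unique[OF jump_dualop _ _ that])
    show "\<bar>u \<tau> B\<bar> \<le> 1" if "0 \<le> \<tau>" for \<tau> B by (rule ub[OF that])
    show "((\<lambda>s. u s B) has_real_derivative dualop n (u \<tau>) B) (at \<tau> within {0..})" if \<tau>: "0 \<le> \<tau>" for \<tau> B
    proof (cases "ok B")
      case False
      then have *: "\<not> (finite B \<and> card B \<le> n)" by (simp add: ok_def)
      show ?thesis unfolding dualop_def if_not_P[OF *] unfolding u_def if_not_P[OF False] by simp
    next
      case True
      then have B: "finite B" "card B \<le> n" by (auto simp: ok_def)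
      let ?g = "voter_stir_gen E d v (ind b B)"
      let ?r = "\<lambda>m. (1 + v) * \<rho> B (snd m)"
      let ?N = "\<lambda>m. insert (snd m) (B - {fst m})"
      have gg: "?g = (\<lambda>\<eta>. \<Sum>m\<in>smoves B. ?r m * (ind b (?N m) \<eta> - ind b B \<eta>))"
        using gen_ind[OF B(1) v \<theta>v] by (intro ext)
      have cyl: "cylinder_fun (\<lambda>\<eta>. ind b (?N m) \<eta> - ind b B \<eta>)" for m
        using cylinder_fun_comb[OF cylinder_ind cylinder_ind, of "?N m" B "\<lambda>x y. x - y"] B by simp
      have gc: "?g \<in> cfg_cont" unfolding gg using B cyl by (intro cylinder_cont cylinder_sum) simp_all
      have t0: "0 \<le> \<tau> / (1 + v)" using \<tau> v by simp
      have "((\<lambda>t. T t (ind b B) \<eta>) has_real_derivative T (\<tau> / (1 + v)) ?g \<eta>) (at (\<tau> / (1 + v)) within {0..})"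
        by (rule feller_deriv[OF F ic[OF B(1)] gc G[OF cylinder_ind[OF B(1)]] t0])
      then have d1: "((\<lambda>t. T t (ind b B) \<eta>) has_real_derivative T (\<tau> / (1 + v)) ?g \<eta>) (at (\<tau> / (1 + v)) within (\<lambda>s. s / (1 + v)) ` {0..})"
        by (rule DERIV_subset) (use v in auto)
      have d2: "((\<lambda>s. s / (1 + v)) has_real_derivative 1 / (1 + v)) (at \<tau> within {0..})"
        using DERIV_cdivide[OF DERIV_ident, of "1 + v"] by simp
      have D: "((\<lambda>s. T (s / (1 + v)) (ind b B) \<eta>) has_real_derivative T (\<tau> / (1 + v)) ?g \<eta> * (1 / (1 + v))) (at \<tau> within {0..})"
        using DERIV_image_chain[OF d1 d2] unfolding o_def .
      have "T (\<tau> / (1 + v)) ?g \<eta> = (\<Sum>m\<in>smoves B. ?r m * T (\<tau> / (1 + v)) (\<lambda>\<eta>. ind b (?N m) \<eta> - ind b B \<eta>) \<eta>)"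
        unfolding gg using B cyl by (intro feller_sum[OF F t0]) simp_all
      also have "\<dots> = (\<Sum>m\<in>smoves B. ?r m * (u \<tau> (?N m) - u \<tau> B))"
      proof (intro sum.cong refl)
        fix m assume m: "m \<in> smoves B"
        have okN: "ok (?N m)" using card_move_le[of B "fst m" "snd m"] m B by (auto simp: ok_def smoves_def)
        have "T (\<tau> / (1 + v)) (\<lambda>\<eta>. 1 * ind b (?N m) \<eta> + (-1) * ind b B \<eta>) = (\<lambda>\<eta>. 1 * T (\<tau> / (1 + v)) (ind b (?N m)) \<eta> + (-1) * T (\<tau> / (1 + v)) (ind b B) \<eta>)"
          using B by (intro feller_lin[OF F t0] ic) simp_all
        from fun_cong[OF this, of \<eta>]
        have "T (\<tau> / (1 + v)) (\<lambda>\<eta>. ind b (?N m) \<eta> - ind b B \<eta>) \<eta> = u \<tau> (?N m) - u \<tau> B"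
          using okN True by (simp add: u_def)
        then show "?r m * T (\<tau> / (1 + v)) (\<lambda>\<eta>. ind b (?N m) \<eta> - ind b B \<eta>) \<eta> = ?r m * (u \<tau> (?N m) - u \<tau> B)" by simp
      qed
      also have "\<dots> = (1 + v) * dualop n (u \<tau>) B" using B by (simp add: dualop_def sum_distrib_left mult_ac)
      finally have "T (\<tau> / (1 + v)) ?g \<eta> * (1 / (1 + v)) = dualop n (u \<tau>) B" using v by simp
      with D show ?thesis using True by (simp add: u_def)
    qed
  qed
  moreover have "u 0 = (\<lambda>B. ind b B \<eta>)" unfolding u_def ok_def using T0[OF ic] by (simp cong: if_cong)
  ultimately have "u ((1 + v) * t) A = sgrp (dualop n) ((1 + v) * t) (\<lambda>B. ind b B \<eta>) A" using t v by simp
  moreover have "(1 + v) * t / (1 + v) = t" using v by simp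
  ultimately show ?thesis using A by (simp add: u_def ok_def)
qed

end

section \<open>Sample paths of the random walk\<close>

lemma prob_Exp: "prob_space (density lborel (\<lambda>x. ennreal (exponential_density 1 x)))"
  using prob_space_exponential_density[of 1] by simp

abbreviation Exp1 :: "real measure" where "Exp1 \<equiv> density lborel (\<lambda>x. ennreal (exponential_density 1 x))"

lemma prob_step: assumes "0 < d" shows "prob_space (step_space d)"
proof -
  interpret P: prob_space Exp1 by (rule prob_Exp)
  interpret Q: prob_space "measure_pmf (pmf_of_set {..<d})" by (rule measure_pmf.prob_space_axioms)
  interpret PP: pair_prob_space "measure_pmf (pmf_of_set {..<d})" Exp1 ..
  show ?thesis unfolding step_space_def by (rule PP.prob_space_axioms)
qed

lemma Exp1_integral:
  assumes [measurable]: "f \<in> borel_measurable borel"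
  shows "(\<integral>h. f h \<partial>Exp1) = (\<integral>h. exponential_density 1 h * f h \<partial>lborel)"
  by (subst integral_density) (auto simp: exponential_density_nonneg)

lemma Exp1_pos: "AE h in Exp1. 0 < h"
  by (subst AE_density) (use AE_lborel_singleton[of 0] in \<open>auto simp: exponential_density_def elim!: eventually_mono\<close>)

text \<open>Substitute h = s + u: on the event h > s the density factors into exp(-s) and the
  density at u.\<close>

lemma Exp1_memoryless:
  assumes [measurable]: "f \<in> borel_measurable borel" and s: "0 \<le> s"
  shows "(\<integral>h. indicator {s<..} h * f (h - s) \<partial>Exp1) = exp (- s) * (\<integral>h. f h \<partial>Exp1)"
proof -
  have "(\<integral>h. indicator {s<..} h * f (h - s) \<partial>Exp1) = (\<integral>h. exponential_density 1 h * (indicator {s<..} h * f (h - s)) \<partial>lborel)"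
    by (rule Exp1_integral) measurable
  also have "\<dots> = (\<integral>u. exponential_density 1 (s + 1 * u) * (indicator {s<..} (s + 1 * u) * f (s + 1 * u - s)) \<partial>lborel)"
    by (subst lborel_integral_real_affine[of 1 _ s]) simp_all
  also have "\<dots> = (\<integral>u. exp (- s) * (exponential_density 1 u * f u) \<partial>lborel)"
  proof (rule integral_cong_AE)
    show "AE u in lborel. exponential_density 1 (s + 1 * u) * (indicator {s<..} (s + 1 * u) * f (s + 1 * u - s)) = exp (- s) * (exponential_density 1 u * f u)"
      using AE_lborel_singleton[of 0]
    proof eventually_elim
      case (elim u)
      then show ?case using s by (cases "0 < u") (auto simp: exponential_density_def exp_add[symmetric] exp_diff exp_minus field_simps)
    qed
  qed measurable
  also have "\<dots> = exp (- s) * (\<integral>h. f h \<partial>Exp1)" by (simp add: Exp1_integral)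
  finally show ?thesis .
qed

lemma Exp1_le: assumes "0 \<le> s" shows "measure Exp1 {..s} = 1 - exp (- s)"
proof -
  interpret prob_space Exp1 by (rule prob_Exp)
  have "(\<integral>h. indicator {s<..} h * 1 \<partial>Exp1) = exp (- s) * (\<integral>h. 1 \<partial>Exp1)"
    by (rule Exp1_memoryless[OF _ assms]) simp
  then have "measure Exp1 {s<..} = exp (- s)" by (simp add: prob_space[simplified])
  moreover have "measure Exp1 (space Exp1 - {s<..}) = 1 - measure Exp1 {s<..}" by (rule prob_compl) simp
  moreover have "space Exp1 - {s<..} = {..s}" by auto
  ultimately show ?thesis by simp
qed

lemma step_integral:
  fixes F :: "nat \<times> real \<Rightarrow> real"
  assumes d: "0 < d" and F[measurable]: "F \<in> borel_measurable (step_space d)" and C: "\<And>s. \<bar>F s\<bar> \<le> C"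
  shows "(\<integral>s. F s \<partial>step_space d) = (\<Sum>i<d. \<integral>h. F (i, h) \<partial>Exp1) / d"
proof -
  interpret P: prob_space Exp1 by (rule prob_Exp)
  interpret Q: prob_space "measure_pmf (pmf_of_set {..<d})" by (rule measure_pmf.prob_space_axioms)
  interpret PP: pair_prob_space "measure_pmf (pmf_of_set {..<d})" Exp1 ..
  interpret S: prob_space "step_space d" by (rule prob_step[OF d])
  have "integrable (step_space d) F" by (rule S.integrable_const_bound[where B = C]) (use C in auto)
  then have "integrable (measure_pmf (pmf_of_set {..<d}) \<Otimes>\<^sub>M Exp1) F" unfolding step_space_def .
  from PP.integral_fst'[OF this]
  have "(\<integral>s. F s \<partial>step_space d) = (\<integral>i. \<integral>h. F (i, h) \<partial>Exp1 \<partial>measure_pmf (pmf_of_set {..<d}))"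
    unfolding step_space_def by simp
  also have "\<dots> = (\<Sum>i<d. \<integral>h. F (i, h) \<partial>Exp1) / d"
    using d by (subst integral_pmf_of_set) auto
  finally show ?thesis .
qed

lemma rw_prob: assumes "0 < d" shows "prob_space (rw_space d)"
proof -
  interpret product_prob_space "\<lambda>_. step_space d" "UNIV :: nat set"
    using prob_step[OF assms] by (intro product_prob_spaceI)
  show ?thesis unfolding rw_space_def by unfold_locales
qed

section \<open>First-step decomposition and non-explosion\<close>

lemma rw_cons_measurable[measurable]:
  "(\<lambda>(s, \<omega>). case_nat s \<omega>) \<in> measurable (step_space d \<Otimes>\<^sub>M rw_space d) (rw_space d)"
  unfolding rw_space_def by measurable

lemma rw_first_step:
  fixes F :: "(nat \<Rightarrow> nat \<times> real) \<Rightarrow> real"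
  assumes d: "0 < d" and F[measurable]: "F \<in> borel_measurable (rw_space d)" and C: "\<And>s. \<bar>F s\<bar> \<le> C"
  shows "(\<integral>\<omega>. F \<omega> \<partial>rw_space d) = (\<integral>s. (\<integral>\<omega>. F (case_nat s \<omega>) \<partial>rw_space d) \<partial>step_space d)"
proof -
  interpret S: prob_space "step_space d" by (rule prob_step[OF d])
  interpret R: prob_space "rw_space d" by (rule rw_prob[OF d])
  interpret SR: pair_prob_space "step_space d" "rw_space d" ..
  interpret sequence_space "step_space d"
    unfolding sequence_space_def using prob_step[OF d] by (intro product_prob_spaceI)
  have eq: "distr (step_space d \<Otimes>\<^sub>M rw_space d) (rw_space d) (\<lambda>(s, \<omega>). case_nat s \<omega>) = rw_space d"
    using PiM_iter unfolding rw_space_def .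
  have "(\<integral>\<omega>. F \<omega> \<partial>rw_space d) = (\<integral>\<omega>. F \<omega> \<partial>distr (step_space d \<Otimes>\<^sub>M rw_space d) (rw_space d) (\<lambda>(s, \<omega>). case_nat s \<omega>))"
    unfolding eq ..
  also have "\<dots> = (\<integral>p. F (case_prod case_nat p) \<partial>(step_space d \<Otimes>\<^sub>M rw_space d))"
    by (rule integral_distr) measurable
  also have "\<dots> = (\<integral>s. (\<integral>\<omega>. F (case_nat s \<omega>) \<partial>rw_space d) \<partial>step_space d)"
  proof -
    have "integrable (step_space d \<Otimes>\<^sub>M rw_space d) (\<lambda>p. F (case_prod case_nat p))"
      by (rule SR.integrable_const_bound[where B = C]) (use C in auto)
    from SR.integral_fst'[OF this] show ?thesis by simp
  qed
  finally show ?thesis .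
qed

text \<open>The almost sure properties that make \<open>jump_count\<close> the size of a finite set
  and zero at time 0.\<close>

definition rw_good :: "(nat \<Rightarrow> nat \<times> real) \<Rightarrow> bool" where
  "rw_good \<omega> \<longleftrightarrow> (\<forall>k. 0 < snd (\<omega> k)) \<and> filterlim (\<lambda>n. \<Sum>k<n. snd (\<omega> k)) at_top sequentially"

lemma rw_coord_measurable[measurable]: "(\<lambda>\<omega>. \<omega> k) \<in> measurable (rw_space d) (step_space d)"
  unfolding rw_space_def by measurable

lemma step_snd_measurable[measurable]: "snd \<in> borel_measurable (step_space d)"
  unfolding step_space_def by measurable

lemma step_fst_measurable[measurable]: "fst \<in> measurable (step_space d) (count_space UNIV)"
proof -
  have "fst \<in> measurable (step_space d) (measure_pmf (pmf_of_set {..<d}))" unfolding step_space_def by measurable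
  then show ?thesis by (simp cong: measurable_cong_sets)
qed

lemma rw_coord_distr: assumes "0 < d" shows "distr (rw_space d) (step_space d) (\<lambda>\<omega>. \<omega> k) = step_space d"
proof -
  interpret product_prob_space "\<lambda>_. step_space d" "UNIV :: nat set"
    using prob_step[OF assms] by (intro product_prob_spaceI)
  show ?thesis unfolding rw_space_def using PiM_component[of k] by simp
qed

lemma step_snd_pos: assumes "0 < d" shows "AE s in step_space d. 0 < snd s"
proof -
  interpret P: prob_space Exp1 by (rule prob_Exp)
  interpret Q: prob_space "measure_pmf (pmf_of_set {..<d})" by (rule measure_pmf.prob_space_axioms)
  interpret PP: pair_prob_space "measure_pmf (pmf_of_set {..<d})" Exp1 ..
  show ?thesis unfolding step_space_def
    by (rule PP.AE_pair_measure) (use Exp1_pos in auto)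
qed

lemma rw_snd_pos: assumes "0 < d" shows "AE \<omega> in rw_space d. \<forall>k. 0 < snd (\<omega> k)"
  unfolding AE_all_countable
proof
  fix k
  have "AE s in distr (rw_space d) (step_space d) (\<lambda>\<omega>. \<omega> k). 0 < snd s"
    unfolding rw_coord_distr[OF assms] by (rule step_snd_pos[OF assms])
  then show "AE \<omega> in rw_space d. 0 < snd (\<omega> k)"
    by (subst (asm) AE_distr_iff) measurable
qed

text \<open>The expectation of exp of minus the n-th partial sum is c^n with c < 1. These variables
  are therefore almost surely summable over n, hence tend to zero, and the partial sums
  diverge.\<close>

lemma rw_sums_at_top: assumes d: "0 < d"
  shows "AE \<omega> in rw_space d. filterlim (\<lambda>n. \<Sum>k<n. snd (\<omega> k)) at_top sequentially"
proof -
  interpret S: prob_space "step_space d" by (rule prob_step[OF d])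
  interpret R: prob_space "rw_space d" by (rule rw_prob[OF d])
  \<comment> \<open>\<open>max 0\<close> bounds \<open>u\<close> by 1 everywhere, as holding times
    are positive only almost surely.\<close>
  define u where "u s = exp (- max 0 s)" for s :: real
  have [measurable]: "u \<in> borel_measurable borel" unfolding u_def by measurable
  have u: "0 \<le> u s" "u s \<le> 1" for s by (auto simp: u_def)
  define c where "c = (\<integral>s. u (snd s) \<partial>step_space d)"
  have iu: "integrable (step_space d) (\<lambda>s. u (snd s))"
    by (rule S.integrable_const_bound[where B = 1]) (use u in auto)
  have c0: "0 \<le> c" unfolding c_def using u by (intro Bochner_Integration.integral_nonneg) auto
  have c1: "c < 1"
  proof -
    have "c < (\<integral>s. 1 \<partial>step_space d)" unfolding c_def
    proof (rule S.integral_less_AE_space)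
      show "integrable (step_space d) (\<lambda>s. u (snd s))" by (rule iu)
      show "AE s in step_space d. u (snd s) < 1" using step_snd_pos[OF d] by eventually_elim (simp add: u_def)
    qed (simp_all add: S.emeasure_space_1)
    then show ?thesis using S.prob_space by simp
  qed
  define q where "q n \<omega> = (\<Prod>k<n. u (snd (\<omega> k)))" for n and \<omega> :: "nat \<Rightarrow> nat \<times> real"
  have [measurable]: "q n \<in> borel_measurable (rw_space d)" for n unfolding q_def[abs_def] by measurable
  have q01: "0 \<le> q n \<omega>" "q n \<omega> \<le> 1" for n \<omega> unfolding q_def using u by (auto intro!: prod_nonneg prod_le_1)
  have iq: "integrable (rw_space d) (q n)" for n by (rule R.integrable_const_bound[where B = 1]) (use q01 in auto)
  have Eq: "(\<integral>\<omega>. q n \<omega> \<partial>rw_space d) = c ^ n" for n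
  proof (induction n)
    case 0 then show ?case using R.prob_space by (simp add: q_def)
  next
    case (Suc n)
    have "(\<integral>\<omega>. q (Suc n) \<omega> \<partial>rw_space d) = (\<integral>s. (\<integral>\<omega>. q (Suc n) (case_nat s \<omega>) \<partial>rw_space d) \<partial>step_space d)"
      by (rule rw_first_step[OF d, where C = 1]) (use q01 in auto)
    also have "q (Suc n) (case_nat s \<omega>) = u (snd s) * q n \<omega>" for s \<omega>
      unfolding q_def prod.lessThan_Suc_shift by simp
    then have "(\<integral>s. (\<integral>\<omega>. q (Suc n) (case_nat s \<omega>) \<partial>rw_space d) \<partial>step_space d) = (\<integral>s. u (snd s) * c ^ n \<partial>step_space d)"
      using Suc by simp
    also have "\<dots> = c * c ^ n" unfolding c_def by simp
    finally show ?case by simp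
  qed
  have "AE \<omega> in rw_space d. (\<Sum>n. ennreal (q n \<omega>)) \<noteq> \<infinity>"
  proof (rule nn_integral_PInf_AE)
    have "(\<integral>\<^sup>+\<omega>. (\<Sum>n. ennreal (q n \<omega>)) \<partial>rw_space d) = (\<Sum>n. \<integral>\<^sup>+\<omega>. ennreal (q n \<omega>) \<partial>rw_space d)"
      by (rule nn_integral_suminf) measurable
    also have "\<dots> = (\<Sum>n. ennreal (c ^ n))"
      using iq q01 Eq by (simp add: nn_integral_eq_integral)
    also have "\<dots> = ennreal (\<Sum>n. c ^ n)" using c0 c1 by (intro suminf_ennreal2) (auto intro: summable_geometric)
    finally show "(\<integral>\<^sup>+\<omega>. (\<Sum>n. ennreal (q n \<omega>)) \<partial>rw_space d) \<noteq> \<infinity>" by simp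
  qed measurable
  then show ?thesis using rw_snd_pos[OF d]
  proof eventually_elim
    case (elim \<omega>)
    have "summable (\<lambda>n. q n \<omega>)" using elim(1) q01 by (intro summable_suminf_not_top) auto
    then have "(\<lambda>n. q n \<omega>) \<longlonglongrightarrow> 0" by (rule summable_LIMSEQ_zero)
    moreover have "q n \<omega> = exp (- (\<Sum>k<n. snd (\<omega> k)))" for n
      using elim(2) by (simp add: q_def u_def max_def exp_sum[symmetric] sum_negf less_imp_le)
    ultimately have "filterlim (\<lambda>n. exp (- (\<Sum>k<n. snd (\<omega> k)))) (at_right 0) sequentially"
      by (auto simp: filterlim_at)
    then have "filterlim (\<lambda>n. ln (exp (- (\<Sum>k<n. snd (\<omega> k))))) at_bot sequentially"
      by (rule filterlim_compose[OF ln_at_0])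
    then show ?case by (simp add: filterlim_uminus_at_top)
  qed
qed

lemma rw_good_AE: assumes "0 < d" shows "AE \<omega> in rw_space d. rw_good \<omega>"
  using rw_snd_pos[OF assms] rw_sums_at_top[OF assms] by eventually_elim (simp add: rw_good_def)

section \<open>Paths before and after the first jump\<close>

lemma rw_good_finite: assumes "rw_good \<omega>" shows "finite {n. (\<Sum>k<n. snd (\<omega> k)) \<le> t}"
proof -
  obtain N where N: "\<And>n. N \<le> n \<Longrightarrow> t < (\<Sum>k<n. snd (\<omega> k))"
    using assms unfolding rw_good_def filterlim_at_top_dense eventually_sequentially by blast
  have "{n. (\<Sum>k<n. snd (\<omega> k)) \<le> t} \<subseteq> {..<N}" using N by (auto simp: not_less[symmetric])
  then show ?thesis by (rule finite_subset) simp
qed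

lemma sum_case_nat: "(\<Sum>k<Suc n. snd (case_nat s \<omega> k)) = snd s + (\<Sum>k<n. snd (\<omega> k))"
  by (simp add: sum.lessThan_Suc_shift del: sum.lessThan_Suc)

lemma jump_set_case_nat: "{n. 1 \<le> n \<and> (\<Sum>k<n. snd (case_nat s \<omega> k)) \<le> t} = Suc ` {n. snd s + (\<Sum>k<n. snd (\<omega> k)) \<le> t}"
proof (intro set_eqI iffI)
  fix n assume "n \<in> {n. 1 \<le> n \<and> (\<Sum>k<n. snd (case_nat s \<omega> k)) \<le> t}"
  then obtain m where "n = Suc m" "(\<Sum>k<Suc m. snd (case_nat s \<omega> k)) \<le> t" by (cases n) auto
  then show "n \<in> Suc ` {n. snd s + (\<Sum>k<n. snd (\<omega> k)) \<le> t}" unfolding sum_case_nat by auto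
next
  fix n assume "n \<in> Suc ` {n. snd s + (\<Sum>k<n. snd (\<omega> k)) \<le> t}"
  then obtain m where "n = Suc m" "snd s + (\<Sum>k<m. snd (\<omega> k)) \<le> t" by auto
  then show "n \<in> {n. 1 \<le> n \<and> (\<Sum>k<n. snd (case_nat s \<omega> k)) \<le> t}" using sum_case_nat[of s \<omega> m] by simp
qed

lemma jump_count_case_nat: "jump_count (case_nat s \<omega>) t = card {n. snd s + (\<Sum>k<n. snd (\<omega> k)) \<le> t}"
  unfolding jump_count_def jump_set_case_nat by (simp add: card_image)

lemma jump_chain_case_nat: "jump_chain E d x (case_nat s \<omega>) (Suc n) = jump_chain E d (nbr E d x (fst s)) \<omega> n"
  by (induction n) auto

lemma jump_chain_indep: "jump_chain E d x (case_nat (i, h) \<omega>) n = jump_chain E d x (case_nat (i, h') \<omega>) n"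
  by (cases n) (simp_all add: jump_chain_case_nat del: jump_chain.simps(2))

text \<open>Time enters only through comparison with partial sums, so advancing the clock by
  \<open>s\<close> amounts to shortening the first holding time by \<open>s\<close>, also when the
  remainder is negative.\<close>

lemma ctsrw_shift: "ctsrw E d x (case_nat (i, h) \<omega>) (s + t) = ctsrw E d x (case_nat (i, h - s) \<omega>) t"
proof -
  have "jump_count (case_nat (i, h) \<omega>) (s + t) = jump_count (case_nat (i, h - s) \<omega>) t"
    unfolding jump_count_case_nat by (simp add: algebra_simps)
  then show ?thesis unfolding ctsrw_def using jump_chain_indep[of E d x i h \<omega> _ "h - s"] by simp
qed

text \<open>Jumps are counted by \<open>card\<close>, so finiteness of the count, granted by
  \<open>rw_good\<close>, is what lets the first jump add exactly one.\<close>

lemma ctsrw_after: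
  assumes g: "rw_good \<omega>" and "h \<le> t"
  shows "ctsrw E d x (case_nat (i, h) \<omega>) t = ctsrw E d (nbr E d x i) \<omega> (t - h)"
proof -
  let ?S = "\<lambda>n. \<Sum>k<n. snd (\<omega> k)"
  have "{n. h + ?S n \<le> t} = insert 0 {n. 1 \<le> n \<and> ?S n \<le> t - h}"
  proof (intro set_eqI)
    fix n show "n \<in> {n. h + ?S n \<le> t} \<longleftrightarrow> n \<in> insert 0 {n. 1 \<le> n \<and> ?S n \<le> t - h}"
      using assms(2) by (cases n) auto
  qed
  moreover have "finite {n. 1 \<le> n \<and> ?S n \<le> t - h}"
    by (rule finite_subset[OF _ rw_good_finite[OF g, of "t - h"]]) auto
  ultimately have "jump_count (case_nat (i, h) \<omega>) t = Suc (jump_count \<omega> (t - h))"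
    unfolding jump_count_case_nat unfolding jump_count_def by simp
  then show ?thesis unfolding ctsrw_def by (simp add: jump_chain_case_nat del: jump_chain.simps(2))
qed

lemma ctsrw_0: assumes "rw_good \<omega>" shows "ctsrw E d x \<omega> 0 = x"
proof -
  have "0 < (\<Sum>k<n. snd (\<omega> k))" if "1 \<le> n" for n
    using assms that unfolding rw_good_def by (intro sum_pos) (auto simp: lessThan_empty_iff)
  then have "\<not> (1 \<le> n \<and> (\<Sum>k<n. snd (\<omega> k)) \<le> 0)" for n by (meson not_le)
  then have "{n. 1 \<le> n \<and> (\<Sum>k<n. snd (\<omega> k)) \<le> 0} = {}" by blast
  then have "jump_count \<omega> 0 = 0" unfolding jump_count_def by (metis card.empty)
  then show ?thesis unfolding ctsrw_def by simp
qed


lemma (in prob_space) abs_expectation_le: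
  fixes f :: "'a \<Rightarrow> real"
  assumes "\<And>x. \<bar>f x\<bar> \<le> C" shows "\<bar>expectation f\<bar> \<le> C"
proof (cases "integrable M f")
  case True
  have "\<bar>expectation f\<bar> \<le> expectation (\<lambda>x. \<bar>f x\<bar>)" by (rule integral_abs_bound)
  also have "\<dots> \<le> expectation (\<lambda>_. C)" using True assms by (intro integral_mono) auto
  finally show ?thesis by (simp add: prob_space)
next
  case False
  then show ?thesis using assms[of undefined] by (simp add: not_integrable_integral_eq)
qed

lemma rw_inner_measurable:
  fixes F :: "(nat \<Rightarrow> nat \<times> real) \<Rightarrow> real"
  assumes [measurable]: "F \<in> borel_measurable (rw_space d)" and d: "0 < d"
  shows "(\<lambda>s. \<integral>\<omega>. F (case_nat s \<omega>) \<partial>rw_space d) \<in> borel_measurable (step_space d)"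
    "(\<lambda>h. \<integral>\<omega>. F (case_nat (i, h) \<omega>) \<partial>rw_space d) \<in> borel_measurable (borel :: real measure)"
proof -
  interpret R: prob_space "rw_space d" by (rule rw_prob[OF d])
  have "(\<lambda>p. F (case_prod case_nat p)) \<in> borel_measurable (step_space d \<Otimes>\<^sub>M rw_space d)" by measurable
  then have "(\<lambda>(s, \<omega>). F (case_nat s \<omega>)) \<in> borel_measurable (step_space d \<Otimes>\<^sub>M rw_space d)"
    by (simp add: case_prod_beta)
  from R.borel_measurable_lebesgue_integral[OF this]
  show 1: "(\<lambda>s. \<integral>\<omega>. F (case_nat s \<omega>) \<partial>rw_space d) \<in> borel_measurable (step_space d)" .
  have "(\<lambda>h. (i, h)) \<in> measurable (borel :: real measure) (step_space d)"
    unfolding step_space_def by measurable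
  from measurable_compose[OF this 1]
  show "(\<lambda>h. \<integral>\<omega>. F (case_nat (i, h) \<omega>) \<partial>rw_space d) \<in> borel_measurable (borel :: real measure)" .
qed

lemma rw_first_step':
  fixes F :: "(nat \<Rightarrow> nat \<times> real) \<Rightarrow> real"
  assumes d: "0 < d" and F: "F \<in> borel_measurable (rw_space d)" and C: "\<And>s. \<bar>F s\<bar> \<le> C"
  shows "(\<integral>\<omega>. F \<omega> \<partial>rw_space d) = (\<Sum>i<d. \<integral>h. (\<integral>\<omega>. F (case_nat (i, h) \<omega>) \<partial>rw_space d) \<partial>Exp1) / d"
  unfolding rw_first_step[OF d F C]
proof (rule step_integral[OF d rw_inner_measurable(1)[OF F d]])
  interpret R: prob_space "rw_space d" by (rule rw_prob[OF d])
  show "\<bar>\<integral>\<omega>. F (case_nat s \<omega>) \<partial>rw_space d\<bar> \<le> C" for s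
    by (rule R.abs_expectation_le[OF C])
qed

abbreviation path_space :: "(nat \<Rightarrow> 'v) measure" where
  "path_space \<equiv> PiM UNIV (\<lambda>_. count_space UNIV)"

context stirring_graph
begin

section \<open>Markov property of the walk\<close>

lemma d_pos: "0 < d" using d2 by simp

text \<open>Balls around a vertex are finite and, by connectedness, exhaust the graph.\<close>

lemma countable_V: "countable (UNIV :: 'v set)"
proof -
  fix x0 :: 'v
  define B where "B n = ((\<lambda>S. S \<union> (\<Union>x\<in>S. nb x)) ^^ n) {x0}" for n
  have fin: "finite (B n)" for n by (induction n) (auto simp: B_def)
  have "\<exists>n. y \<in> B n" if "E\<^sup>*\<^sup>* x0 y" for y
    using that
  proof induction
    case base show ?case by (rule exI[of _ 0]) (simp add: B_def)
  next
    case (step y z)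
    then obtain n where "y \<in> B n" by auto
    then have "z \<in> B (Suc n)" using step(2) by (auto simp: B_def nb_def)
    then show ?case by blast
  qed
  then have "UNIV = (\<Union>n. B n)" using conn unfolding connected_graph_def by auto
  moreover have "countable (\<Union>n. B n)" using fin by (intro countable_UN) (auto intro: countable_finite)
  ultimately show ?thesis by simp
qed

lemma nbr_bij: "bij_betw (nbr E d x) {..<d} (nb x)"
proof -
  have "\<exists>g. bij_betw g {..<d} {y. E x y}"
    using ex_bij_betw_nat_finite[OF nb_fin, of x] unfolding nb_card atLeast0LessThan by (simp add: nb_def)
  then show ?thesis unfolding nbr_def nb_def by (rule someI_ex)
qed

lemma rwop_nbr: "rwop \<phi> x = (\<Sum>i<d. \<phi> (nbr E d x i)) / d - \<phi> x"
proof -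
  have "rwop \<phi> x = (\<Sum>y\<in>nb x. \<phi> y) / d - \<phi> x"
    using d0 by (simp add: rwop_def sum_subtractf diff_divide_distrib sum_divide_distrib)
  also have "(\<Sum>y\<in>nb x. \<phi> y) = (\<Sum>i<d. \<phi> (nbr E d x i))"
    by (rule sum.reindex_bij_betw[OF nbr_bij, symmetric])
  finally show ?thesis .
qed

lemma jump_chain_measurable[measurable]:
  "(\<lambda>\<omega>. jump_chain E d x \<omega> n) \<in> measurable (rw_space d) (count_space UNIV)"
proof (induction n)
  case (Suc n)
  have "(\<lambda>\<omega>. nbr E d y (fst (\<omega> n))) \<in> measurable (rw_space d) (count_space UNIV)" for y by measurable
  then have "(\<lambda>\<omega>. nbr E d (jump_chain E d x \<omega> n) (fst (\<omega> n))) \<in> measurable (rw_space d) (count_space UNIV)"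
    by (rule measurable_compose_countable'[OF _ Suc countable_V])
  then show ?case by simp
qed simp

lemma jump_count_measurable[measurable]:
  "(\<lambda>\<omega>. jump_count \<omega> t) \<in> measurable (rw_space d) (count_space UNIV)"
  unfolding jump_count_def by measurable

lemma ctsrw_measurable[measurable]:
  "(\<lambda>\<omega>. ctsrw E d x \<omega> t) \<in> measurable (rw_space d) (count_space UNIV)"
  unfolding ctsrw_def
  by (rule measurable_compose_countable'[OF jump_chain_measurable jump_count_measurable]) simp

lemma path_measurable[measurable]:
  "(\<lambda>\<omega> j. ctsrw E d x \<omega> (\<tau> j)) \<in> measurable (rw_space d) (path_space :: (nat \<Rightarrow> 'v) measure)"
  by (rule measurable_PiM_single') (auto simp: space_PiM)

text \<open>Conditioning on the first jump, read off from the series: the neighbour average is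
  \<open>rwop\<close> plus the identity, so exp(-h) times this average at time s-h is the derivative
  in h of -exp(-h) times the value at \<open>x\<close>.\<close>

lemma rw_renewal:
  assumes a: "bnd C a" and s: "0 \<le> s"
  shows "sgrp rwop s a x = exp (- s) * a x + (\<Sum>i<d. \<integral>h. indicator {..s} h * sgrp rwop (s - h) a (nbr E d x i) \<partial>Exp1) / d"
proof -
  let ?p = "\<lambda>s. sgrp rwop s a"
  have cont: "continuous_on UNIV (\<lambda>h. ?p (s - h) y)" for y
  proof -
    have "continuous_on UNIV (\<lambda>t. ?p t y)"
      by (rule DERIV_continuous_on[where D = "\<lambda>t. sgrp rwop t (rwop a) y"]) (rule sgrp_deriv[OF jump_rwop a])
    then show ?thesis by (rule continuous_on_compose2) (auto intro!: continuous_intros)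
  qed
  then have [measurable]: "(\<lambda>h. ?p (s - h) y) \<in> borel_measurable borel" for y by (rule borel_measurable_continuous_onI)
  let ?q = "\<lambda>h. (\<Sum>i<d. ?p (s - h) (nbr E d x i)) / d"
  have q: "?q h = rwop (?p (s - h)) x + ?p (s - h) x" for h unfolding rwop_nbr by simp
  interpret P: prob_space Exp1 by (rule prob_Exp)
  have bp: "\<bar>?p (s - h) y\<bar> \<le> C" if "h \<le> s" for h y using bndD[OF sgrp_bnd[OF jump_rwop a]] that by simp
  have int: "integrable Exp1 (\<lambda>h. indicator {..s} h * ?p (s - h) y)" for y
    by (rule P.integrable_const_bound[where B = C]) (use bp bnd_nonneg[OF a] in \<open>auto simp: indicator_def\<close>)
  have "(\<Sum>i<d. \<integral>h. indicator {..s} h * ?p (s - h) (nbr E d x i) \<partial>Exp1) / d = (\<integral>h. indicator {..s} h * ?q h \<partial>Exp1)"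
  proof -
    have "(\<integral>h. indicator {..s} h * ?q h \<partial>Exp1) = (\<integral>h. (\<Sum>i<d. indicator {..s} h * ?p (s - h) (nbr E d x i)) / d \<partial>Exp1)"
      by (simp add: sum_distrib_left)
    also have "\<dots> = (\<Sum>i<d. \<integral>h. indicator {..s} h * ?p (s - h) (nbr E d x i) \<partial>Exp1) / d"
      using int by (subst integral_divide_zero, subst Bochner_Integration.integral_sum) auto
    finally show ?thesis by (rule sym)
  qed
  also have "\<dots> = (\<integral>h. exponential_density 1 h * (indicator {..s} h * ?q h) \<partial>lborel)"
    by (rule Exp1_integral) measurable
  also have "\<dots> = (\<integral>h. (exp (- h) * ?q h) * indicator {0..s} h \<partial>lborel)"
    by (rule Bochner_Integration.integral_cong[OF refl]) (auto simp: exponential_density_def indicator_def)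
  also have "\<dots> = (- exp (- s) * ?p (s - s) x) - (- exp (- 0) * ?p (s - 0) x)"
  proof (rule integral_FTC_Icc_real[OF s])
    fix h assume "0 \<le> h" "h \<le> s"
    have "((\<lambda>h. ?p (s - h) x) has_real_derivative rwop (?p (s - h)) x * (- 1)) (at h)"
      by (rule DERIV_chain2[OF sgrp_deriv'[OF jump_rwop a]]) (auto intro!: derivative_eq_intros)
    then show "((\<lambda>h. - exp (- h) * ?p (s - h) x) has_real_derivative exp (- h) * ?q h) (at h)"
      unfolding q by (auto intro!: derivative_eq_intros simp: algebra_simps)
    show "isCont (\<lambda>h. exp (- h) * ?q h) h"
      using cont d0 by (auto intro!: continuous_intros simp: continuous_on_eq_continuous_at)
  qed
  finally show ?thesis by simp
qed

text \<open>Both sides satisfy the same first-jump equation: after a jump the path restarts from the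
  neighbour, and without a jump by \<open>s\<close> the holding time is memoryless. Iterating the
  equation shrinks their distance each time by the probability 1-exp(-s) of a jump. \<open>G\<close>
  may depend on countably many later times, as collisions on a grid require.\<close>

theorem rw_markov:
  fixes G :: "(nat \<Rightarrow> 'v) \<Rightarrow> real"
  assumes G[measurable]: "G \<in> borel_measurable path_space" and C: "bnd C G"
    and \<tau>: "\<And>j. 0 \<le> \<tau> j" and s: "0 \<le> s"
  shows "(\<integral>\<omega>. G (\<lambda>j. ctsrw E d x \<omega> (s + \<tau> j)) \<partial>rw_space d)
    = sgrp rwop s (\<lambda>z. \<integral>\<omega>. G (\<lambda>j. ctsrw E d z \<omega> (\<tau> j)) \<partial>rw_space d) x"
proof -
  interpret R: prob_space "rw_space d" by (rule rw_prob[OF d_pos])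
  interpret P: prob_space Exp1 by (rule prob_Exp)
  define A where "A s x = (\<integral>\<omega>. G (\<lambda>j. ctsrw E d x \<omega> (s + \<tau> j)) \<partial>rw_space d)" for s x
  define a where "a z = (\<integral>\<omega>. G (\<lambda>j. ctsrw E d z \<omega> (\<tau> j)) \<partial>rw_space d)" for z
  let ?p = "\<lambda>s. sgrp rwop s a"
  have GC: "\<bar>G w\<bar> \<le> C" for w using bndD[OF C] .
  have C0: "0 \<le> C" by (rule bnd_nonneg[OF C])
  have AC: "\<bar>A s x\<bar> \<le> C" for s x unfolding A_def by (rule R.abs_expectation_le[OF GC])
  have aC: "bnd C a" unfolding bnd_def a_def by (intro allI R.abs_expectation_le[OF GC])
  have cont: "continuous_on UNIV (\<lambda>h. ?p (s - h) y)" for s y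
  proof -
    have "continuous_on UNIV (\<lambda>t. ?p t y)"
      by (rule DERIV_continuous_on[where D = "\<lambda>t. sgrp rwop t (rwop a) y"]) (rule sgrp_deriv[OF jump_rwop aC])
    then show ?thesis by (rule continuous_on_compose2) (auto intro!: continuous_intros)
  qed
  then have pm[measurable]: "(\<lambda>h. ?p (s - h) y) \<in> borel_measurable borel" for s y by (rule borel_measurable_continuous_onI)
  have pC: "\<bar>?p t y\<bar> \<le> C" if "0 \<le> t" for t y using bndD[OF sgrp_bnd[OF jump_rwop aC that]] .
  \<comment> \<open>Only the event of a jump by \<open>s\<close> contributes to the difference; on
    its complement the two sides agree exactly by \<open>Exp1_memoryless\<close>.\<close>
  have step: "\<bar>A s x - ?p s x\<bar> \<le> m * (1 - exp (- s))"
    if s: "0 \<le> s" and m: "0 \<le> m" and le: "\<And>t y. 0 \<le> t \<Longrightarrow> t \<le> s \<Longrightarrow> \<bar>A t y - ?p t y\<bar> \<le> m" for s x m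
  proof -
    define J where "J i h = (\<integral>\<omega>. G (\<lambda>j. ctsrw E d x (case_nat (i, h) \<omega>) (s + \<tau> j)) \<partial>rw_space d)" for i h
    define b where "b i h = (\<integral>\<omega>. G (\<lambda>j. ctsrw E d x (case_nat (i, h) \<omega>) (\<tau> j)) \<partial>rw_space d)" for i h
    have pathG: "(\<lambda>\<omega>. G (\<lambda>j. ctsrw E d x \<omega> (r + \<tau> j))) \<in> borel_measurable (rw_space d)" for r by measurable
    have Jm: "(\<lambda>h. J i h) \<in> borel_measurable borel" for i
      unfolding J_def by (rule rw_inner_measurable(2)[OF pathG d_pos])
    have bm: "(\<lambda>h. b i h) \<in> borel_measurable borel" for i
      unfolding b_def by (rule rw_inner_measurable(2)[OF pathG[of 0] d_pos, simplified])
    note [measurable] = Jm bm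
    have JC: "\<bar>J i h\<bar> \<le> C" "\<bar>b i h\<bar> \<le> C" for i h unfolding J_def b_def by (rule R.abs_expectation_le[OF GC])+
    have A1: "A s x = (\<Sum>i<d. \<integral>h. J i h \<partial>Exp1) / d"
      unfolding A_def J_def by (rule rw_first_step'[OF d_pos _ GC]) measurable
    have a1: "a x = (\<Sum>i<d. \<integral>h. b i h \<partial>Exp1) / d"
      unfolding a_def b_def by (rule rw_first_step'[OF d_pos _ GC]) measurable
    have J1: "J i h = A (s - h) (nbr E d x i)" if "0 < h" "h \<le> s" for i h
      unfolding J_def A_def
    proof (rule integral_cong_AE)
      show "AE \<omega> in rw_space d. G (\<lambda>j. ctsrw E d x (case_nat (i, h) \<omega>) (s + \<tau> j)) = G (\<lambda>j. ctsrw E d (nbr E d x i) \<omega> (s - h + \<tau> j))"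
        using rw_good_AE[OF d_pos]
      proof eventually_elim
        case (elim \<omega>)
        have "ctsrw E d x (case_nat (i, h) \<omega>) (s + \<tau> j) = ctsrw E d (nbr E d x i) \<omega> (s - h + \<tau> j)" for j
          using ctsrw_after[OF elim, of h "s + \<tau> j" E d x i] that \<tau>[of j] by (simp add: algebra_simps)
        then show ?case by simp
      qed
      have "(\<lambda>\<omega>. ((i, h), \<omega>)) \<in> measurable (rw_space d) (step_space d \<Otimes>\<^sub>M rw_space d)"
        by (rule measurable_Pair1') (simp add: step_space_def space_pair_measure)
      from measurable_compose[OF measurable_compose[OF this rw_cons_measurable] pathG]
      show "(\<lambda>\<omega>. G (\<lambda>j. ctsrw E d x (case_nat (i, h) \<omega>) (s + \<tau> j))) \<in> borel_measurable (rw_space d)"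
        by simp
    qed measurable
    have J2: "J i h = b i (h - s)" for i h unfolding J_def b_def ctsrw_shift ..
    have b2: "(\<integral>h. indicator {s<..} h * b i (h - s) \<partial>Exp1) = exp (- s) * (\<integral>h. b i h \<partial>Exp1)" for i
      by (rule Exp1_memoryless[OF _ s]) measurable
    let ?I = "\<lambda>i h. J i h - indicator {..s} h * ?p (s - h) (nbr E d x i) - indicator {s<..} h * b i (h - s)"
    have i1: "integrable Exp1 (J i)" for i by (rule P.integrable_const_bound[where B = C]) (use JC in auto)
    have i2: "integrable Exp1 (\<lambda>h. indicator {..s} h * ?p (s - h) y)" for y
      by (rule P.integrable_const_bound[where B = C]) (use pC C0 in \<open>auto simp: indicator_def\<close>)
    have i3: "integrable Exp1 (\<lambda>h. indicator {s<..} h * b i (h - s))" for i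
      by (rule P.integrable_const_bound[where B = C]) (use JC C0 in \<open>auto simp: indicator_def\<close>)
    have "A s x - ?p s x = (\<Sum>i<d. \<integral>h. ?I i h \<partial>Exp1) / d"
    proof -
      have "(\<integral>h. ?I i h \<partial>Exp1) = (\<integral>h. J i h \<partial>Exp1) - (\<integral>h. indicator {..s} h * ?p (s - h) (nbr E d x i) \<partial>Exp1) - exp (- s) * (\<integral>h. b i h \<partial>Exp1)" for i
        unfolding b2[symmetric] using i1 i2 i3 by simp
      then have "(\<Sum>i<d. \<integral>h. ?I i h \<partial>Exp1) / d = A s x - (\<Sum>i<d. \<integral>h. indicator {..s} h * ?p (s - h) (nbr E d x i) \<partial>Exp1) / d - exp (- s) * a x"
        unfolding A1 a1 by (simp add: sum_subtractf diff_divide_distrib sum_distrib_left)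
      then show ?thesis unfolding rw_renewal[OF aC s, of x] by simp
    qed
    moreover have "\<bar>\<integral>h. ?I i h \<partial>Exp1\<bar> \<le> m * (1 - exp (- s))" for i
    proof -
      have "\<bar>\<integral>h. ?I i h \<partial>Exp1\<bar> \<le> (\<integral>h. \<bar>?I i h\<bar> \<partial>Exp1)" by (rule integral_abs_bound)
      also have "\<dots> \<le> (\<integral>h. m * indicator {..s} h \<partial>Exp1)"
      proof (rule integral_mono_AE)
        show "AE h in Exp1. \<bar>?I i h\<bar> \<le> m * indicator {..s} h"
          using Exp1_pos
        proof eventually_elim
          case (elim h)
          show ?case
          proof (cases "h \<le> s")
            case True
            then show ?thesis using J1[OF elim True] le[of "s - h" "nbr E d x i"] elim by (simp add: indicator_def)
          next
            case False
            then show ?thesis using J2[of i h] by (simp add: indicator_def)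
          qed
        qed
        show "integrable Exp1 (\<lambda>h. \<bar>?I i h\<bar>)" using i1 i2 i3 by simp
        show "integrable Exp1 (\<lambda>h. m * indicator {..s} h)"
          by (rule P.integrable_const_bound[where B = m]) (use m in \<open>auto simp: indicator_def\<close>)
      qed
      also have "\<dots> = m * (1 - exp (- s))" using Exp1_le[OF s] by simp
      finally show ?thesis .
    qed
    ultimately have "\<bar>A s x - ?p s x\<bar> \<le> (\<Sum>i<d. m * (1 - exp (- s))) / d"
      using d0 by (simp only: abs_divide abs_of_nat) (intro divide_right_mono order_trans[OF sum_abs] sum_mono, auto)
    then show ?thesis using d0 by simp
  qed
  have bound: "\<bar>A t x - ?p t x\<bar> \<le> 2 * C * (1 - exp (- s)) ^ n" if "0 \<le> t" "t \<le> s" for n t x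
    using that
  proof (induction n arbitrary: t x)
    case 0
    show ?case using AC[of t x] pC[OF 0(1), of x] by simp
  next
    case (Suc n)
    have "\<bar>A t x - ?p t x\<bar> \<le> 2 * C * (1 - exp (- s)) ^ n * (1 - exp (- t))"
      using Suc C0 by (intro step) (auto intro!: mult_nonneg_nonneg)
    also have "\<dots> \<le> 2 * C * (1 - exp (- s)) ^ n * (1 - exp (- s))"
      using Suc.prems C0 by (intro mult_left_mono) (auto intro!: mult_nonneg_nonneg)
    finally show ?case by (simp add: mult_ac)
  qed
  have "(\<lambda>n. 2 * C * (1 - exp (- s)) ^ n) \<longlonglongrightarrow> 2 * C * 0"
    using s by (intro tendsto_intros LIMSEQ_power_zero) (auto simp: abs_if)
  then have "\<bar>A s x - ?p s x\<bar> \<le> 2 * C * 0"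
    by (rule LIMSEQ_le_const) (use bound[OF s order_refl] in auto)
  then show ?thesis unfolding A_def a_def by simp
qed

section \<open>Pairs of independent walks\<close>

definition pairL :: "('v \<times> 'v \<Rightarrow> real) \<Rightarrow> 'v \<times> 'v \<Rightarrow> real" where
  "pairL g p = rwop (\<lambda>z. g (z, snd p)) (fst p)"
definition pairR :: "('v \<times> 'v \<Rightarrow> real) \<Rightarrow> 'v \<times> 'v \<Rightarrow> real" where
  "pairR g p = rwop (\<lambda>z. g (fst p, z)) (snd p)"
definition pairop :: "('v \<times> 'v \<Rightarrow> real) \<Rightarrow> 'v \<times> 'v \<Rightarrow> real" where
  "pairop g p = pairL g p + pairR g p"

lemma jump_pairL: "jump_op 1 pairL"
  by (rule jump_opI[of "\<lambda>p. nb (fst p)" "\<lambda>_ _. 1 / d" 1 pairL "\<lambda>p y. (y, snd p)"])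
     (use d0 in \<open>simp_all add: pairL_def rwop_def\<close>)

lemma jump_pairR: "jump_op 1 pairR"
  by (rule jump_opI[of "\<lambda>p. nb (snd p)" "\<lambda>_ _. 1 / d" 1 pairR "\<lambda>p y. (fst p, y)"])
     (use d0 in \<open>simp_all add: pairR_def rwop_def\<close>)

lemma jump_op_sum:
  assumes L1: "jump_op \<Lambda> L1" and L2: "jump_op \<Gamma> L2" and L: "\<And>f a. L f a = L1 f a + L2 f a"
  shows "jump_op (\<Lambda> + \<Gamma>) L"
  unfolding jump_op_def
proof (rule allI)
  fix a
  obtain S w where S: "finite S" "\<forall>b\<in>S. 0 \<le> w b" "sum w S \<le> \<Lambda>" "\<forall>f. L1 f a = (\<Sum>b\<in>S. w b * (f b - f a))"
    by (rule jump_opE[OF L1])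
  obtain S' w' where S': "finite S'" "\<forall>b\<in>S'. 0 \<le> w' b" "sum w' S' \<le> \<Gamma>" "\<forall>f. L2 f a = (\<Sum>b\<in>S'. w' b * (f b - f a))"
    by (rule jump_opE[OF L2])
  define u where "u b = (if b \<in> S then w b else 0)" for b
  define u' where "u' b = (if b \<in> S' then w' b else 0)" for b
  have ext: "(\<Sum>b\<in>S \<union> S'. u b * f b) = (\<Sum>b\<in>S. w b * f b)" "(\<Sum>b\<in>S \<union> S'. u' b * f b) = (\<Sum>b\<in>S'. w' b * f b)" for f :: "_ \<Rightarrow> real"
    using S(1) S'(1) by (intro sum.mono_neutral_cong_right; simp add: u_def u'_def)+
  show "\<exists>S w. finite S \<and> (\<forall>b\<in>S. 0 \<le> w b) \<and> sum w S \<le> \<Lambda> + \<Gamma> \<and> (\<forall>f. L f a = (\<Sum>b\<in>S. w b * (f b - f a)))"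
  proof (intro exI[of _ "S \<union> S'"] exI[of _ "\<lambda>b. u b + u' b"] conjI allI)
    show "\<forall>b\<in>S \<union> S'. 0 \<le> u b + u' b" using S(2) S'(2) by (simp add: u_def u'_def)
    show "(\<Sum>b\<in>S \<union> S'. u b + u' b) \<le> \<Lambda> + \<Gamma>"
      using ext(1)[of "\<lambda>_. 1"] ext(2)[of "\<lambda>_. 1"] S(3) S'(3) by (simp add: sum.distrib)
    show "L f a = (\<Sum>b\<in>S \<union> S'. (u b + u' b) * (f b - f a))" for f
      unfolding L S(4)[rule_format] S'(4)[rule_format] using ext(1)[of "\<lambda>b. f b - f a"] ext(2)[of "\<lambda>b. f b - f a"]
      by (simp add: distrib_right sum.distrib)
  qed (use S(1) S'(1) in simp)
qed

lemma jump_pairop: "jump_op 2 pairop"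
  using jump_op_sum[OF jump_pairL jump_pairR pairop_def] by simp

lemma rwop_rwop:
  "rwop (\<lambda>z. rwop (\<lambda>w. g z w) y) x = (\<Sum>z\<in>nb x. \<Sum>w\<in>nb y. 1 / d * (1 / d * ((g z w - g z y) - (g x w - g x y))))"
  unfolding rwop_def sum_subtractf[symmetric] sum_distrib_left by (intro sum.cong refl) (simp add: right_diff_distrib)

lemma rwop_swap:
  "rwop (\<lambda>z. rwop (\<lambda>w. g z w) y) x = rwop (\<lambda>w. rwop (\<lambda>z. g z w) x) y"
proof -
  have 1: "rwop (\<lambda>z. rwop (\<lambda>w. g z w) y) x = (\<Sum>w\<in>nb y. \<Sum>z\<in>nb x. 1 / d * (1 / d * ((g z w - g z y) - (g x w - g x y))))"
    by (rule trans[OF rwop_rwop sum.swap])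
  have 2: "\<dots> = (\<Sum>w\<in>nb y. \<Sum>z\<in>nb x. 1 / d * (1 / d * ((g z w - g x w) - (g z y - g x y))))"
  proof (intro sum.cong refl)
    fix w z
    have "(g z w - g z y) - (g x w - g x y) = (g z w - g x w) - (g z y - g x y)" by linarith
    then show "1 / d * (1 / d * ((g z w - g z y) - (g x w - g x y))) = 1 / d * (1 / d * ((g z w - g x w) - (g z y - g x y)))"
      by (simp only:)
  qed
  show ?thesis by (rule trans[OF 1 trans[OF 2 rwop_rwop[of "\<lambda>w z. g z w", symmetric]]])
qed

lemma pair_split:
  assumes g: "bnd C g" and s: "0 \<le> s"
  shows "sgrp pairop s g (x, y) = sgrp rwop s (\<lambda>z. sgrp rwop s (\<lambda>z'. g (z, z')) y) x"
proof -
  have "sgrp pairop s g (x, y) = sgrp pairL s (sgrp pairR s g) (x, y)"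
    by (rule sgrp_commuting_sum[OF jump_pairL jump_pairR jump_pairop g pairop_def _ s])
       (simp only: pairL_def pairR_def fst_conv snd_conv, rule rwop_swap)
  also have "\<dots> = sgrp rwop s (\<lambda>z. sgrp pairR s g (z, y)) x"
    by (rule sgrp_intertwine[of rwop "\<lambda>z. (z, y)" pairL, symmetric]) (simp add: pairL_def)
  also have "(\<lambda>z. sgrp pairR s g (z, y)) = (\<lambda>z. sgrp rwop s (\<lambda>z'. g (z, z')) y)"
  proof
    fix z
    show "sgrp pairR s g (z, y) = sgrp rwop s (\<lambda>z'. g (z, z')) y"
      by (rule sgrp_intertwine[of rwop "\<lambda>z'. (z, z')" pairR, symmetric]) (simp add: pairR_def)
  qed
  finally show ?thesis .
qed

section \<open>Several independent walks and the Liouville property\<close>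

lemma walkop_sum: assumes "finite J" shows "walkop J F x = (\<Sum>j\<in>J. rwop (\<lambda>y. F (x(j := y))) (x j))"
  unfolding walkop_def moves_def rwop_def using assms
  by (subst sum.Sigma) (auto simp: case_prod_beta)

lemma walkop_pair:
  assumes J: "finite J" and ij: "i \<in> J" "j \<in> J" "i \<noteq> j"
  shows "sgrp (walkop J) t (\<lambda>x. g (x i, x j)) x = sgrp pairop t g (x i, x j)"
proof (rule sgrp_intertwine[of "walkop J" "\<lambda>x. (x i, x j)" pairop])
  fix g :: "'v \<times> 'v \<Rightarrow> real" and x :: "nat \<Rightarrow> 'v"
  have "walkop J (\<lambda>x. g (x i, x j)) x = (\<Sum>k\<in>J. rwop (\<lambda>y. g ((x(k := y)) i, (x(k := y)) j)) (x k))"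
    by (rule walkop_sum[OF J])
  also have "\<dots> = (\<Sum>k\<in>{i, j}. rwop (\<lambda>y. g ((x(k := y)) i, (x(k := y)) j)) (x k))"
  proof (rule sum.mono_neutral_right[OF J])
    show "\<forall>k\<in>J - {i, j}. rwop (\<lambda>y. g ((x(k := y)) i, (x(k := y)) j)) (x k) = 0"
    proof
      fix k assume "k \<in> J - {i, j}"
      then have "(\<lambda>y. g ((x(k := y)) i, (x(k := y)) j)) = (\<lambda>_. g (x i, x j))" by auto
      then show "rwop (\<lambda>y. g ((x(k := y)) i, (x(k := y)) j)) (x k) = 0" by (simp add: jump_op_const[OF jump_rwop])
    qed
  qed (use ij in auto)
  also have "\<dots> = pairop g (x i, x j)" using ij(3) by (simp add: pairop_def pairL_def pairR_def)
  finally show "walkop J (\<lambda>x. g (x i, x j)) x = pairop g (x i, x j)" .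
qed

lemma rwop_sum: "rwop (\<lambda>z. \<Sum>k\<in>S. \<phi> k z) x = (\<Sum>k\<in>S. rwop (\<phi> k) x)"
  unfolding rwop_def sum_subtractf[symmetric] sum_distrib_left by (rule sum.swap)

text \<open>As the coordinates evolve by commuting semigroups, invariance says: the value of
  \<open>F\<close> at \<open>x\<close> is the walk in coordinate \<open>j\<close> alone, started
  from \<open>x j\<close>, applied to a bounded function in which \<open>x j\<close> no longer
  occurs. By \<open>tv\<close> the walk forgets its starting point, so \<open>F\<close> does not see
  it.\<close>

theorem liouville_product:
  assumes tv: "\<And>a b e. 0 < e \<Longrightarrow> \<exists>t\<ge>0. \<forall>\<phi>. bnd 1 \<phi> \<longrightarrow> \<bar>sgrp rwop t \<phi> a - sgrp rwop t \<phi> b\<bar> \<le> e"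
    and J: "finite J" "j \<in> J" and F: "bnd B F" and inv: "\<And>t x. 0 \<le> t \<Longrightarrow> sgrp (walkop J) t F x = F x"
  shows "F (x(j := b)) = F x"
proof -
  have L1: "jump_op (card {j}) (walkop {j})" by (rule jump_walkop) simp
  have L2: "jump_op (card (J - {j})) (walkop (J - {j}))" using J by (intro jump_walkop) simp
  have split: "walkop J g y = walkop {j} g y + walkop (J - {j}) g y" for g y
    using J by (simp add: walkop_sum sum.remove)
  have comm: "walkop {j} (walkop (J - {j}) g) y = walkop (J - {j}) (walkop {j} g) y" for g y
  proof -
    have 1: "walkop {j} (walkop (J - {j}) g) y = rwop (\<lambda>z. \<Sum>k\<in>J - {j}. rwop (\<lambda>w. g ((y(j := z))(k := w))) ((y(j := z)) k)) (y j)"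
      using J(1) by (simp only: walkop_sum finite_Diff finite.intros sum.insert sum.empty empty_iff not_False_eq_True add_0_right)
    have 2: "\<dots> = (\<Sum>k\<in>J - {j}. rwop (\<lambda>z. rwop (\<lambda>w. g ((y(j := z))(k := w))) ((y(j := z)) k)) (y j))"
      by (rule rwop_sum)
    have 3: "\<dots> = (\<Sum>k\<in>J - {j}. rwop (\<lambda>w. walkop {j} g (y(k := w))) (y k))"
    proof (intro sum.cong refl)
      fix k assume k: "k \<in> J - {j}"
      then have kj: "k \<noteq> j" by simp
      have a: "(y(j := z)) k = y k" "(y(k := w)) j = y j" for z w using kj by simp_all
      have tw: "(y(j := z))(k := w) = (y(k := w))(j := z)" for z w by (rule fun_upd_twist) (use kj in simp)
      have b: "walkop {j} g (y(k := w)) = rwop (\<lambda>z. g ((y(k := w))(j := z))) (y j)" for w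
        using walkop_sum[of "{j}" g "y(k := w)"] a(2) by simp
      show "rwop (\<lambda>z. rwop (\<lambda>w. g ((y(j := z))(k := w))) ((y(j := z)) k)) (y j) = rwop (\<lambda>w. walkop {j} g (y(k := w))) (y k)"
        unfolding a(1) tw b by (rule rwop_swap[of "\<lambda>z w. g ((y(k := w))(j := z))"])
    qed
    have 4: "\<dots> = walkop (J - {j}) (walkop {j} g) y"
      using J(1) by (intro walkop_sum[symmetric]) simp
    show ?thesis by (rule trans[OF 1 trans[OF 2 trans[OF 3 4]]])
  qed
  have one: "F y = sgrp rwop t (\<lambda>z. sgrp (walkop (J - {j})) t F (y(j := z))) (y j)" if t: "0 \<le> t" for t y
  proof -
    have "F y = sgrp (walkop {j}) t (sgrp (walkop (J - {j})) t F) y"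
      by (rule trans[OF inv[OF t, symmetric] sgrp_commuting_sum[OF L1 L2 jump_walkop[OF J(1)] F]])
        (rule split, rule comm, rule t)
    also have "\<dots> = sgrp (walkop {j}) t (sgrp (walkop (J - {j})) t F) (y(j := y j))" by simp
    also have "\<dots> = sgrp rwop t (\<lambda>z. sgrp (walkop (J - {j})) t F (y(j := z))) (y j)"
      by (rule sgrp_intertwine[of rwop "\<lambda>z. y(j := z)" "walkop {j}", symmetric]) (simp add: walkop_sum)
    finally show ?thesis .
  qed
  have "\<bar>F (x(j := b)) - F x\<bar> \<le> e" if e: "0 < e" for e
  proof -
    have B: "0 \<le> B" by (rule bnd_nonneg[OF F])
    \<comment> \<open>Dividing by B+1, positive also for B = 0, brings the bounded function into the
      unit ball to which \<open>tv\<close> applies.\<close>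
    have "0 < e / (B + 1)" using e B by simp
    from tv[OF this, of b "x j"] obtain t where t: "0 \<le> t"
      "\<forall>\<phi>. bnd 1 \<phi> \<longrightarrow> \<bar>sgrp rwop t \<phi> b - sgrp rwop t \<phi> (x j)\<bar> \<le> e / (B + 1)" by blast
    define \<phi> where "\<phi> z = sgrp (walkop (J - {j})) t F (x(j := z))" for z
    have \<phi>B: "bnd B \<phi>" using bndD[OF sgrp_bnd[OF L2 F t(1)]] by (simp add: bnd_def \<phi>_def)
    have "bnd 1 (\<lambda>z. 1 / (B + 1) * \<phi> z)"
      unfolding bnd_def
    proof
      fix z
      have "\<bar>\<phi> z\<bar> \<le> B + 1" using bndD[OF \<phi>B, of z] by simp
      then show "\<bar>1 / (B + 1) * \<phi> z\<bar> \<le> 1" using B by (simp add: abs_mult)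
    qed
    with t(2) have "\<bar>sgrp rwop t (\<lambda>z. 1 / (B + 1) * \<phi> z) b - sgrp rwop t (\<lambda>z. 1 / (B + 1) * \<phi> z) (x j)\<bar> \<le> e / (B + 1)" by blast
    moreover have "F x = sgrp rwop t \<phi> (x j)" "F (x(j := b)) = sgrp rwop t \<phi> b"
      using one[OF t(1), of x] one[OF t(1), of "x(j := b)"] by (simp_all add: \<phi>_def[abs_def])
    ultimately have "\<bar>1 / (B + 1) * F (x(j := b)) - 1 / (B + 1) * F x\<bar> \<le> e / (B + 1)"
      by (simp only: sgrp_cmult[OF jump_rwop \<phi>B])
    then have "\<bar>F (x(j := b)) - F x\<bar> / (B + 1) \<le> e / (B + 1)"
      using B by (simp add: diff_divide_distrib[symmetric])
    then show ?thesis using B by (simp add: divide_le_cancel)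
  qed
  then have "\<bar>F (x(j := b)) - F x\<bar> \<le> 0" by (rule field_le_epsilon[of _ 0, simplified])
  then show ?thesis by simp
qed

section \<open>Collisions observed on a time grid\<close>

abbreviation \<Omega>2 :: "((nat \<Rightarrow> nat \<times> real) \<times> (nat \<Rightarrow> nat \<times> real)) measure" where
  "\<Omega>2 \<equiv> rw_space d \<Otimes>\<^sub>M rw_space d"

lemma prob_\<Omega>2: "prob_space \<Omega>2"
proof -
  interpret R: prob_space "rw_space d" by (rule rw_prob[OF d_pos])
  interpret RR: pair_prob_space "rw_space d" "rw_space d" ..
  show ?thesis by (rule RR.prob_space_axioms)
qed

text \<open>The Markov property is used in each coordinate with the other one integrated out; Fubini
  and \<open>pair_split\<close> assemble the two.\<close>

theorem pair_markov:
  fixes G :: "(nat \<Rightarrow> 'v) \<times> (nat \<Rightarrow> 'v) \<Rightarrow> real"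
  assumes G[measurable]: "G \<in> borel_measurable (path_space \<Otimes>\<^sub>M path_space)" and C: "bnd C G"
    and \<tau>: "\<And>j. 0 \<le> \<tau> j" and s: "0 \<le> s"
  shows "(\<integral>\<omega>. G (\<lambda>j. ctsrw E d x (fst \<omega>) (s + \<tau> j), \<lambda>j. ctsrw E d y (snd \<omega>) (s + \<tau> j)) \<partial>\<Omega>2)
    = sgrp pairop s (\<lambda>p. \<integral>\<omega>. G (\<lambda>j. ctsrw E d (fst p) (fst \<omega>) (\<tau> j), \<lambda>j. ctsrw E d (snd p) (snd \<omega>) (\<tau> j)) \<partial>\<Omega>2) (x, y)"
proof -
  interpret R: prob_space "rw_space d" by (rule rw_prob[OF d_pos])
  interpret RR: pair_prob_space "rw_space d" "rw_space d" ..
  define P where "P z \<omega> = (\<lambda>j. ctsrw E d z \<omega> (\<tau> j))" for z \<omega>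
  define P' where "P' z \<omega> = (\<lambda>j. ctsrw E d z \<omega> (s + \<tau> j))" for z \<omega>
  have [measurable]: "P z \<in> measurable (rw_space d) path_space" "P' z \<in> measurable (rw_space d) path_space" for z
    unfolding P_def[abs_def] P'_def[abs_def] by measurable
  have GC: "\<bar>G w\<bar> \<le> C" for w using bndD[OF C] .
  define g where "g p = (\<integral>\<omega>. G (P (fst p) (fst \<omega>), P (snd p) (snd \<omega>)) \<partial>\<Omega>2)" for p
  have gC: "bnd C g" unfolding bnd_def g_def by (intro allI RR.abs_expectation_le GC)
  have fub: "(\<integral>\<omega>. G (f (fst \<omega>), k (snd \<omega>)) \<partial>\<Omega>2) = (\<integral>\<omega>1. (\<integral>\<omega>2. G (f \<omega>1, k \<omega>2) \<partial>rw_space d) \<partial>rw_space d)"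
     "(\<integral>\<omega>. G (f (fst \<omega>), k (snd \<omega>)) \<partial>\<Omega>2) = (\<integral>\<omega>2. (\<integral>\<omega>1. G (f \<omega>1, k \<omega>2) \<partial>rw_space d) \<partial>rw_space d)"
    if [measurable]: "f \<in> measurable (rw_space d) path_space" "k \<in> measurable (rw_space d) path_space" for f k
  proof -
    have int: "integrable \<Omega>2 (\<lambda>\<omega>. G (f (fst \<omega>), k (snd \<omega>)))"
      by (rule RR.integrable_const_bound[where B = C]) (use GC in auto)
    from RR.integral_fst'[OF int] show 1: "(\<integral>\<omega>. G (f (fst \<omega>), k (snd \<omega>)) \<partial>\<Omega>2) = (\<integral>\<omega>1. (\<integral>\<omega>2. G (f \<omega>1, k \<omega>2) \<partial>rw_space d) \<partial>rw_space d)"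
      by simp
    have "(\<lambda>\<omega>. G (f (fst \<omega>), k (snd \<omega>))) = (\<lambda>(\<omega>1, \<omega>2). G (f \<omega>1, k \<omega>2))" by (simp add: fun_eq_iff)
    with int have "integrable \<Omega>2 (\<lambda>(\<omega>1, \<omega>2). G (f \<omega>1, k \<omega>2))" by simp
    from RR.Fubini_integral[OF this] show "(\<integral>\<omega>. G (f (fst \<omega>), k (snd \<omega>)) \<partial>\<Omega>2) = (\<integral>\<omega>2. (\<integral>\<omega>1. G (f \<omega>1, k \<omega>2) \<partial>rw_space d) \<partial>rw_space d)"
      unfolding 1 by simp
  qed
  define G1 where "G1 w = (\<integral>\<omega>2. G (w, P' y \<omega>2) \<partial>rw_space d)" for w
  define G2 where "G2 z w = (\<integral>\<omega>1. G (P z \<omega>1, w) \<partial>rw_space d)" for z w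
  have [measurable]: "G1 \<in> borel_measurable path_space" unfolding G1_def[abs_def] by measurable
  have [measurable]: "G2 z \<in> borel_measurable path_space" for z unfolding G2_def[abs_def] by measurable
  have G1C: "bnd C G1" unfolding bnd_def G1_def by (intro allI R.abs_expectation_le GC)
  have G2C: "bnd C (G2 z)" for z unfolding bnd_def G2_def by (intro allI R.abs_expectation_le GC)
  have "(\<integral>\<omega>. G (P' x (fst \<omega>), P' y (snd \<omega>)) \<partial>\<Omega>2) = (\<integral>\<omega>1. G1 (P' x \<omega>1) \<partial>rw_space d)"
    unfolding G1_def by (rule fub(1)) measurable
  also have "\<dots> = sgrp rwop s (\<lambda>z. \<integral>\<omega>1. G1 (P z \<omega>1) \<partial>rw_space d) x"
    unfolding P'_def P_def by (rule rw_markov[OF _ G1C \<tau> s]) measurable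
  also have "(\<lambda>z. \<integral>\<omega>1. G1 (P z \<omega>1) \<partial>rw_space d) = (\<lambda>z. sgrp rwop s (\<lambda>z'. g (z, z')) y)"
  proof
    fix z
    have "(\<integral>\<omega>1. G1 (P z \<omega>1) \<partial>rw_space d) = (\<integral>\<omega>. G (P z (fst \<omega>), P' y (snd \<omega>)) \<partial>\<Omega>2)"
      unfolding G1_def by (rule fub(1)[symmetric]) measurable
    also have "\<dots> = (\<integral>\<omega>2. G2 z (P' y \<omega>2) \<partial>rw_space d)" unfolding G2_def by (rule fub(2)) measurable
    also have "\<dots> = sgrp rwop s (\<lambda>z'. \<integral>\<omega>2. G2 z (P z' \<omega>2) \<partial>rw_space d) y"
      unfolding P'_def P_def[of _ _ ] by (rule rw_markov[OF _ G2C \<tau> s, unfolded P_def]) measurable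
    also have "(\<lambda>z'. \<integral>\<omega>2. G2 z (P z' \<omega>2) \<partial>rw_space d) = (\<lambda>z'. g (z, z'))"
    proof
      fix z'
      show "(\<integral>\<omega>2. G2 z (P z' \<omega>2) \<partial>rw_space d) = g (z, z')"
        unfolding G2_def g_def fst_conv snd_conv by (rule fub(2)[symmetric]) measurable
    qed
    finally show "(\<integral>\<omega>1. G1 (P z \<omega>1) \<partial>rw_space d) = sgrp rwop s (\<lambda>z'. g (z, z')) y" .
  qed
  also have "sgrp rwop s (\<lambda>z. sgrp rwop s (\<lambda>z'. g (z, z')) y) x = sgrp pairop s g (x, y)"
    by (rule pair_split[OF gC s, symmetric])
  finally show ?thesis unfolding P'_def g_def P_def .
qed

text \<open>Observing the walks only at the times \<epsilon>k lets the Markov property at the fixed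
  time \<epsilon> produce a recursion, without hitting times.\<close>

definition avoid :: "real \<Rightarrow> nat set \<Rightarrow> 'v \<times> 'v \<Rightarrow> real" where
  "avoid \<epsilon> K p = (\<integral>\<omega>. of_bool (\<forall>k\<in>K. ctsrw E d (fst p) (fst \<omega>) (\<epsilon> * real k) \<noteq> ctsrw E d (snd p) (snd \<omega>) (\<epsilon> * real k)) \<partial>\<Omega>2)"

lemma avoid_pred[measurable]:
  "Measurable.pred (path_space \<Otimes>\<^sub>M path_space) (\<lambda>p :: (nat \<Rightarrow> 'v) \<times> (nat \<Rightarrow> 'v). \<forall>k\<in>K. fst p k \<noteq> snd p k)"
proof -
  have *: "Measurable.pred (path_space \<Otimes>\<^sub>M path_space) (\<lambda>p :: (nat \<Rightarrow> 'v) \<times> (nat \<Rightarrow> 'v). fst p k \<noteq> snd p k)" for k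
  proof -
    have "Measurable.pred (path_space \<Otimes>\<^sub>M path_space) (\<lambda>p :: (nat \<Rightarrow> 'v) \<times> (nat \<Rightarrow> 'v). z \<noteq> snd p k)" for z by measurable
    moreover have "(\<lambda>p :: (nat \<Rightarrow> 'v) \<times> (nat \<Rightarrow> 'v). fst p k) \<in> measurable (path_space \<Otimes>\<^sub>M path_space) (count_space UNIV)" by measurable
    ultimately show ?thesis by (rule measurable_compose_countable'[OF _ _ countable_V])
  qed
  have "Measurable.pred (path_space \<Otimes>\<^sub>M path_space) (\<lambda>p :: (nat \<Rightarrow> 'v) \<times> (nat \<Rightarrow> 'v). \<forall>k. k \<in> K \<longrightarrow> fst p k \<noteq> snd p k)"
    using * by measurable
  then show ?thesis by (simp add: Ball_def)
qed

lemma avoid_shift: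
  assumes s: "0 \<le> s" and \<epsilon>: "0 \<le> \<epsilon>"
  shows "(\<integral>\<omega>. of_bool (\<forall>k\<in>K. ctsrw E d x (fst \<omega>) (s + \<epsilon> * real k) \<noteq> ctsrw E d y (snd \<omega>) (s + \<epsilon> * real k)) \<partial>\<Omega>2)
     = sgrp pairop s (avoid \<epsilon> K) (x, y)"
proof -
  have "(\<lambda>p :: (nat \<Rightarrow> 'v) \<times> (nat \<Rightarrow> 'v). of_bool (\<forall>k\<in>K. fst p k \<noteq> snd p k) :: real) \<in> borel_measurable (path_space \<Otimes>\<^sub>M path_space)"
    by measurable
  from pair_markov[OF this bnd_of_bool _ s, of "\<lambda>k. \<epsilon> * real k" x y] \<epsilon>
  show ?thesis unfolding avoid_def[abs_def] by simp
qed

lemma avoid_measurable: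
  fixes t :: "nat \<Rightarrow> real" and K :: "nat set"
  shows
  "(\<lambda>\<omega>. of_bool (\<forall>k\<in>K. ctsrw E d x (fst \<omega>) (t k) \<noteq> ctsrw E d y (snd \<omega>) (t k)) :: real) \<in> borel_measurable \<Omega>2"
proof -
  have "(\<lambda>\<omega>. (\<lambda>k. ctsrw E d x (fst \<omega>) (t k), \<lambda>k. ctsrw E d y (snd \<omega>) (t k))) \<in> measurable \<Omega>2 (path_space \<Otimes>\<^sub>M path_space)"
    by (intro measurable_Pair measurable_compose[OF measurable_fst path_measurable] measurable_compose[OF measurable_snd path_measurable])
  from measurable_compose[OF this, of "\<lambda>p. of_bool (\<forall>k\<in>K. fst p k \<noteq> snd p k) :: real" borel] show ?thesis by simp
qed

lemma avoid_bnd: "bnd 1 (avoid \<epsilon> K)"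
proof -
  interpret Q: prob_space \<Omega>2 by (rule prob_\<Omega>2)
  show ?thesis unfolding bnd_def avoid_def by (intro allI Q.abs_expectation_le) simp
qed

lemma avoid_nonneg: "0 \<le> avoid \<epsilon> K p" unfolding avoid_def by (rule Bochner_Integration.integral_nonneg) simp

lemma good2_AE: "AE \<omega> in \<Omega>2. rw_good (fst \<omega>) \<and> rw_good (snd \<omega>)"
proof -
  interpret R: prob_space "rw_space d" by (rule rw_prob[OF d_pos])
  interpret RR: pair_prob_space "rw_space d" "rw_space d" ..
  obtain N where N: "{\<omega> \<in> space (rw_space d). \<not> rw_good \<omega>} \<subseteq> N" "emeasure (rw_space d) N = 0" "N \<in> sets (rw_space d)"
    using rw_good_AE[OF d_pos] by (rule AE_E)
  have n: "AE \<omega> in rw_space d. \<omega> \<notin> N" using N by (intro AE_not_in) (simp add: null_sets_def)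
  have "AE \<omega> in \<Omega>2. fst \<omega> \<notin> N \<and> snd \<omega> \<notin> N"
  proof (rule RR.AE_pair_measure)
    show "{\<omega> \<in> space \<Omega>2. fst \<omega> \<notin> N \<and> snd \<omega> \<notin> N} \<in> sets \<Omega>2" using N(3) by measurable
    show "AE \<omega>1 in rw_space d. AE \<omega>2 in rw_space d. fst (\<omega>1, \<omega>2) \<notin> N \<and> snd (\<omega>1, \<omega>2) \<notin> N"
      using n by eventually_elim (use n in simp)
  qed
  then show ?thesis using AE_space
  proof eventually_elim
    case (elim \<omega>)
    then show ?case using N(1) by (auto simp: space_pair_measure)
  qed
qed

lemma avoid_diag: assumes "0 \<in> K" shows "avoid \<epsilon> K (x, x) = 0"
proof -
  have "avoid \<epsilon> K (x, x) = (\<integral>\<omega>. 0 \<partial>\<Omega>2)" unfolding avoid_def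
  proof (rule integral_cong_AE)
    show "AE \<omega> in \<Omega>2. of_bool (\<forall>k\<in>K. ctsrw E d (fst (x, x)) (fst \<omega>) (\<epsilon> * real k) \<noteq> ctsrw E d (snd (x, x)) (snd \<omega>) (\<epsilon> * real k)) = (0 :: real)"
      using good2_AE
    proof eventually_elim
      case (elim \<omega>)
      then show ?case using assms ctsrw_0[of "fst \<omega>" E d x] ctsrw_0[of "snd \<omega>" E d x] by (auto intro!: bexI[of _ 0])
    qed
  qed (simp only: fst_conv snd_conv, rule avoid_measurable, simp)
  then show ?thesis by simp
qed

text \<open>From distinct sites the condition at grid time 0 holds for free, and the rest of the
  grid is the old grid delayed by one step.\<close>

lemma avoid_off:
  assumes xy: "x \<noteq> y" and \<epsilon>: "0 \<le> \<epsilon>"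
  shows "avoid \<epsilon> (insert 0 (Suc ` K)) (x, y) = sgrp pairop \<epsilon> (avoid \<epsilon> K) (x, y)"
proof -
  have "avoid \<epsilon> (insert 0 (Suc ` K)) (x, y) = (\<integral>\<omega>. of_bool (\<forall>k\<in>K. ctsrw E d x (fst \<omega>) (\<epsilon> + \<epsilon> * real k) \<noteq> ctsrw E d y (snd \<omega>) (\<epsilon> + \<epsilon> * real k)) \<partial>\<Omega>2)"
    unfolding avoid_def
  proof (rule integral_cong_AE)
    show "AE \<omega> in \<Omega>2. of_bool (\<forall>k\<in>insert 0 (Suc ` K). ctsrw E d (fst (x, y)) (fst \<omega>) (\<epsilon> * real k) \<noteq> ctsrw E d (snd (x, y)) (snd \<omega>) (\<epsilon> * real k))
        = (of_bool (\<forall>k\<in>K. ctsrw E d x (fst \<omega>) (\<epsilon> + \<epsilon> * real k) \<noteq> ctsrw E d y (snd \<omega>) (\<epsilon> + \<epsilon> * real k)) :: real)"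
      using good2_AE
    proof eventually_elim
      case (elim \<omega>)
      then show ?case using xy ctsrw_0[of "fst \<omega>" E d x] ctsrw_0[of "snd \<omega>" E d y] by (simp add: algebra_simps)
    qed
  qed (simp only: fst_conv snd_conv, rule avoid_measurable, rule avoid_measurable)
  also have "\<dots> = sgrp pairop \<epsilon> (avoid \<epsilon> K) (x, y)" by (rule avoid_shift[OF \<epsilon> \<epsilon>])
  finally show ?thesis .
qed

end

section \<open>Collisions and coalescence\<close>

text \<open>Jump times of a good path do not accumulate, so some time passes before the next one. A
  collision at a real time therefore persists for a while and is seen by every fine enough
  grid.\<close>

lemma ctsrw_right_constant:
  assumes g: "rw_good \<omega>"
  shows "\<exists>\<delta>>0. \<forall>r. t \<le> r \<longrightarrow> r < t + \<delta> \<longrightarrow> ctsrw E d x \<omega> r = ctsrw E d x \<omega> t"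
proof -
  let ?S = "\<lambda>n. \<Sum>k<n. snd (\<omega> k)"
  let ?N = "{n. ?S n \<le> t + 1 \<and> t < ?S n}"
  have fin: "finite ?N" by (rule finite_subset[OF _ rw_good_finite[OF g, of "t + 1"]]) auto
  define \<delta> where "\<delta> = Min (insert 1 ((\<lambda>n. ?S n - t) ` ?N))"
  have \<delta>0: "0 < \<delta>" unfolding \<delta>_def using fin by (subst Min_gr_iff) auto
  have \<delta>1: "\<delta> \<le> 1" unfolding \<delta>_def using fin by (intro Min_le) auto
  have \<delta>S: "\<delta> \<le> ?S n - t" if "n \<in> ?N" for n unfolding \<delta>_def using fin that by (intro Min_le) auto
  have "ctsrw E d x \<omega> r = ctsrw E d x \<omega> t" if r: "t \<le> r" "r < t + \<delta>" for r
  proof -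
    have "?S n \<le> r \<longleftrightarrow> ?S n \<le> t" for n
    proof
      assume n: "?S n \<le> r"
      show "?S n \<le> t"
      proof (rule ccontr)
        assume "\<not> ?S n \<le> t"
        then have "n \<in> ?N" using n r \<delta>1 by simp
        from \<delta>S[OF this] show False using n r by simp
      qed
    qed (use r in simp)
    then have "jump_count \<omega> r = jump_count \<omega> t" unfolding jump_count_def by simp
    then show ?thesis unfolding ctsrw_def by simp
  qed
  then show ?thesis using \<delta>0 by blast
qed

context stirring_graph
begin

definition diag :: "'v \<times> 'v \<Rightarrow> real" where "diag p = of_bool (fst p = snd p)"

lemma bnd_diag: "bnd 1 diag" by (simp add: bnd_def diag_def)

text \<open>A source of strength 2 on the diagonal is dominated by evolving the multiple exp(2t)-1
  of \<open>diag\<close>: the pair stays put up to time s with probability at least exp(-2s), so the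
  growth 2 exp(2s) of the factor covers the source.\<close>

lemma heat_bound:
  assumes q: "\<And>t p. 0 \<le> t \<Longrightarrow> \<bar>q t p\<bar> \<le> B"
    and der: "\<And>t p. 0 \<le> t \<Longrightarrow> ((\<lambda>s. q s p) has_real_derivative q' t p) (at t within {0..})"
    and ineq: "\<And>t p. 0 \<le> t \<Longrightarrow> q' t p \<le> pairop (q t) p + 2 * diag p"
    and t: "0 \<le> t"
  shows "q t p \<le> sgrp pairop t (\<lambda>p. q 0 p + (exp (2 * t) - 1) * diag p) p"
proof -
  have q0: "bnd B (q 0)" using q[of 0] by (simp add: bnd_def)
  have B: "0 \<le> B" by (rule bnd_nonneg[OF q0])
  let ?U = "sgrp pairop"
  have L: "jump_op 2 pairop" by (rule jump_pairop)
  define w where "w s p = ?U s (q 0) p + (exp (2 * s) - 1) * ?U s diag p - q s p" for s p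
  define w' where "w' s p = pairop (?U s (q 0)) p + ((exp (2 * s) - 1) * pairop (?U s diag) p + 2 * exp (2 * s) * ?U s diag p) - q' s p" for s p
  have "0 \<le> w t p"
  proof (rule jump_supersolution_nonneg[OF L, of t "2 * B" w UNIV w' t p])
    fix s p assume s: "0 \<le> s" "s \<le> t"
    have "0 \<le> ?U s diag p" by (rule sgrp_nonneg[OF L bnd_diag _ s(1)]) (simp add: diag_def)
    then have "0 \<le> (exp (2 * s) - 1) * ?U s diag p" using s by (intro mult_nonneg_nonneg) auto
    then show "- (2 * B) \<le> w s p"
      using q[OF s(1), of p] bndD[OF sgrp_bnd[OF L q0 s(1)], of p] unfolding w_def by linarith
    show "((\<lambda>s. w s p) has_real_derivative w' s p) (at s within {0..})"
      unfolding w_def w'_def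
      by (rule derivative_eq_intros sgrp_deriv'[OF L q0] sgrp_deriv'[OF L bnd_diag] der[OF s(1)] refl | simp)+
    have "exp (- 2 * s) * diag p \<le> ?U s diag p" by (rule sgrp_ge_exp[OF L bnd_diag _ s(1)]) (simp add: diag_def)
    then have "exp (2 * s) * (exp (- 2 * s) * diag p) \<le> exp (2 * s) * ?U s diag p" by (intro mult_left_mono) auto
    then have e: "2 * diag p \<le> 2 * exp (2 * s) * ?U s diag p" by (simp add: mult.assoc[symmetric] exp_add[symmetric])
    have "pairop (w s) p = pairop (?U s (q 0)) p + (exp (2 * s) - 1) * pairop (?U s diag) p - pairop (q s) p"
      unfolding w_def[abs_def] by (simp only: jump_op_diff[OF L] jump_op_add[OF L] jump_op_cmult[OF L])
    then show "pairop (w s) p \<le> w' s p" unfolding w'_def using e ineq[OF s(1), of p] by linarith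
  qed (use t in \<open>auto simp: w_def\<close>)
  moreover have "?U t (\<lambda>p. q 0 p + (exp (2 * t) - 1) * diag p) p = ?U t (q 0) p + (exp (2 * t) - 1) * ?U t diag p"
    using sgrp_linear[OF L q0 bnd_diag, of t 1 "exp (2 * t) - 1" p] by simp
  ultimately show ?thesis unfolding w_def by simp
qed

text \<open>Writing both generators move by move allows their comparison neighbour by neighbour;
  they differ only where a particle meets the other.\<close>

lemma pairop_set:
  assumes xz: "x \<noteq> z"
  shows "pairop g (x, z) - dualop 2 b {x, z} = (\<Sum>y\<in>nb x. 1 / d * (g (y, z) - g (x, z)) - \<rho> {x, z} y * (b {y, z} - b {x, z}))
     + (\<Sum>y\<in>nb z. 1 / d * (g (x, y) - g (x, z)) - \<rho> {x, z} y * (b {y, x} - b {x, z}))"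
  unfolding dualop_pair[OF xz] by (simp add: pairop_def pairL_def pairR_def rwop_def sum_subtractf)

text \<open>Independent walks reach the diagonal at least as fast as dual particles coalesce, so off
  the diagonal \<open>cp\<close> is a subsolution for them; on it \<open>cp\<close> is 1 and the
  exit rate 2 acts as a source. Over a unit of time \<open>heat_bound\<close> turns the source into
  the value exp 2 on the diagonal, and exp 2 times the probability of a collision at integer times
  satisfies the matching recursion.\<close>

lemma h_le_collision:
  "h {x, y} \<le> exp 2 * (1 - avoid 1 UNIV (x, y))"
proof -
  define e where "e p = 1 - avoid 1 UNIV p" for p
  define c where "c t p = cp t {fst p, snd p}" for t p
  have e0: "0 \<le> e p" "e p \<le> 1" for p
    using avoid_nonneg[of 1 UNIV p] bndD[OF avoid_bnd, of 1 UNIV p] by (auto simp: e_def)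
  have be: "bnd 1 e" using e0 by (simp add: bnd_def)
  have ediag: "e (x, x) = 1" for x using avoid_diag[of UNIV 1 x] by (simp add: e_def)
  have eoff: "e p = sgrp pairop 1 e p" if "fst p \<noteq> snd p" for p
  proof -
    have "insert 0 (Suc ` UNIV) = (UNIV :: nat set)" by (auto intro: nat.exhaust simp: image_iff)
    then have "avoid 1 UNIV p = sgrp pairop 1 (avoid 1 UNIV) p"
      using avoid_off[OF that, of 1 UNIV] by simp
    then show ?thesis
      using sgrp_diff[OF jump_pairop bndI_const[of 1] avoid_bnd, of 1 1 UNIV p] sgrp_const[OF jump_pairop, of 1 1 p]
      unfolding e_def[abs_def] by simp
  qed
  have c01: "0 \<le> c t p" "c t p \<le> 1" if "0 \<le> t" for t p using cp_nonneg[OF that] cp_le_1[OF that] by (auto simp: c_def)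
  have bc: "bnd 1 (c t)" if "0 \<le> t" for t using c01[OF that] by (simp add: bnd_def)
  have cd: "c t (x, x) = 1" if "0 \<le> t" for t x using cp_1[OF that, of "{x}"] by (simp add: c_def)
  have step: "c (real k + 1) p \<le> sgrp pairop 1 (\<lambda>p. c (real k) p + (exp 2 - 1) * diag p) p" for k p
  proof -
    let ?q' = "\<lambda>t p. dualop 2 (cp (real k + t)) {fst p, snd p}"
    have "c (real k + 1) p \<le> sgrp pairop 1 (\<lambda>p. c (real k + 0) p + (exp (2 * 1) - 1) * diag p) p"
    proof (rule heat_bound[of "\<lambda>t. c (real k + t)" 1 ?q'])
      show "\<bar>c (real k + t) p\<bar> \<le> 1" if "0 \<le> t" for t p using c01[of "real k + t" p] that by simp
      show "((\<lambda>s. c (real k + s) p) has_real_derivative ?q' t p) (at t within {0..})" if "0 \<le> t" for t p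
      proof -
        have "((\<lambda>r. cp r {fst p, snd p}) has_real_derivative ?q' t p) (at (t + real k))"
          using sgrp_deriv'[OF jump_dualop bnd_of_bool, of 2 "\<lambda>B. card B \<le> 1" "{fst p, snd p}" "t + real k" UNIV]
          by (simp add: cp_def add.commute)
        then have "((\<lambda>r. cp (r + real k) {fst p, snd p}) has_real_derivative ?q' t p) (at t)" by (simp add: DERIV_shift)
        then show ?thesis unfolding c_def by (simp add: add.commute) (rule DERIV_subset, auto)
      qed
      show "?q' t p \<le> pairop (c (real k + t)) p + 2 * diag p" if t: "0 \<le> t" for t p
      proof -
        obtain x z where p: "p = (x, z)" by (cases p)
        define r where "r = real k + t"
        have r: "0 \<le> r" using t by (simp add: r_def)
        show ?thesis
        proof (cases "x = z")
          case True
          have "dualop 2 (cp r) {x} = 0"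
          proof -
            have "\<rho> {x} (snd m) * (cp r (insert (snd m) ({x} - {fst m})) - cp r {x}) = 0" if "m \<in> smoves {x}" for m
              using that cp_1[OF r, of "{snd m}"] cp_1[OF r, of "{x}"] by (auto simp: smoves_def)
            then have "(\<Sum>m\<in>smoves {x}. \<rho> {x} (snd m) * (cp r (insert (snd m) ({x} - {fst m})) - cp r {x})) = 0"
              by (intro sum.neutral ballI)
            then show ?thesis by (simp add: dualop_def)
          qed
          moreover have "- 2 * c r p - 2 * 0 \<le> pairop (c r) p"
            using jump_op_le[OF jump_pairop, of 0 "c r" p] c01[OF r] by simp
          ultimately show ?thesis using True cd[OF r, of x] by (simp add: p r_def[symmetric] diag_def)
        next
          case False
          have "0 \<le> pairop (c r) (x, z) - dualop 2 (cp r) {x, z}"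
            unfolding pairop_set[OF False]
          proof (intro add_nonneg_nonneg sum_nonneg)
            have le: "\<theta> / d * (1 - cp r {x, z}) \<le> 1 / d * (1 - cp r {x, z})"
              using \<theta> d0 cp_le_1[OF r, of "{x, z}"] by (intro mult_right_mono divide_right_mono) auto
            fix y
            show "0 \<le> 1 / d * (c r (y, z) - c r (x, z)) - \<rho> {x, z} y * (cp r {y, z} - cp r {x, z})" if "y \<in> nb x"
              using that le cp_1[OF r, of "{z}"] by (cases "y = z") (auto simp: c_def \<rho>_def)
            show "0 \<le> 1 / d * (c r (x, y) - c r (x, z)) - \<rho> {x, z} y * (cp r {y, x} - cp r {x, z})" if "y \<in> nb z"
              using that le cp_1[OF r, of "{x}"] by (cases "y = x") (auto simp: c_def \<rho>_def insert_commute)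
          qed
          then show ?thesis using False by (simp add: p r_def[symmetric] diag_def)
        qed
      qed
    qed simp
    then show ?thesis by simp
  qed
  have ee: "1 \<le> exp (2 :: real)" by simp
  have main: "c (real k) p \<le> exp 2 * e p" for k p
  proof (induction k arbitrary: p)
    case 0
    show ?case
    proof (cases "fst p = snd p")
      case True
      then have "e p = 1" using ediag[of "fst p"] by (cases p) simp
      then show ?thesis using order_trans[OF c01(2)[of 0 p] ee] by simp
    next
      case False
      then have "c 0 p = 0" by (simp add: c_def cp_0)
      then show ?thesis using e0(1)[of p] by simp
    qed
  next
    case (Suc k)
    show ?case
    proof (cases "fst p = snd p")
      case True
      then have "e p = 1" using ediag[of "fst p"] by (cases p) simp
      then show ?thesis using order_trans[OF c01(2)[of "real (Suc k)" p] ee] by simp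
    next
      case False
      have "c (real (Suc k)) p \<le> sgrp pairop 1 (\<lambda>p. c (real k) p + (exp 2 - 1) * diag p) p"
        using step[of k p] by (simp add: add.commute)
      also have "\<dots> \<le> sgrp pairop 1 (\<lambda>p. exp 2 * e p) p"
      proof (rule sgrp_mono[OF jump_pairop])
        show "bnd (1 + (exp 2 - 1)) (\<lambda>p. c (real k) p + (exp 2 - 1) * diag p)"
          unfolding bnd_def
        proof
          fix p
          show "\<bar>c (real k) p + (exp 2 - 1) * diag p\<bar> \<le> 1 + (exp 2 - 1)"
            using c01[of "real k" p] order_trans[OF c01(2)[of "real k" p] ee] by (cases "fst p = snd p") (simp_all add: diag_def)
        qed
        show "bnd (exp 2) (\<lambda>p. exp 2 * e p)" using e0 by (simp add: bnd_def abs_mult)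
        show "c (real k) p + (exp 2 - 1) * diag p \<le> exp 2 * e p" for p
        proof (cases "fst p = snd p")
          case True
          then have "e p = 1" "c (real k) p = 1" using ediag[of "fst p"] cd[of "real k" "fst p"] by (cases p, simp)+
          then show ?thesis using True by (simp add: diag_def)
        qed (use Suc[of p] in \<open>simp add: diag_def\<close>)
      qed simp
      also have "\<dots> = exp 2 * e p" using sgrp_cmult[OF jump_pairop be, of 1 "exp 2" p] eoff[OF False] by simp
      finally show ?thesis .
    qed
  qed
  have "h {x, y} \<le> exp 2 * e (x, y)"
    by (rule LIMSEQ_le_const2[OF cp_LIMSEQ]) (use main[of _ "(x, y)"] in \<open>auto simp: c_def\<close>)
  then show ?thesis by (simp add: e_def)
qed

text \<open>After evolution for time m, the bound of \<open>h_le_collision\<close> involves only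
  collisions at the times m, m+1 and so on, whose probability tends to zero when the walks
  eventually stay apart.\<close>

theorem finite_collision_vanishes:
  assumes fc: "finite_collision E d"
  shows "(\<lambda>m. sgrp pairop (real m) (\<lambda>p. h {fst p, snd p}) (x, y)) \<longlonglongrightarrow> 0"
proof -
  interpret Q: prob_space \<Omega>2 by (rule prob_\<Omega>2)
  let ?U = "\<lambda>m. sgrp pairop (real m)"
  let ?I = "\<lambda>m \<omega>. of_bool (\<forall>k\<in>UNIV. ctsrw E d x (fst \<omega>) (real m + 1 * real k) \<noteq> ctsrw E d y (snd \<omega>) (real m + 1 * real k)) :: real"
  have "(\<lambda>m. \<integral>\<omega>. ?I m \<omega> \<partial>\<Omega>2) \<longlonglongrightarrow> (\<integral>\<omega>. 1 \<partial>\<Omega>2)"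
  proof (rule integral_dominated_convergence[where w = "\<lambda>_. 1"])
    show "?I m \<in> borel_measurable \<Omega>2" for m by (rule avoid_measurable)
    have "AE \<omega> in \<Omega>2. \<exists>s>0. \<forall>t\<ge>s. ctsrw E d x (fst \<omega>) t \<noteq> ctsrw E d y (snd \<omega>) t"
      using fc unfolding finite_collision_def by blast
    then show "AE \<omega> in \<Omega>2. (\<lambda>m. ?I m \<omega>) \<longlonglongrightarrow> 1"
    proof eventually_elim
      case (elim \<omega>)
      then obtain s where s: "\<forall>t\<ge>s. ctsrw E d x (fst \<omega>) t \<noteq> ctsrw E d y (snd \<omega>) t" by blast
      have "\<forall>\<^sub>F m in sequentially. s \<le> real m"
        using filterlim_real_sequentially unfolding filterlim_at_top by blast
      then have "\<forall>\<^sub>F m in sequentially. ?I m \<omega> = 1" by eventually_elim (use s in auto)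
      then show ?case by (rule tendsto_eventually)
    qed
  qed auto
  then have av: "(\<lambda>m. ?U m (avoid 1 UNIV) (x, y)) \<longlonglongrightarrow> 1"
    by (simp only: avoid_shift of_nat_0_le_iff zero_le_one) (simp add: Q.prob_space)
  have hc: "h {fst p, snd p} \<le> exp 2 * (1 - avoid 1 UNIV p)" for p
    using h_le_collision[of "fst p" "snd p"] by simp
  have b1: "bnd (exp 2) (\<lambda>p. exp 2 * (1 - avoid 1 UNIV p))"
    using avoid_nonneg[of 1 UNIV] bndD[OF avoid_bnd, of 1 UNIV] by (auto simp: bnd_def abs_mult abs_le_iff)
  have b2: "bnd 1 (\<lambda>p::'v \<times> 'v. h {fst p, snd p})" using h_nonneg h_le_1 by (simp add: bnd_def)
  have b3: "bnd 1 (\<lambda>p. 1 - avoid 1 UNIV p)"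
    using avoid_nonneg[of 1 UNIV] bndD[OF avoid_bnd, of 1 UNIV] by (auto simp: bnd_def abs_le_iff)
  have eq: "?U m (\<lambda>p. exp 2 * (1 - avoid 1 UNIV p)) (x, y) = exp 2 * (1 - ?U m (avoid 1 UNIV) (x, y))" for m
    using sgrp_cmult[OF jump_pairop b3, of "real m" "exp 2" "(x, y)"]
      sgrp_diff[OF jump_pairop bndI_const[of 1] avoid_bnd, of "real m" 1 UNIV "(x, y)"] sgrp_const[OF jump_pairop, of "real m" 1 "(x, y)"]
    by simp
  show ?thesis
  proof (rule tendsto_sandwich[OF _ _ tendsto_const])
    show "\<forall>\<^sub>F m in sequentially. 0 \<le> ?U m (\<lambda>p. h {fst p, snd p}) (x, y)"
      by (intro always_eventually allI sgrp_nonneg[OF jump_pairop b2]) (simp_all add: h_nonneg)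
    show "\<forall>\<^sub>F m in sequentially. ?U m (\<lambda>p. h {fst p, snd p}) (x, y) \<le> exp 2 * (1 - ?U m (avoid 1 UNIV) (x, y))"
      unfolding eq[symmetric]
      by (intro always_eventually allI sgrp_mono[OF jump_pairop b2 b1] hc) simp
    have "(\<lambda>m. exp 2 * (1 - ?U m (avoid 1 UNIV) (x, y))) \<longlonglongrightarrow> exp 2 * (1 - 1)" by (intro tendsto_intros av)
    then show "(\<lambda>m. exp 2 * (1 - ?U m (avoid 1 UNIV) (x, y))) \<longlonglongrightarrow> 0" by simp
  qed
qed

text \<open>If failure to coalesce never has probability above \<open>M\<close>, then once the walks
  meet it is at most (1-\<theta>)M: the attempt succeeds with probability \<open>\<theta>\<close>,
  and otherwise the pair starts afresh. The other two terms are the cost of noticing meetings only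
  on a grid of mesh \<open>\<epsilon>\<close> and of not meeting at its first points.\<close>

lemma coalescence_improve:
  assumes M: "0 \<le> M" "M \<le> 1" and g: "\<And>x y. 1 - h {x, y} \<le> M" and xy: "x \<noteq> y" and \<epsilon>: "0 \<le> \<epsilon>"
  shows "1 - h {x, y} \<le> (1 - \<theta>) * M + (exp (2 * \<epsilon>) - 1) + M * avoid \<epsilon> {..n} (x, y)"
proof -
  define c where "c = (1 - \<theta>) * M"
  have c: "0 \<le> c" "c \<le> 1" using M \<theta> unfolding c_def by (auto intro: mult_le_one)
  define k where "k = exp (2 * \<epsilon>) - 1"
  have k: "0 \<le> k" using \<epsilon> by (simp add: k_def)
  \<comment> \<open>On the diagonal the value is the bound that holds after an attempt. With this
    choice, harmonicity of \<open>h\<close> makes \<open>G\<close> a subsolution for independent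
    walks up to the source of \<open>heat_bound\<close>, to be used with a time-independent
    function.\<close>
  define G where "G p = (if fst p = snd p then c else 1 - h {fst p, snd p})" for p
  have G0: "0 \<le> G p" "G p \<le> 1" for p using c h_nonneg h_le_1 by (auto simp: G_def)
  have GM: "G p \<le> M" if "fst p \<noteq> snd p" for p using g that by (simp add: G_def)
  have bG: "bnd 1 G" using G0 by (simp add: bnd_def)
  have super: "0 \<le> pairop G p + 2 * diag p" for p
  proof -
    obtain x z where p: "p = (x, z)" by (cases p)
    show ?thesis
    proof (cases "x = z")
      case True
      have "- 2 * G p - 2 * 0 \<le> pairop G p" using jump_op_le[OF jump_pairop, of 0 G p] G0 by simp
      then show ?thesis using G0(2)[of p] True by (simp add: p diag_def)
    next
      case False
      let ?b = "\<lambda>B. 1 - h B"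
      have "dualop 2 ?b {x, z} = 0"
        using jump_op_diff[OF jump_dualop, of 2 "\<lambda>_. 1" h "{x, z}"] jump_op_const[OF jump_dualop, of 2 1 "{x, z}"] h_harmonic[of "{x, z}"] by simp
      moreover have "0 \<le> pairop G (x, z) - dualop 2 ?b {x, z}"
        unfolding pairop_set[OF False]
      proof (intro add_nonneg_nonneg sum_nonneg)
        have "(1 - \<theta>) * G (x, z) \<le> c" using GM[of "(x, z)"] False \<theta> unfolding c_def by (intro mult_left_mono) auto
        then have "0 \<le> 1 / d * (c - (1 - \<theta>) * G (x, z))" using d0 by simp
        then have le: "0 \<le> 1 / d * (c - G (x, z)) - \<theta> / d * (0 - G (x, z))" by (simp add: algebra_simps diff_divide_distrib add_divide_distrib)
        fix y
        show "0 \<le> 1 / d * (G (y, z) - G (x, z)) - \<rho> {x, z} y * (?b {y, z} - ?b {x, z})" if "y \<in> nb x"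
        proof (cases "y = z")
          case True
          then show ?thesis using le False h_1[of "{z}"] by (simp add: G_def \<rho>_def)
        next
          case False
          moreover have "y \<noteq> x" using that by auto
          ultimately show ?thesis using \<open>x \<noteq> z\<close> by (simp add: G_def \<rho>_def)
        qed
        show "0 \<le> 1 / d * (G (x, y) - G (x, z)) - \<rho> {x, z} y * (?b {y, x} - ?b {x, z})" if "y \<in> nb z"
        proof (cases "y = x")
          case True
          then show ?thesis using le False h_1[of "{x}"] by (simp add: G_def \<rho>_def)
        next
          case False
          moreover have "y \<noteq> z" using that by auto
          ultimately show ?thesis using \<open>x \<noteq> z\<close> by (simp add: G_def \<rho>_def insert_commute)
        qed
      qed
      ultimately show ?thesis by (simp add: p diag_def False)
    qed
  qed
  have heat: "G p \<le> sgrp pairop \<epsilon> (\<lambda>p. G p + k * diag p) p" for p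
    unfolding k_def
    by (rule heat_bound[of "\<lambda>_. G" 1 "\<lambda>_ _. 0", OF _ _ _ \<epsilon>]) (use G0 super in auto)
  have main: "G p \<le> c + k + M * avoid \<epsilon> {..n} p" if "fst p \<noteq> snd p" for p
    using that
  proof (induction n arbitrary: p)
    case 0
    have "avoid \<epsilon> {..0} p = avoid \<epsilon> (insert 0 (Suc ` {})) (fst p, snd p)" by simp
    also have "\<dots> = sgrp pairop \<epsilon> (avoid \<epsilon> {}) (fst p, snd p)" by (rule avoid_off[OF 0 \<epsilon>])
    also have "avoid \<epsilon> {} = (\<lambda>_. 1)" using prob_space.prob_space[OF prob_\<Omega>2] by (auto simp: avoid_def)
    finally have "avoid \<epsilon> {..0} p = 1" by (simp add: sgrp_const[OF jump_pairop])
    then show ?case using GM[OF 0] c k by simp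
  next
    case (Suc n)
    let ?R = "\<lambda>p. (c + k) * 1 + M * avoid \<epsilon> {..n} p"
    have "G p \<le> sgrp pairop \<epsilon> (\<lambda>p. G p + k * diag p) p" by (rule heat)
    also have "\<dots> \<le> sgrp pairop \<epsilon> ?R p"
    proof (rule sgrp_mono[OF jump_pairop _ _ _ \<epsilon>])
      show "bnd (1 + k) (\<lambda>p. G p + k * diag p)" 
        unfolding bnd_def
      proof
        fix p
        show "\<bar>G p + k * diag p\<bar> \<le> 1 + k" using G0[of p] k by (cases "fst p = snd p") (simp_all add: diag_def)
      qed
      show "bnd (c + k + M) ?R" unfolding bnd_def
      proof
        fix p
        have "0 \<le> M * avoid \<epsilon> {..n} p" "M * avoid \<epsilon> {..n} p \<le> M * 1"
          using M avoid_nonneg[of \<epsilon> "{..n}" p] bndD[OF avoid_bnd, of \<epsilon> "{..n}" p] mult_left_mono[of "avoid \<epsilon> {..n} p" 1 M] by simp_all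
        then show "\<bar>?R p\<bar> \<le> c + k + M" using c k by (simp add: abs_le_iff)
      qed
      show "G p + k * diag p \<le> ?R p" for p
      proof (cases "fst p = snd p")
        case True
        have "0 \<le> M * avoid \<epsilon> {..n} p" using M avoid_nonneg by simp
        then show ?thesis using True by (simp add: G_def diag_def)
      next
        case False
        then show ?thesis using Suc.IH[OF False] by (simp add: diag_def)
      qed
    qed
    also have "\<dots> = (c + k) + M * sgrp pairop \<epsilon> (avoid \<epsilon> {..n}) p"
      using sgrp_linear[OF jump_pairop bndI_const[of 1] avoid_bnd, of \<epsilon> "c + k" M \<epsilon> "{..n}" p] by (simp add: sgrp_const[OF jump_pairop])
    also have "sgrp pairop \<epsilon> (avoid \<epsilon> {..n}) p = avoid \<epsilon> {..Suc n} p"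
    proof -
      have "insert 0 (Suc ` {..n}) = {..Suc n}" by (simp add: atMost_Suc_eq_insert_0)
      then show ?thesis using avoid_off[OF Suc.prems \<epsilon>, of "{..n}"] by simp
    qed
    finally show ?case .
  qed
  show ?thesis using main[of "(x, y)"] xy by (simp add: G_def c_def k_def)
qed

text \<open>With mesh 2^(-m) and 4^m steps the mesh tends to zero while the horizon 2^m grows
  without bound. A collision lasts for a positive time, so eventually the grid sees it.\<close>

lemma inf_collision_avoid:
  assumes ic: "inf_collision E d"
  shows "(\<lambda>m. avoid ((1 / 2) ^ m) {..4 ^ m} (x, y)) \<longlonglongrightarrow> 0"
proof -
  interpret Q: prob_space \<Omega>2 by (rule prob_\<Omega>2)
  let ?I = "\<lambda>m \<omega>. of_bool (\<forall>k\<in>{..4 ^ m}. ctsrw E d x (fst \<omega>) ((1 / 2) ^ m * real k) \<noteq> ctsrw E d y (snd \<omega>) ((1 / 2) ^ m * real k)) :: real"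
  have "(\<lambda>m. \<integral>\<omega>. ?I m \<omega> \<partial>\<Omega>2) \<longlonglongrightarrow> (\<integral>\<omega>. 0 \<partial>\<Omega>2)"
  proof (rule integral_dominated_convergence[where w = "\<lambda>_. 1"])
    show "?I m \<in> borel_measurable \<Omega>2" for m by (rule avoid_measurable)
    have "AE \<omega> in \<Omega>2. \<forall>s>0. \<exists>t\<ge>s. ctsrw E d x (fst \<omega>) t = ctsrw E d y (snd \<omega>) t"
      using ic unfolding inf_collision_def by blast
    then show "AE \<omega> in \<Omega>2. (\<lambda>m. ?I m \<omega>) \<longlonglongrightarrow> 0" using good2_AE
    proof eventually_elim
      case (elim \<omega>)
      obtain t where t: "1 \<le> t" "ctsrw E d x (fst \<omega>) t = ctsrw E d y (snd \<omega>) t"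
        using elim(1)[rule_format, of 1] by auto
      obtain \<delta>1 where 1: "0 < \<delta>1" "\<forall>r. t \<le> r \<longrightarrow> r < t + \<delta>1 \<longrightarrow> ctsrw E d x (fst \<omega>) r = ctsrw E d x (fst \<omega>) t"
        using ctsrw_right_constant[of "fst \<omega>" t E d x] elim(2) by blast
      obtain \<delta>2 where 2: "0 < \<delta>2" "\<forall>r. t \<le> r \<longrightarrow> r < t + \<delta>2 \<longrightarrow> ctsrw E d y (snd \<omega>) r = ctsrw E d y (snd \<omega>) t"
        using ctsrw_right_constant[of "snd \<omega>" t E d y] elim(2) by blast
      have lim0: "(\<lambda>m. (1 / 2 :: real) ^ m) \<longlonglongrightarrow> 0" by (rule LIMSEQ_power_zero) simp
      have "\<forall>\<^sub>F m in sequentially. (1 / 2 :: real) ^ m < min \<delta>1 \<delta>2"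
        using order_tendstoD(2)[OF lim0, of "min \<delta>1 \<delta>2"] 1(1) 2(1) by simp
      moreover have "\<forall>\<^sub>F m in sequentially. t + 1 \<le> 2 ^ m"
      proof -
        obtain N where N: "t + 1 \<le> real N" using real_arch_simple by blast
        have "t + 1 \<le> 2 ^ m" if "N \<le> m" for m
        proof -
          have "real N \<le> real m" using that by simp
          moreover have "real m < 2 ^ m" using less_exp[of m] by (metis of_nat_less_iff of_nat_numeral of_nat_power)
          ultimately show ?thesis using N by linarith
        qed
        then show ?thesis unfolding eventually_sequentially by blast
      qed
      ultimately have "\<forall>\<^sub>F m in sequentially. ?I m \<omega> = 0"
      proof eventually_elim
        case (elim m)
        define e where "e = (1 / 2 :: real) ^ m"
        have e: "0 < e" "e \<le> 1" "e * 2 ^ m = 1" by (auto simp: e_def power_one_over power_le_one)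
        \<comment> \<open>Index of the first grid point not before the collision time.\<close>
        define k where "k = nat \<lceil>t / e\<rceil>"
        have te: "0 \<le> t / e" using t e by simp
        have rk: "real k = of_int \<lceil>t / e\<rceil>" unfolding k_def using te by simp
        have k1: "t / e \<le> real k" "real k < t / e + 1" unfolding rk by linarith+
        have b: "t \<le> e * real k" "e * real k < t + e" using k1 e by (auto simp: field_simps)
        have "real k \<le> 4 ^ m"
        proof -
          have "real k = (e * real k) * 2 ^ m" using e by simp
          also have "\<dots> \<le> 2 ^ m * 2 ^ m" using b e elim(2) by (intro mult_right_mono) auto
          finally show ?thesis by (simp add: power_mult_distrib[symmetric])
        qed
        then have "real k \<le> real (4 ^ m)" by simp
        then have "k \<in> {..4 ^ m}" by (simp only: of_nat_le_iff atMost_iff)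
        moreover have "ctsrw E d x (fst \<omega>) (e * real k) = ctsrw E d y (snd \<omega>) (e * real k)"
          using 1(2)[rule_format, of "e * real k"] 2(2)[rule_format, of "e * real k"] b elim(1) t(2) unfolding e_def[symmetric] by simp
        ultimately have "\<not> (\<forall>k\<in>{..4 ^ m}. ctsrw E d x (fst \<omega>) (e * real k) \<noteq> ctsrw E d y (snd \<omega>) (e * real k))" by blast
        then show ?case unfolding e_def by (simp only: of_bool_eq simp_thms)
      qed
      then show ?case by (rule tendsto_eventually)
    qed
  qed auto
  then show ?thesis unfolding avoid_def fst_conv snd_conv by (simp only: Bochner_Integration.integral_zero)
qed

text \<open>Refining the grid gains a factor 1-\<theta> in any uniform bound on failure to coalesce;
  starting from 1, iteration brings the bound to zero.\<close>

theorem inf_collision_coalesce: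
  assumes ic: "inf_collision E d"
  shows "h {x, y} = 1"
proof (cases "x = y")
  case False
  have imp: "1 - h {x, y} \<le> (1 - \<theta>) * M" if M: "0 \<le> M" "M \<le> 1" and g: "\<And>x y. 1 - h {x, y} \<le> M" for M x y
  proof (cases "x = y")
    case True then show ?thesis using h_1[of "{x}"] M \<theta> by simp
  next
    case False
    have pz: "(\<lambda>m. (1 / 2 :: real) ^ m) \<longlonglongrightarrow> 0" by (rule LIMSEQ_power_zero) simp
    have "(\<lambda>m. (1 - \<theta>) * M + (exp (2 * (1 / 2) ^ m) - 1) + M * avoid ((1 / 2) ^ m) {..4 ^ m} (x, y)) \<longlonglongrightarrow> (1 - \<theta>) * M + (exp (2 * 0) - 1) + M * 0"
      by (intro tendsto_intros pz inf_collision_avoid[OF ic])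
    then have "1 - h {x, y} \<le> (1 - \<theta>) * M + (exp (2 * 0) - 1) + M * 0"
      by (rule LIMSEQ_le_const) (intro exI[of _ 0] allI impI coalescence_improve[OF M g False], simp)
    then show ?thesis by simp
  qed
  have pow: "1 - h {x, y} \<le> (1 - \<theta>) ^ n" for n x y
  proof (induction n arbitrary: x y)
    case 0 then show ?case using h_nonneg by simp
  next
    case (Suc n)
    have "0 \<le> (1 - \<theta>) ^ n" "(1 - \<theta>) ^ n \<le> 1" using \<theta> by (simp_all add: power_le_one)
    from imp[OF this Suc] show ?case by simp
  qed
  have "(\<lambda>n. (1 - \<theta>) ^ n) \<longlonglongrightarrow> 0" using \<theta> by (intro LIMSEQ_power_zero) auto
  then have "1 - h {x, y} \<le> 0" by (rule LIMSEQ_le_const) (intro exI[of _ 0] allI impI pow)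
  then show ?thesis using h_le_1[of "{x, y}"] by simp
qed (simp add: h_1)

section \<open>Tail triviality\<close>

lemma path_fun_measurable: "(\<lambda>w :: nat \<Rightarrow> 'v. f (w k) :: real) \<in> borel_measurable path_space"
  by (rule measurable_compose[OF measurable_component_singleton[OF UNIV_I]]) simp

lemma ctsrw_fun_measurable: "(\<lambda>\<omega>. f (ctsrw E d z \<omega> t) :: real) \<in> borel_measurable (rw_space d)"
  by (rule measurable_compose[OF ctsrw_measurable]) simp

text \<open>The Markov property for the product of two observations at distance \<open>r\<close>; it
  feeds the covariances of the reverse martingale below.\<close>

lemma rw_expect_two:
  assumes \<psi>: "bnd B \<psi>" and \<phi>: "bnd C \<phi>" and s: "0 \<le> s" and r: "0 \<le> r"
  shows "(\<integral>\<omega>. \<psi> (ctsrw E d x \<omega> s) * \<phi> (ctsrw E d x \<omega> (s + r)) \<partial>rw_space d) = sgrp rwop s (\<lambda>z. \<psi> z * sgrp rwop r \<phi> z) x"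
proof -
  interpret R: prob_space "rw_space d" by (rule rw_prob[OF d_pos])
  have one: "(\<integral>\<omega>. \<phi> (ctsrw E d z \<omega> r) \<partial>rw_space d) = sgrp rwop r \<phi> z" for z
  proof -
    have "(\<lambda>w :: nat \<Rightarrow> 'v. \<phi> (w 0)) \<in> borel_measurable path_space" by (rule path_fun_measurable)
    moreover have "bnd C (\<lambda>w :: nat \<Rightarrow> 'v. \<phi> (w 0))" using \<phi> by (simp add: bnd_def)
    ultimately have "(\<integral>\<omega>. \<phi> (ctsrw E d z \<omega> (r + 0)) \<partial>rw_space d) = sgrp rwop r (\<lambda>z. \<integral>\<omega>. \<phi> (ctsrw E d z \<omega> 0) \<partial>rw_space d) z"
      using rw_markov[of "\<lambda>w. \<phi> (w 0)" C "\<lambda>_. 0" r z] r by simp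
    also have "(\<lambda>z. \<integral>\<omega>. \<phi> (ctsrw E d z \<omega> 0) \<partial>rw_space d) = \<phi>"
    proof
      fix z
      have "(\<integral>\<omega>. \<phi> (ctsrw E d z \<omega> 0) \<partial>rw_space d) = (\<integral>\<omega>. \<phi> z \<partial>rw_space d)"
      proof (rule integral_cong_AE)
        show "AE \<omega> in rw_space d. \<phi> (ctsrw E d z \<omega> 0) = \<phi> z"
          using rw_good_AE[OF d_pos] by eventually_elim (simp add: ctsrw_0)
      qed (intro ctsrw_fun_measurable borel_measurable_const)+
      then show "(\<integral>\<omega>. \<phi> (ctsrw E d z \<omega> 0) \<partial>rw_space d) = \<phi> z" by (simp add: R.prob_space)
    qed
    finally show ?thesis by simp
  qed
  let ?\<tau> = "\<lambda>j::nat. if j = 0 then 0 else r"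
  have m: "(\<lambda>w :: nat \<Rightarrow> 'v. \<psi> (w 0) * \<phi> (w 1)) \<in> borel_measurable path_space"
    by (intro borel_measurable_times path_fun_measurable)
  have b: "bnd (B * C) (\<lambda>w :: nat \<Rightarrow> 'v. \<psi> (w 0) * \<phi> (w 1))"
    using bndD[OF \<psi>] bndD[OF \<phi>] by (auto simp: bnd_def abs_mult intro!: mult_mono bnd_nonneg[OF \<psi>])
  have "(\<integral>\<omega>. \<psi> (ctsrw E d x \<omega> (s + ?\<tau> 0)) * \<phi> (ctsrw E d x \<omega> (s + ?\<tau> 1)) \<partial>rw_space d)
     = sgrp rwop s (\<lambda>z. \<integral>\<omega>. \<psi> (ctsrw E d z \<omega> (?\<tau> 0)) * \<phi> (ctsrw E d z \<omega> (?\<tau> 1)) \<partial>rw_space d) x"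
    by (rule rw_markov[OF m b _ s]) (use r in simp)
  also have "(\<lambda>z. \<integral>\<omega>. \<psi> (ctsrw E d z \<omega> (?\<tau> 0)) * \<phi> (ctsrw E d z \<omega> (?\<tau> 1)) \<partial>rw_space d) = (\<lambda>z. \<psi> z * sgrp rwop r \<phi> z)"
  proof
    fix z
    have "(\<integral>\<omega>. \<psi> (ctsrw E d z \<omega> (?\<tau> 0)) * \<phi> (ctsrw E d z \<omega> (?\<tau> 1)) \<partial>rw_space d) = (\<integral>\<omega>. \<psi> z * \<phi> (ctsrw E d z \<omega> r) \<partial>rw_space d)"
    proof (rule integral_cong_AE)
      show "AE \<omega> in rw_space d. \<psi> (ctsrw E d z \<omega> (?\<tau> 0)) * \<phi> (ctsrw E d z \<omega> (?\<tau> 1)) = \<psi> z * \<phi> (ctsrw E d z \<omega> r)"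
        using rw_good_AE[OF d_pos] by eventually_elim (simp add: ctsrw_0)
    qed (intro borel_measurable_times ctsrw_fun_measurable borel_measurable_const)+
    also have "\<dots> = \<psi> z * sgrp rwop r \<phi> z" unfolding one[symmetric] by simp
    finally show "(\<integral>\<omega>. \<psi> (ctsrw E d z \<omega> (?\<tau> 0)) * \<phi> (ctsrw E d z \<omega> (?\<tau> 1)) \<partial>rw_space d) = \<psi> z * sgrp rwop r \<phi> z" .
  qed
  finally show ?thesis by simp
qed

lemma rw_expect:
  assumes \<phi>: "bnd C \<phi>" and s: "0 \<le> s"
  shows "(\<integral>\<omega>. \<phi> (ctsrw E d x \<omega> s) \<partial>rw_space d) = sgrp rwop s \<phi> x"
  using rw_expect_two[OF bndI_const[of 1] \<phi> order_refl s, of x] by simp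

text \<open>Jump to \<open>y\<close> and stay there: exp(t) times the value at \<open>x\<close>
  grows at least at rate 1/d, because the value at \<open>y\<close> is at least exp(-t).\<close>

lemma rw_adjacent_pos:
  assumes y: "y \<in> nb x" shows "0 < sgrp rwop 1 (\<lambda>z. of_bool (z = y)) x"
proof -
  let ?f = "\<lambda>z. of_bool (z = y) :: real"
  let ?u = "\<lambda>t. sgrp rwop t ?f"
  have f: "bnd 1 ?f" by (rule bnd_of_bool)
  have u0: "0 \<le> ?u t z" if "0 \<le> t" for t z by (rule sgrp_nonneg[OF jump_rwop f _ that]) simp
  have "exp 0 * ?u 0 x - 0 / d \<le> exp 1 * ?u 1 x - 1 / d"
  proof (rule DERIV_nonneg_imp_nondecreasing[of 0 1 "\<lambda>t. exp t * ?u t x - t / d"])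
    fix t :: real assume t: "0 \<le> t" "t \<le> 1"
    have "((\<lambda>t. exp t * ?u t x - t / d) has_real_derivative (exp t * (?u t x + rwop (?u t) x) - 1 / d)) (at t)"
      using d0 by (auto intro!: derivative_eq_intros sgrp_deriv'[OF jump_rwop f] simp: algebra_simps)
    moreover have "0 \<le> exp t * (?u t x + rwop (?u t) x) - 1 / d"
    proof -
      have "?u t x + rwop (?u t) x = (\<Sum>z\<in>nb x. ?u t z) / d"
        using d0 by (simp add: rwop_def sum_subtractf diff_divide_distrib sum_divide_distrib)
      moreover have "?u t y \<le> (\<Sum>z\<in>nb x. ?u t z)" using y by (intro member_le_sum u0[OF t(1)]) auto
      moreover have "exp (- 1 * t) * ?f y \<le> ?u t y" by (rule sgrp_ge_exp[OF jump_rwop f _ t(1)]) simp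
      ultimately have "exp (- t) / d \<le> ?u t x + rwop (?u t) x" using d0 by (simp add: divide_right_mono)
      then have "exp t * (exp (- t) / d) \<le> exp t * (?u t x + rwop (?u t) x)" by (intro mult_left_mono) auto
      then show ?thesis by (simp add: exp_minus)
    qed
    ultimately show "\<exists>z. ((\<lambda>t. exp t * ?u t x - t / d) has_real_derivative z) (at t) \<and> 0 \<le> z" by blast
  qed simp
  moreover have "x \<noteq> y" using y by auto
  ultimately have "1 / d \<le> exp 1 * ?u 1 x" by simp
  then have "0 < exp 1 * ?u 1 x" using d0 by (smt (verit) divide_pos_pos)
  then show ?thesis by (simp add: zero_less_mult_iff)
qed

text \<open>\<^term>\<open>m n\<close> is the conditional probability of \<^term>\<open>X 1 = y\<close> given \<^term>\<open>X (n + 1)\<close>, a reverse martingale.\<close>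

lemma reverse_density:
  fixes x y :: 'v
  defines "p \<equiv> sgrp rwop 1 (\<lambda>z. of_bool (z = y)) x"
  shows "\<exists>m. (\<forall>z. 0 \<le> m z \<and> m z \<le> 1) \<and> (\<forall>\<phi> C. bnd C \<phi> \<longrightarrow>
     sgrp rwop (real n + 1) (\<lambda>z. \<phi> z * m z) x = p * sgrp rwop (real n) \<phi> y)"
proof -
  let ?one = "\<lambda>w z. of_bool (z = w) :: real"
  define a where "a w = p * sgrp rwop (real n) (?one w) y" for w
  define b where "b w = sgrp rwop (real n + 1) (?one w) x" for w
  have p0: "0 \<le> p" unfolding p_def by (rule sgrp_nonneg[OF jump_rwop bnd_of_bool]) simp_all
  have a0: "0 \<le> a w" for w unfolding a_def
    by (intro mult_nonneg_nonneg p0 sgrp_nonneg[OF jump_rwop bnd_of_bool]) simp_all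
  have ab: "a w \<le> b w" for w
  proof -
    let ?g = "sgrp rwop (real n) (?one w)"
    have g0: "0 \<le> ?g z" for z by (rule sgrp_nonneg[OF jump_rwop bnd_of_bool]) simp_all
    have gb: "bnd 1 ?g" by (rule sgrp_bnd[OF jump_rwop bnd_of_bool]) simp
    have "b w = sgrp rwop 1 ?g x"
      unfolding b_def using sgrp_semigroup[OF jump_rwop bnd_of_bool, of "real n" 1 "\<lambda>z. z = w" x] by (simp add: add.commute)
    also have "sgrp rwop 1 (\<lambda>z. ?g y * ?one y z) x \<le> sgrp rwop 1 ?g x"
    proof (rule sgrp_mono[OF jump_rwop _ gb])
      show "bnd 1 (\<lambda>z. ?g y * ?one y z)" using bndD[OF gb, of y] by (simp add: bnd_def)
      show "?g y * ?one y z \<le> ?g z" for z using g0[of z] by simp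
    qed simp
    moreover have "sgrp rwop 1 (\<lambda>z. ?g y * ?one y z) x = ?g y * p"
      unfolding p_def by (rule sgrp_cmult[OF jump_rwop bnd_of_bool])
    ultimately show ?thesis by (simp add: a_def mult.commute)
  qed
  \<comment> \<open>Bayes' formula. Where \<open>b\<close> vanishes so does \<open>a\<close>, hence
    the value 0 there preserves b m = a.\<close>
  define m where "m w = (if b w = 0 then 0 else a w / b w)" for w
  have m01: "0 \<le> m w" "m w \<le> 1" for w
    using a0[of w] ab[of w] by (auto simp: m_def divide_le_eq)
  have bm: "b w * m w = a w" for w using a0[of w] ab[of w] by (auto simp: m_def)
  have "sgrp rwop (real n + 1) (\<lambda>z. \<phi> z * m z) x = p * sgrp rwop (real n) \<phi> y" if \<phi>: "bnd C \<phi>" for \<phi> C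
  proof -
    \<comment> \<open>For functions of finite support the identity follows by linearity; an
      enumeration of the vertices and bounded convergence extend it to bounded functions.\<close>
    obtain e :: "nat \<Rightarrow> 'v" where e: "range e = UNIV"
      using countable_V range_from_nat_into[of "UNIV :: 'v set"] by blast
    let ?S = "\<lambda>k. e ` {..<k}"
    let ?t = "\<lambda>k z. of_bool (z \<in> ?S k) * \<phi> z"
    have fin: "sgrp rwop (real n + 1) (\<lambda>z. ?t k z * m z) x = p * sgrp rwop (real n) (?t k) y" for k
    proof -
      have sums: "sgrp rwop t (\<lambda>z. \<Sum>w\<in>S. c w * ?one w z) x' = (\<Sum>w\<in>S. c w * sgrp rwop t (?one w) x')" if "finite S" for S c t x'
        using that
      proof (induction S)
        case empty then show ?case by (simp add: sgrp_const[OF jump_rwop])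
      next
        case (insert w S)
        have "bnd (\<Sum>w\<in>S. \<bar>c w\<bar>) (\<lambda>z. \<Sum>w\<in>S. c w * ?one w z)" unfolding bnd_def
        proof
          fix z
          have "\<bar>\<Sum>w\<in>S. c w * ?one w z\<bar> \<le> (\<Sum>w\<in>S. \<bar>c w * ?one w z\<bar>)" by (rule sum_abs)
          also have "\<dots> \<le> (\<Sum>w\<in>S. \<bar>c w\<bar>)" by (intro sum_mono) simp
          finally show "\<bar>\<Sum>w\<in>S. c w * ?one w z\<bar> \<le> (\<Sum>w\<in>S. \<bar>c w\<bar>)" .
        qed
        from sgrp_linear[OF jump_rwop bnd_of_bool this, of t "c w" "\<lambda>z. z = w" 1 x']
        show ?case by (simp only: sum.insert[OF insert.hyps(1,2)] insert.IH mult_1_left)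
      qed
      have fS: "finite (?S k)" by simp
      have 1: "(\<lambda>z. ?t k z * m z) = (\<lambda>z. \<Sum>w\<in>?S k. (\<phi> w * m w) * ?one w z)"
      proof
        fix z show "?t k z * m z = (\<Sum>w\<in>?S k. (\<phi> w * m w) * ?one w z)"
          using sum.delta[OF fS, of z "\<lambda>w. \<phi> w * m w"] by (simp add: if_distrib of_bool_def cong: if_cong)
      qed
      have 2: "?t k = (\<lambda>z. \<Sum>w\<in>?S k. \<phi> w * ?one w z)"
      proof
        fix z show "?t k z = (\<Sum>w\<in>?S k. \<phi> w * ?one w z)"
          using sum.delta[OF fS, of z "\<lambda>w. \<phi> w"] by (simp add: if_distrib of_bool_def cong: if_cong)
      qed
      have "sgrp rwop (real n + 1) (\<lambda>z. ?t k z * m z) x = (\<Sum>w\<in>?S k. (\<phi> w * m w) * b w)"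
        unfolding 1 b_def by (rule sums[OF fS])
      also have "\<dots> = (\<Sum>w\<in>?S k. p * (\<phi> w * sgrp rwop (real n) (?one w) y))"
      proof (intro sum.cong refl)
        fix w
        have "(\<phi> w * m w) * b w = \<phi> w * (b w * m w)" by simp
        also have "\<dots> = p * (\<phi> w * sgrp rwop (real n) (?one w) y)" unfolding bm a_def by simp
        finally show "(\<phi> w * m w) * b w = p * (\<phi> w * sgrp rwop (real n) (?one w) y)" .
      qed
      also have "\<dots> = p * sgrp rwop (real n) (?t k) y" unfolding 2 sums[OF fS] sum_distrib_left ..
      finally show ?thesis .
    qed
    have ev: "\<forall>\<^sub>F k in sequentially. z \<in> ?S k" for z
    proof -
      obtain j where "z = e j" using e by (metis rangeE UNIV_I)
      then have "z \<in> ?S k" if "Suc j \<le> k" for k using that by auto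
      then show ?thesis unfolding eventually_sequentially by blast
    qed
    have C: "0 \<le> C" by (rule bnd_nonneg[OF \<phi>])
    have l1: "(\<lambda>k. sgrp rwop (real n + 1) (\<lambda>z. ?t k z * m z) x) \<longlonglongrightarrow> sgrp rwop (real n + 1) (\<lambda>z. \<phi> z * m z) x"
    proof (rule sgrp_tendsto[OF jump_rwop])
      show "bnd C (\<lambda>z. ?t k z * m z)" for k unfolding bnd_def
      proof
        fix z
        have "\<bar>?t k z * m z\<bar> \<le> C * 1" unfolding abs_mult
          using bndD[OF \<phi>, of z] m01[of z] C by (intro mult_mono) auto
        then show "\<bar>?t k z * m z\<bar> \<le> C" by simp
      qed
      show "(\<lambda>k. ?t k z * m z) \<longlonglongrightarrow> \<phi> z * m z" for z
        by (rule tendsto_eventually) (use ev[of z] in eventually_elim, simp)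
    qed
    have l2: "(\<lambda>k. p * sgrp rwop (real n) (?t k) y) \<longlonglongrightarrow> p * sgrp rwop (real n) \<phi> y"
    proof (intro tendsto_mult tendsto_const sgrp_tendsto[OF jump_rwop])
      show "bnd C (?t k)" for k using bndD[OF \<phi>] C by (auto simp: bnd_def)
      show "(\<lambda>k. ?t k z) \<longlonglongrightarrow> \<phi> z" for z
        by (rule tendsto_eventually) (use ev[of z] in eventually_elim, simp)
    qed
    show ?thesis by (rule LIMSEQ_unique[OF l1 l2[folded fin]])
  qed
  then show ?thesis using m01 by (intro exI[of _ m] conjI allI impI) auto
qed

text \<open>A statement about all large indices may forget the finitely many that concern times
  before a given \<open>t\<close>.\<close>

lemma srw_tail_eventually:
  assumes r: "strict_mono (r :: nat \<Rightarrow> nat)"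
  shows "{\<omega> \<in> space (rw_space d). \<exists>N. \<forall>i\<ge>N. ctsrw E d x \<omega> (real (r i) + 1) \<in> W i} \<in> srw_tail_sets E d x"
  unfolding srw_tail_sets_def
proof (rule INT_I)
  fix t :: real assume "t \<in> {0..}"
  let ?Gen = "{{\<omega> \<in> space (rw_space d). ctsrw E d x \<omega> s = y} | s y. s \<ge> t}"
  interpret sigma_algebra "space (rw_space d)" "sigma_sets (space (rw_space d)) ?Gen"
    by (rule sigma_algebra_sigma_sets) auto
  obtain K where K: "t \<le> real K" using real_arch_simple by blast
  have one: "{\<omega> \<in> space (rw_space d). ctsrw E d x \<omega> s \<in> A} \<in> sigma_sets (space (rw_space d)) ?Gen" if "t \<le> s" for s A
  proof -
    have "{\<omega> \<in> space (rw_space d). ctsrw E d x \<omega> s \<in> A} = (\<Union>w\<in>A. {\<omega> \<in> space (rw_space d). ctsrw E d x \<omega> s = w})" by auto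
    also have "\<dots> \<in> sigma_sets (space (rw_space d)) ?Gen"
    proof (rule countable_UN')
      show "countable A" using countable_V by (rule countable_subset[rotated]) simp
      show "(\<lambda>w. {\<omega> \<in> space (rw_space d). ctsrw E d x \<omega> s = w}) ` A \<subseteq> sigma_sets (space (rw_space d)) ?Gen"
        using that by (auto intro!: sigma_sets.Basic)
    qed
    finally show ?thesis .
  qed
  \<comment> \<open>Starting at K+N loses nothing, and since r i is at least i it puts all observed
    times beyond \<open>t\<close>.\<close>
  have "{\<omega> \<in> space (rw_space d). \<exists>N. \<forall>i\<ge>N. ctsrw E d x \<omega> (real (r i) + 1) \<in> W i}
     = (\<Union>N. \<Inter>i. {\<omega> \<in> space (rw_space d). ctsrw E d x \<omega> (real (r (K + N + i)) + 1) \<in> W (K + N + i)})"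
  proof (intro set_eqI iffI)
    fix \<omega> assume "\<omega> \<in> {\<omega> \<in> space (rw_space d). \<exists>N. \<forall>i\<ge>N. ctsrw E d x \<omega> (real (r i) + 1) \<in> W i}"
    then obtain N where "\<omega> \<in> space (rw_space d)" "\<forall>i\<ge>N. ctsrw E d x \<omega> (real (r i) + 1) \<in> W i"
      by (elim CollectE conjE exE) (rule that)
    then have "\<omega> \<in> (\<Inter>i. {\<omega> \<in> space (rw_space d). ctsrw E d x \<omega> (real (r (K + N + i)) + 1) \<in> W (K + N + i)})" by simp
    then show "\<omega> \<in> (\<Union>N. \<Inter>i. {\<omega> \<in> space (rw_space d). ctsrw E d x \<omega> (real (r (K + N + i)) + 1) \<in> W (K + N + i)})" by (rule UN_I[OF UNIV_I])
  next
    fix \<omega> assume "\<omega> \<in> (\<Union>N. \<Inter>i. {\<omega> \<in> space (rw_space d). ctsrw E d x \<omega> (real (r (K + N + i)) + 1) \<in> W (K + N + i)})"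
    then obtain N where N': "\<omega> \<in> (\<Inter>i. {\<omega> \<in> space (rw_space d). ctsrw E d x \<omega> (real (r (K + N + i)) + 1) \<in> W (K + N + i)})"
      by (elim UN_E) (rule that)
    have N: "\<omega> \<in> space (rw_space d) \<and> ctsrw E d x \<omega> (real (r (K + N + i)) + 1) \<in> W (K + N + i)" for i
      using INT_D[OF N' UNIV_I, of i] by simp
    have "ctsrw E d x \<omega> (real (r i) + 1) \<in> W i" if "K + N \<le> i" for i
      using N[of "i - (K + N)"] that by simp
    then show "\<omega> \<in> {\<omega> \<in> space (rw_space d). \<exists>N. \<forall>i\<ge>N. ctsrw E d x \<omega> (real (r i) + 1) \<in> W i}"
      using N[of 0] by (intro CollectI conjI exI[of _ "K + N"] allI impI) simp_all
  qed
  also have "\<dots> \<in> sigma_sets (space (rw_space d)) ?Gen"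
  proof (rule countable_nat_UN, intro image_subsetI, rule countable_INT, intro image_subsetI)
    fix N i :: nat
    have "t \<le> real (r (K + N + i)) + 1" using K seq_suble[OF r, of "K + N + i"] by simp
    then show "{\<omega> \<in> space (rw_space d). ctsrw E d x \<omega> (real (r (K + N + i)) + 1) \<in> W (K + N + i)} \<in> sigma_sets (space (rw_space d)) ?Gen"
      by (rule one)
  qed simp
  finally show "{\<omega> \<in> space (rw_space d). \<exists>N. \<forall>i\<ge>N. ctsrw E d x \<omega> (real (r i) + 1) \<in> W i} \<in> sigma_sets (space (rw_space d)) ?Gen" .
qed

text \<open>The events of eventually exceeding q decrease in q and have probability 0 or 1; the
  almost sure limit can only be the supremum of the levels with probability 1.\<close>

lemma zero_one_limit_const:
  fixes M :: "nat \<Rightarrow> 'w \<Rightarrow> real"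
  assumes P: "prob_space P" and M01: "\<And>i \<omega>. 0 \<le> M i \<omega> \<and> M i \<omega> \<le> 1"
    and cau: "AE \<omega> in P. Cauchy (\<lambda>i. M i \<omega>)"
    and tail: "\<And>q. {\<omega> \<in> space P. \<exists>N. \<forall>i\<ge>N. q < M i \<omega>} \<in> sets P"
      "\<And>q. measure P {\<omega> \<in> space P. \<exists>N. \<forall>i\<ge>N. q < M i \<omega>} = 0 \<or> measure P {\<omega> \<in> space P. \<exists>N. \<forall>i\<ge>N. q < M i \<omega>} = 1"
  shows "\<exists>c. AE \<omega> in P. (\<lambda>i. M i \<omega>) \<longlonglongrightarrow> c"
proof -
  interpret prob_space P by (rule P)
  define A where "A q = {\<omega> \<in> space P. \<exists>N. \<forall>i\<ge>N. q < M i \<omega>}" for q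
  have sA: "A q \<in> sets P" for q unfolding A_def by (rule tail(1))
  have zo: "prob (A q) = 0 \<or> prob (A q) = 1" for q unfolding A_def by (rule tail(2))
  let ?Q = "{q. prob (A q) = 1}"
  have "A (-1) = space P"
  proof -
    have "-1 < M i \<omega>" for i \<omega> using M01[of i \<omega>, THEN conjunct1] by linarith
    then show ?thesis unfolding A_def by simp
  qed
  then have ne: "-1 \<in> ?Q" by (simp add: prob_space)
  have up: "q \<le> 1" if "q \<in> ?Q" for q
  proof (rule ccontr)
    assume "\<not> q \<le> 1"
    then have n: "\<not> q < M i \<omega>" for i \<omega> using M01[of i \<omega>, THEN conjunct2] by linarith
    have "A q = {}" unfolding A_def using n by auto
    then show False using that by simp
  qed
  have bdd: "bdd_above ?Q" by (rule bdd_aboveI[of _ 1]) (rule up)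
  define c where "c = Sup ?Q"
  have lo: "AE \<omega> in P. \<omega> \<in> A (c - 1 / Suc j)" for j
  proof -
    have "c - 1 / Suc j < Sup ?Q" unfolding c_def by simp
    then obtain q where q: "prob (A q) = 1" "c - 1 / Suc j < q"
      using less_cSup_iff[of ?Q "c - 1 / Suc j"] ne bdd by blast
    have "AE \<omega> in P. \<omega> \<in> A q" using q(1) sA by (simp add: prob_eq_1)
    then show ?thesis
    proof eventually_elim
      case (elim \<omega>)
      then obtain N where "\<omega> \<in> space P" "\<forall>i\<ge>N. q < M i \<omega>" unfolding A_def by blast
      moreover from this have "\<forall>i\<ge>N. c - 1 / Suc j < M i \<omega>" using q(2) by (meson less_trans)
      ultimately show ?case unfolding A_def by blast
    qed
  qed
  have hi: "AE \<omega> in P. \<omega> \<notin> A (c + 1 / Suc j)" for j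
  proof -
    have "prob (A (c + 1 / Suc j)) \<noteq> 1"
    proof
      assume "prob (A (c + 1 / Suc j)) = 1"
      then have "c + 1 / Suc j \<le> c" unfolding c_def using bdd by (intro cSup_upper) simp
      then show False by simp
    qed
    then have "prob (A (c + 1 / Suc j)) = 0" using zo by blast
    then show ?thesis using sA by (intro AE_not_in) (simp add: null_sets_def emeasure_eq_measure)
  qed
  have loA: "AE \<omega> in P. \<forall>j. \<omega> \<in> A (c - 1 / Suc j)" unfolding AE_all_countable by (intro allI lo)
  have hiA: "AE \<omega> in P. \<forall>j. \<omega> \<notin> A (c + 1 / Suc j)" unfolding AE_all_countable by (intro allI hi)
  have "AE \<omega> in P. (\<lambda>i. M i \<omega>) \<longlonglongrightarrow> c"
    using cau loA hiA AE_space
  proof eventually_elim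
    case (elim \<omega>)
    obtain l where l: "(\<lambda>i. M i \<omega>) \<longlonglongrightarrow> l" using Cauchy_convergent[OF elim(1)] unfolding convergent_def by blast
    have 1: "c - 1 / Suc j \<le> l" for j
    proof -
      obtain N where "\<forall>i\<ge>N. c - 1 / Suc j < M i \<omega>" using elim(2) unfolding A_def by blast
      then show ?thesis by (intro LIMSEQ_le_const[OF l] exI[of _ N]) (auto intro: less_imp_le)
    qed
    have 2: "l \<le> c + 1 / Suc j" for j
    proof (rule ccontr)
      assume "\<not> l \<le> c + 1 / Suc j"
      then have "\<forall>\<^sub>F i in sequentially. c + 1 / Suc j < M i \<omega>" by (intro order_tendstoD(1)[OF l]) simp
      then have "\<omega> \<in> A (c + 1 / Suc j)" using elim(4) unfolding A_def eventually_sequentially by blast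
      then show False using elim(3) by blast
    qed
    have lim: "(\<lambda>j. 1 / real (Suc j)) \<longlonglongrightarrow> 0" using LIMSEQ_inverse_real_of_nat by (simp add: inverse_eq_divide)
    have "(\<lambda>j. c - 1 / real (Suc j)) \<longlonglongrightarrow> c - 0" by (intro tendsto_intros lim)
    then have "c - 0 \<le> l" by (rule LIMSEQ_le_const2) (intro exI[of _ 0] allI impI 1)
    moreover have "(\<lambda>j. c + 1 / real (Suc j)) \<longlonglongrightarrow> c + 0" by (intro tendsto_intros lim)
    then have "l \<le> c + 0" by (rule LIMSEQ_le_const) (intro exI[of _ 0] allI impI 2)
    ultimately have "l = c" by simp
    then show ?case using l by simp
  qed
  then show ?thesis by blast
qed

text \<open>With p the probability that the walk X from \<open>x\<close> is at \<open>y\<close> at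
  time 1, the conditional probabilities M n of this event given X(n+1) form a bounded reverse
  martingale. Its limit is a tail variable, hence the constant p. As p times the difference to be
  estimated is the expectation of \<phi>(X(n+1)) (M n - p), the estimate is uniform in
  \<open>\<phi>\<close>.\<close>

lemma tail_trivial_shift:
  assumes tt: "srw_tail_trivial E d" and p: "0 < sgrp rwop 1 (\<lambda>z. of_bool (z = y)) x" and e: "0 < e"
  shows "\<exists>N. \<forall>n\<ge>N. \<forall>\<phi>. bnd 1 \<phi> \<longrightarrow> \<bar>sgrp rwop (real n) \<phi> y - sgrp rwop (real n + 1) \<phi> x\<bar> \<le> e"
proof -
  interpret R: prob_space "rw_space d" by (rule rw_prob[OF d_pos])
  define p where "p = sgrp rwop 1 (\<lambda>z. of_bool (z = y)) x"
  have p0: "0 < p" using p by (simp add: p_def)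
  have "\<forall>n. \<exists>m. (\<forall>z. 0 \<le> m z \<and> m z \<le> 1) \<and> (\<forall>\<phi> C. bnd C \<phi> \<longrightarrow>
     sgrp rwop (real n + 1) (\<lambda>z. \<phi> z * m z) x = p * sgrp rwop (real n) \<phi> y)"
    unfolding p_def by (intro allI reverse_density)
  from choice[OF this] obtain m where m': "\<forall>n. (\<forall>z. 0 \<le> m n z \<and> m n z \<le> 1) \<and> (\<forall>\<phi> C. bnd C \<phi> \<longrightarrow>
     sgrp rwop (real n + 1) (\<lambda>z. \<phi> z * m n z) x = p * sgrp rwop (real n) \<phi> y)" by blast
  have m01: "0 \<le> m n z" "m n z \<le> 1" for n z using m' by blast+
  have m: "sgrp rwop (real n + 1) (\<lambda>z. \<phi> z * m n z) x = p * sgrp rwop (real n) \<phi> y" if "bnd C \<phi>" for n \<phi> C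
    using m'[rule_format, of n, THEN conjunct2, rule_format, OF that] .
  have bm: "bnd 1 (m n)" for n using m01 by (simp add: bnd_def)
  have bmm: "bnd 1 (\<lambda>z. m n z * m n z)" for n using m01 by (simp add: bnd_def abs_mult mult_le_one)
  define M where "M n \<omega> = m n (ctsrw E d x \<omega> (real n + 1))" for n \<omega>
  have [measurable]: "M n \<in> borel_measurable (rw_space d)" for n
  proof -
    have "m n \<in> measurable (count_space UNIV) borel" by simp
    from measurable_compose[OF ctsrw_measurable this] show ?thesis unfolding M_def .
  qed
  have M01: "0 \<le> M n \<omega>" "M n \<omega> \<le> 1" for n \<omega> by (simp_all add: M_def m01)
  have iM: "integrable (rw_space d) (M n)" for n by (rule R.integrable_const_bound[where B = 1]) (use M01 in auto)
  have iMM: "integrable (rw_space d) (\<lambda>\<omega>. M n \<omega> * M k \<omega>)" for n k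
    by (rule R.integrable_const_bound[where B = 1]) (use M01 in \<open>auto simp: abs_mult mult_le_one\<close>)
  have EM: "R.expectation (M n) = p" for n
    unfolding M_def using rw_expect[OF bm, of "real n + 1" n x] m[OF bndI_const[of 1], of n] by (simp add: sgrp_const[OF jump_rwop])
  \<comment> \<open>The reverse martingale property: projecting M n on the later M k returns M k.
    Squared L2 distances thus become differences of the monotone sequence \<open>q\<close>.\<close>
  have EMM: "R.expectation (\<lambda>\<omega>. M n \<omega> * M k \<omega>) = R.expectation (\<lambda>\<omega>. M k \<omega> * M k \<omega>)" if nk: "n \<le> k" for n k
  proof -
    have gb: "bnd 1 (sgrp rwop (real (k - n)) (m k))" by (rule sgrp_bnd[OF jump_rwop bm]) simp
    have t: "real n + 1 + real (k - n) = real k + 1" using nk by simp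
    have "R.expectation (\<lambda>\<omega>. M n \<omega> * M k \<omega>) = sgrp rwop (real n + 1) (\<lambda>z. m n z * sgrp rwop (real (k - n)) (m k) z) x"
      using rw_expect_two[OF bm[of n] bm[of k], of "real n + 1" "real (k - n)" x] unfolding M_def t by simp
    also have "\<dots> = sgrp rwop (real n + 1) (\<lambda>z. sgrp rwop (real (k - n)) (m k) z * m n z) x" by (simp only: mult.commute)
    also have "\<dots> = p * sgrp rwop (real n) (sgrp rwop (real (k - n)) (m k)) y" by (rule m[OF gb])
    also have "\<dots> = p * sgrp rwop (real k) (m k) y"
      using sgrp_semigroup[OF jump_rwop bm, of "real (k - n)" "real n" k y] nk by simp
    also have "\<dots> = sgrp rwop (real k + 1) (\<lambda>z. m k z * m k z) x" by (rule m[OF bm, symmetric])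
    also have "\<dots> = R.expectation (\<lambda>\<omega>. M k \<omega> * M k \<omega>)" unfolding M_def by (rule rw_expect[OF bmm, symmetric]) simp
    finally show ?thesis .
  qed
  define q where "q n = R.expectation (\<lambda>\<omega>. M n \<omega> * M n \<omega>)" for n
  have diff: "R.expectation (\<lambda>\<omega>. (M n \<omega> - M k \<omega>)\<^sup>2) = q n - q k" if "n \<le> k" for n k
  proof -
    have "(\<lambda>\<omega>. (M n \<omega> - M k \<omega>)\<^sup>2) = (\<lambda>\<omega>. M n \<omega> * M n \<omega> - 2 * (M n \<omega> * M k \<omega>) + M k \<omega> * M k \<omega>)"
      by (auto simp: power2_eq_square algebra_simps)
    then show ?thesis using iMM EMM[OF that] by (simp add: q_def)
  qed
  have dec: "decseq q"
    unfolding decseq_def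
  proof (intro allI impI)
    fix n k :: nat assume "n \<le> k"
    have "0 \<le> R.expectation (\<lambda>\<omega>. (M n \<omega> - M k \<omega>)\<^sup>2)" by (rule Bochner_Integration.integral_nonneg) simp
    then show "q k \<le> q n" using diff[OF \<open>n \<le> k\<close>] by simp
  qed
  have q0: "0 \<le> q n" for n unfolding q_def using M01 by (intro Bochner_Integration.integral_nonneg) auto
  obtain ql where ql: "q \<longlonglongrightarrow> ql" using decseq_convergent[OF dec, of 0] q0 by blast
  have L1: "R.expectation (\<lambda>\<omega>. norm (M i \<omega> - M j \<omega>)) < \<delta>" if \<delta>: "0 < \<delta>" and ij: "\<bar>q i - q j\<bar> < \<delta> * \<delta>" for i j \<delta>
  proof -
    have sq: "R.expectation (\<lambda>\<omega>. (M i \<omega> - M j \<omega>)\<^sup>2) = \<bar>q i - q j\<bar>"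
    proof (cases "i \<le> j")
      case True
      then show ?thesis using diff[OF True] decseqD[OF dec True] by simp
    next
      case False
      then have "j \<le> i" by simp
      then show ?thesis using diff[OF \<open>j \<le> i\<close>] decseqD[OF dec \<open>j \<le> i\<close>] by (simp add: power2_commute)
    qed
    have isq: "integrable (rw_space d) (\<lambda>\<omega>. (M i \<omega> - M j \<omega>)\<^sup>2)"
    proof -
      have "(\<lambda>\<omega>. (M i \<omega> - M j \<omega>)\<^sup>2) = (\<lambda>\<omega>. M i \<omega> * M i \<omega> - 2 * (M i \<omega> * M j \<omega>) + M j \<omega> * M j \<omega>)"
        by (auto simp: power2_eq_square algebra_simps)
      then show ?thesis using iMM by simp
    qed
    \<comment> \<open>From 2|z|\<delta> at most z^2 + \<delta>^2: control in L2 passes to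
      L1.\<close>
    have "R.expectation (\<lambda>\<omega>. norm (M i \<omega> - M j \<omega>)) \<le> R.expectation (\<lambda>\<omega>. ((M i \<omega> - M j \<omega>)\<^sup>2 / \<delta> + \<delta>) / 2)"
    proof (rule integral_mono)
      show "integrable (rw_space d) (\<lambda>\<omega>. norm (M i \<omega> - M j \<omega>))" using iM by simp
      show "integrable (rw_space d) (\<lambda>\<omega>. ((M i \<omega> - M j \<omega>)\<^sup>2 / \<delta> + \<delta>) / 2)" using isq by simp
      fix \<omega>
      define z where "z = M i \<omega> - M j \<omega>"
      have "0 \<le> (\<bar>z\<bar> - \<delta>)\<^sup>2" by simp
      also have "\<dots> = z\<^sup>2 + \<delta>\<^sup>2 - 2 * \<bar>z\<bar> * \<delta>" by (simp add: power2_diff)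
      finally have "2 * \<bar>z\<bar> * \<delta> \<le> z\<^sup>2 + \<delta> * \<delta>" by (simp add: power2_eq_square)
      then have "norm z \<le> (z\<^sup>2 / \<delta> + \<delta>) / 2"
        using \<delta> by (simp add: field_simps)
      then show "norm (M i \<omega> - M j \<omega>) \<le> ((M i \<omega> - M j \<omega>)\<^sup>2 / \<delta> + \<delta>) / 2"
        by (simp only: z_def)
    qed
    also have "\<dots> = (\<bar>q i - q j\<bar> / \<delta> + \<delta>) / 2" using isq sq by (simp add: R.prob_space)
    also have "\<dots> < \<delta>" using ij \<delta> by (simp add: field_simps)
    finally show ?thesis .
  qed
  have "\<exists>N. \<forall>i\<ge>N. \<forall>j\<ge>N. R.expectation (\<lambda>\<omega>. norm (M i \<omega> - M j \<omega>)) < \<delta>" if \<delta>: "0 < \<delta>" for \<delta>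
  proof -
    have "Cauchy q" using ql by (auto intro: LIMSEQ_imp_Cauchy)
    from metric_CauchyD[OF this, of "\<delta> * \<delta>"] obtain N where N: "\<forall>i\<ge>N. \<forall>j\<ge>N. dist (q i) (q j) < \<delta> * \<delta>"
      using \<delta> by auto
    then have "\<forall>i\<ge>N. \<forall>j\<ge>N. R.expectation (\<lambda>\<omega>. norm (M i \<omega> - M j \<omega>)) < \<delta>"
      by (intro allI impI L1[OF \<delta>]) (simp add: dist_real_def)
    then show ?thesis by blast
  qed
  \<comment> \<open>Almost sure convergence is available along a subsequence only; one good index of
    it will be enough.\<close>
  then obtain r where r: "strict_mono r" "AE \<omega> in rw_space d. Cauchy (\<lambda>i. M (r i) \<omega>)"
    using cauchy_L1_AE_cauchy_subseq[where s = M, OF iM] by blast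
  have tl: "{\<omega> \<in> space (rw_space d). \<exists>N. \<forall>i\<ge>N. c < M (r i) \<omega>} \<in> srw_tail_sets E d x" for c
    using srw_tail_eventually[OF r(1), of x "\<lambda>i. {z. c < m (r i) z}"] unfolding M_def by simp
  have "\<exists>c. AE \<omega> in rw_space d. (\<lambda>i. M (r i) \<omega>) \<longlonglongrightarrow> c"
  proof (rule zero_one_limit_const[OF R.prob_space_axioms _ r(2)])
    show "0 \<le> M (r i) \<omega> \<and> M (r i) \<omega> \<le> 1" for i \<omega> using M01 by simp
    show "{\<omega> \<in> space (rw_space d). \<exists>N. \<forall>i\<ge>N. c < M (r i) \<omega>} \<in> sets (rw_space d)" for c by measurable
    show "R.prob {\<omega> \<in> space (rw_space d). \<exists>N. \<forall>i\<ge>N. c < M (r i) \<omega>} = 0 \<or> R.prob {\<omega> \<in> space (rw_space d). \<exists>N. \<forall>i\<ge>N. c < M (r i) \<omega>} = 1" for c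
      using tt[unfolded srw_tail_trivial_def, THEN spec, THEN bspec, OF tl] .
  qed
  then obtain c where c: "AE \<omega> in rw_space d. (\<lambda>i. M (r i) \<omega>) \<longlonglongrightarrow> c" by blast
  have "(\<lambda>i. R.expectation (M (r i))) \<longlonglongrightarrow> R.expectation (\<lambda>_. c)"
    by (rule integral_dominated_convergence[where w = "\<lambda>_. 1"]) (use c M01 in auto)
  then have "(\<lambda>i. p) \<longlonglongrightarrow> c" by (simp add: EM R.prob_space)
  then have cp: "c = p" by (simp add: LIMSEQ_const_iff)
  have "(\<lambda>i. R.expectation (\<lambda>\<omega>. \<bar>M (r i) \<omega> - p\<bar>)) \<longlonglongrightarrow> R.expectation (\<lambda>_. 0)"
  proof (rule integral_dominated_convergence[where w = "\<lambda>_. 1 + \<bar>p\<bar>"])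
    show "AE \<omega> in rw_space d. (\<lambda>i. \<bar>M (r i) \<omega> - p\<bar>) \<longlonglongrightarrow> 0"
      using c unfolding cp
    proof eventually_elim
      case (elim \<omega>)
      then show ?case by (simp add: LIM_zero tendsto_rabs_zero)
    qed
    show "AE \<omega> in rw_space d. norm \<bar>M (r i) \<omega> - p\<bar> \<le> 1 + \<bar>p\<bar>" for i
    proof (rule AE_I2)
      fix \<omega> show "norm \<bar>M (r i) \<omega> - p\<bar> \<le> 1 + \<bar>p\<bar>" using M01[of "r i" \<omega>] by simp
    qed
  qed auto
  then have "(\<lambda>i. R.expectation (\<lambda>\<omega>. \<bar>M (r i) \<omega> - p\<bar>)) \<longlonglongrightarrow> 0" by simp
  from order_tendstoD(2)[OF this, of "e * p"] obtain i where i: "R.expectation (\<lambda>\<omega>. \<bar>M (r i) \<omega> - p\<bar>) < e * p"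
    using e p0 unfolding eventually_sequentially by auto
  have base: "\<bar>sgrp rwop (real (r i)) \<phi> y - sgrp rwop (real (r i) + 1) \<phi> x\<bar> \<le> e" if \<phi>: "bnd 1 \<phi>" for \<phi>
  proof -
    let ?n = "r i"
    have b1: "bnd 1 (\<lambda>z. \<phi> z * m ?n z)"
    proof -
      have "\<bar>\<phi> z * m ?n z\<bar> \<le> 1 * 1" for z unfolding abs_mult using bndD[OF \<phi>, of z] m01[of ?n z] by (intro mult_mono) auto
      then show ?thesis by (simp add: bnd_def)
    qed
    have b3: "bnd (1 + \<bar>p\<bar>) (\<lambda>z. 1 * (\<phi> z * m ?n z) + (- p) * \<phi> z)"
      unfolding bnd_def
    proof
      fix z
      have "\<bar>p * \<phi> z\<bar> \<le> \<bar>p\<bar> * 1" unfolding abs_mult using bndD[OF \<phi>, of z] by (intro mult_left_mono) auto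
      then show "\<bar>1 * (\<phi> z * m ?n z) + (- p) * \<phi> z\<bar> \<le> 1 + \<bar>p\<bar>" using bndD[OF b1, of z] by simp
    qed
    have "p * (sgrp rwop (real ?n) \<phi> y - sgrp rwop (real ?n + 1) \<phi> x) = sgrp rwop (real ?n + 1) (\<lambda>z. 1 * (\<phi> z * m ?n z) + (- p) * \<phi> z) x"
      unfolding sgrp_linear[OF jump_rwop b1 \<phi>] m[OF \<phi>] by (simp add: right_diff_distrib)
    also have "\<dots> = R.expectation (\<lambda>\<omega>. 1 * (\<phi> (ctsrw E d x \<omega> (real ?n + 1)) * m ?n (ctsrw E d x \<omega> (real ?n + 1))) + (- p) * \<phi> (ctsrw E d x \<omega> (real ?n + 1)))"
      by (rule rw_expect[OF b3, symmetric]) simp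
    also have "\<dots> = R.expectation (\<lambda>\<omega>. \<phi> (ctsrw E d x \<omega> (real ?n + 1)) * (M ?n \<omega> - p))"
      unfolding M_def by (simp add: algebra_simps)
    finally have eq: "p * (sgrp rwop (real ?n) \<phi> y - sgrp rwop (real ?n + 1) \<phi> x) = R.expectation (\<lambda>\<omega>. \<phi> (ctsrw E d x \<omega> (real ?n + 1)) * (M ?n \<omega> - p))" .
    have "\<bar>R.expectation (\<lambda>\<omega>. \<phi> (ctsrw E d x \<omega> (real ?n + 1)) * (M ?n \<omega> - p))\<bar> \<le> R.expectation (\<lambda>\<omega>. \<bar>M ?n \<omega> - p\<bar>)"
    proof -
      have fm: "(\<lambda>\<omega>. \<phi> (ctsrw E d x \<omega> (real ?n + 1))) \<in> borel_measurable (rw_space d)"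
        by (rule measurable_compose[OF ctsrw_measurable]) simp
      have le: "\<bar>\<phi> (ctsrw E d x \<omega> (real ?n + 1)) * (M ?n \<omega> - p)\<bar> \<le> \<bar>M ?n \<omega> - p\<bar>" for \<omega>
        unfolding abs_mult using bndD[OF \<phi>, of "ctsrw E d x \<omega> (real ?n + 1)"] by (intro mult_left_le_one_le) auto
      have ia: "integrable (rw_space d) (\<lambda>\<omega>. \<bar>M ?n \<omega> - p\<bar>)" using iM by simp
      have "integrable (rw_space d) (\<lambda>\<omega>. \<phi> (ctsrw E d x \<omega> (real ?n + 1)) * (M ?n \<omega> - p))"
        by (rule Bochner_Integration.integrable_bound[OF ia]) (use fm le in auto)
      then have "R.expectation (\<lambda>\<omega>. \<bar>\<phi> (ctsrw E d x \<omega> (real ?n + 1)) * (M ?n \<omega> - p)\<bar>) \<le> R.expectation (\<lambda>\<omega>. \<bar>M ?n \<omega> - p\<bar>)"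
        using ia le by (intro integral_mono) auto
      then show ?thesis by (rule order_trans[OF integral_abs_bound])
    qed
    then have "\<bar>p * (sgrp rwop (real ?n) \<phi> y - sgrp rwop (real ?n + 1) \<phi> x)\<bar> \<le> e * p" unfolding eq using i by linarith
    then have "p * \<bar>sgrp rwop (real ?n) \<phi> y - sgrp rwop (real ?n + 1) \<phi> x\<bar> \<le> p * e" using p0 by (simp add: abs_mult mult.commute)
    then show ?thesis using p0 by simp
  qed
  \<comment> \<open>Beyond time r i both laws undergo the same further evolution, a contraction, so
    the estimate persists.\<close>
  show ?thesis
  proof (intro exI[of _ "r i"] allI impI)
    fix n \<phi> assume n: "r i \<le> n" and \<phi>: "bnd 1 (\<phi> :: 'v \<Rightarrow> real)"
    let ?\<psi> = "sgrp rwop (real (n - r i)) \<phi>"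
    have b1: "bnd 1 ?\<psi>" by (rule sgrp_bnd[OF jump_rwop \<phi>]) simp
    have t: "real (r i) + real (n - r i) = real n" "real (r i) + 1 + real (n - r i) = real n + 1" using n by simp_all
    have "sgrp rwop (real n) \<phi> y = sgrp rwop (real (r i)) ?\<psi> y"
      using sgrp_semigroup[OF jump_rwop \<phi>, of "real (n - r i)" "real (r i)" y] unfolding t by simp
    moreover have "sgrp rwop (real n + 1) \<phi> x = sgrp rwop (real (r i) + 1) ?\<psi> x"
      using sgrp_semigroup[OF jump_rwop \<phi>, of "real (n - r i)" "real (r i) + 1" x] unfolding t by simp
    ultimately show "\<bar>sgrp rwop (real n) \<phi> y - sgrp rwop (real n + 1) \<phi> x\<bar> \<le> e"
      using base[OF b1] by simp
  qed
qed

text \<open>For an edge from x to y, the walk from y at time n and the walk from x at time n are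
  both close to the walk from x at time n+1: \<open>tail_trivial_shift\<close> is applied to the
  step to y and to remaining at x. The offset of one time unit thus cancels, and connectedness
  chains the edges.\<close>

theorem tail_trivial_tv:
  assumes tt: "srw_tail_trivial E d" and e: "0 < e"
  shows "\<exists>t\<ge>0. \<forall>\<phi>. bnd 1 \<phi> \<longrightarrow> \<bar>sgrp rwop t \<phi> a - sgrp rwop t \<phi> b\<bar> \<le> e"
proof -
  have self: "0 < sgrp rwop 1 (\<lambda>z. of_bool (z = x)) x" for x
  proof -
    have "exp (- 1 * 1) * of_bool (x = x) \<le> sgrp rwop 1 (\<lambda>z. of_bool (z = x)) x"
      by (rule sgrp_ge_exp[OF jump_rwop bnd_of_bool]) simp_all
    then show ?thesis by (simp add: order_less_le_trans[OF exp_gt_zero])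
  qed
  have "\<forall>e>0. \<exists>N. \<forall>n\<ge>N. \<forall>\<phi>. bnd 1 \<phi> \<longrightarrow> \<bar>sgrp rwop (real n) \<phi> a - sgrp rwop (real n) \<phi> b\<bar> \<le> e" if "E\<^sup>*\<^sup>* a b" for b
    using that
  proof induction
    case base show ?case by auto
  next
    case (step x y)
    then have yx: "y \<in> nb x" by (simp add: nb_def)
    show ?case
    proof (intro allI impI)
      fix e :: real assume e: "0 < e"
      then have e3: "0 < e / 3" by simp
      obtain N1 where 1: "\<forall>n\<ge>N1. \<forall>\<phi>. bnd 1 \<phi> \<longrightarrow> \<bar>sgrp rwop (real n) \<phi> a - sgrp rwop (real n) \<phi> x\<bar> \<le> e / 3"
        using step.IH e3 by blast
      obtain N2 where 2: "\<forall>n\<ge>N2. \<forall>\<phi>. bnd 1 \<phi> \<longrightarrow> \<bar>sgrp rwop (real n) \<phi> x - sgrp rwop (real n + 1) \<phi> x\<bar> \<le> e / 3"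
        using tail_trivial_shift[OF tt self e3] by blast
      obtain N3 where 3: "\<forall>n\<ge>N3. \<forall>\<phi>. bnd 1 \<phi> \<longrightarrow> \<bar>sgrp rwop (real n) \<phi> y - sgrp rwop (real n + 1) \<phi> x\<bar> \<le> e / 3"
        using tail_trivial_shift[OF tt rw_adjacent_pos[OF yx] e3] by blast
      show "\<exists>N. \<forall>n\<ge>N. \<forall>\<phi>. bnd 1 \<phi> \<longrightarrow> \<bar>sgrp rwop (real n) \<phi> a - sgrp rwop (real n) \<phi> y\<bar> \<le> e"
      proof (intro exI[of _ "N1 + N2 + N3"] allI impI)
        fix n \<phi> assume n: "N1 + N2 + N3 \<le> n" and \<phi>: "bnd 1 (\<phi> :: 'v \<Rightarrow> real)"
        show "\<bar>sgrp rwop (real n) \<phi> a - sgrp rwop (real n) \<phi> y\<bar> \<le> e"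
          using 1[rule_format, of n, OF _ \<phi>] 2[rule_format, of n, OF _ \<phi>] 3[rule_format, of n, OF _ \<phi>] n by linarith
      qed
    qed
  qed
  moreover have "E\<^sup>*\<^sup>* a b" using conn unfolding connected_graph_def by blast
  ultimately obtain N where N: "\<forall>n\<ge>N. \<forall>\<phi>. bnd 1 \<phi> \<longrightarrow> \<bar>sgrp rwop (real n) \<phi> a - sgrp rwop (real n) \<phi> b\<bar> \<le> e"
    using e by blast
  show ?thesis by (rule exI[of _ "real N"]) (use N in simp)
qed

end

section \<open>Moments of measures on configurations\<close>

lemma sgrp_sum:
  assumes L: "jump_op \<Lambda> L" and S: "finite S" and f: "\<And>s. s \<in> S \<Longrightarrow> bnd B (f s)"
  shows "sgrp L t (\<lambda>a. \<Sum>s\<in>S. c s * f s a) a = (\<Sum>s\<in>S. c s * sgrp L t (f s) a)"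
proof -
  have "(\<exists>C. bnd C (\<lambda>a. \<Sum>s\<in>S. c s * f s a)) \<and>
    sgrp L t (\<lambda>a. \<Sum>s\<in>S. c s * f s a) a = (\<Sum>s\<in>S. c s * sgrp L t (f s) a)"
    using S f
  proof (induction S rule: finite_induct)
    case empty
    have "bnd 0 (\<lambda>a. 0)" by (simp add: bnd_def)
    then show ?case using sgrp_const[OF L, of t 0 a] by auto
  next
    case (insert s S)
    obtain C where C: "bnd C (\<lambda>a. \<Sum>s\<in>S. c s * f s a)"
      and eq: "sgrp L t (\<lambda>a. \<Sum>s\<in>S. c s * f s a) a = (\<Sum>s\<in>S. c s * sgrp L t (f s) a)"
      using insert.IH insert.prems by auto
    have fs: "bnd B (f s)" using insert.prems by simp
    have b: "bnd (\<bar>c s\<bar> * B + C) (\<lambda>a. c s * f s a + 1 * (\<Sum>s\<in>S. c s * f s a))"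
      unfolding bnd_def
    proof
      fix a
      have "\<bar>c s * f s a\<bar> \<le> \<bar>c s\<bar> * B" unfolding abs_mult by (intro mult_left_mono bndD[OF fs]) simp
      then show "\<bar>c s * f s a + 1 * (\<Sum>s\<in>S. c s * f s a)\<bar> \<le> \<bar>c s\<bar> * B + C"
        using bndD[OF C, of a] by linarith
    qed
    show ?case
      using sgrp_linear[OF L fs C, of t "c s" 1 a] b eq insert.hyps by auto
  qed
  then show ?thesis by blast
qed

lemma jump_pow_integral:
  assumes \<mu>: "prob_space \<mu>" and L: "jump_op \<Lambda> L" and F: "\<And>\<eta>. bnd C (F \<eta>)"
    and meas: "\<And>a. (\<lambda>\<eta>. F \<eta> a) \<in> borel_measurable \<mu>"
  shows "(\<lambda>\<eta>. (L ^^ k) (F \<eta>) a) \<in> borel_measurable \<mu> \<and> (\<integral>\<eta>. (L ^^ k) (F \<eta>) a \<partial>\<mu>) = (L ^^ k) (\<lambda>a. \<integral>\<eta>. F \<eta> a \<partial>\<mu>) a"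
proof (induction k arbitrary: a)
  case 0
  show ?case using meas[of a] by simp
next
  case (Suc k)
  interpret prob_space \<mu> by (rule \<mu>)
  obtain S w where S: "finite S" and eq: "\<forall>f. L f a = (\<Sum>b\<in>S. w b * (f b - f a))" using jump_opE[OF L] by metis
  have i: "integrable \<mu> (\<lambda>\<eta>. (L ^^ k) (F \<eta>) b)" for b
    using bndD[OF jump_op_bnd_pow[OF L F]] Suc.IH[of b] by (intro integrable_const_bound[where B = "(2 * \<Lambda>) ^ k * C"]) auto
  have "(\<lambda>\<eta>. (L ^^ Suc k) (F \<eta>) a) = (\<lambda>\<eta>. \<Sum>b\<in>S. w b * ((L ^^ k) (F \<eta>) b - (L ^^ k) (F \<eta>) a))"
    using eq by simp
  moreover have "integrable \<mu> (\<lambda>\<eta>. \<Sum>b\<in>S. w b * ((L ^^ k) (F \<eta>) b - (L ^^ k) (F \<eta>) a))"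
    using i by simp
  moreover have "(\<integral>\<eta>. (\<Sum>b\<in>S. w b * ((L ^^ k) (F \<eta>) b - (L ^^ k) (F \<eta>) a)) \<partial>\<mu>) = (L ^^ Suc k) (\<lambda>a. \<integral>\<eta>. F \<eta> a \<partial>\<mu>) a"
    using i Suc.IH eq by (simp add: Bochner_Integration.integral_sum)
  ultimately show ?case by simp
qed

text \<open>Powers of \<open>L\<close> are finite sums, and the exponential bound permits
  integrating the series term by term. It turns duality for single configurations into a flow of
  moments.\<close>

lemma sgrp_integral:
  assumes \<mu>: "prob_space \<mu>" and L: "jump_op \<Lambda> L" and F: "\<And>\<eta>. bnd C (F \<eta>)"
    and meas: "\<And>a. (\<lambda>\<eta>. F \<eta> a) \<in> borel_measurable \<mu>"
  shows "(\<integral>\<eta>. sgrp L t (F \<eta>) a \<partial>\<mu>) = sgrp L t (\<lambda>a. \<integral>\<eta>. F \<eta> a \<partial>\<mu>) a"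
proof -
  interpret prob_space \<mu> by (rule \<mu>)
  note pw = jump_pow_integral[OF \<mu> L F meas]
  let ?t = "\<lambda>k \<eta>. (L ^^ k) (F \<eta>) a / fact k * t ^ k"
  have b: "norm (?t k \<eta>) \<le> C * ((2 * \<Lambda> * \<bar>t\<bar>) ^ k / fact k)" for k \<eta> by (rule sgrp_term_le[OF L F])
  have m: "?t k \<in> borel_measurable \<mu>" for k
  proof -
    have [measurable]: "(\<lambda>\<eta>. (L ^^ k) (F \<eta>) a) \<in> borel_measurable \<mu>" using pw[of k a] by blast
    show ?thesis by measurable
  qed
  have i: "integrable \<mu> (?t k)" for k
    using b m by (intro integrable_const_bound[where B = "C * ((2 * \<Lambda> * \<bar>t\<bar>) ^ k / fact k)"]) auto
  have s: "summable (\<lambda>k. C * ((2 * \<Lambda> * \<bar>t\<bar>) ^ k / fact k))" by (rule summable_exp_bound)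
  have ib: "(\<integral>\<eta>. norm (?t k \<eta>) \<partial>\<mu>) \<le> C * ((2 * \<Lambda> * \<bar>t\<bar>) ^ k / fact k)" for k
  proof -
    have "(\<integral>\<eta>. norm (?t k \<eta>) \<partial>\<mu>) \<le> (\<integral>\<eta>. C * ((2 * \<Lambda> * \<bar>t\<bar>) ^ k / fact k) \<partial>\<mu>)"
      using integrable_norm[OF i] b by (intro integral_mono) simp_all
    then show ?thesis by (simp add: prob_space)
  qed
  have "(\<integral>\<eta>. (\<Sum>k. ?t k \<eta>) \<partial>\<mu>) = (\<Sum>k. \<integral>\<eta>. ?t k \<eta> \<partial>\<mu>)"
  proof (rule integral_suminf[OF i])
    show "AE \<eta> in \<mu>. summable (\<lambda>k. norm (?t k \<eta>))"
      by (intro AE_I2 summable_comparison_test'[OF s]) (use b in simp)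
    show "summable (\<lambda>k. \<integral>\<eta>. norm (?t k \<eta>) \<partial>\<mu>)"
    proof (rule summable_comparison_test'[OF s, of 0])
      fix k show "norm (\<integral>\<eta>. norm (?t k \<eta>) \<partial>\<mu>) \<le> C * ((2 * \<Lambda> * \<bar>t\<bar>) ^ k / fact k)"
        using ib[of k] by (simp add: integral_nonneg_AE)
    qed
  qed
  also have "\<dots> = (\<Sum>k. (L ^^ k) (\<lambda>a. \<integral>\<eta>. F \<eta> a \<partial>\<mu>) a / fact k * t ^ k)"
    using pw by simp
  finally show ?thesis unfolding sgrp_def .
qed

text \<open>The default 0 on infinite sets gives a bounded function of all sets, on which the dual
  can act; finite sets never lead to infinite ones.\<close>

definition mom :: "bool \<Rightarrow> ('v \<Rightarrow> bool) measure \<Rightarrow> 'v set \<Rightarrow> real" where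
  "mom b \<mu> A = (if finite A then \<integral>\<eta>. ind b A \<eta> \<partial>\<mu> else 0)"

lemma ind_integrable: "\<mu> \<in> cfg_probs \<Longrightarrow> finite A \<Longrightarrow> integrable \<mu> (ind b A)"
  by (intro cfg_cont_integrable cylinder_cont cylinder_ind)

lemma mom_nonneg: "0 \<le> mom b \<mu> A"
  by (simp add: mom_def ind_nonneg)

lemma mom_measure: "\<mu> \<in> cfg_probs \<Longrightarrow> finite A \<Longrightarrow> mom b \<mu> A = measure \<mu> {\<eta>. \<forall>x\<in>A. \<eta> x = b}"
  by (simp add: mom_def integral_ind)

lemma mom_mono:
  assumes "\<mu> \<in> cfg_probs" "finite B" "A \<subseteq> B"
  shows "mom b \<mu> B \<le> mom b \<mu> A"
proof -
  have A: "finite A" using assms finite_subset by blast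
  have "ind b B \<eta> \<le> ind b A \<eta>" for \<eta> using assms(3) by (auto simp: ind_def)
  then show ?thesis using assms A by (auto simp: mom_def intro!: integral_mono ind_integrable)
qed

lemma mom_empty: "\<mu> \<in> cfg_probs \<Longrightarrow> mom b \<mu> {} = 1"
  using prob_space.prob_space[OF cfg_probsD(1), of \<mu>] cfg_probsD(3)[of \<mu>] by (simp add: mom_measure)

lemma mom_le_1: "\<mu> \<in> cfg_probs \<Longrightarrow> mom b \<mu> A \<le> 1"
  using mom_mono[of \<mu> A "{}" b] mom_empty[of \<mu> b] by (cases "finite A") (simp_all add: mom_def)

lemma bnd_mom: "\<mu> \<in> cfg_probs \<Longrightarrow> bnd 1 (mom b \<mu>)"
  by (simp add: bnd_def mom_nonneg mom_le_1)

lemma mom_eqI: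
  assumes "\<mu> \<in> cfg_probs" "\<nu> \<in> cfg_probs" "\<And>A. finite A \<Longrightarrow> mom True \<mu> A = mom True \<nu> A"
  shows "\<mu> = \<nu>"
  using assms by (intro cfg_probs_eqI) (auto simp: mom_def)

lemma stationary_cfg: "stationary T \<mu> \<Longrightarrow> \<mu> \<in> cfg_probs"
  by (simp add: stationary_def)

text \<open>The mixture is sampled by first tossing a coin with success probability
  \<open>c\<close>.\<close>

lemma mixture_exists:
  assumes \<mu>: "\<mu> \<in> cfg_probs" and \<nu>: "\<nu> \<in> cfg_probs" and c: "0 \<le> c" "c \<le> 1"
  shows "\<exists>\<kappa>\<in>cfg_probs. \<forall>A\<in>sets cfg_space. measure \<kappa> A = c * measure \<mu> A + (1 - c) * measure \<nu> A"
proof -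
  let ?M = "measure_pmf (bernoulli_pmf c)"
  let ?f = "\<lambda>b. if b then \<mu> else \<nu>"
  interpret M: prob_space \<mu> using cfg_probsD[OF \<mu>] by simp
  interpret N: prob_space \<nu> using cfg_probsD[OF \<nu>] by simp
  have f: "?f \<in> measurable ?M (subprob_algebra cfg_space)"
    using \<mu> \<nu> by (auto simp: space_subprob_algebra cfg_probs_def prob_space_imp_subprob_space)
  define \<kappa> where "\<kappa> = ?M \<bind> ?f"
  have \<kappa>s: "sets \<kappa> = sets cfg_space" unfolding \<kappa>_def by (rule sets_bind) (use \<mu> \<nu> in \<open>auto simp: cfg_probs_def\<close>)
  have e: "emeasure \<kappa> A = ennreal (c * measure \<mu> A + (1 - c) * measure \<nu> A)" if A: "A \<in> sets cfg_space" for A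
  proof -
    have "emeasure \<kappa> A = (\<integral>\<^sup>+ b. emeasure (?f b) A \<partial>?M)"
      unfolding \<kappa>_def by (rule emeasure_bind[OF _ f A]) simp
    also have "\<dots> = emeasure \<mu> A * ennreal c + emeasure \<nu> A * ennreal (1 - c)"
      using c by simp
    also have "\<dots> = ennreal (c * measure \<mu> A + (1 - c) * measure \<nu> A)"
      using c by (simp add: M.emeasure_eq_measure N.emeasure_eq_measure ennreal_mult' ennreal_plus mult.commute)
    finally show ?thesis .
  qed
  have "prob_space \<kappa>"
  proof
    have U: "(UNIV :: ('a \<Rightarrow> bool) set) \<in> sets cfg_space" using sets.top[of cfg_space] by simp
    have "space \<kappa> = UNIV" using sets_eq_imp_space_eq[OF \<kappa>s] by simp
    then show "emeasure \<kappa> (space \<kappa>) = 1"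
      using e[OF U] M.prob_space N.prob_space cfg_probsD(3)[OF \<mu>] cfg_probsD(3)[OF \<nu>] by simp
  qed
  then have "\<kappa> \<in> cfg_probs" using \<kappa>s by (simp add: cfg_probs_def)
  moreover have "measure \<kappa> A = c * measure \<mu> A + (1 - c) * measure \<nu> A" if "A \<in> sets cfg_space" for A
  proof -
    have nn: "0 \<le> c * measure \<mu> A + (1 - c) * measure \<nu> A" using c by simp
    show ?thesis unfolding measure_def[of \<kappa>] e[OF that] by (rule enn2real_ennreal[OF nn])
  qed
  ultimately show ?thesis by blast
qed

lemma extremal_stationaryI:
  assumes st: "stationary T \<mu>"
    and ex: "\<And>\<mu>1 \<mu>2 c. stationary T \<mu>1 \<Longrightarrow> stationary T \<mu>2 \<Longrightarrow> 0 < c \<Longrightarrow> c < 1 \<Longrightarrow>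
      (\<And>A. finite A \<Longrightarrow> mom True \<mu> A = c * mom True \<mu>1 A + (1 - c) * mom True \<mu>2 A) \<Longrightarrow> \<mu>1 = \<mu>2"
  shows "extremal_stationary T \<mu>"
  unfolding extremal_stationary_def
proof (intro conjI st notI, elim exE conjE)
  fix \<mu>1 \<mu>2 c
  assume s: "stationary T \<mu>1" "stationary T \<mu>2" and ne: "\<mu>1 \<noteq> \<mu>2" and c: "0 < c" "c < 1"
    and eq: "\<forall>A\<in>sets cfg_space. measure \<mu> A = c * measure \<mu>1 A + (1 - c) * measure \<mu>2 A"
  have "mom True \<mu> A = c * mom True \<mu>1 A + (1 - c) * mom True \<mu>2 A" if "finite A" for A
    using eq[THEN bspec, OF cfg_ind_sets[OF that, of True]] st s that by (simp add: mom_measure stationary_cfg)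
  from ex[OF s c this] ne show False by simp
qed

text \<open>The mixture of the two measures has the moments of \<open>\<mu>\<close> and hence is
  \<open>\<mu>\<close>, so decomposing the moments is enough to decompose the measure.\<close>

lemma extremal_stationaryD:
  assumes ex: "extremal_stationary T \<mu>" and s: "stationary T \<mu>1" "stationary T \<mu>2" and c: "0 < c" "c < 1"
    and mom: "\<And>A. finite A \<Longrightarrow> mom True \<mu> A = c * mom True \<mu>1 A + (1 - c) * mom True \<mu>2 A"
  shows "\<mu>1 = \<mu>2"
proof (rule ccontr)
  assume ne: "\<mu>1 \<noteq> \<mu>2"
  have st: "stationary T \<mu>" using ex by (simp add: extremal_stationary_def)
  obtain \<kappa> where \<kappa>: "\<kappa> \<in> cfg_probs"
    and eq: "\<forall>A\<in>sets cfg_space. measure \<kappa> A = c * measure \<mu>1 A + (1 - c) * measure \<mu>2 A"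
    using mixture_exists[OF stationary_cfg[OF s(1)] stationary_cfg[OF s(2)], of c] c by auto
  have "mom True \<kappa> A = c * mom True \<mu>1 A + (1 - c) * mom True \<mu>2 A" if "finite A" for A
    using eq[THEN bspec, OF cfg_ind_sets[OF that, of True]] \<kappa> s that by (simp add: mom_measure stationary_cfg)
  then have "\<kappa> = \<mu>" using mom by (intro mom_eqI \<kappa> stationary_cfg[OF st]) simp
  then show False using ex s ne c eq unfolding extremal_stationary_def by blast
qed

lemma incl_ind:
  assumes "finite C"
  shows "incl (\<lambda>B. ind True B \<eta>) A C = ind True A \<eta> * ind False C \<eta>"
  using assms
proof (induction C arbitrary: A rule: finite_induct)
  case (insert x C)
  then show ?case by (auto simp: incl_insert ind_def)
qed simp

text \<open>The iterated differences of a sequence; they are all nonnegative iff the sequence consists of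
  the moments of a probability measure on the unit interval (Hausdorff).\<close>

fun dlt :: "(nat \<Rightarrow> real) \<Rightarrow> nat \<Rightarrow> nat \<Rightarrow> real" where
  "dlt c 0 j = c j"
| "dlt c (Suc k) j = dlt c k j - dlt c k (Suc j)"

definition cmono :: "(nat \<Rightarrow> real) \<Rightarrow> bool" where
  "cmono c \<longleftrightarrow> c 0 = 1 \<and> (\<forall>k j. 0 \<le> dlt c k j)"

section \<open>Iterated differences and exchangeable measures\<close>

lemma dlt_linear: "dlt (\<lambda>n. a * f n + b * g n) k j = a * dlt f k j + b * dlt g k j"
  by (induction k arbitrary: j) (simp_all add: algebra_simps)

lemma dlt_Suc: "dlt (\<lambda>n. c (Suc n)) k j = dlt c k (Suc j)"
  by (induction k arbitrary: j) simp_all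

lemma dlt_diff: "dlt (\<lambda>n. c n - c (Suc n)) k j = dlt c (Suc k) j"
  using dlt_linear[of 1 c "-1" "\<lambda>n. c (Suc n)" k j] by (simp add: dlt_Suc)

lemma dlt_power: "dlt (\<lambda>n. \<alpha> ^ n) k j = \<alpha> ^ j * (1 - \<alpha>) ^ k"
  by (induction k arbitrary: j) (simp_all add: algebra_simps)

lemma cmono_power: "0 \<le> \<alpha> \<Longrightarrow> \<alpha> \<le> 1 \<Longrightarrow> cmono (\<lambda>n. \<alpha> ^ n)"
  by (simp add: cmono_def dlt_power)

lemma cmono_mix:
  assumes "cmono f" "cmono g" "0 \<le> a" "a \<le> 1"
  shows "cmono (\<lambda>n. a * f n + (1 - a) * g n)"
  using assms by (simp add: cmono_def dlt_linear)

lemma cmono_nonneg: "cmono c \<Longrightarrow> 0 \<le> c k"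
  unfolding cmono_def by (metis dlt.simps(1))

lemma cmono_decseq: "cmono c \<Longrightarrow> decseq c"
  unfolding decseq_Suc_iff
proof
  fix n assume "cmono c"
  then have "0 \<le> dlt c (Suc 0) n" unfolding cmono_def by blast
  then show "c (Suc n) \<le> c n" by simp
qed

lemma cmono_le_1: "cmono c \<Longrightarrow> c k \<le> 1"
  using decseqD[OF cmono_decseq, of c 0 k] by (simp add: cmono_def)

lemma incl_card:
  assumes "finite C" "finite A" "A \<inter> C = {}"
  shows "incl (\<lambda>B. c (card B)) A C = dlt c (card C) (card A)"
  using assms
proof (induction C arbitrary: A rule: finite_induct)
  case (insert x C)
  then show ?case by (simp add: incl_insert)
qed simp

text \<open>By \<open>incl_card\<close>, nonnegativity of the iterated differences is the positivity
  that the extension requires. For the powers of \<alpha> the measure is the Bernoulli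
  product.\<close>

lemma exchangeable_exists:
  assumes "cmono c"
  shows "\<exists>\<pi>\<in>cfg_probs. \<forall>A. finite A \<longrightarrow> mom True \<pi> A = c (card A)"
proof -
  have "\<exists>\<mu>\<in>cfg_probs. \<forall>A. finite A \<longrightarrow> (\<integral>\<eta>. ind True A \<eta> \<partial>\<mu>) = c (card A)"
    by (rule cfg_probs_exists) (use assms in \<open>auto simp: incl_card cmono_def\<close>)
  then show ?thesis by (auto simp: mom_def)
qed

lemma bernoulli_product_cfg: "bernoulli_product \<alpha> \<in> cfg_probs"
proof -
  have "prob_space (bernoulli_product \<alpha> :: ('v \<Rightarrow> bool) measure)"
    unfolding bernoulli_product_def by (intro prob_space_PiM measure_pmf.prob_space_axioms)
  moreover have "sets (bernoulli_product \<alpha> :: ('v \<Rightarrow> bool) measure) = sets cfg_space"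
    unfolding bernoulli_product_def cfg_space_def by (intro sets_PiM_cong) simp_all
  ultimately show ?thesis by (simp add: cfg_probs_def)
qed

lemma bernoulli_product_mom:
  fixes A :: "'v set"
  assumes \<alpha>: "0 \<le> \<alpha>" "\<alpha> \<le> 1" and A: "finite A"
  shows "mom True (bernoulli_product \<alpha>) A = \<alpha> ^ card A"
proof -
  let ?M = "\<lambda>_ :: 'v. measure_pmf (bernoulli_pmf \<alpha>)"
  interpret product_prob_space ?M UNIV by unfold_locales
  have "{\<eta>. \<forall>x\<in>A. \<eta> x = True} = prod_emb UNIV ?M A (Pi\<^sub>E A (\<lambda>_. {True}))"
    unfolding set_eq_iff prod_emb_iff PiE_iff by auto
  then have "mom True (bernoulli_product \<alpha>) A = measure (PiM UNIV ?M) (prod_emb UNIV ?M A (Pi\<^sub>E A (\<lambda>_. {True})))"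
    using mom_measure[OF bernoulli_product_cfg A, of True \<alpha>] by (simp add: bernoulli_product_def)
  also have "\<dots> = (\<Prod>x\<in>A. measure (?M x) {True})" by (rule measure_PiM_emb) (use A in auto)
  finally show ?thesis using \<alpha> by (simp add: measure_pmf_single)
qed

section \<open>Weak limits\<close>

text \<open>\<open>T t\<close> is a contraction, so approximation of \<open>f\<close> by a cylinder
  function survives the evolution: one finite combination of moments controls \<open>f\<close> for
  all times and all measures at once. Weak convergence thereby reduces to convergence of
  moments.\<close>

lemma cylinder_reduction:
  assumes T: "feller_semigroup T" and f: "f \<in> cfg_cont" and e: "0 < e"
  shows "\<exists>\<A> c. finite \<A> \<and> (\<forall>A\<in>\<A>. finite A) \<and> (\<forall>t\<ge>0. \<forall>\<mu>\<in>cfg_probs. \<forall>\<nu>\<in>cfg_probs.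
    \<bar>((\<integral>\<eta>. T t f \<eta> \<partial>\<mu>) - (\<integral>\<eta>. f \<eta> \<partial>\<nu>))
      - (\<Sum>A\<in>\<A>. c A * ((\<integral>\<eta>. T t (ind True A) \<eta> \<partial>\<mu>) - mom True \<nu> A))\<bar> \<le> e)"
proof -
  obtain g where g: "cylinder_fun g" and fg: "\<forall>\<eta>. \<bar>f \<eta> - g \<eta>\<bar> \<le> e / 2"
    using cfg_cont_approx[OF f, of "e / 2"] e by auto
  have gc: "g \<in> cfg_cont" by (rule cylinder_cont[OF g])
  obtain \<A> c where \<A>: "finite \<A>" "\<forall>A\<in>\<A>. finite A" and gsum: "g = (\<lambda>\<eta>. \<Sum>A\<in>\<A>. c A * ind True A \<eta>)"
    by (rule cylinder_spanE[OF g])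
  have cyl: "cylinder_fun (ind True A)" if "A \<in> \<A>" for A using \<A> that by (intro cylinder_ind) blast
  have close: "\<bar>(\<integral>\<eta>. F \<eta> \<partial>\<mu>) - (\<integral>\<eta>. G \<eta> \<partial>\<mu>)\<bar> \<le> e / 2"
    if "\<mu> \<in> cfg_probs" "F \<in> cfg_cont" "G \<in> cfg_cont" "\<And>\<eta>. \<bar>F \<eta> - G \<eta>\<bar> \<le> e / 2" for F G \<mu>
  proof -
    interpret prob_space \<mu> using cfg_probsD[OF that(1)] by simp
    have i: "integrable \<mu> F" "integrable \<mu> G" using that by (auto intro: cfg_cont_integrable)
    have "\<bar>\<integral>\<eta>. F \<eta> - G \<eta> \<partial>\<mu>\<bar> \<le> e / 2"
      by (rule abs_expectation_le) (use i that(4) in auto)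
    then show ?thesis using i by simp
  qed
  have main: "\<bar>((\<integral>\<eta>. T t f \<eta> \<partial>\<mu>) - (\<integral>\<eta>. f \<eta> \<partial>\<nu>))
      - (\<Sum>A\<in>\<A>. c A * ((\<integral>\<eta>. T t (ind True A) \<eta> \<partial>\<mu>) - mom True \<nu> A))\<bar> \<le> e"
    if t: "0 \<le> t" and \<mu>: "\<mu> \<in> cfg_probs" and \<nu>: "\<nu> \<in> cfg_probs" for t \<mu> \<nu>
  proof -
    have 1: "\<bar>(\<integral>\<eta>. T t f \<eta> \<partial>\<mu>) - (\<integral>\<eta>. T t g \<eta> \<partial>\<mu>)\<bar> \<le> e / 2"
    proof (rule close[OF \<mu> feller_cont[OF T t f] feller_cont[OF T t gc]])
      fix \<eta> show "\<bar>T t f \<eta> - T t g \<eta>\<bar> \<le> e / 2"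
        by (rule feller_contraction[OF T t f gc]) (use fg in blast)
    qed
    have 2: "\<bar>(\<integral>\<eta>. f \<eta> \<partial>\<nu>) - (\<integral>\<eta>. g \<eta> \<partial>\<nu>)\<bar> \<le> e / 2" by (rule close[OF \<nu> f gc]) (use fg in blast)
    have "T t g = (\<lambda>\<eta>. \<Sum>A\<in>\<A>. c A * T t (ind True A) \<eta>)"
      unfolding gsum by (rule ext, rule feller_sum[OF T t \<A>(1) cyl])
    moreover have "integrable \<mu> (T t (ind True A))" if "A \<in> \<A>" for A
      by (rule cfg_cont_integrable[OF feller_cont[OF T t cylinder_cont[OF cyl[OF that]]] \<mu>])
    ultimately have 3: "(\<integral>\<eta>. T t g \<eta> \<partial>\<mu>) = (\<Sum>A\<in>\<A>. c A * (\<integral>\<eta>. T t (ind True A) \<eta> \<partial>\<mu>))"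
      by simp
    have "(\<integral>\<eta>. g \<eta> \<partial>\<nu>) = (\<Sum>A\<in>\<A>. c A * (\<integral>\<eta>. ind True A \<eta> \<partial>\<nu>))"
      unfolding gsum using \<A>(2) \<nu> by (simp add: ind_integrable)
    also have "\<dots> = (\<Sum>A\<in>\<A>. c A * mom True \<nu> A)"
      using \<A>(2) by (intro sum.cong refl) (simp add: mom_def)
    finally have 4: "(\<integral>\<eta>. g \<eta> \<partial>\<nu>) = (\<Sum>A\<in>\<A>. c A * mom True \<nu> A)" .
    have 5: "(\<Sum>A\<in>\<A>. c A * ((\<integral>\<eta>. T t (ind True A) \<eta> \<partial>\<mu>) - mom True \<nu> A))
      = (\<integral>\<eta>. T t g \<eta> \<partial>\<mu>) - (\<integral>\<eta>. g \<eta> \<partial>\<nu>)"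
      unfolding 3 4 by (simp add: right_diff_distrib sum_subtractf)
    show ?thesis using 1 2 unfolding 5 by linarith
  qed
  show ?thesis
  proof (rule exI[of _ \<A>], rule exI[of _ c], intro conjI allI impI ballI)
    show "finite A" if "A \<in> \<A>" for A using \<A>(2) that by blast
  qed (rule \<A>(1), rule main)
qed

lemma law_weak_convI:
  assumes T: "feller_semigroup T" and \<pi>: "\<pi> \<in> cfg_probs" and \<mu>: "\<mu> \<in> cfg_probs"
    and lim: "\<And>A. finite A \<Longrightarrow> ((\<lambda>t. \<integral>\<eta>. T t (ind True A) \<eta> \<partial>\<pi>) \<longlongrightarrow> mom True \<mu> A) at_top"
  shows "law_weak_conv T \<pi> \<mu>"
  unfolding law_weak_conv_def
proof (intro ballI tendstoI)
  fix f :: "('a \<Rightarrow> bool) \<Rightarrow> real" and e :: real assume f: "f \<in> cfg_cont" and e: "0 < e"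
  then obtain \<A> c where \<A>: "finite \<A>" "\<forall>A\<in>\<A>. finite A" and b: "\<forall>t\<ge>0. \<forall>\<mu>\<in>cfg_probs. \<forall>\<nu>\<in>cfg_probs.
    \<bar>((\<integral>\<eta>. T t f \<eta> \<partial>\<mu>) - (\<integral>\<eta>. f \<eta> \<partial>\<nu>))
      - (\<Sum>A\<in>\<A>. c A * ((\<integral>\<eta>. T t (ind True A) \<eta> \<partial>\<mu>) - mom True \<nu> A))\<bar> \<le> e / 2"
    using cylinder_reduction[OF T f half_gt_zero[OF e]] by (elim exE conjE) (rule that)
  have "((\<lambda>t. \<Sum>A\<in>\<A>. c A * ((\<integral>\<eta>. T t (ind True A) \<eta> \<partial>\<pi>) - mom True \<mu> A)) \<longlongrightarrow> (\<Sum>A\<in>\<A>. c A * (mom True \<mu> A - mom True \<mu> A))) at_top"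
    using \<A>(2) by (intro tendsto_sum tendsto_mult tendsto_diff tendsto_const lim) blast
  then have "((\<lambda>t. \<Sum>A\<in>\<A>. c A * ((\<integral>\<eta>. T t (ind True A) \<eta> \<partial>\<pi>) - mom True \<mu> A)) \<longlongrightarrow> 0) at_top" by simp
  from tendstoD[OF this, of "e / 2"] e
  have "\<forall>\<^sub>F t in at_top. \<bar>\<Sum>A\<in>\<A>. c A * ((\<integral>\<eta>. T t (ind True A) \<eta> \<partial>\<pi>) - mom True \<mu> A)\<bar> < e / 2" by simp
  with eventually_ge_at_top[of 0] show "\<forall>\<^sub>F t in at_top. dist (\<integral>\<eta>. T t f \<eta> \<partial>\<pi>) (\<integral>\<eta>. f \<eta> \<partial>\<mu>) < e"
  proof eventually_elim
    case (elim t)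
    have "\<bar>((\<integral>\<eta>. T t f \<eta> \<partial>\<pi>) - (\<integral>\<eta>. f \<eta> \<partial>\<mu>))
      - (\<Sum>A\<in>\<A>. c A * ((\<integral>\<eta>. T t (ind True A) \<eta> \<partial>\<pi>) - mom True \<mu> A))\<bar> \<le> e / 2"
      using b elim(1) \<pi> \<mu> by blast
    then show ?case using elim(2) unfolding dist_real_def by linarith
  qed
qed

text \<open>\<open>T s f\<close> is again continuous, and delaying the observation by
  \<open>s\<close> does not change the limit.\<close>

lemma weak_limit_stationary:
  assumes T: "feller_semigroup T" and \<mu>: "\<mu> \<in> cfg_probs" and lim: "law_weak_conv T \<pi> \<mu>"
  shows "stationary T \<mu>"
  unfolding stationary_def
proof (intro conjI \<mu> allI impI ballI)
  fix s :: real and f :: "('a \<Rightarrow> bool) \<Rightarrow> real" assume s: "0 \<le> s" and f: "f \<in> cfg_cont"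
  have "((\<lambda>t. \<integral>\<eta>. T t (T s f) \<eta> \<partial>\<pi>) \<longlongrightarrow> (\<integral>\<eta>. T s f \<eta> \<partial>\<mu>)) at_top"
    using lim feller_cont[OF T s f] unfolding law_weak_conv_def by blast
  moreover have "\<forall>\<^sub>F t in at_top. (\<integral>\<eta>. T t (T s f) \<eta> \<partial>\<pi>) = (\<integral>\<eta>. T (t + s) f \<eta> \<partial>\<pi>)"
    using eventually_ge_at_top[of 0] by eventually_elim (simp add: feller_add[OF T _ s f])
  ultimately have "((\<lambda>t. \<integral>\<eta>. T (t + s) f \<eta> \<partial>\<pi>) \<longlongrightarrow> (\<integral>\<eta>. T s f \<eta> \<partial>\<mu>)) at_top"
    by (simp add: tendsto_cong)
  moreover have "((\<lambda>t. \<integral>\<eta>. T (t + s) f \<eta> \<partial>\<pi>) \<longlongrightarrow> (\<integral>\<eta>. f \<eta> \<partial>\<mu>)) at_top"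
  proof (rule filterlim_compose[of "\<lambda>t. \<integral>\<eta>. T t f \<eta> \<partial>\<pi>"])
    show "((\<lambda>t. \<integral>\<eta>. T t f \<eta> \<partial>\<pi>) \<longlongrightarrow> (\<integral>\<eta>. f \<eta> \<partial>\<mu>)) at_top" using lim f unfolding law_weak_conv_def by blast
    show "filterlim (\<lambda>t. t + s) at_top at_top" using filterlim_tendsto_add_at_top[OF tendsto_const[of s] filterlim_ident[of at_top]] by (simp add: add.commute)
  qed
  ultimately show "(\<integral>\<eta>. T s f \<eta> \<partial>\<mu>) = (\<integral>\<eta>. f \<eta> \<partial>\<mu>)" by (rule tendsto_unique[OF trivial_limit_at_top_linorder])
qed

text \<open>Positivity of the semigroup makes the inclusion-exclusion expressions nonnegative at
  every time. They involve finitely many moments, so nonnegativity passes to the limit, where it is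
  the extension criterion.\<close>

lemma weak_limit_exists:
  assumes T: "feller_semigroup T" and \<pi>: "\<pi> \<in> cfg_probs"
    and lim: "\<And>A. finite A \<Longrightarrow> ((\<lambda>t. \<integral>\<eta>. T t (ind True A) \<eta> \<partial>\<pi>) \<longlongrightarrow> \<phi> A) at_top"
  shows "\<exists>\<mu>\<in>cfg_probs. \<forall>A. finite A \<longrightarrow> mom True \<mu> A = \<phi> A"
proof -
  interpret prob_space \<pi> using cfg_probsD[OF \<pi>] by simp
  have cyl: "cylinder_fun (ind True A)" if "finite A" for A using that by (rule cylinder_ind)
  have "\<exists>\<mu>\<in>cfg_probs. \<forall>A. finite A \<longrightarrow> (\<integral>\<eta>. ind True A \<eta> \<partial>\<mu>) = \<phi> A"
  proof (rule cfg_probs_exists)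
    have 1: "\<forall>\<^sub>F t in at_top. (\<integral>\<eta>. T t (ind True {}) \<eta> \<partial>\<pi>) = 1"
      using eventually_ge_at_top[of 0]
    proof eventually_elim
      case (elim t)
      have "ind True ({} :: 'a set) = (\<lambda>_. 1)" by (rule ext) simp
      then show ?case using feller_1[OF T elim] prob_space by simp
    qed
    have "((\<lambda>t. \<integral>\<eta>. T t (ind True {}) \<eta> \<partial>\<pi>) \<longlongrightarrow> 1) at_top" by (rule tendsto_eventually[OF 1])
    from tendsto_unique[OF _ lim[of "{}"] this] show "\<phi> {} = 1" by simp
    fix A C :: "'a set" assume A: "finite A" and C: "finite C" and AC: "A \<inter> C = {}"
    have fin: "finite (A \<union> B)" if "B \<in> Pow C" for B using that A C finite_subset by auto
    have "((\<lambda>t. incl (\<lambda>B. \<integral>\<eta>. T t (ind True B) \<eta> \<partial>\<pi>) A C) \<longlongrightarrow> incl \<phi> A C) at_top"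
      unfolding incl_def by (intro tendsto_sum tendsto_mult tendsto_const lim fin)
    moreover have "\<forall>\<^sub>F t in at_top. 0 \<le> incl (\<lambda>B. \<integral>\<eta>. T t (ind True B) \<eta> \<partial>\<pi>) A C"
      using eventually_ge_at_top[of 0]
    proof eventually_elim
      case (elim t)
      have int: "integrable \<pi> (T t (ind True (A \<union> B)))" if "B \<in> Pow C" for B
        by (rule cfg_cont_integrable[OF feller_cont[OF T elim cylinder_cont[OF cyl[OF fin[OF that]]]] \<pi>])
      let ?g = "\<lambda>\<eta>. \<Sum>B\<in>Pow C. (-1) ^ card B * ind True (A \<union> B) \<eta>"
      have g: "?g \<eta> = ind True A \<eta> * ind False C \<eta>" for \<eta>
        using incl_ind[OF C, of \<eta> A] by (simp add: incl_def)
      have gc: "?g \<in> cfg_cont" using C fin by (intro cylinder_cont cylinder_sum cyl) simp_all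
      have "0 \<le> T t ?g \<eta>" for \<eta>
        by (rule feller_pos[OF T elim gc]) (simp only: g mult_nonneg_nonneg ind_nonneg)
      then have "0 \<le> (\<integral>\<eta>. T t ?g \<eta> \<partial>\<pi>)" by simp
      also have "T t ?g = (\<lambda>\<eta>. \<Sum>B\<in>Pow C. (-1) ^ card B * T t (ind True (A \<union> B)) \<eta>)"
        using C by (intro ext feller_sum[OF T elim] cyl fin) simp_all
      also have "(\<integral>\<eta>. (\<Sum>B\<in>Pow C. (-1) ^ card B * T t (ind True (A \<union> B)) \<eta>) \<partial>\<pi>) = incl (\<lambda>B. \<integral>\<eta>. T t (ind True B) \<eta> \<partial>\<pi>) A C"
        using int by (simp add: incl_def)
      finally show ?case .
    qed
    ultimately show "0 \<le> incl \<phi> A C" by (rule tendsto_lowerbound) simp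
  qed
  then show ?thesis by (auto simp: mom_def)
qed

section \<open>Moments of the process and of stationary measures\<close>

locale voter_stirring = stirring_graph E d \<theta> for E :: "'v \<Rightarrow> 'v \<Rightarrow> bool" and d \<theta> +
  fixes v :: real and T :: "real \<Rightarrow> (('v \<Rightarrow> bool) \<Rightarrow> real) \<Rightarrow> (('v \<Rightarrow> bool) \<Rightarrow> real)"
  assumes T: "voter_stir_semigroup E d v T" and v: "0 < v" and \<theta>v: "\<theta> = 1 / (1 + v)"
begin

lemma feller: "feller_semigroup T" using T by (simp add: voter_stir_semigroup_def)

lemma flow_moment:
  assumes \<mu>: "\<mu> \<in> cfg_probs" and A: "finite A" "card A \<le> n" and t: "0 \<le> t"
  shows "(\<integral>\<eta>. T t (ind b A) \<eta> \<partial>\<mu>) = sgrp (dualop n) ((1 + v) * t) (mom b \<mu>) A"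
proof -
  let ?F = "\<lambda>\<eta> B. if finite B then ind b B \<eta> else (0 :: real)"
  have "T t (ind b A) \<eta> = sgrp (dualop n) ((1 + v) * t) (?F \<eta>) A" for \<eta>
    unfolding duality[OF T v \<theta>v A t] by (rule dual_local[OF _ A]) simp
  moreover have "(\<integral>\<eta>. sgrp (dualop n) ((1 + v) * t) (?F \<eta>) A \<partial>\<mu>) = sgrp (dualop n) ((1 + v) * t) (\<lambda>B. \<integral>\<eta>. ?F \<eta> B \<partial>\<mu>) A"
  proof (rule sgrp_integral[OF cfg_probsD(1)[OF \<mu>] jump_dualop])
    show "bnd 1 (?F \<eta>)" for \<eta> by (simp add: bnd_def ind_le_1 ind_nonneg)
    show "(\<lambda>\<eta>. ?F \<eta> B) \<in> borel_measurable \<mu>" for B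
      using ind_integrable[OF \<mu>, of B b] by (cases "finite B") auto
  qed
  moreover have "(\<lambda>B. \<integral>\<eta>. ?F \<eta> B \<partial>\<mu>) = mom b \<mu>" by (rule ext) (simp add: mom_def)
  ultimately show ?thesis by simp
qed

lemma dualop_outside: "\<not> (finite A \<and> card A \<le> n) \<Longrightarrow> dualop n f A = 0"
  by (auto simp: dualop_def)

text \<open>Stationarity keeps the moments fixed under the dual flow: within the cutoff by duality
  at time t/(1+v), beyond it because those states are absorbing.\<close>

lemma stationary_harmonic:
  assumes st: "stationary T \<mu>"
  shows "dualop n (mom b \<mu>) A = 0"
proof -
  have \<mu>: "\<mu> \<in> cfg_probs" by (rule stationary_cfg[OF st])
  have inv: "sgrp (dualop n) t (mom b \<mu>) B = mom b \<mu> B" if t: "0 \<le> t" for t B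
  proof (cases "finite B \<and> card B \<le> n")
    case True
    have s: "0 \<le> t / (1 + v)" "(1 + v) * (t / (1 + v)) = t" using v t by simp_all
    have "(\<integral>\<eta>. T (t / (1 + v)) (ind b B) \<eta> \<partial>\<mu>) = (\<integral>\<eta>. ind b B \<eta> \<partial>\<mu>)"
      using st s(1) cylinder_cont[OF cylinder_ind] True unfolding stationary_def by blast
    then show ?thesis using flow_moment[OF \<mu> conjunct1[OF True] conjunct2[OF True] s(1), of b] True s(2) by (simp add: mom_def)
  next
    case False
    have "sgrp (dualop n) t (mom b \<mu>) B = sgrp (dualop n) t (\<lambda>_. mom b \<mu> B) B"
      by (rule sgrp_local[of "\<lambda>C. C = B"]) (use False in \<open>simp_all add: dualop_outside\<close>)
    then show ?thesis by (simp add: sgrp_const[OF jump_dualop])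
  qed
  then have "sgrp (dualop n) t (mom b \<mu>) = mom b \<mu>" if "0 \<le> t" for t using that by (intro ext)
  then show ?thesis by (rule sgrp_invariant_harmonic[OF jump_dualop bnd_mom[OF \<mu>]])
qed

section \<open>Limit measures and infinite collisions\<close>

lemma bnd_card_fun: "cmono c \<Longrightarrow> bnd 1 (\<lambda>B. c (card B))"
  by (simp add: bnd_def cmono_nonneg cmono_le_1)

lemma dualop_card_nonneg:
  assumes c: "decseq c"
  shows "0 \<le> dualop n (\<lambda>B. c (card B)) A"
proof (cases "finite A \<and> card A \<le> n")
  case True
  have "0 \<le> \<rho> A (snd m) * (c (card (insert (snd m) (A - {fst m}))) - c (card A))" if "m \<in> smoves A" for m
  proof (intro mult_nonneg_nonneg \<rho>_nonneg)
    have "card (insert (snd m) (A - {fst m})) \<le> card A"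
      using that True by (intro card_move_le) (auto simp: smoves_def)
    then show "0 \<le> c (card (insert (snd m) (A - {fst m}))) - c (card A)" using decseqD[OF c] by simp
  qed
  then show ?thesis unfolding dualop_def if_P[OF True] by (rule sum_nonneg)
next
  case False
  then show ?thesis by (simp add: dualop_outside)
qed

text \<open>The number of particles never increases and \<open>c\<close> is nonincreasing, so
  \<open>c\<close> of the cardinality is subharmonic and its bounded evolution is monotone in
  time.\<close>

lemma card_fun_limit:
  assumes c: "cmono c"
  shows "\<exists>l. ((\<lambda>t. sgrp (dualop n) t (\<lambda>B. c (card B)) A) \<longlongrightarrow> l) at_top"
proof -
  let ?u = "\<lambda>t. sgrp (dualop n) t (\<lambda>B. c (card B)) A"
  \<comment> \<open>\<open>max 0\<close> extends the monotonicity from nonnegative times to all real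
    times.\<close>
  have mono: "mono (\<lambda>t. ?u (max 0 t))"
    by (intro monoI sgrp_mono_time[OF jump_dualop bnd_card_fun[OF c] dualop_card_nonneg[OF cmono_decseq[OF c]]]) auto
  have "incseq (\<lambda>k. ?u (max 0 (real k)))" unfolding incseq_def by (intro allI impI monoD[OF mono]) simp
  moreover have "bdd_above (range (\<lambda>k. ?u (max 0 (real k))))"
  proof (rule bdd_aboveI2)
    fix k show "?u (max 0 (real k)) \<le> 1" by (rule abs_le_D1[OF bndD[OF sgrp_bnd[OF jump_dualop bnd_card_fun[OF c]]]]) simp
  qed
  ultimately obtain l where "(\<lambda>k. ?u (max 0 (real k))) \<longlonglongrightarrow> l" using LIMSEQ_incseq_SUP by blast
  from tendsto_at_topI_sequentially_real[OF mono this]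
  have "((\<lambda>t. ?u (max 0 t)) \<longlongrightarrow> l) at_top" .
  moreover have "\<forall>\<^sub>F t in at_top. ?u (max 0 t) = ?u t"
    using eventually_ge_at_top[of 0] by eventually_elim (simp add: max_def)
  ultimately have "(?u \<longlongrightarrow> l) at_top" by (rule Lim_transform_eventually)
  then show ?thesis by blast
qed

lemma flow_card:
  assumes \<pi>: "\<pi> \<in> cfg_probs" and mom: "\<And>A. finite A \<Longrightarrow> mom True \<pi> A = c (card A)"
    and A: "finite A" "card A \<le> n" and t: "0 \<le> t"
  shows "(\<integral>\<eta>. T t (ind True A) \<eta> \<partial>\<pi>) = sgrp (dualop n) ((1 + v) * t) (\<lambda>B. c (card B)) A"
  unfolding flow_moment[OF \<pi> A t] by (rule dual_local[OF _ A]) (simp add: mom)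

lemma flow_card_tendsto:
  assumes \<pi>: "\<pi> \<in> cfg_probs" and mom: "\<And>A. finite A \<Longrightarrow> mom True \<pi> A = c (card A)"
    and A: "finite A" "card A \<le> n"
    and lim: "((\<lambda>t. sgrp (dualop n) t (\<lambda>B. c (card B)) A) \<longlongrightarrow> l) at_top"
  shows "((\<lambda>t. \<integral>\<eta>. T t (ind True A) \<eta> \<partial>\<pi>) \<longlongrightarrow> l) at_top"
proof (rule Lim_transform_eventually)
  have "filterlim (\<lambda>t. (1 + v) * t) at_top at_top"
    by (rule filterlim_tendsto_pos_mult_at_top[OF tendsto_const _ filterlim_ident]) (use v in simp)
  from filterlim_compose[OF lim this]
  show "((\<lambda>t. sgrp (dualop n) ((1 + v) * t) (\<lambda>B. c (card B)) A) \<longlongrightarrow> l) at_top" .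
  show "\<forall>\<^sub>F t in at_top. sgrp (dualop n) ((1 + v) * t) (\<lambda>B. c (card B)) A = (\<integral>\<eta>. T t (ind True A) \<eta> \<partial>\<pi>)"
    using eventually_ge_at_top[of 0] by eventually_elim (simp add: flow_card[OF \<pi> mom A])
qed

text \<open>The moments are prescribed for every admissible cutoff at once, so that the cutoff can
  be chosen freely afterwards. For the powers of \<alpha> this is the limit law started from the
  Bernoulli product.\<close>

definition lim_meas :: "(nat \<Rightarrow> real) \<Rightarrow> ('v \<Rightarrow> bool) measure" where
  "lim_meas c = (SOME \<mu>. \<mu> \<in> cfg_probs \<and> (\<forall>A n. finite A \<longrightarrow> card A \<le> n \<longrightarrow>
     ((\<lambda>t. sgrp (dualop n) t (\<lambda>B. c (card B)) A) \<longlongrightarrow> mom True \<mu> A) at_top))"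

lemma lim_meas_ex:
  assumes c: "cmono c"
  shows "lim_meas c \<in> cfg_probs \<and> (\<forall>A n. finite A \<longrightarrow> card A \<le> n \<longrightarrow>
     ((\<lambda>t. sgrp (dualop n) t (\<lambda>B. c (card B)) A) \<longlongrightarrow> mom True (lim_meas c) A) at_top)"
  unfolding lim_meas_def
proof (rule someI_ex)
  obtain \<pi> :: "('v \<Rightarrow> bool) measure" where \<pi>: "\<pi> \<in> cfg_probs" and m: "\<forall>A. finite A \<longrightarrow> mom True \<pi> A = c (card A)"
    using exchangeable_exists[OF c] by blast
  have mom: "\<And>A. finite A \<Longrightarrow> mom True \<pi> A = c (card A)" using m by blast
  define \<phi> where "\<phi> n A = (SOME l. ((\<lambda>t. sgrp (dualop n) t (\<lambda>B. c (card B)) A) \<longlongrightarrow> l) at_top)" for n A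
  have \<phi>: "((\<lambda>t. sgrp (dualop n) t (\<lambda>B. c (card B)) A) \<longlongrightarrow> \<phi> n A) at_top" for n A
    unfolding \<phi>_def by (rule someI_ex[OF card_fun_limit[OF c]])
  have fl: "((\<lambda>t. \<integral>\<eta>. T t (ind True A) \<eta> \<partial>\<pi>) \<longlongrightarrow> \<phi> n A) at_top" if "finite A" "card A \<le> n" for A n
    by (rule flow_card_tendsto[OF \<pi> mom that \<phi>])
  have \<phi>eq: "\<phi> n A = \<phi> (card A) A" if "finite A" "card A \<le> n" for A n
    by (rule tendsto_unique[OF trivial_limit_at_top_linorder fl[OF that] fl[OF that(1) order_refl]])
  have fl': "((\<lambda>t. \<integral>\<eta>. T t (ind True A) \<eta> \<partial>\<pi>) \<longlongrightarrow> \<phi> (card A) A) at_top" if "finite A" for A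
    by (rule fl[OF that order_refl])
  obtain \<mu> where \<mu>: "\<mu> \<in> cfg_probs" and m\<mu>: "\<forall>A. finite A \<longrightarrow> mom True \<mu> A = \<phi> (card A) A"
    using weak_limit_exists[where \<phi> = "\<lambda>A. \<phi> (card A) A", OF feller \<pi> fl'] by blast
  show "\<exists>\<mu>. \<mu> \<in> cfg_probs \<and> (\<forall>A n. finite A \<longrightarrow> card A \<le> n \<longrightarrow>
     ((\<lambda>t. sgrp (dualop n) t (\<lambda>B. c (card B)) A) \<longlongrightarrow> mom True \<mu> A) at_top)"
  proof (intro exI[of _ \<mu>] conjI \<mu> allI impI)
    fix A :: "'v set" and n assume A: "finite A" "card A \<le> n"
    have "mom True \<mu> A = \<phi> n A" using m\<mu> A \<phi>eq[OF A] by simp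
    then show "((\<lambda>t. sgrp (dualop n) t (\<lambda>B. c (card B)) A) \<longlongrightarrow> mom True \<mu> A) at_top" using \<phi>[of n A] by simp
  qed
qed

lemma lim_meas_cfg: "cmono c \<Longrightarrow> lim_meas c \<in> cfg_probs"
  by (rule lim_meas_ex[THEN conjunct1])

lemma lim_meas_tendsto:
  "cmono c \<Longrightarrow> finite A \<Longrightarrow> card A \<le> n \<Longrightarrow>
    ((\<lambda>t. sgrp (dualop n) t (\<lambda>B. c (card B)) A) \<longlongrightarrow> mom True (lim_meas c) A) at_top"
  by (rule lim_meas_ex[THEN conjunct2, rule_format])

lemma lim_meas_conv:
  assumes c: "cmono c" and \<pi>: "\<pi> \<in> cfg_probs" and mom: "\<And>A. finite A \<Longrightarrow> mom True \<pi> A = c (card A)"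
  shows "law_weak_conv T \<pi> (lim_meas c)"
  by (rule law_weak_convI[OF feller \<pi> lim_meas_cfg[OF c] flow_card_tendsto[OF \<pi> mom _ order_refl lim_meas_tendsto[OF c _ order_refl]]])

lemma lim_meas_stationary:
  assumes c: "cmono c"
  shows "stationary T (lim_meas c)"
proof -
  obtain \<pi> :: "('v \<Rightarrow> bool) measure" where \<pi>: "\<pi> \<in> cfg_probs" and m: "\<forall>A. finite A \<longrightarrow> mom True \<pi> A = c (card A)"
    using exchangeable_exists[OF c] by blast
  show ?thesis
    by (rule weak_limit_stationary[OF feller lim_meas_cfg[OF c] lim_meas_conv[OF c \<pi>]]) (use m in blast)
qed

lemma lim_meas_close:
  assumes c: "cmono c" and J: "finite J"
  shows "\<bar>mom True (lim_meas c) (x ` J) - c (card (x ` J))\<bar> \<le> 2 / \<theta> * HH J x"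
proof (rule tendsto_upperbound)
  show "((\<lambda>t. \<bar>sgrp (dualop (card J)) t (\<lambda>B. c (card B)) (x ` J) - c (card (x ` J))\<bar>) \<longlongrightarrow>
    \<bar>mom True (lim_meas c) (x ` J) - c (card (x ` J))\<bar>) at_top"
    using J by (intro tendsto_intros lim_meas_tendsto[OF c] card_image_le) simp_all
  show "\<forall>\<^sub>F t in at_top. \<bar>sgrp (dualop (card J)) t (\<lambda>B. c (card B)) (x ` J) - c (card (x ` J))\<bar> \<le> 2 / \<theta> * HH J x"
    using eventually_ge_at_top[of 0]
    by eventually_elim (rule card_fun_vs_dual[OF J order_refl cmono_nonneg[OF c] cmono_le_1[OF c]])
qed simp

text \<open>A single particle has no partner, so its \<open>HH\<close> is zero and the moment is
  exact. This separates the limit measures for different \<alpha>.\<close>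

lemma lim_meas_singleton:
  assumes c: "cmono c"
  shows "mom True (lim_meas c) {x} = c 1"
  using lim_meas_close[OF c, of "{0}" "\<lambda>_. x"] by (simp add: HH_def)

lemma lim_meas_mix:
  assumes c: "cmono c1" "cmono c2" and a: "0 \<le> a" "a \<le> 1" and A: "finite A"
  shows "mom True (lim_meas (\<lambda>n. a * c1 n + (1 - a) * c2 n)) A = a * mom True (lim_meas c1) A + (1 - a) * mom True (lim_meas c2) A"
proof (rule tendsto_unique[OF trivial_limit_at_top_linorder lim_meas_tendsto[OF cmono_mix[OF c a] A order_refl]])
  have "((\<lambda>t. a * sgrp (dualop (card A)) t (\<lambda>B. c1 (card B)) A + (1 - a) * sgrp (dualop (card A)) t (\<lambda>B. c2 (card B)) A)
    \<longlongrightarrow> a * mom True (lim_meas c1) A + (1 - a) * mom True (lim_meas c2) A) at_top"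
    by (intro tendsto_intros lim_meas_tendsto c A order_refl)
  then show "((\<lambda>t. sgrp (dualop (card A)) t (\<lambda>B. a * c1 (card B) + (1 - a) * c2 (card B)) A)
    \<longlongrightarrow> a * mom True (lim_meas c1) A + (1 - a) * mom True (lim_meas c2) A) at_top"
    by (simp only: sgrp_linear[OF jump_dualop bnd_card_fun[OF c(1)] bnd_card_fun[OF c(2)]])
qed

lemma return_cfg: "return cfg_space \<eta> \<in> cfg_probs"
  by (simp add: cfg_probs_def prob_space_return)

lemma return_mom: "finite A \<Longrightarrow> mom True (return cfg_space \<eta>) A = ind True A \<eta>"
  by (simp add: mom_def integral_return ind_measurable)

lemma lim_meas_1_mom:
  assumes A: "finite A"
  shows "mom True (lim_meas (\<lambda>n. 1 ^ n)) A = 1"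
proof -
  have c: "cmono (\<lambda>n. 1 ^ n)" by (rule cmono_power) simp_all
  have "((\<lambda>t. sgrp (dualop (card A)) t (\<lambda>B. 1 ^ card B) A) \<longlongrightarrow> 1) at_top"
    by (simp add: sgrp_const[OF jump_dualop])
  from tendsto_unique[OF trivial_limit_at_top_linorder lim_meas_tendsto[OF c A order_refl] this] show ?thesis .
qed

lemma lim_meas_0_mom:
  assumes A: "finite A"
  shows "mom True (lim_meas (\<lambda>n. 0 ^ n)) A = of_bool (A = {})"
proof (cases "A = {}")
  case True
  then show ?thesis using mom_empty[OF lim_meas_cfg[OF cmono_power[of 0]]] by simp
next
  case False
  then obtain x where "x \<in> A" by blast
  have c: "cmono (\<lambda>n. 0 ^ n)" by (rule cmono_power) simp_all
  have "mom True (lim_meas (\<lambda>n. 0 ^ n)) A \<le> 0"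
    using mom_mono[OF lim_meas_cfg[OF c] A, of "{x}" True] lim_meas_singleton[OF c, of x] \<open>x \<in> A\<close> by simp
  then show ?thesis using mom_nonneg[of True "lim_meas (\<lambda>n. 0 ^ n)" A] False by simp
qed

lemma lim_meas_1: "lim_meas (\<lambda>n. 1 ^ n) = return cfg_space (\<lambda>_. True)"
  by (rule mom_eqI[OF lim_meas_cfg[OF cmono_power] return_cfg]) (simp_all add: lim_meas_1_mom[simplified] return_mom ind_def)

lemma lim_meas_0: "lim_meas (\<lambda>n. 0 ^ n) = return cfg_space (\<lambda>_. False)"
proof (rule mom_eqI[OF lim_meas_cfg[OF cmono_power] return_cfg])
  fix A :: "'v set" assume "finite A"
  then show "mom True (lim_meas (\<lambda>n. 0 ^ n)) A = mom True (return cfg_space (\<lambda>_. False)) A"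
    unfolding lim_meas_0_mom[OF \<open>finite A\<close>] return_mom[OF \<open>finite A\<close>] by (auto simp: ind_def)
qed simp_all

text \<open>Moments lie in [0,1], and a proper convex combination takes an end value only if both
  terms do. The constant configuration of ones is treated in the same way.\<close>

lemma lim_meas_0_extremal: "extremal_stationary T (lim_meas (\<lambda>n. 0 ^ n))"
proof (rule extremal_stationaryI[OF lim_meas_stationary[OF cmono_power]])
  fix \<mu>1 \<mu>2 c
  assume s: "stationary T \<mu>1" "stationary T \<mu>2" and c: "0 < c" "c < 1"
    and m: "\<And>A. finite A \<Longrightarrow> mom True (lim_meas (\<lambda>n. 0 ^ n)) A = c * mom True \<mu>1 A + (1 - c) * mom True \<mu>2 A"
  show "\<mu>1 = \<mu>2"
  proof (rule mom_eqI[OF stationary_cfg[OF s(1)] stationary_cfg[OF s(2)]])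
    fix A :: "'v set" assume A: "finite A"
    show "mom True \<mu>1 A = mom True \<mu>2 A"
    proof (cases "A = {}")
      case True
      then show ?thesis using s by (simp add: mom_empty stationary_cfg)
    next
      case False
      have "c * mom True \<mu>1 A + (1 - c) * mom True \<mu>2 A = 0" using m[OF A] lim_meas_0_mom[OF A] False by simp
      moreover have "0 \<le> c * mom True \<mu>1 A" "0 \<le> (1 - c) * mom True \<mu>2 A" using c by (auto intro!: mult_nonneg_nonneg mom_nonneg)
      ultimately have "c * mom True \<mu>1 A = 0" "(1 - c) * mom True \<mu>2 A = 0" by linarith+
      then show ?thesis using c by simp
    qed
  qed
qed simp_all

lemma lim_meas_1_extremal: "extremal_stationary T (lim_meas (\<lambda>n. 1 ^ n))"
proof (rule extremal_stationaryI[OF lim_meas_stationary[OF cmono_power]])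
  fix \<mu>1 \<mu>2 c
  assume s: "stationary T \<mu>1" "stationary T \<mu>2" and c: "0 < c" "c < 1"
    and m: "\<And>A. finite A \<Longrightarrow> mom True (lim_meas (\<lambda>n. 1 ^ n)) A = c * mom True \<mu>1 A + (1 - c) * mom True \<mu>2 A"
  show "\<mu>1 = \<mu>2"
  proof (rule mom_eqI[OF stationary_cfg[OF s(1)] stationary_cfg[OF s(2)]])
    fix A :: "'v set" assume A: "finite A"
    have e: "c * mom True \<mu>1 A + (1 - c) * mom True \<mu>2 A = 1" using m[OF A] lim_meas_1_mom[OF A] by simp
    have "c * mom True \<mu>1 A \<le> c" "(1 - c) * mom True \<mu>2 A \<le> 1 - c"
      using c mom_le_1[OF stationary_cfg[OF s(1)], of True A] mom_le_1[OF stationary_cfg[OF s(2)], of True A]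
      by (simp_all add: mult_left_le)
    then have "c * mom True \<mu>1 A = c" "(1 - c) * mom True \<mu>2 A = 1 - c" using e by linarith+
    then show "mom True \<mu>1 A = mom True \<mu>2 A" using c by simp
  qed
qed simp_all

text \<open>Under coalescence the disagreement probability is a bounded dual-harmonic function that
  vanishes on singletons, hence zero, and a stationary measure only sees constant configurations.\<close>

lemma coalescing_agree:
  assumes h1: "h {x, y} = 1" and st: "stationary T \<nu>"
  shows "mom True \<nu> {x, y} + mom False \<nu> {x, y} = 1"
proof -
  have \<nu>: "\<nu> \<in> cfg_probs" by (rule stationary_cfg[OF st])
  interpret prob_space \<nu> using cfg_probsD[OF \<nu>] by simp
  \<comment> \<open>The empty set is excluded: there both moments are 1 and the formula would give
    -1.\<close>
  define r where "r B = (if finite B \<and> B \<noteq> {} then 1 - mom True \<nu> B - mom False \<nu> B else 0)" for B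
  have sum_int: "mom True \<nu> B + mom False \<nu> B = (\<integral>\<eta>. ind True B \<eta> + ind False B \<eta> \<partial>\<nu>)" if "finite B" for B
    using that ind_integrable[OF \<nu>] by (simp add: mom_def)
  have r0: "0 \<le> r B" for B
  proof (cases "finite B \<and> B \<noteq> {}")
    case True
    have "ind True B \<eta> + ind False B \<eta> \<le> 1" for \<eta> using True by (auto simp: ind_def)
    then have "(\<integral>\<eta>. ind True B \<eta> + ind False B \<eta> \<partial>\<nu>) \<le> (\<integral>\<eta>. 1 \<partial>\<nu>)"
      using True ind_integrable[OF \<nu>] by (intro integral_mono) auto
    then show ?thesis using sum_int[of B] True by (simp add: r_def prob_space)
  next
    case False
    then show ?thesis unfolding r_def if_not_P[OF False] by simp
  qed
  have r1: "r B \<le> 1" for B using mom_nonneg[of True \<nu> B] mom_nonneg[of False \<nu> B] by (simp add: r_def)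
  have rs: "r B = 0" if "card B \<le> 1" for B
  proof (cases "finite B \<and> B \<noteq> {}")
    case True
    then have "card B = 1" using that by (metis One_nat_def card_0_eq le_SucE le_zero_eq)
    then obtain z where z: "B = {z}" by (rule card_1_singletonE)
    have "ind True B \<eta> + ind False B \<eta> = 1" for \<eta> by (auto simp: z ind_def)
    then show ?thesis using sum_int[of B] True by (simp add: r_def prob_space)
  next
    case False
    then show ?thesis unfolding r_def if_not_P[OF False] by simp
  qed
  have harm: "dualop 2 r B = 0" for B
  proof (cases "finite B \<and> card B \<le> 2")
    case True
    have "dualop 2 r B = (\<Sum>m\<in>smoves B. \<rho> B (snd m) * (r (insert (snd m) (B - {fst m})) - r B))"
      unfolding dualop_def if_P[OF True] ..
    also have "\<dots> = (\<Sum>m\<in>smoves B. - (\<rho> B (snd m) * (mom True \<nu> (insert (snd m) (B - {fst m})) - mom True \<nu> B))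
      - \<rho> B (snd m) * (mom False \<nu> (insert (snd m) (B - {fst m})) - mom False \<nu> B))"
    proof (intro sum.cong refl)
      fix m assume "m \<in> smoves B"
      then have "B \<noteq> {}" by (auto simp: smoves_def)
      then show "\<rho> B (snd m) * (r (insert (snd m) (B - {fst m})) - r B) = - (\<rho> B (snd m) * (mom True \<nu> (insert (snd m) (B - {fst m})) - mom True \<nu> B))
      - \<rho> B (snd m) * (mom False \<nu> (insert (snd m) (B - {fst m})) - mom False \<nu> B)"
        using True by (simp add: r_def algebra_simps)
    qed
    also have "\<dots> = - dualop 2 (mom True \<nu>) B - dualop 2 (mom False \<nu>) B"
      unfolding dualop_def if_P[OF True] by (simp add: sum_subtractf sum_negf)
    finally show ?thesis by (simp add: stationary_harmonic[OF st])
  next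
    case False then show ?thesis by (simp add: dualop_outside)
  qed
  have br: "bnd 1 r" using r0 r1 by (simp add: bnd_def)
  have le: "r {x, y} \<le> 1 - cp t {x, y}" if t: "0 \<le> t" for t
  proof -
    have "r {x, y} = sgrp (dualop 2) t r {x, y}" by (rule sgrp_harmonic[OF jump_dualop harm, symmetric])
    also have "\<dots> \<le> sgrp (dualop 2) t (\<lambda>B. 1 - of_bool (card B \<le> 1)) {x, y}"
    proof (rule sgrp_mono[OF jump_dualop br _ _ t])
      show "bnd 1 (\<lambda>B :: 'v set. 1 - of_bool (card B \<le> 1) :: real)" by (simp add: bnd_def)
      show "r B \<le> 1 - of_bool (card B \<le> 1)" for B using r1[of B] rs[of B] by simp
    qed
    also have "\<dots> = 1 - cp t {x, y}"
      unfolding cp_def by (simp add: sgrp_diff[OF jump_dualop bndI_const bnd_of_bool] sgrp_const[OF jump_dualop])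
    finally show ?thesis .
  qed
  have "((\<lambda>t. 1 - cp t {x, y}) \<longlongrightarrow> 1 - h {x, y}) at_top" by (intro tendsto_intros cp_tendsto)
  then have "r {x, y} \<le> 1 - h {x, y}"
  proof (rule tendsto_lowerbound)
    show "\<forall>\<^sub>F t in at_top. r {x, y} \<le> 1 - cp t {x, y}" using eventually_ge_at_top[of 0] by eventually_elim (rule le)
  qed simp
  then have "r {x, y} = 0" using r0[of "{x, y}"] h1 by simp
  then show ?thesis by (simp add: r_def)
qed

text \<open>Any two sites agree almost surely, so all moments of nonempty sets equal one density a,
  and the measure is the mixture of the two constant configurations with weight a. Extremality
  leaves a = 0 or a = 1.\<close>

theorem inf_collision_extremal:
  assumes ic: "inf_collision E d"
  shows "{\<nu>. extremal_stationary T \<nu>} = {lim_meas (\<lambda>n. 0 ^ n), lim_meas (\<lambda>n. 1 ^ n)}"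
proof (rule equalityI)
  show "{lim_meas (\<lambda>n. 0 ^ n), lim_meas (\<lambda>n. 1 ^ n)} \<subseteq> {\<nu>. extremal_stationary T \<nu>}"
    using lim_meas_0_extremal lim_meas_1_extremal by blast
  show "{\<nu>. extremal_stationary T \<nu>} \<subseteq> {lim_meas (\<lambda>n. 0 ^ n), lim_meas (\<lambda>n. 1 ^ n)}"
  proof
    fix \<nu> assume "\<nu> \<in> {\<nu>. extremal_stationary T \<nu>}"
    then have ex: "extremal_stationary T \<nu>" by simp
    then have st: "stationary T \<nu>" by (simp add: extremal_stationary_def)
    have \<nu>: "\<nu> \<in> cfg_probs" by (rule stationary_cfg[OF st])
    interpret prob_space \<nu> using cfg_probsD[OF \<nu>] by simp
    have sing: "mom True \<nu> {x} + mom False \<nu> {x} = 1" for x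
      using coalescing_agree[OF inf_collision_coalesce[OF ic] st, of x x] by simp
    have pair: "mom True \<nu> {x, y} = mom True \<nu> {x}" for x y
      using coalescing_agree[OF inf_collision_coalesce[OF ic] st, of x y] sing[of x]
        mom_mono[OF \<nu>, of "{x, y}" "{x}" True] mom_mono[OF \<nu>, of "{x, y}" "{x}" False] by simp
    have eq: "mom True \<nu> {x} = mom True \<nu> {y}" for x y using pair[of x y] pair[of y x] by (simp add: insert_commute)
    define a where "a = mom True \<nu> {undefined}"
    have a: "mom True \<nu> {x} = a" for x unfolding a_def by (rule eq)
    have mom: "mom True \<nu> A = a" if A: "finite A" and x: "x \<in> A" for A x
    proof (rule antisym)
      show "mom True \<nu> A \<le> a" using mom_mono[OF \<nu> A, of "{x}" True] x a by simp
      have i: "integrable \<nu> (\<lambda>\<eta>. ind True {x} \<eta>)" "integrable \<nu> (\<lambda>\<eta>. ind True {x, y} \<eta>)" "integrable \<nu> (\<lambda>\<eta>. ind True A \<eta>)" for y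
        using ind_integrable[OF \<nu>] A by simp_all
      \<comment> \<open>Union bound: if x carries a one but \<open>A\<close> is not full of ones,
        some y in \<open>A\<close> disagrees with x.\<close>
      have "ind True {x} \<eta> \<le> ind True A \<eta> + (\<Sum>y\<in>A. ind True {x} \<eta> - ind True {x, y} \<eta>)" for \<eta>
      proof (cases "\<eta> x \<and> \<not> (\<forall>y\<in>A. \<eta> y)")
        case True
        then obtain y where y: "y \<in> A" "\<not> \<eta> y" "\<eta> x" by blast
        have "ind True {x} \<eta> - ind True {x, y} \<eta> \<le> (\<Sum>y\<in>A. ind True {x} \<eta> - ind True {x, y} \<eta>)"
          by (rule member_le_sum[OF y(1) _ A]) (auto simp: ind_def)
        then show ?thesis using y by (simp add: ind_def split: if_splits)
      next
        case False
        have "0 \<le> (\<Sum>y\<in>A. ind True {x} \<eta> - ind True {x, y} \<eta>)" by (rule sum_nonneg) (auto simp: ind_def)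
        moreover have "ind True {x} \<eta> \<le> ind True A \<eta>" using False by (auto simp: ind_def)
        ultimately show ?thesis by linarith
      qed
      then have "(\<integral>\<eta>. ind True {x} \<eta> \<partial>\<nu>) \<le> (\<integral>\<eta>. ind True A \<eta> + (\<Sum>y\<in>A. ind True {x} \<eta> - ind True {x, y} \<eta>) \<partial>\<nu>)"
        using i by (intro integral_mono) auto
      also have "\<dots> = mom True \<nu> A + (\<Sum>y\<in>A. mom True \<nu> {x} - mom True \<nu> {x, y})"
        using i A by (simp add: mom_def)
      finally show "a \<le> mom True \<nu> A" using a[of x] by (simp add: pair) (simp add: mom_def)
    qed
    have mix: "mom True \<nu> A = a * mom True (lim_meas (\<lambda>n. 1 ^ n)) A + (1 - a) * mom True (lim_meas (\<lambda>n. 0 ^ n)) A" if A: "finite A" for A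
      unfolding lim_meas_0_mom[OF A] lim_meas_1_mom[OF A] using mom[OF A] mom_empty[OF \<nu>] by (cases "A = {}") auto
    have a01: "0 \<le> a" "a \<le> 1" unfolding a_def by (simp_all add: mom_nonneg mom_le_1[OF \<nu>])
    have "\<not> (0 < a \<and> a < 1)"
    proof
      assume "0 < a \<and> a < 1"
      have c: "cmono (\<lambda>n. 1 ^ n)" "cmono (\<lambda>n. 0 ^ n)" by (rule cmono_power, simp_all)+
      have "lim_meas (\<lambda>n. 1 ^ n) = lim_meas (\<lambda>n. 0 ^ n)"
        by (rule extremal_stationaryD[OF ex lim_meas_stationary[OF c(1)] lim_meas_stationary[OF c(2)] _ _ mix])
          (use \<open>0 < a \<and> a < 1\<close> in simp_all)
      then show False using lim_meas_1_mom[of "{undefined}"] lim_meas_0_mom[of "{undefined}"] by simp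
    qed
    then consider "a = 0" | "a = 1" using a01 by linarith
    then show "\<nu> \<in> {lim_meas (\<lambda>n. 0 ^ n), lim_meas (\<lambda>n. 1 ^ n)}"
    proof cases
      case 1
      have "\<nu> = lim_meas (\<lambda>n. 0 ^ n)" by (rule mom_eqI[OF \<nu> lim_meas_cfg[OF cmono_power]]) (simp_all add: mix 1)
      then show ?thesis by simp
    next
      case 2
      have "\<nu> = lim_meas (\<lambda>n. 1 ^ n)" by (rule mom_eqI[OF \<nu> lim_meas_cfg[OF cmono_power]]) (simp_all add: mix 2)
      then show ?thesis by simp
    qed
  qed
qed

end

section \<open>Stationary measures under finite collisions\<close>

lemma sgrp_abs_le:
  assumes L: "jump_op \<Lambda> L" and f: "bnd B f" and g: "bnd B' g" and k: "bnd C k"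
    and le: "\<And>a. \<bar>f a - g a\<bar> \<le> k a" and t: "0 \<le> t"
  shows "\<bar>sgrp L t f a - sgrp L t g a\<bar> \<le> sgrp L t k a"
proof -
  have b: "bnd (P + Q) (\<lambda>a. p a + q a)" if "bnd P p" "bnd Q q" for P Q p q
    unfolding bnd_def using bndD[OF that(1)] bndD[OF that(2)] by (meson abs_triangle_ineq add_mono order_trans)
  have "sgrp L t f a \<le> sgrp L t (\<lambda>a. g a + k a) a"
    by (rule sgrp_mono[OF L f b[OF g k] _ t]) (use le in \<open>simp add: abs_le_iff algebra_simps\<close>)
  moreover have "sgrp L t g a \<le> sgrp L t (\<lambda>a. f a + k a) a"
  proof (rule sgrp_mono[OF L g b[OF f k] _ t])
    show "g a \<le> f a + k a" for a using le[of a] by linarith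
  qed
  ultimately show ?thesis unfolding sgrp_add[OF L g k] sgrp_add[OF L f k] by linarith
qed

lemma bnd_sum:
  assumes "\<And>s. s \<in> S \<Longrightarrow> bnd B (f s)"
  shows "bnd (\<Sum>s\<in>S. \<bar>c s\<bar> * B) (\<lambda>a. \<Sum>s\<in>S. c s * f s a)"
  unfolding bnd_def
proof
  fix a
  have "\<bar>\<Sum>s\<in>S. c s * f s a\<bar> \<le> (\<Sum>s\<in>S. \<bar>c s * f s a\<bar>)" by (rule sum_abs)
  also have "\<dots> \<le> (\<Sum>s\<in>S. \<bar>c s\<bar> * B)"
    unfolding abs_mult by (intro sum_mono mult_left_mono bndD[OF assms]) simp_all
  finally show "\<bar>\<Sum>s\<in>S. c s * f s a\<bar> \<le> (\<Sum>s\<in>S. \<bar>c s\<bar> * B)" .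
qed

context stirring_graph
begin

text \<open>Only labels in the image of \<open>\<sigma>\<close> influence the new configuration; its
  labels outside \<open>J'\<close> rest at the dummy vertex \<open>x0\<close>.\<close>

lemma walkop_relabel:
  assumes J: "finite J" and J': "finite J'" and \<sigma>: "inj_on \<sigma> J'" "\<sigma> ` J' \<subseteq> J"
  shows "walkop J (\<lambda>x. F (\<lambda>i. if i \<in> J' then x (\<sigma> i) else x0)) x
    = walkop J' F (\<lambda>i. if i \<in> J' then x (\<sigma> i) else x0)"
proof -
  let ?\<Phi> = "\<lambda>x i. if i \<in> J' then x (\<sigma> i) else x0"
  have off: "rwop (\<lambda>y. F (?\<Phi> (x(j := y)))) (x j) = 0" if "j \<in> J - \<sigma> ` J'" for j
  proof -
    have "?\<Phi> (x(j := y)) = ?\<Phi> x" for y using that by (intro ext) auto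
    then show ?thesis by (simp only: jump_op_const[OF jump_rwop])
  qed
  have on: "?\<Phi> (x(\<sigma> i := y)) = (?\<Phi> x)(i := y)" if "i \<in> J'" for i y
    using that inj_onD[OF \<sigma>(1)] by (intro ext) auto
  have "walkop J (\<lambda>x. F (?\<Phi> x)) x = (\<Sum>j\<in>J. rwop (\<lambda>y. F (?\<Phi> (x(j := y)))) (x j))"
    by (rule walkop_sum[OF J])
  also have "\<dots> = (\<Sum>j\<in>\<sigma> ` J'. rwop (\<lambda>y. F (?\<Phi> (x(j := y)))) (x j))"
    by (rule sum.mono_neutral_right[OF J \<sigma>(2)]) (use off in blast)
  also have "\<dots> = (\<Sum>i\<in>J'. rwop (\<lambda>y. F (?\<Phi> (x(\<sigma> i := y)))) (x (\<sigma> i)))"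
    by (simp only: sum.reindex[OF \<sigma>(1)] o_def)
  also have "\<dots> = (\<Sum>i\<in>J'. rwop (\<lambda>y. F ((?\<Phi> x)(i := y))) (?\<Phi> x i))"
  proof (rule sum.cong[OF refl])
    fix i assume i: "i \<in> J'"
    show "rwop (\<lambda>y. F (?\<Phi> (x(\<sigma> i := y)))) (x (\<sigma> i)) = rwop (\<lambda>y. F ((?\<Phi> x)(i := y))) (?\<Phi> x i)"
      unfolding on[OF i] using i by simp
  qed
  also have "\<dots> = walkop J' F (?\<Phi> x)" by (rule walkop_sum[OF J', symmetric])
  finally show ?thesis .
qed

lemma sgrp_relabel:
  assumes J: "finite J" and J': "finite J'" and \<sigma>: "inj_on \<sigma> J'" "\<sigma> ` J' \<subseteq> J"
  shows "sgrp (walkop J) t (\<lambda>x. f (x ` \<sigma> ` J')) x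
    = sgrp (walkop J') t (\<lambda>x. f (x ` J')) (\<lambda>i. if i \<in> J' then x (\<sigma> i) else x0)"
proof -
  have "(\<lambda>i. if i \<in> J' then x (\<sigma> i) else x0) ` J' = x ` \<sigma> ` J'" for x :: "nat \<Rightarrow> 'v"
    by (simp add: image_image)
  moreover have "sgrp (walkop J) t (\<lambda>x. (\<lambda>x. f (x ` J')) (\<lambda>i. if i \<in> J' then x (\<sigma> i) else x0)) x
    = sgrp (walkop J') t (\<lambda>x. f (x ` J')) (\<lambda>i. if i \<in> J' then x (\<sigma> i) else x0)"
    by (rule sgrp_intertwine[where \<Phi> = "\<lambda>x i. if i \<in> J' then x (\<sigma> i) else x0"]) (rule walkop_relabel[OF J J' \<sigma>])
  ultimately show ?thesis by simp
qed

lemma bnd_HH: "finite J \<Longrightarrow> bnd (real (card J) * real (card J)) (HH J)"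
  using HH_nonneg HH_le by (simp add: bnd_def)

lemma HH_vanishes:
  assumes fc: "finite_collision E d" and J: "finite J"
  shows "(\<lambda>m. sgrp (walkop J) (real m) (HH J) x) \<longlonglongrightarrow> 0"
proof -
  let ?S = "Sigma J (\<lambda>i. J - {i})"
  have S: "finite ?S" using J by simp
  have HH: "HH J = (\<lambda>x. \<Sum>p\<in>?S. 1 * h {x (fst p), x (snd p)})"
    unfolding HH_def using J by (intro ext) (simp add: sum.Sigma split_def)
  have "sgrp (walkop J) (real m) (HH J) x = (\<Sum>p\<in>?S. 1 * sgrp pairop (real m) (\<lambda>q. h {fst q, snd q}) (x (fst p), x (snd p)))" for m
  proof -
    have "sgrp (walkop J) (real m) (HH J) x = (\<Sum>p\<in>?S. 1 * sgrp (walkop J) (real m) (\<lambda>x. h {x (fst p), x (snd p)}) x)"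
      unfolding HH by (rule sgrp_sum[OF jump_walkop[OF J] S, where B = 1]) (simp add: bnd_def h_nonneg h_le_1)
    also have "\<dots> = (\<Sum>p\<in>?S. 1 * sgrp pairop (real m) (\<lambda>q. h {fst q, snd q}) (x (fst p), x (snd p)))"
    proof (rule sum.cong[OF refl])
      fix p assume "p \<in> ?S"
      then have "fst p \<in> J" "snd p \<in> J" "fst p \<noteq> snd p" by auto
      from walkop_pair[OF J this, of "real m" "\<lambda>q. h {fst q, snd q}" x]
      show "1 * sgrp (walkop J) (real m) (\<lambda>x. h {x (fst p), x (snd p)}) x = 1 * sgrp pairop (real m) (\<lambda>q. h {fst q, snd q}) (x (fst p), x (snd p))"
        by simp
    qed
    finally show ?thesis .
  qed
  moreover have "(\<lambda>m. \<Sum>p\<in>?S. 1 * sgrp pairop (real m) (\<lambda>q. h {fst q, snd q}) (x (fst p), x (snd p))) \<longlonglongrightarrow> (\<Sum>p\<in>?S. 1 * 0)"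
    by (intro tendsto_sum tendsto_mult tendsto_const finite_collision_vanishes[OF fc])
  ultimately show ?thesis by simp
qed

lemma walk_limit:
  assumes fc: "finite_collision E d" and tt: "srw_tail_trivial E d" and J: "finite J"
    and f: "\<And>A. 0 \<le> f A" "\<And>A. f A \<le> 1" and harm: "\<And>n A. dualop n f A = 0"
  shows "\<exists>c. \<forall>x. (\<lambda>m. sgrp (walkop J) (real m) (\<lambda>x. f (x ` J)) x) \<longlonglongrightarrow> c"
proof -
  note L = jump_walkop[OF J]
  let ?F = "\<lambda>x :: nat \<Rightarrow> 'v. f (x ` J)"
  let ?U = "sgrp (walkop J)"
  define K where "K = 2 / \<theta>"
  have K0: "0 \<le> K" using \<theta> by (simp add: K_def)
  have bF: "bnd 1 ?F" using f by (simp add: bnd_def)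
  have bU: "bnd 1 (?U t ?F)" if "0 \<le> t" for t by (rule sgrp_bnd[OF L bF that])
  have bKH: "bnd (K * (real (card J) * real (card J))) (\<lambda>x. K * HH J x)"
    using K0 HH_nonneg HH_le[OF J] by (simp add: bnd_def abs_mult mult_left_mono)
  define D where "D m x = K * ?U (real m) (HH J) x" for m x
  have D: "(\<lambda>m. D m x) \<longlonglongrightarrow> 0" for x
    using tendsto_mult_right_zero[OF HH_vanishes[OF fc J, of x], of K] by (simp add: D_def)
  have shift: "\<bar>?U (real m + t) ?F x - ?U (real m) ?F x\<bar> \<le> D m x" if t: "0 \<le> t" for m t x
  proof -
    have "\<bar>?U (real m) (?U t ?F) x - ?U (real m) ?F x\<bar> \<le> ?U (real m) (\<lambda>x. K * HH J x) x"
    proof (rule sgrp_abs_le[OF L bU[OF t] bF bKH])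
      fix y
      show "\<bar>?U t ?F y - f (y ` J)\<bar> \<le> K * HH J y"
        using harmonic_vs_walk[where n = "card J", OF J order_refl f harm t, of y] by (simp add: abs_minus_commute K_def)
    qed simp
    then show ?thesis
      using sgrp_semigroup[OF L bF t, of "real m" x] by (simp add: D_def sgrp_cmult[OF L bnd_HH[OF J]])
  qed
  have "Cauchy (\<lambda>m. ?U (real m) ?F x)" for x
  proof (rule metric_CauchyI)
    fix e :: real assume "0 < e"
    then have "\<forall>\<^sub>F m in sequentially. D m x < e / 2" by (intro order_tendstoD(2)[OF D]) simp
    then obtain N where N: "D N x < e / 2" unfolding eventually_sequentially by blast
    have *: "\<bar>?U (real m) ?F x - ?U (real N) ?F x\<bar> < e / 2" if "N \<le> m" for m
    proof -
      have e: "real N + real (m - N) = real m" using that by simp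
      show ?thesis using shift[of "real (m - N)" N x] N unfolding e by simp
    qed
    show "\<exists>M. \<forall>m\<ge>M. \<forall>n\<ge>M. dist (?U (real m) ?F x) (?U (real n) ?F x) < e"
    proof (intro exI[of _ N] allI impI)
      fix m n assume "N \<le> m" "N \<le> n"
      then show "dist (?U (real m) ?F x) (?U (real n) ?F x) < e"
        using *[of m] *[of n] unfolding dist_real_def by linarith
    qed
  qed
  then have "\<forall>x. \<exists>l. (\<lambda>m. ?U (real m) ?F x) \<longlonglongrightarrow> l" using Cauchy_convergent unfolding convergent_def by blast
  from choice[OF this] obtain g where g: "\<And>x. (\<lambda>m. ?U (real m) ?F x) \<longlonglongrightarrow> g x" by blast
  have bg: "bnd 1 g"
    unfolding bnd_def
  proof
    fix x
    show "\<bar>g x\<bar> \<le> 1"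
      by (rule LIMSEQ_le_const2[OF tendsto_rabs[OF g]]) (intro exI[of _ 0] allI impI bndD[OF bU], simp)
  qed
  have inv: "?U t g x = g x" if t: "0 \<le> t" for t x
  proof (rule LIMSEQ_unique)
    show "(\<lambda>m. ?U t (?U (real m) ?F) x) \<longlonglongrightarrow> ?U t g x"
      by (rule sgrp_tendsto[OF L bU g]) simp
    have eq: "?U t (?U (real m) ?F) x = ?U (real m + t) ?F x" for m
      using sgrp_semigroup[OF L bF _ t, of "real m" x] by (simp add: add.commute)
    have "(\<lambda>m. ?U (real m + t) ?F x - ?U (real m) ?F x) \<longlonglongrightarrow> 0"
      by (rule Lim_null_comparison[OF _ D[of x]]) (simp add: shift[OF t])
    from tendsto_add[OF this g[of x]] show "(\<lambda>m. ?U t (?U (real m) ?F) x) \<longlonglongrightarrow> g x"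
      unfolding eq by simp
  qed
  have upd: "g (x(j := b)) = g x" if "j \<in> J" for x j b
    by (rule liouville_product[OF tail_trivial_tv[OF tt] J that bg inv])
  fix x0 :: 'v
  \<comment> \<open>Labels outside \<open>J\<close> carry no information; resting them at
    \<open>x0\<close> leaves finitely many coordinates to be changed one by one.\<close>
  have loc: "g x = g (\<lambda>i. if i \<in> J then x i else x0)" for x
  proof (rule LIMSEQ_unique[OF g])
    have "?U t ?F x = ?U t ?F (\<lambda>i. if i \<in> J then x i else x0)" for t
      using sgrp_relabel[OF J J, of "\<lambda>i. i" t f x x0] by simp
    then show "(\<lambda>m. ?U (real m) ?F x) \<longlonglongrightarrow> g (\<lambda>i. if i \<in> J then x i else x0)"
      using g[of "\<lambda>i. if i \<in> J then x i else x0"] by simp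
  qed
  have "g (\<lambda>i. if i \<in> S then x i else x0) = g (\<lambda>_. x0)" if "finite S" "S \<subseteq> J" for S x
    using that
  proof (induction S rule: finite_induct)
    case (insert j S)
    have "(\<lambda>i. if i \<in> insert j S then x i else x0) = (\<lambda>i. if i \<in> S then x i else x0)(j := x j)" by (intro ext) simp
    then show ?case using insert upd[of j "\<lambda>i. if i \<in> S then x i else x0" "x j"] by simp
  qed simp
  from this[OF J order_refl] have "g x = g (\<lambda>_. x0)" for x using loc[of x] by simp
  then show ?thesis using g by metis
qed

text \<open>Relabelling shows that the limit depends on the number of labels alone. The larger
  system \<open>J\<close> is kept so that all subsets can be moved by one and the same walk in the
  inclusion-exclusion that follows.\<close>

lemma walk_limits:
  assumes fc: "finite_collision E d" and tt: "srw_tail_trivial E d"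
    and f: "\<And>A. 0 \<le> f A" "\<And>A. f A \<le> 1" and harm: "\<And>n A. dualop n f A = 0"
  obtains c where "\<And>J S x. finite J \<Longrightarrow> S \<subseteq> J \<Longrightarrow> (\<lambda>m. sgrp (walkop J) (real m) (\<lambda>x. f (x ` S)) x) \<longlonglongrightarrow> c (card S)"
proof -
  have "\<forall>k. \<exists>c. \<forall>x. (\<lambda>m. sgrp (walkop {0..<k}) (real m) (\<lambda>x. f (x ` {0..<k})) x) \<longlonglongrightarrow> c"
    by (intro allI walk_limit[OF fc tt _ f harm]) simp
  from choice[OF this] obtain c where c: "\<And>k x. (\<lambda>m. sgrp (walkop {0..<k}) (real m) (\<lambda>x. f (x ` {0..<k})) x) \<longlonglongrightarrow> c k" by blast
  have "(\<lambda>m. sgrp (walkop J) (real m) (\<lambda>x. f (x ` S)) x) \<longlonglongrightarrow> c (card S)" if J: "finite J" "S \<subseteq> J" for J S x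
  proof -
    obtain \<sigma> where \<sigma>: "bij_betw \<sigma> {0..<card S} S"
      using ex_bij_betw_nat_finite[OF finite_subset[OF J(2,1)]] by blast
    have i: "inj_on \<sigma> {0..<card S}" "\<sigma> ` {0..<card S} = S" using \<sigma> by (simp_all add: bij_betw_def)
    show ?thesis
      using sgrp_relabel[OF J(1) finite_atLeastLessThan i(1), of _ f x "undefined"] c J(2) unfolding i(2) by simp
  qed
  then show ?thesis by (rule that)
qed

lemma walk_limit_close:
  assumes f: "\<And>A. 0 \<le> f A" "\<And>A. f A \<le> 1" and harm: "\<And>n A. dualop n f A = 0" and J: "finite J"
    and c: "(\<lambda>m. sgrp (walkop J) (real m) (\<lambda>x. f (x ` J)) x) \<longlonglongrightarrow> c"
  shows "\<bar>f (x ` J) - c\<bar> \<le> 2 / \<theta> * HH J x"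
  by (rule LIMSEQ_le_const2[OF tendsto_rabs[OF tendsto_diff[OF tendsto_const c]]])
    (intro exI[of _ 0] allI impI harmonic_vs_walk[where n = "card J", OF J order_refl f harm], simp)

end

context voter_stirring
begin

text \<open>Before the limit, inclusion-exclusion gives an average, over the positions y of the
  walks, of the \<nu>-expectation of a product of factors \<eta>(y i) and 1-\<eta>(y i). This is
  nonnegative even when positions coincide.\<close>

lemma walk_limit_cmono:
  assumes \<nu>: "\<nu> \<in> cfg_probs"
    and c: "\<And>J S x. finite J \<Longrightarrow> S \<subseteq> J \<Longrightarrow> (\<lambda>m. sgrp (walkop J) (real m) (\<lambda>x. mom True \<nu> (x ` S)) x) \<longlonglongrightarrow> c (card S)"
  shows "cmono c"
  unfolding cmono_def
proof (intro conjI allI)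
  fix x :: "nat \<Rightarrow> 'v"
  have "(\<lambda>m. sgrp (walkop {}) (real m) (\<lambda>x. mom True \<nu> (x ` {})) x) \<longlonglongrightarrow> c (card ({} :: nat set))" by (rule c) simp_all
  then show "c 0 = 1" using sgrp_const[OF jump_walkop[of "{}"]] by (simp add: mom_empty[OF \<nu>] LIMSEQ_const_iff)
  fix k j :: nat
  let ?J = "{0..<j + k}" and ?S = "{0..<j}" and ?C = "{j..<j + k}"
  let ?u = "\<lambda>m S'. sgrp (walkop ?J) (real m) (\<lambda>x. mom True \<nu> (x ` S')) x"
  have sub: "?S \<union> B \<subseteq> ?J" if "B \<in> Pow ?C" for B using that by auto
  have lim: "(\<lambda>m. incl (?u m) ?S ?C) \<longlonglongrightarrow> incl (\<lambda>B. c (card B)) ?S ?C"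
    unfolding incl_def by (intro tendsto_sum tendsto_mult tendsto_const c sub) simp_all
  have nn: "0 \<le> incl (?u m) ?S ?C" for m
  proof -
    interpret prob_space \<nu> using cfg_probsD[OF \<nu>] by simp
    let ?G = "\<lambda>x. \<Sum>B\<in>Pow ?C. (-1) ^ card B * mom True \<nu> (x ` (?S \<union> B))"
    have "0 \<le> ?G y" for y :: "nat \<Rightarrow> 'v"
    proof -
      have fin: "finite (y ` (?S \<union> B))" if "B \<in> Pow ?C" for B using sub[OF that] finite_subset by blast
      \<comment> \<open>Pulling \<eta> back along y replaces sets of sites by sets of labels, where
        \<open>incl_ind\<close> applies whether or not y is injective.\<close>
      have cyl: "ind True (y ` S') \<eta> = ind True S' (\<lambda>i. \<eta> (y i))" for S' \<eta> by (auto simp: ind_def)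
      have "?G y = (\<Sum>B\<in>Pow ?C. (-1) ^ card B * (\<integral>\<eta>. ind True (y ` (?S \<union> B)) \<eta> \<partial>\<nu>))"
        using fin by (intro sum.cong refl) (simp add: mom_def)
      also have "\<dots> = (\<integral>\<eta>. (\<Sum>B\<in>Pow ?C. (-1) ^ card B * ind True (y ` (?S \<union> B)) \<eta>) \<partial>\<nu>)"
        using fin by (subst Bochner_Integration.integral_sum) (auto intro: ind_integrable[OF \<nu>] simp del: Un_iff)
      also have "\<dots> = (\<integral>\<eta>. incl (\<lambda>B. ind True B (\<lambda>i. \<eta> (y i))) ?S ?C \<partial>\<nu>)"
        unfolding incl_def cyl ..
      also have "0 \<le> \<dots>"
        by (rule Bochner_Integration.integral_nonneg) (simp only: incl_ind[OF finite_atLeastLessThan] mult_nonneg_nonneg ind_nonneg)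
      finally show ?thesis .
    qed
    moreover have "incl (?u m) ?S ?C = sgrp (walkop ?J) (real m) ?G x"
      unfolding incl_def
      by (rule sgrp_sum[OF jump_walkop, symmetric, where B = 1]) (simp_all add: bnd_def mom_nonneg mom_le_1[OF \<nu>])
    moreover have "bnd (\<Sum>B\<in>Pow ?C. \<bar>(-1) ^ card B\<bar> * 1) ?G"
      by (rule bnd_sum) (simp add: bnd_def mom_nonneg mom_le_1[OF \<nu>])
    ultimately show ?thesis using sgrp_nonneg[OF jump_walkop[of ?J]] by simp
  qed
  have "0 \<le> incl (\<lambda>B. c (card B)) ?S ?C" by (rule LIMSEQ_le_const[OF lim]) (intro exI[of _ 0] allI impI nn)
  also have "\<dots> = dlt c k j" by (subst incl_card) auto
  finally show "0 \<le> dlt c k j" .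
qed

text \<open>The moments of \<open>\<nu>\<close> and of \<open>lim_meas c\<close> are both the
  long-time values of the dual run on \<open>c\<close> of the cardinality: the former by
  \<open>harmonic_representation\<close>, the latter by construction.\<close>

theorem stationary_representation:
  assumes fc: "finite_collision E d" and tt: "srw_tail_trivial E d" and st: "stationary T \<nu>"
  shows "\<exists>c. cmono c \<and> \<nu> = lim_meas c"
proof -
  have \<nu>: "\<nu> \<in> cfg_probs" by (rule stationary_cfg[OF st])
  let ?f = "mom True \<nu>"
  obtain c where c: "\<And>J S x. finite J \<Longrightarrow> S \<subseteq> J \<Longrightarrow> (\<lambda>m. sgrp (walkop J) (real m) (\<lambda>x. ?f (x ` S)) x) \<longlonglongrightarrow> c (card S)"
    using walk_limits[OF fc tt mom_nonneg mom_le_1[OF \<nu>] stationary_harmonic[OF st]] by metis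
  have cm: "cmono c" by (rule walk_limit_cmono[OF \<nu> c])
  have close: "\<bar>?f B - c (card B)\<bar> \<le> 2 / \<theta> * pairsum h B" if B: "finite B" for B
  proof -
    obtain x where "bij_betw x {0..<card B} B" using ex_bij_betw_nat_finite[OF B] by blast
    then have x: "inj_on x {0..<card B}" "x ` {0..<card B} = B" by (simp_all add: bij_betw_def)
    have "(\<lambda>m. sgrp (walkop {0..<card B}) (real m) (\<lambda>x. ?f (x ` {0..<card B})) x) \<longlonglongrightarrow> c (card {0..<card B})"
      by (rule c) simp_all
    from walk_limit_close[OF mom_nonneg mom_le_1[OF \<nu>] stationary_harmonic[OF st] finite_atLeastLessThan this]
    show ?thesis unfolding HH_pairsum[OF x(1)] x(2) by simp
  qed
  have "\<nu> = lim_meas c"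
  proof (rule mom_eqI[OF \<nu> lim_meas_cfg[OF cm]])
    fix A :: "'v set" assume A: "finite A"
    have "((\<lambda>t. sgrp (dualop (card A)) t (\<lambda>B. c (card B)) A) \<longlongrightarrow> ?f A) at_top"
    proof (rule harmonic_representation[OF A order_refl bnd_mom[OF \<nu>] stationary_harmonic[OF st]])
      show "bnd 1 c" by (simp add: bnd_def cmono_nonneg[OF cm] cmono_le_1[OF cm])
      show "0 \<le> 2 / \<theta>" using \<theta> by simp
    qed (rule close)
    from tendsto_unique[OF trivial_limit_at_top_linorder this lim_meas_tendsto[OF cm A order_refl]]
    show "?f A = mom True (lim_meas c) A" .
  qed
  then show ?thesis using cm by blast
qed

text \<open>Independent walks drift apart, so along them the moments of \<open>lim_meas c\<close>
  return the sequence from which the measure was built; this makes \<open>lim_meas\<close>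
  injective.\<close>

lemma lim_meas_walk:
  assumes fc: "finite_collision E d" and c: "cmono c" and J: "finite J"
  shows "(\<lambda>m. sgrp (walkop J) (real m) (\<lambda>x. mom True (lim_meas c) (x ` J)) x) \<longlonglongrightarrow> c (card J)"
proof -
  note L = jump_walkop[OF J] and P = lim_meas_cfg[OF c]
  let ?F = "\<lambda>x. mom True (lim_meas c) (x ` J)"
  have K2: "2 \<le> 2 / \<theta>" using \<theta> by (simp add: field_simps)
  have near: "\<bar>?F x - c (card J)\<bar> \<le> 2 / \<theta> * HH J x" for x
  proof (cases "inj_on x J")
    case True
    then show ?thesis using lim_meas_close[OF c J, of x] by (simp add: card_image)
  next
    case False
    \<comment> \<open>Where labels coincide, the cardinality of the image is below card J, so
      closeness is not inherited; but there the bound exceeds 1 and holds trivially.\<close>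
    have "2 * 2 \<le> 2 / \<theta> * HH J x" using K2 \<theta> HH_noninj[OF J False] by (intro mult_mono) simp_all
    moreover have "\<bar>?F x - c (card J)\<bar> \<le> 1"
      using mom_nonneg[of True "lim_meas c" "x ` J"] mom_le_1[OF P, of True "x ` J"] cmono_nonneg[OF c, of "card J"] cmono_le_1[OF c, of "card J"]
      by linarith
    ultimately show ?thesis by linarith
  qed
  have bF: "bnd 1 ?F" by (simp add: bnd_def mom_nonneg mom_le_1[OF P])
  have bKH: "bnd (2 / \<theta> * (real (card J) * real (card J))) (\<lambda>x. 2 / \<theta> * HH J x)"
    unfolding bnd_def
  proof
    fix x
    have "0 \<le> 2 / \<theta>" using K2 by linarith
    then have "0 \<le> 2 / \<theta> * HH J x" "2 / \<theta> * HH J x \<le> 2 / \<theta> * (real (card J) * real (card J))"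
      using mult_nonneg_nonneg[OF _ HH_nonneg] mult_left_mono[OF HH_le[OF J]] by blast+
    then show "\<bar>2 / \<theta> * HH J x\<bar> \<le> 2 / \<theta> * (real (card J) * real (card J))" by linarith
  qed
  have "\<bar>sgrp (walkop J) (real m) ?F x - c (card J)\<bar> \<le> 2 / \<theta> * sgrp (walkop J) (real m) (HH J) x" for m
    using sgrp_abs_le[OF L bF bndI_const bKH near, of "real m" x]
    by (simp add: sgrp_const[OF L] sgrp_cmult[OF L bnd_HH[OF J]] del: times_divide_eq_left)
  then have "(\<lambda>m. sgrp (walkop J) (real m) ?F x - c (card J)) \<longlonglongrightarrow> 0"
    by (intro Lim_null_comparison[OF _ tendsto_mult_right_zero[OF HH_vanishes[OF fc J, of x], of "2 / \<theta>"]]) simp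
  then show ?thesis by (simp add: LIM_zero_iff)
qed

lemma lim_meas_inj:
  assumes fc: "finite_collision E d" and c: "cmono c" "cmono c'" and eq: "lim_meas c = lim_meas c'"
  shows "c = c'"
proof
  fix k
  show "c k = c' k"
    using LIMSEQ_unique[OF lim_meas_walk[OF fc c(1), of "{0..<k}"] lim_meas_walk[OF fc c(2), of "{0..<k}", folded eq]] by simp
qed

end

section \<open>Extremal measures\<close>

text \<open>\<open>B\<close> acts as a conditioning event, and the sum over \<open>A\<close>
  estimates the deviation of the random density from \<alpha>. In de Finetti's picture the
  coefficient of |A|(|A|-1) is the second moment of that deviation.\<close>

lemma exchangeable_square:
  fixes A B :: "'v set"
  assumes \<pi>: "\<pi> \<in> cfg_probs" and mom: "\<And>A. finite A \<Longrightarrow> mom True \<pi> A = c (card A)"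
    and A: "finite A" and B: "finite B" and AB: "A \<inter> B = {}"
  shows "(\<integral>\<eta>. (s * ind True B \<eta> + (\<Sum>x\<in>A. ind True {x} \<eta> - \<alpha>))\<^sup>2 \<partial>\<pi>)
    = s\<^sup>2 * c (card B) + 2 * s * (real (card A) * (c (Suc (card B)) - \<alpha> * c (card B)))
      + real (card A) * (c 1 - 2 * \<alpha> * c 1 + \<alpha>\<^sup>2)
      + real (card A) * (real (card A) - 1) * (c 2 - 2 * \<alpha> * c 1 + \<alpha>\<^sup>2)"
proof -
  interpret prob_space \<pi> using cfg_probsD[OF \<pi>] by simp
  note int = ind_integrable[OF \<pi>]
  have E: "(\<integral>\<eta>. ind True S \<eta> \<partial>\<pi>) = c (card S)" if "finite S" for S using mom[OF that] that by (simp add: mom_def)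
  have pt: "(s * ind True B \<eta> + (\<Sum>x\<in>A. ind True {x} \<eta> - \<alpha>))\<^sup>2 = s\<^sup>2 * ind True B \<eta>
      + 2 * s * (\<Sum>x\<in>A. ind True (insert x B) \<eta> - \<alpha> * ind True B \<eta>)
      + (\<Sum>x\<in>A. \<Sum>y\<in>A. ind True {x, y} \<eta> - \<alpha> * ind True {x} \<eta> - \<alpha> * ind True {y} \<eta> + \<alpha>\<^sup>2)" for \<eta>
  proof -
    let ?X = "\<Sum>x\<in>A. ind True {x} \<eta> - \<alpha>"
    have 1: "(ind True B \<eta>)\<^sup>2 = ind True B \<eta>" by (simp add: ind_def)
    have 2: "ind True B \<eta> * ?X = (\<Sum>x\<in>A. ind True (insert x B) \<eta> - \<alpha> * ind True B \<eta>)"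
      unfolding sum_distrib_left by (intro sum.cong refl) (auto simp: ind_def)
    have 3: "?X\<^sup>2 = (\<Sum>x\<in>A. \<Sum>y\<in>A. ind True {x, y} \<eta> - \<alpha> * ind True {x} \<eta> - \<alpha> * ind True {y} \<eta> + \<alpha>\<^sup>2)"
      unfolding power2_eq_square sum_product by (intro sum.cong refl) (auto simp: ind_def algebra_simps)
    have "(s * ind True B \<eta> + ?X)\<^sup>2 = s\<^sup>2 * (ind True B \<eta>)\<^sup>2 + 2 * s * (ind True B \<eta> * ?X) + ?X\<^sup>2"
      by (simp add: power2_sum power_mult_distrib)
    then show ?thesis unfolding 1 2 3 .
  qed
  have b: "(\<integral>\<eta>. (\<Sum>x\<in>A. ind True (insert x B) \<eta> - \<alpha> * ind True B \<eta>) \<partial>\<pi>) = real (card A) * (c (Suc (card B)) - \<alpha> * c (card B))"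
  proof -
    have "(\<integral>\<eta>. (\<Sum>x\<in>A. ind True (insert x B) \<eta> - \<alpha> * ind True B \<eta>) \<partial>\<pi>) = (\<Sum>x\<in>A. c (card (insert x B)) - \<alpha> * c (card B))"
      using int B E by simp
    also have "\<dots> = (\<Sum>x\<in>A. c (Suc (card B)) - \<alpha> * c (card B))"
      using AB B by (intro sum.cong refl) (auto simp: card_insert_if)
    finally show ?thesis by simp
  qed
  have x: "(\<integral>\<eta>. (\<Sum>x\<in>A. \<Sum>y\<in>A. ind True {x, y} \<eta> - \<alpha> * ind True {x} \<eta> - \<alpha> * ind True {y} \<eta> + \<alpha>\<^sup>2) \<partial>\<pi>)
    = real (card A) * (c 1 - 2 * \<alpha> * c 1 + \<alpha>\<^sup>2) + real (card A) * (real (card A) - 1) * (c 2 - 2 * \<alpha> * c 1 + \<alpha>\<^sup>2)"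
  proof -
    have "(\<integral>\<eta>. (\<Sum>x\<in>A. \<Sum>y\<in>A. ind True {x, y} \<eta> - \<alpha> * ind True {x} \<eta> - \<alpha> * ind True {y} \<eta> + \<alpha>\<^sup>2) \<partial>\<pi>)
      = (\<Sum>x\<in>A. \<Sum>y\<in>A. c (card {x, y}) - 2 * \<alpha> * c 1 + \<alpha>\<^sup>2)"
      using int E by (simp add: prob_space mult.assoc)
    also have "\<dots> = (\<Sum>x\<in>A. (c 1 - 2 * \<alpha> * c 1 + \<alpha>\<^sup>2) + (real (card A) - 1) * (c 2 - 2 * \<alpha> * c 1 + \<alpha>\<^sup>2))"
    proof (intro sum.cong refl)
      fix x assume x: "x \<in> A"
      have "(\<Sum>y\<in>A. c (card {x, y}) - 2 * \<alpha> * c 1 + \<alpha>\<^sup>2)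
        = (c (card {x, x}) - 2 * \<alpha> * c 1 + \<alpha>\<^sup>2) + (\<Sum>y\<in>A - {x}. c (card {x, y}) - 2 * \<alpha> * c 1 + \<alpha>\<^sup>2)"
        by (rule sum.remove[OF A x])
      also have "(\<Sum>y\<in>A - {x}. c (card {x, y}) - 2 * \<alpha> * c 1 + \<alpha>\<^sup>2) = (\<Sum>y\<in>A - {x}. c 2 - 2 * \<alpha> * c 1 + \<alpha>\<^sup>2)"
        by (intro sum.cong refl) (auto simp: card_insert_if numeral_2_eq_2)
      also have "\<dots> = (real (card A) - 1) * (c 2 - 2 * \<alpha> * c 1 + \<alpha>\<^sup>2)"
      proof -
        have "1 \<le> card A" using A x by (metis One_nat_def Suc_leI card_gt_0_iff empty_iff)
        then show ?thesis using x A by (simp add: of_nat_diff)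
      qed
      finally show "(\<Sum>y\<in>A. c (card {x, y}) - 2 * \<alpha> * c 1 + \<alpha>\<^sup>2)
        = (c 1 - 2 * \<alpha> * c 1 + \<alpha>\<^sup>2) + (real (card A) - 1) * (c 2 - 2 * \<alpha> * c 1 + \<alpha>\<^sup>2)" by simp
    qed
    also have "\<dots> = real (card A) * (c 1 - 2 * \<alpha> * c 1 + \<alpha>\<^sup>2) + real (card A) * (real (card A) - 1) * (c 2 - 2 * \<alpha> * c 1 + \<alpha>\<^sup>2)"
      unfolding sum_constant by (simp only: distrib_left mult.assoc)
    finally show ?thesis .
  qed
  have i: "integrable \<pi> (\<lambda>\<eta>. \<Sum>x\<in>A. ind True (insert x B) \<eta> - \<alpha> * ind True B \<eta>)"
    "integrable \<pi> (\<lambda>\<eta>. \<Sum>x\<in>A. \<Sum>y\<in>A. ind True {x, y} \<eta> - \<alpha> * ind True {x} \<eta> - \<alpha> * ind True {y} \<eta> + \<alpha>\<^sup>2)"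
    "integrable \<pi> (ind True B)"
    using int B by simp_all
  show ?thesis unfolding pt using i by (simp add: b x E[OF B])
qed

lemma cmono_square:
  assumes c: "cmono c"
  shows "0 \<le> s\<^sup>2 * c k + 2 * s * (real n * (c (Suc k) - \<alpha> * c k))
      + real n * (c 1 - 2 * \<alpha> * c 1 + \<alpha>\<^sup>2) + real n * (real n - 1) * (c 2 - 2 * \<alpha> * c 1 + \<alpha>\<^sup>2)"
proof -
  obtain \<pi> :: "(nat \<Rightarrow> bool) measure" where \<pi>: "\<pi> \<in> cfg_probs" and m: "\<forall>A. finite A \<longrightarrow> mom True \<pi> A = c (card A)"
    using exchangeable_exists[OF c] by blast
  have mom: "\<And>A. finite A \<Longrightarrow> mom True \<pi> A = c (card A)" using m by blast
  have "0 \<le> (\<integral>\<eta>. (s * ind True {0..<k} \<eta> + (\<Sum>x\<in>{k..<k + n}. ind True {x} \<eta> - \<alpha>))\<^sup>2 \<partial>\<pi>)" by simp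
  also have "\<dots> = s\<^sup>2 * c k + 2 * s * (real n * (c (Suc k) - \<alpha> * c k))
      + real n * (c 1 - 2 * \<alpha> * c 1 + \<alpha>\<^sup>2) + real n * (real n - 1) * (c 2 - 2 * \<alpha> * c 1 + \<alpha>\<^sup>2)"
    by (subst exchangeable_square[OF \<pi> mom]) auto
  finally show ?thesis .
qed

text \<open>For s = 0 the quadratic in n of \<open>cmono_square\<close> is nonnegative at every n,
  hence so is its leading coefficient.\<close>

lemma cmono_variance_nonneg:
  assumes c: "cmono c"
  shows "0 \<le> c 2 - 2 * \<alpha> * c 1 + \<alpha>\<^sup>2"
proof (rule ccontr)
  define p where "p = c 1 - 2 * \<alpha> * c 1 + \<alpha>\<^sup>2"
  define q where "q = c 2 - 2 * \<alpha> * c 1 + \<alpha>\<^sup>2"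
  assume "\<not> 0 \<le> c 2 - 2 * \<alpha> * c 1 + \<alpha>\<^sup>2"
  then have q: "0 < - q" by (simp add: q_def)
  obtain n where n: "p < real n * - q" using reals_Archimedean3[OF q] by blast
  have "0 \<le> real (Suc n) * p + real (Suc n) * (real (Suc n) - 1) * q"
    using cmono_square[OF c, of 0 0 "Suc n" \<alpha>] unfolding p_def[symmetric] q_def[symmetric] by simp
  also have "\<dots> = real (Suc n) * (p + real n * q)" by (simp add: algebra_simps)
  finally have "0 \<le> p + real n * q" by (simp add: zero_le_mult_iff)
  then show False using n by simp
qed

text \<open>Zero variance about \<alpha> removes the term of order n^2 from
  \<open>cmono_square\<close>. If r is the deviation of c (Suc k) from \<alpha> c k, the choice s =
  -nr then puts -n^2 r^2 against a linear term, which forces r = 0.\<close>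

lemma cmono_power_unique:
  assumes c: "cmono c" and q: "c 2 - 2 * \<alpha> * c 1 + \<alpha>\<^sup>2 = 0"
  shows "c n = \<alpha> ^ n"
proof -
  define p where "p = c 1 - 2 * \<alpha> * c 1 + \<alpha>\<^sup>2"
  have "c (Suc k) = \<alpha> * c k" for k
  proof (rule ccontr)
    define r where "r = c (Suc k) - \<alpha> * c k"
    assume "c (Suc k) \<noteq> \<alpha> * c k"
    then have r: "0 < r\<^sup>2" by (simp add: r_def)
    obtain n where n: "p < real n * r\<^sup>2" using reals_Archimedean3[OF r] by blast
    let ?n = "real (Suc n)"
    have "0 \<le> (- (?n * r))\<^sup>2 * c k + 2 * (- (?n * r)) * (?n * r) + ?n * p"
      using cmono_square[OF c, of "- (?n * r)" k "Suc n" \<alpha>] unfolding q r_def[symmetric] p_def[symmetric] by simp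
    moreover have "(- (?n * r))\<^sup>2 * c k \<le> (?n * r)\<^sup>2 * 1"
      unfolding power2_minus by (intro mult_left_mono cmono_le_1[OF c]) simp
    moreover have "2 * (- (?n * r)) * (?n * r) = - (2 * (?n * r)\<^sup>2)" by (simp add: power2_eq_square)
    ultimately have "0 \<le> ?n * p - (?n * r)\<^sup>2" by linarith
    also have "\<dots> = ?n * (p - ?n * r\<^sup>2)" by (simp add: power2_eq_square algebra_simps)
    finally have "0 \<le> p - ?n * r\<^sup>2" by (simp only: zero_le_mult_iff) simp
    moreover have "real n * r\<^sup>2 \<le> ?n * r\<^sup>2" by (intro mult_right_mono) simp_all
    ultimately show False using n by linarith
  qed
  then show ?thesis using c by (induction n) (simp_all add: cmono_def)
qed

context voter_stirring
begin

text \<open>In a decomposition the variances about \<alpha> are nonnegative and average to that of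
  the power sequence, which is zero. Each component thus has variance zero about \<alpha> and is
  itself the power sequence.\<close>

theorem lim_meas_power_extremal:
  assumes fc: "finite_collision E d" and tt: "srw_tail_trivial E d" and \<alpha>: "0 \<le> \<alpha>" "\<alpha> \<le> 1"
  shows "extremal_stationary T (lim_meas (\<lambda>n. \<alpha> ^ n))"
proof (rule extremal_stationaryI[OF lim_meas_stationary[OF cmono_power[OF \<alpha>]]])
  fix \<mu>1 \<mu>2 a
  assume s: "stationary T \<mu>1" "stationary T \<mu>2" and a: "0 < a" "a < 1"
    and m: "\<And>A. finite A \<Longrightarrow> mom True (lim_meas (\<lambda>n. \<alpha> ^ n)) A = a * mom True \<mu>1 A + (1 - a) * mom True \<mu>2 A"
  obtain c1 where c1: "cmono c1" "\<mu>1 = lim_meas c1" using stationary_representation[OF fc tt s(1)] by blast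
  obtain c2 where c2: "cmono c2" "\<mu>2 = lim_meas c2" using stationary_representation[OF fc tt s(2)] by blast
  have a': "0 \<le> a" "a \<le> 1" using a by simp_all
  note mix = cmono_mix[OF c1(1) c2(1) a']
  have "lim_meas (\<lambda>n. \<alpha> ^ n) = lim_meas (\<lambda>n. a * c1 n + (1 - a) * c2 n)"
    by (rule mom_eqI[OF lim_meas_cfg[OF cmono_power[OF \<alpha>]] lim_meas_cfg[OF mix]])
      (simp only: m lim_meas_mix[OF c1(1) c2(1) a'] c1(2) c2(2))
  from lim_meas_inj[OF fc cmono_power[OF \<alpha>] mix this]
  have eq: "\<alpha> ^ n = a * c1 n + (1 - a) * c2 n" for n by (rule fun_cong)
  let ?q = "\<lambda>c. c 2 - 2 * \<alpha> * c 1 + \<alpha>\<^sup>2"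
  have "a * ?q c1 + (1 - a) * ?q c2 = (a * c1 2 + (1 - a) * c2 2) - 2 * \<alpha> * (a * c1 1 + (1 - a) * c2 1) + \<alpha>\<^sup>2"
    by (simp add: algebra_simps)
  also have "\<dots> = 0" unfolding eq[symmetric] by (simp add: power2_eq_square)
  finally have "a * ?q c1 + (1 - a) * ?q c2 = 0" .
  moreover have "0 \<le> a * ?q c1" "0 \<le> (1 - a) * ?q c2"
    using a' cmono_variance_nonneg[OF c1(1), of \<alpha>] cmono_variance_nonneg[OF c2(1), of \<alpha>] by simp_all
  ultimately have "a * ?q c1 = 0" "(1 - a) * ?q c2 = 0" by linarith+
  then have q: "?q c1 = 0" "?q c2 = 0" using a by simp_all
  have "c1 = c2"
    by (rule ext) (rule trans[OF cmono_power_unique[OF c1(1) q(1)] cmono_power_unique[OF c2(1) q(2), symmetric]])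
  then show "\<mu>1 = \<mu>2" using c1 c2 by simp
qed

text \<open>If a = c 1 is strictly between 0 and 1, the sequence splits according to the value at
  one extra site: conditioned on a one it becomes c (n+1) / a, on a zero (c n - c (n+1)) / (1-a).
  Extremality and injectivity of \<open>lim_meas\<close> make both equal to c, which is the
  geometric recursion.\<close>

theorem extremal_is_power:
  assumes fc: "finite_collision E d" and tt: "srw_tail_trivial E d" and ex: "extremal_stationary T \<nu>"
  shows "\<exists>\<alpha>. 0 \<le> \<alpha> \<and> \<alpha> \<le> 1 \<and> \<nu> = lim_meas (\<lambda>n. \<alpha> ^ n)"
proof -
  have st: "stationary T \<nu>" using ex by (simp add: extremal_stationary_def)
  obtain c where c: "cmono c" and \<nu>: "\<nu> = lim_meas c" using stationary_representation[OF fc tt st] by blast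
  define a where "a = c 1"
  have a: "0 \<le> a" "a \<le> 1" unfolding a_def by (rule cmono_nonneg[OF c], rule cmono_le_1[OF c])
  have c0: "c 0 = 1" using c by (simp add: cmono_def)
  have dnn: "0 \<le> dlt c k j" for k j using c unfolding cmono_def by blast
  have dec: "decseq c" by (rule cmono_decseq[OF c])
  have step: "c (Suc n) = a * c n" for n
  proof -
    consider "a = 0" | "a = 1" | "0 < a" "a < 1" using a by linarith
    then show ?thesis
    proof cases
      case 1
      have "c (Suc n) \<le> 0" using decseqD[OF dec, of 1 "Suc n"] 1 by (simp add: a_def)
      then show ?thesis using 1 cmono_nonneg[OF c, of "Suc n"] by simp
    next
      case 2
      \<comment> \<open>Convexity: the decrements of c decrease, and the first of them is zero as c
        1 = 1.\<close>
      have "decseq (\<lambda>n. c n - c (Suc n))"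
        unfolding decseq_Suc_iff
      proof
        fix n
        have "0 \<le> dlt c (Suc (Suc 0)) n" by (rule dnn)
        then show "c (Suc n) - c (Suc (Suc n)) \<le> c n - c (Suc n)" by simp
      qed
      from decseqD[OF this, of 0 n] have "c n - c (Suc n) \<le> 0" using 2 c0 by (simp add: a_def)
      then show ?thesis using 2 decseqD[OF dec, of n "Suc n"] by simp
    next
      case 3
      define c1 where "c1 n = c (Suc n) / a" for n
      define c2 where "c2 n = (c n - c (Suc n)) / (1 - a)" for n
      have d1: "dlt c1 k j = dlt c k (Suc j) / a" for k j
        using dlt_linear[of "1 / a" "\<lambda>n. c (Suc n)" 0 c k j] by (simp add: c1_def[abs_def] dlt_Suc)
      have d2: "dlt c2 k j = dlt c (Suc k) j / (1 - a)" for k j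
        using dlt_linear[of "1 / (1 - a)" "\<lambda>n. c n - c (Suc n)" 0 c k j] by (simp add: c2_def[abs_def] dlt_diff del: dlt.simps)
      have cm: "cmono c1" "cmono c2"
        unfolding cmono_def d1 d2 using 3 dnn c0 by (auto simp: c1_def c2_def a_def simp del: dlt.simps)
      have mix: "c = (\<lambda>n. a * c1 n + (1 - a) * c2 n)"
        using 3 by (intro ext) (simp add: c1_def c2_def)
      have "lim_meas c1 = lim_meas c2"
      proof (rule extremal_stationaryD[OF ex lim_meas_stationary[OF cm(1)] lim_meas_stationary[OF cm(2)] 3])
        fix A :: "'v set" assume A: "finite A"
        show "mom True \<nu> A = a * mom True (lim_meas c1) A + (1 - a) * mom True (lim_meas c2) A"
          using lim_meas_mix[OF cm a A] unfolding mix[symmetric] \<nu> .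
      qed
      from lim_meas_inj[OF fc cm this] have "c n = c1 n" using fun_cong[OF mix, of n] by (simp add: algebra_simps)
      then show ?thesis using 3 by (simp add: c1_def)
    qed
  qed
  have "c n = a ^ n" for n by (induction n) (simp_all add: c0 step)
  then have "c = (\<lambda>n. a ^ n)" by (rule ext)
  then show ?thesis using a \<nu> by blast
qed

end

theorem theorem1p1:
  fixes E :: "'v \<Rightarrow> 'v \<Rightarrow> bool" and d :: nat and v :: real
    and T :: "real \<Rightarrow> (('v \<Rightarrow> bool) \<Rightarrow> real) \<Rightarrow> (('v \<Rightarrow> bool) \<Rightarrow> real)"
  assumes "d \<ge> 2" and "regular_graph E d" and "connected_graph E"
    and "infinite (UNIV :: 'v set)" and "v > 0"
    and "voter_stir_semigroup E d v T"
  shows "\<exists>\<mu> :: real \<Rightarrow> ('v \<Rightarrow> bool) measure.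
     (\<forall>\<alpha>\<in>{0..1}. \<mu> \<alpha> \<in> cfg_probs \<and> law_weak_conv T (bernoulli_product \<alpha>) (\<mu> \<alpha>)
                  \<and> stationary T (\<mu> \<alpha>)) \<and>
     inj_on \<mu> {0..1} \<and>
     (inf_collision E d \<longrightarrow>
        \<mu> 0 = return cfg_space (\<lambda>_. False) \<and> \<mu> 1 = return cfg_space (\<lambda>_. True) \<and>
        {\<nu>. extremal_stationary T \<nu>} = {\<mu> 0, \<mu> 1}) \<and>
     (finite_collision E d \<and> srw_tail_trivial E d \<longrightarrow>
        {\<nu>. extremal_stationary T \<nu>} = \<mu> ` {0..1})"
proof -
  interpret voter_stirring E d "1 / (1 + v)" v T
    by unfold_locales (use assms in simp_all)
  define \<mu> where "\<mu> \<alpha> = lim_meas (\<lambda>n. \<alpha> ^ n)" for \<alpha>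
  show ?thesis
  proof (intro exI[of _ \<mu>] conjI ballI impI)
    fix \<alpha> :: real assume "\<alpha> \<in> {0..1}"
    then have \<alpha>: "0 \<le> \<alpha>" "\<alpha> \<le> 1" by simp_all
    note c = cmono_power[OF \<alpha>]
    show "\<mu> \<alpha> \<in> cfg_probs" unfolding \<mu>_def by (rule lim_meas_cfg[OF c])
    show "stationary T (\<mu> \<alpha>)" unfolding \<mu>_def by (rule lim_meas_stationary[OF c])
    show "law_weak_conv T (bernoulli_product \<alpha>) (\<mu> \<alpha>)"
      unfolding \<mu>_def by (rule lim_meas_conv[OF c bernoulli_product_cfg bernoulli_product_mom[OF \<alpha>]])
  next
    show "inj_on \<mu> {0..1}"
    proof (rule inj_onI)
      fix \<alpha> \<beta> :: real assume "\<alpha> \<in> {0..1}" "\<beta> \<in> {0..1}" "\<mu> \<alpha> = \<mu> \<beta>"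
      \<comment> \<open>The density at a single site recovers the parameter.\<close>
      have sing: "mom True (\<mu> \<gamma>) {undefined} = \<gamma>" if "\<gamma> \<in> {0..1}" for \<gamma>
      proof -
        have c: "cmono (\<lambda>n. \<gamma> ^ n)" by (rule cmono_power) (use that in simp_all)
        show ?thesis unfolding \<mu>_def lim_meas_singleton[OF c] by simp
      qed
      show "\<alpha> = \<beta>" using sing[OF \<open>\<alpha> \<in> {0..1}\<close>] sing[OF \<open>\<beta> \<in> {0..1}\<close>] unfolding \<open>\<mu> \<alpha> = \<mu> \<beta>\<close> by (rule trans[OF sym])
    qed
  next
    show "\<mu> 0 = return cfg_space (\<lambda>_. False)" unfolding \<mu>_def by (rule lim_meas_0)
    show "\<mu> 1 = return cfg_space (\<lambda>_. True)" unfolding \<mu>_def by (rule lim_meas_1)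
    show "{\<nu>. extremal_stationary T \<nu>} = {\<mu> 0, \<mu> 1}" if "inf_collision E d"
      unfolding \<mu>_def by (rule inf_collision_extremal[OF that])
  next
    assume "finite_collision E d \<and> srw_tail_trivial E d"
    then have fc: "finite_collision E d" and tt: "srw_tail_trivial E d" by simp_all
    show "{\<nu>. extremal_stationary T \<nu>} = \<mu> ` {0..1}"
    proof (rule equalityI; rule subsetI)
      fix \<nu> assume "\<nu> \<in> {\<nu>. extremal_stationary T \<nu>}"
      then obtain \<alpha> where "0 \<le> \<alpha>" "\<alpha> \<le> 1" "\<nu> = \<mu> \<alpha>" using extremal_is_power[OF fc tt] unfolding \<mu>_def by blast
      then show "\<nu> \<in> \<mu> ` {0..1}" by simp
    next
      fix \<nu> assume "\<nu> \<in> \<mu> ` {0..1}"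
      then obtain \<alpha> where "0 \<le> \<alpha>" "\<alpha> \<le> 1" "\<nu> = \<mu> \<alpha>" by auto
      then show "\<nu> \<in> {\<nu>. extremal_stationary T \<nu>}" using lim_meas_power_extremal[OF fc tt] unfolding \<mu>_def by blast
    qed
  qed
qed

end
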